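(* Let $E,F$ be Hausdorff locally convex spaces over $\mathbf K$, let $k\in\{1,2,3,\dots\}\cup\{\infty\}$, and let the vector map $(E\times F,F,f)$ be $B\partial_2$-extensible in $C^k_\pi$ around $(z,b)$, where $z=(x^0,y^0)\in\operatorname{dom}f$ and $f(z)=b$. Then there is an open set $W$ in $E\times F$ with $z\in W$ such that $(E,F,g)\in C^k_\pi$ for $g=\{(x,y)\in W\cap\operatorname{dom}f: f(x,y)=b\}$ (in particular, $g$ is a function $x\mapsto y$ with domain open in $E$).
   Context: $\mathbf K$ is $\mathbf R$ or $\mathbf C$; all locally convex spaces are Hausdorff and over $\mathbf K$. A function is identified with its graph. Vector map: a triple $(E,F,f)$ with $E,F$ locally convex and $f$ a function with $\operatorname{dom}f\subseteq E$ and values in $F$. Class $C^k_\pi$ (Keller), $k\in\{0,1,2,\dots\}\cup\{\infty\}$: for a vector map $(E,F,f)$ and $u\in E$ put $d_uf(x)=\lim_{t\to0,\,t\in\mathbf K\setminus\{0\}}t^{-1}(f(x+tu)-f(x))$ where the limit exists. For $l\ge 0$ and $\mathbf u=(u_1,\dots,u_l)\in E^l$ put $d(\mathbf u)f=d_{u_l}\cdots d_{u_1}f$. One has $x\in\operatorname{dom}(d^lf)$ iff $d(\mathbf u)f(x)$ exists for all $\mathbf u\in E^l$ and $\mathbf u\mapsto d(\mathbf u)f(x)$ is $l$-linear; this map is then $d^lf(x)$. Then $(E,F,f)\in C^k_\pi$ means: $\operatorname{dom}f$ is open in $E$ and for every integer $0\le l<k+1$ (with $\infty+1=\infty$) one has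 $\operatorname{dom}(d^lf)=\operatorname{dom}f$, each $d^lf(x)$ is a continuous $l$-linear map $E^l\to F$, and for all $x\in\operatorname{dom}f$ and every zero neighbourhood $W$ in $F$ there is a zero neighbourhood $U$ in $E$ such that for every $\varepsilon>0$ there is a zero neighbourhood $V$ in $E$ with $(d^lf(x+v)-d^lf(x))[U^l]\subseteq\varepsilon W$ for all $v\in V$. $\partial_2f_i(x,y)$ denotes the linear map $v\mapsto\lim_{t\to0}t^{-1}(f_i(x,y+tv)-f_i(x,y))$. A direction on a set $I_1$ is a reflexive and transitive relation $\Delta$ with $\operatorname{dom}\Delta=I_1$ such that for all $i,j\in I_1$ there is $k$ with $(i,k),(j,k)\in\Delta$. A projective system over $\Delta$ consists of locally convex spaces $F_i$ ($i\in I_1$) and continuous linear maps $\rho_{ij}:F_j\to F_i$ ($(i,j)\in\Delta$) with $\rho_{ii}=\mathrm{id}$ and $\rho_{ij}\circ\rho_{jk}=\rho_{ik}$ for $(i,j),(j,k)\in\Delta$. A projective limit is a locally convex space $F$ with continuous linear $\rho_i:F\to F_i$, $\rho_i=\rho_{ij}\circ\rho_j$ for $(i,j)\in\Delta$, universal among such cones of locally convex spaces and continuous linear maps. $I_1$ is assumed nonempty. $\mathrm{Bp}_2$-extension: $\langle(F_i,f_i,\rho_i):i\in I_1\rangle$ is a $\mathrm{Bp}_2$-extension of the vector map $(E\times F,F,f)$ by $\{(i,j,\rho_{ij}):(i,j)\in\Delta\}$ if $\Delta$ is a direction on $I_1$, $(F,(\rho_i)_{i})$ is a projective limit of the projective system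 $(F_i,\rho_{ij})$ over $\Delta$, each $F_i$ is a Banachable space (complete, normable), and for every $i$ and every $(x,y)\in\operatorname{dom}f$ one has $(x,\rho_iy)\in\operatorname{dom}f_i$ and $f_i(x,\rho_iy)=\rho_i(f(x,y))$. Here $(E\times F_i,F_i,f_i)$ are vector maps. $B\partial_2$-extensible: $(E\times F,F,f)$ is $B\partial_2$-extensible in $C^k_\pi$ around $((x^0,y^0),b)$ if $(x^0,y^0)\in\operatorname{dom} f$, $f(x^0,y^0)=b$, and it has a $\mathrm{Bp}_2$-extension $\langle(F_i,f_i,\rho_i):i\in I_1\rangle$ by some $\{(i,j,\rho_{ij}):(i,j)\in\Delta\}$ with $\Delta$ a direction on $I_1$ (with all $(E\times F_i,F_i,f_i)\in C^k_\pi$), an index $i_0\in I_1$ and an open set $W_0$ in $E\times F_{i_0}$ with $(x^0,\rho_{i_0}y^0)\in W_0\subseteq\operatorname{dom}f_{i_0}$, such that $\partial_2f_{i_0}(x^0,\rho_{i_0}y^0):F_{i_0}\to F_{i_0}$ is bijective [condition (1)], and for every $j$ with $(i_0,j)\in\Delta$ the following hold: (0) $\rho_{i_0j}$ is injective; $\rho_j\circ f=f_j\circ(\mathrm{id}\times\rho_j)$ and $\rho_{i_0j}\circ f_j=f_{i_0}\circ(\mathrm{id}\times\rho_{i_0j})$ as equalities of partial functions (including equality of domains, so e.g. $(x,y)\in\operatorname{dom}f\iff(x,\rho_jy)\in\operatorname{dom}f_j$); (2) whenever $(x,y)\in\operatorname{dom}f_j$, $(x,\rho_{i_0j}y)\in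 W_0$ and $\partial_2f_{i_0}(x,\rho_{i_0j}y):F_{i_0}\to F_{i_0}$ is bijective, then $\partial_2f_j(x,y):F_j\to F_j$ is bijective; (3) whenever $(x^1,y^1)\in E\times F_{i_0}$ and $(y_n)_{n\ge1}$ is a sequence in $F_j$ with $f_{i_0}(n^{-1}x^0+(1-n^{-1})x^1,\rho_{i_0j}y_n)=\rho_{i_0}b$ for all integers $n\ge1$, $f_{i_0}(x^1,y^1)=\rho_{i_0}b$ (all these points lying in $\operatorname{dom}f_{i_0}$), and $\rho_{i_0j}y_n\to y^1$ in $F_{i_0}$, then $y^1\in\rho_{i_0j}[F_j]$. *)

theory Defs
  imports "HOL-Analysis.Analysis" "HOL-Library.Function_Algebras" "HOL-Library.Extended_Nat"
begin

section \<open>Scalars and locally convex spaces\<close>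

text \<open>The two members of this class are, up to isometric isomorphism, the fields of real and of
  complex numbers; a type variable of this class plays the role of the scalar field.\<close>

class real_or_complex = real_normed_field +
  assumes real_or_complex:
    "(\<forall>z. \<exists>a. z = a *\<^sub>R 1) \<or>
     (\<exists>j. j * j = - 1 \<and> (\<forall>z. \<exists>a b. z = a *\<^sub>R 1 + b *\<^sub>R j \<and> norm z = sqrt (a\<^sup>2 + b\<^sup>2)))"

instance real :: real_or_complex
  by standard auto

instance complex :: real_or_complex
proof
  have "\<exists>a b. z = a *\<^sub>R 1 + b *\<^sub>R \<i> \<and> norm z = sqrt (a\<^sup>2 + b\<^sup>2)" for z :: complex
    by (rule exI[of _ "Re z"], rule exI[of _ "Im z"]) (simp add: complex_eq_iff cmod_def)
  then show "(\<forall>z::complex. \<exists>a. z = a *\<^sub>R 1) \<or>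
     (\<exists>j::complex. j * j = - 1 \<and>
        (\<forall>z. \<exists>a b. z = a *\<^sub>R 1 + b *\<^sub>R j \<and> norm z = sqrt (a\<^sup>2 + b\<^sup>2)))"
    by (intro disjI2 exI[of _ \<i>]) auto
qed

text \<open>The underlying vector space of a space \<open>E\<close> is a linear subspace, namely the set of points of
  its topology, of a vector space that occupies the whole type \<open>'a\<close>. Every vector space is a
  subspace of itself, and any family of vector spaces embeds into a single vector space, so up to
  isomorphism a function \<open>'i \<Rightarrow> ('k, 'x) tvs\<close> is an arbitrary family of spaces.\<close>

record ('k, 'a) tvs =
  scl :: "'k \<Rightarrow> 'a \<Rightarrow> 'a"
  topo :: "'a topology"

abbreviation points :: "('k, 'a, 'm) tvs_scheme \<Rightarrow> 'a set" where
  "points E \<equiv> topspace (topo E)"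

definition zero_nbhd :: "('k, 'a::zero) tvs \<Rightarrow> 'a set \<Rightarrow> bool" where
  "zero_nbhd E U \<longleftrightarrow> U \<subseteq> points E \<and> (\<exists>O'. openin (topo E) O' \<and> 0 \<in> O' \<and> O' \<subseteq> U)"

definition convex_in :: "('k::real_normed_field, 'a::ab_group_add) tvs \<Rightarrow> 'a set \<Rightarrow> bool" where
  "convex_in E S \<longleftrightarrow> (\<forall>x\<in>S. \<forall>y\<in>S. \<forall>a b::real. 0 \<le> a \<and> 0 \<le> b \<and> a + b = 1 \<longrightarrow>
     scl E (of_real a) x + scl E (of_real b) y \<in> S)"

text \<open>Hausdorff locally convex topological vector spaces.\<close>

definition lcs :: "('k::real_or_complex, 'a::ab_group_add) tvs \<Rightarrow> bool" where
  "lcs E \<longleftrightarrow>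
     vector_space (scl E) \<and> module.subspace (scl E) (points E) \<and>
     Hausdorff_space (topo E) \<and>
     continuous_map (prod_topology (topo E) (topo E)) (topo E) (\<lambda>(x, y). x + y) \<and>
     continuous_map (prod_topology euclidean (topo E)) (topo E) (\<lambda>(c, x). scl E c x) \<and>
     (\<forall>U. zero_nbhd E U \<longrightarrow> (\<exists>V. zero_nbhd E V \<and> convex_in E V \<and> V \<subseteq> U))"

definition banachable :: "('k::real_or_complex, 'a::ab_group_add) tvs \<Rightarrow> bool" where
  "banachable E \<longleftrightarrow> lcs E \<and> (\<exists>N :: 'a \<Rightarrow> real.
     (\<forall>x\<in>points E. N x = 0 \<longleftrightarrow> x = 0) \<and>
     (\<forall>x\<in>points E. \<forall>c. N (scl E c x) = norm c * N x) \<and>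
     (\<forall>x\<in>points E. \<forall>y\<in>points E. N (x + y) \<le> N x + N y) \<and>
     Metric_space (points E) (\<lambda>x y. N (x - y)) \<and>
     Metric_space.mtopology (points E) (\<lambda>x y. N (x - y)) = topo E \<and>
     Metric_space.mcomplete (points E) (\<lambda>x y. N (x - y)))"

definition tvs_prod :: "('k, 'a) tvs \<Rightarrow> ('k, 'b) tvs \<Rightarrow> ('k, 'a \<times> 'b) tvs" (infixr "\<times>\<^sub>t" 80) where
  "E \<times>\<^sub>t F = \<lparr>scl = (\<lambda>c (x, y). (scl E c x, scl F c y)), topo = prod_topology (topo E) (topo F)\<rparr>"

definition linear_from_to ::
  "('k, 'a::ab_group_add) tvs \<Rightarrow> ('k, 'b::ab_group_add) tvs \<Rightarrow> ('a \<Rightarrow> 'b) \<Rightarrow> bool" where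
  "linear_from_to E F h \<longleftrightarrow>
     h \<in> points E \<rightarrow> points F \<and>
     (\<forall>x\<in>points E. \<forall>y\<in>points E. h (x + y) = h x + h y) \<and>
     (\<forall>c. \<forall>x\<in>points E. h (scl E c x) = scl F c (h x))"

definition cont_linear ::
  "('k, 'a::ab_group_add) tvs \<Rightarrow> ('k, 'b::ab_group_add) tvs \<Rightarrow> ('a \<Rightarrow> 'b) \<Rightarrow> bool" where
  "cont_linear E F h \<longleftrightarrow> linear_from_to E F h \<and> continuous_map (topo E) (topo F) h"

section \<open>Vector maps and the classes of Keller\<close>

definition vector_map ::
  "('k::real_or_complex, 'a::ab_group_add) tvs \<Rightarrow> ('k, 'b::ab_group_add) tvs \<Rightarrow> ('a \<rightharpoonup> 'b) \<Rightarrow> bool" where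
  "vector_map E F f \<longleftrightarrow> lcs E \<and> lcs F \<and> dom f \<subseteq> points E \<and> ran f \<subseteq> points F"

text \<open>The filter \<open>at 0\<close> on the scalars excludes the point 0; the difference quotient has to be
  defined for all sufficiently small nonzero scalars.\<close>

definition has_dir_deriv ::
  "('k::real_or_complex, 'a::ab_group_add) tvs \<Rightarrow> ('k, 'b::ab_group_add) tvs \<Rightarrow> 'a \<Rightarrow> ('a \<rightharpoonup> 'b) \<Rightarrow>
   'a \<Rightarrow> 'b \<Rightarrow> bool" where
  "has_dir_deriv E F u f x L \<longleftrightarrow>
     x \<in> dom f \<and> (\<forall>\<^sub>F t in at (0::'k). x + scl E t u \<in> dom f) \<and>
     limitin (topo F) (\<lambda>t::'k. scl F (inverse t) (the (f (x + scl E t u)) - the (f x))) L (at 0)"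

definition dir_deriv ::
  "('k::real_or_complex, 'a::ab_group_add) tvs \<Rightarrow> ('k, 'b::ab_group_add) tvs \<Rightarrow> 'a \<Rightarrow> ('a \<rightharpoonup> 'b) \<Rightarrow>
   ('a \<rightharpoonup> 'b)" where
  "dir_deriv E F u f = (\<lambda>x. if \<exists>L. has_dir_deriv E F u f x L
     then Some (THE L. has_dir_deriv E F u f x L) else None)"

text \<open>A tuple in \<open>E\<^sup>l\<close> is a function on \<open>{..<l}\<close>, and the direction with index 0 is
  differentiated first.\<close>

definition tuples :: "'a set \<Rightarrow> nat \<Rightarrow> (nat \<Rightarrow> 'a) set" where
  "tuples S l = {..<l} \<rightarrow>\<^sub>E S"

definition iter_deriv ::
  "('k::real_or_complex, 'a::ab_group_add) tvs \<Rightarrow> ('k, 'b::ab_group_add) tvs \<Rightarrow> nat \<Rightarrow> (nat \<Rightarrow> 'a) \<Rightarrow>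
   ('a \<rightharpoonup> 'b) \<Rightarrow> ('a \<rightharpoonup> 'b)" where
  "iter_deriv E F l u f = fold (dir_deriv E F) (map u [0..<l]) f"

definition multilinear ::
  "('k, 'a::ab_group_add) tvs \<Rightarrow> ('k, 'b::ab_group_add) tvs \<Rightarrow> nat \<Rightarrow> ((nat \<Rightarrow> 'a) \<Rightarrow> 'b) \<Rightarrow> bool" where
  "multilinear E F l \<phi> \<longleftrightarrow> \<phi> \<in> tuples (points E) l \<rightarrow> points F \<and>
     (\<forall>u\<in>tuples (points E) l. \<forall>i<l. linear_from_to E F (\<lambda>v. \<phi> (u(i := v))))"

definition deriv_map ::
  "('k::real_or_complex, 'a::ab_group_add) tvs \<Rightarrow> ('k, 'b::ab_group_add) tvs \<Rightarrow> nat \<Rightarrow> ('a \<rightharpoonup> 'b) \<Rightarrow>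
   ('a \<rightharpoonup> ((nat \<Rightarrow> 'a) \<Rightarrow> 'b))" where
  "deriv_map E F l f = (\<lambda>x.
     if (\<forall>u\<in>tuples (points E) l. x \<in> dom (iter_deriv E F l u f)) \<and>
        multilinear E F l (\<lambda>u. the (iter_deriv E F l u f x))
     then Some (\<lambda>u\<in>tuples (points E) l. the (iter_deriv E F l u f x)) else None)"

definition Ck_pi ::
  "enat \<Rightarrow> ('k::real_or_complex, 'a::ab_group_add) tvs \<Rightarrow> ('k, 'b::ab_group_add) tvs \<Rightarrow> ('a \<rightharpoonup> 'b) \<Rightarrow> bool"
  where
  "Ck_pi k E F f \<longleftrightarrow> vector_map E F f \<and> openin (topo E) (dom f) \<and>
     (\<forall>l::nat. enat l < k + 1 \<longrightarrow>
        dom (deriv_map E F l f) = dom f \<and>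
        (\<forall>x\<in>dom f.
           multilinear E F l (the (deriv_map E F l f x)) \<and>
           continuous_map (product_topology (\<lambda>_. topo E) {..<l}) (topo F)
             (the (deriv_map E F l f x)) \<and>
           (\<forall>W. zero_nbhd F W \<longrightarrow> (\<exists>U. zero_nbhd E U \<and>
              (\<forall>\<epsilon>::real. \<epsilon> > 0 \<longrightarrow> (\<exists>V. zero_nbhd E V \<and>
                 (\<forall>v\<in>V. x + v \<in> dom f \<and>
                    (\<lambda>u. the (deriv_map E F l f (x + v)) u - the (deriv_map E F l f x) u)
                      ` tuples U l \<subseteq> scl F (of_real \<epsilon>) ` W)))))))"

section \<open>Projective limits\<close>

definition direction_on :: "'i set \<Rightarrow> ('i \<times> 'i) set \<Rightarrow> bool" where
  "direction_on I \<Delta> \<longleftrightarrow> \<Delta> \<subseteq> I \<times> I \<and> Domain \<Delta> = I \<and> refl_on I \<Delta> \<and> trans \<Delta> \<and>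
     (\<forall>i\<in>I. \<forall>j\<in>I. \<exists>k. (i, k) \<in> \<Delta> \<and> (j, k) \<in> \<Delta>)"

definition projective_system ::
  "'i set \<Rightarrow> ('i \<times> 'i) set \<Rightarrow> ('i \<Rightarrow> ('k::real_or_complex, 'x::ab_group_add) tvs) \<Rightarrow>
   ('i \<Rightarrow> 'i \<Rightarrow> 'x \<Rightarrow> 'x) \<Rightarrow> bool" where
  "projective_system I \<Delta> Fi \<rho>\<rho> \<longleftrightarrow>
     (\<forall>i\<in>I. lcs (Fi i)) \<and>
     (\<forall>(i, j)\<in>\<Delta>. cont_linear (Fi j) (Fi i) (\<rho>\<rho> i j)) \<and>
     (\<forall>i\<in>I. \<forall>y\<in>points (Fi i). \<rho>\<rho> i i y = y) \<and>
     (\<forall>i j k. (i, j) \<in> \<Delta> \<and> (j, k) \<in> \<Delta> \<longrightarrow>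
        (\<forall>y\<in>points (Fi k). \<rho>\<rho> i j (\<rho>\<rho> j k y) = \<rho>\<rho> i k y))"

definition proj_cone ::
  "'i set \<Rightarrow> ('i \<times> 'i) set \<Rightarrow> ('i \<Rightarrow> ('k::real_or_complex, 'x::ab_group_add) tvs) \<Rightarrow>
   ('i \<Rightarrow> 'i \<Rightarrow> 'x \<Rightarrow> 'x) \<Rightarrow> ('k, 'g::ab_group_add) tvs \<Rightarrow> ('i \<Rightarrow> 'g \<Rightarrow> 'x) \<Rightarrow> bool" where
  "proj_cone I \<Delta> Fi \<rho>\<rho> G \<sigma> \<longleftrightarrow> lcs G \<and> (\<forall>i\<in>I. cont_linear G (Fi i) (\<sigma> i)) \<and>
     (\<forall>(i, j)\<in>\<Delta>. \<forall>x\<in>points G. \<sigma> i x = \<rho>\<rho> i j (\<sigma> j x))"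

text \<open>Universality among the cones whose vertex is carried by the type \<open>'g\<close>.\<close>

definition universal_cone ::
  "'g::ab_group_add itself \<Rightarrow> 'i set \<Rightarrow> ('i \<times> 'i) set \<Rightarrow> ('i \<Rightarrow> ('k::real_or_complex, 'x::ab_group_add) tvs) \<Rightarrow>
   ('i \<Rightarrow> 'i \<Rightarrow> 'x \<Rightarrow> 'x) \<Rightarrow> ('k, 'f::ab_group_add) tvs \<Rightarrow> ('i \<Rightarrow> 'f \<Rightarrow> 'x) \<Rightarrow> bool" where
  "universal_cone _ I \<Delta> Fi \<rho>\<rho> F \<rho> \<longleftrightarrow> proj_cone I \<Delta> Fi \<rho>\<rho> F \<rho> \<and>
     (\<forall>(G :: ('k, 'g) tvs) \<sigma>. proj_cone I \<Delta> Fi \<rho>\<rho> G \<sigma> \<longrightarrow>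
        (\<exists>h. cont_linear G F h \<and> (\<forall>i\<in>I. \<forall>x\<in>points G. \<rho> i (h x) = \<sigma> i x) \<and>
           (\<forall>h'. cont_linear G F h' \<and> (\<forall>i\<in>I. \<forall>x\<in>points G. \<rho> i (h' x) = \<sigma> i x) \<longrightarrow>
              (\<forall>x\<in>points G. h' x = h x))))"

text \<open>A definition cannot quantify over types. The type \<open>'f \<times> ('i \<Rightarrow> 'x)\<close> is large enough to carry
  both \<open>F\<close> and the space of threads, so testing on it gives universality among
  the cones carried by any type whatsoever; see \<open>projective_limit_universal\<close> below.\<close>

definition projective_limit ::
  "'i set \<Rightarrow> ('i \<times> 'i) set \<Rightarrow> ('i \<Rightarrow> ('k::real_or_complex, 'x::ab_group_add) tvs) \<Rightarrow>
   ('i \<Rightarrow> 'i \<Rightarrow> 'x \<Rightarrow> 'x) \<Rightarrow> ('k, 'f::ab_group_add) tvs \<Rightarrow> ('i \<Rightarrow> 'f \<Rightarrow> 'x) \<Rightarrow> bool" where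
  "projective_limit I \<Delta> Fi \<rho>\<rho> F \<rho> \<longleftrightarrow> universal_cone TYPE('f \<times> ('i \<Rightarrow> 'x)) I \<Delta> Fi \<rho>\<rho> F \<rho>"

lemma zero_nbhd_openin: "openin (topo E) U \<Longrightarrow> 0 \<in> U \<Longrightarrow> zero_nbhd E U"
  unfolding zero_nbhd_def by (auto dest: openin_subset)

lemma lcs_tvs_prod:
  assumes E: "lcs E" and F: "lcs F"
  shows "lcs (E \<times>\<^sub>t F)"
proof -
  interpret E: vector_space "scl E" using E by (simp add: lcs_def)
  interpret F: vector_space "scl F" using F by (simp add: lcs_def)
  note p = tvs_prod_def
  have vs: "vector_space (scl (E \<times>\<^sub>t F))"
    by unfold_locales
      (auto simp: p E.scale_right_distrib E.scale_left_distrib F.scale_right_distrib F.scale_left_distrib)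
  then interpret P: vector_space "scl (E \<times>\<^sub>t F)" .
  have sub: "P.subspace (points (E \<times>\<^sub>t F))"
    using E F unfolding lcs_def P.subspace_def E.subspace_def F.subspace_def
    by (auto simp: p zero_prod_def)
  have H: "Hausdorff_space (topo (E \<times>\<^sub>t F))"
    using E F by (simp add: lcs_def p Hausdorff_space_prod_topology)
  have fstc: "continuous_map (prod_topology A (prod_topology B C)) B (\<lambda>z. fst (snd z))"
    "continuous_map (prod_topology A (prod_topology B C)) C (\<lambda>z. snd (snd z))"
    "continuous_map (prod_topology (prod_topology B C) A) B (\<lambda>z. fst (fst z))"
    "continuous_map (prod_topology (prod_topology B C) A) C (\<lambda>z. snd (fst z))"
    for A :: "'p topology" and B :: "'q topology" and C :: "'r topology"
    using continuous_map_compose[OF continuous_map_snd continuous_map_fst, of A B C]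
      continuous_map_compose[OF continuous_map_snd continuous_map_snd, of A B C]
      continuous_map_compose[OF continuous_map_fst continuous_map_fst, of B C A]
      continuous_map_compose[OF continuous_map_fst continuous_map_snd, of B C A]
    by (auto simp: o_def)
  have addE: "continuous_map (prod_topology (topo E) (topo E)) (topo E) (\<lambda>z. fst z + snd z)"
    and addF: "continuous_map (prod_topology (topo F) (topo F)) (topo F) (\<lambda>z. fst z + snd z)"
    and sclE: "continuous_map (prod_topology euclidean (topo E)) (topo E) (\<lambda>z. scl E (fst z) (snd z))"
    and sclF: "continuous_map (prod_topology euclidean (topo F)) (topo F) (\<lambda>z. scl F (fst z) (snd z))"
    using E F by (simp_all add: lcs_def case_prod_beta')
  have add: "continuous_map (prod_topology (topo (E \<times>\<^sub>t F)) (topo (E \<times>\<^sub>t F))) (topo (E \<times>\<^sub>t F))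
    (\<lambda>(x, y). x + y)"
  proof -
    have 1: "continuous_map (prod_topology (topo (E \<times>\<^sub>t F)) (topo (E \<times>\<^sub>t F))) (topo E)
        ((\<lambda>z. fst z + snd z) \<circ> (\<lambda>z. (fst (fst z), fst (snd z))))"
      by (rule continuous_map_compose[OF _ addE]) (auto simp: p intro!: continuous_map_pairedI fstc)
    have 2: "continuous_map (prod_topology (topo (E \<times>\<^sub>t F)) (topo (E \<times>\<^sub>t F))) (topo F)
        ((\<lambda>z. fst z + snd z) \<circ> (\<lambda>z. (snd (fst z), snd (snd z))))"
      by (rule continuous_map_compose[OF _ addF]) (auto simp: p intro!: continuous_map_pairedI fstc)
    have "continuous_map (prod_topology (topo (E \<times>\<^sub>t F)) (topo (E \<times>\<^sub>t F))) (prod_topology (topo E) (topo F))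
       (\<lambda>z. (fst (fst z) + fst (snd z), snd (fst z) + snd (snd z)))"
      using 1 2 by (intro continuous_map_pairedI) (simp_all add: o_def)
    then show ?thesis by (simp add: p case_prod_beta' plus_prod_def)
  qed
  have scal: "continuous_map (prod_topology euclidean (topo (E \<times>\<^sub>t F))) (topo (E \<times>\<^sub>t F))
    (\<lambda>(c, x). scl (E \<times>\<^sub>t F) c x)"
  proof -
    have 1: "continuous_map (prod_topology euclidean (topo (E \<times>\<^sub>t F))) (topo E)
        ((\<lambda>z. scl E (fst z) (snd z)) \<circ> (\<lambda>z. (fst z, fst (snd z))))"
      by (rule continuous_map_compose[OF _ sclE])
        (auto simp: p intro!: continuous_map_pairedI fstc continuous_map_fst)
    have 2: "continuous_map (prod_topology euclidean (topo (E \<times>\<^sub>t F))) (topo F)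
        ((\<lambda>z. scl F (fst z) (snd z)) \<circ> (\<lambda>z. (fst z, snd (snd z))))"
      by (rule continuous_map_compose[OF _ sclF])
        (auto simp: p intro!: continuous_map_pairedI fstc continuous_map_fst)
    have "continuous_map (prod_topology euclidean (topo (E \<times>\<^sub>t F))) (prod_topology (topo E) (topo F))
       (\<lambda>z. (scl E (fst z) (fst (snd z)), scl F (fst z) (snd (snd z))))"
      using 1 2 by (intro continuous_map_pairedI) (simp_all add: o_def)
    then show ?thesis by (simp add: p case_prod_beta')
  qed
  have conv: "\<exists>V. zero_nbhd (E \<times>\<^sub>t F) V \<and> convex_in (E \<times>\<^sub>t F) V \<and> V \<subseteq> U"
    if U: "zero_nbhd (E \<times>\<^sub>t F) U" for U
  proof -
    obtain O' where O': "openin (prod_topology (topo E) (topo F)) O'" "(0, 0) \<in> O'" "O' \<subseteq> U"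
      using U by (auto simp: zero_nbhd_def p zero_prod_def)
    then obtain A B where AB: "openin (topo E) A" "openin (topo F) B" "0 \<in> A" "0 \<in> B" "A \<times> B \<subseteq> O'"
      unfolding openin_prod_topology_alt by (meson order_trans)
    obtain V1 where V1: "zero_nbhd E V1" "convex_in E V1" "V1 \<subseteq> A"
      using E AB(1,3) unfolding lcs_def by (meson zero_nbhd_openin)
    obtain V2 where V2: "zero_nbhd F V2" "convex_in F V2" "V2 \<subseteq> B"
      using F AB(2,4) unfolding lcs_def by (meson zero_nbhd_openin)
    obtain P1 where P1: "openin (topo E) P1" "0 \<in> P1" "P1 \<subseteq> V1" "V1 \<subseteq> points E"
      using V1 by (auto simp: zero_nbhd_def)
    obtain P2 where P2: "openin (topo F) P2" "0 \<in> P2" "P2 \<subseteq> V2" "V2 \<subseteq> points F"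
      using V2 by (auto simp: zero_nbhd_def)
    have "openin (topo (E \<times>\<^sub>t F)) (P1 \<times> P2)"
      using P1 P2 by (simp add: p openin_prod_Times_iff)
    then have "zero_nbhd (E \<times>\<^sub>t F) (V1 \<times> V2)"
      unfolding zero_nbhd_def using P1 P2
      by (intro conjI exI[of _ "P1 \<times> P2"]) (auto simp: p zero_prod_def)
    moreover have "convex_in (E \<times>\<^sub>t F) (V1 \<times> V2)"
      using V1(2) V2(2) by (auto simp: convex_in_def p)
    ultimately show ?thesis using V1(3) V2(3) AB(5) O'(3) by blast
  qed
  show ?thesis
    using vs sub H add scal conv by (simp add: lcs_def)
qed

definition thread_space ::
  "'i set \<Rightarrow> ('i \<times> 'i) set \<Rightarrow> ('i \<Rightarrow> ('k::real_or_complex, 'x::ab_group_add) tvs) \<Rightarrow>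
   ('i \<Rightarrow> 'i \<Rightarrow> 'x \<Rightarrow> 'x) \<Rightarrow> ('k, 'i \<Rightarrow> 'x) tvs" where
  "thread_space I \<Delta> Fi \<rho>\<rho> = \<lparr>
     scl = (\<lambda>c p i. scl (Fi (if i \<in> I then i else SOME i. i \<in> I)) c (p i)),
     topo = pullback_topology
       {p. (\<forall>i\<in>I. p i \<in> points (Fi i)) \<and> (\<forall>i. i \<notin> I \<longrightarrow> p i = 0) \<and>
           (\<forall>(i, j)\<in>\<Delta>. p i = \<rho>\<rho> i j (p j))}
       (\<lambda>p. restrict p I) (product_topology (\<lambda>i. topo (Fi i)) I)\<rparr>"

lemma points_thread_space:
  "points (thread_space I \<Delta> Fi \<rho>\<rho>) =
     {p. (\<forall>i\<in>I. p i \<in> points (Fi i)) \<and> (\<forall>i. i \<notin> I \<longrightarrow> p i = 0) \<and>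
         (\<forall>(i, j)\<in>\<Delta>. p i = \<rho>\<rho> i j (p j))}"
  by (auto simp: thread_space_def topspace_pullback_topology)

lemma continuous_map_thread_space:
  assumes "m \<in> topspace X \<rightarrow> points (thread_space I \<Delta> Fi \<rho>\<rho>)"
    and "\<And>i. i \<in> I \<Longrightarrow> continuous_map X (topo (Fi i)) (\<lambda>x. m x i)"
  shows "continuous_map X (topo (thread_space I \<Delta> Fi \<rho>\<rho>)) m"
proof -
  have "continuous_map X (product_topology (\<lambda>i. topo (Fi i)) I) ((\<lambda>p. restrict p I) \<circ> m)"
    using assms(2) by (auto simp: continuous_map_componentwise o_def)
  then show ?thesis
    using assms(1) unfolding points_thread_space
    by (auto simp: thread_space_def intro!: continuous_map_pullback')
qed

lemma continuous_map_thread_component: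
  assumes "i \<in> I"
  shows "continuous_map (topo (thread_space I \<Delta> Fi \<rho>\<rho>)) (topo (Fi i)) (\<lambda>p. p i)"
proof -
  have "continuous_map (topo (thread_space I \<Delta> Fi \<rho>\<rho>)) (topo (Fi i)) ((\<lambda>q. q i) \<circ> (\<lambda>p. restrict p I))"
    unfolding thread_space_def
    using assms by (auto intro!: continuous_map_pullback continuous_map_product_projection)
  then show ?thesis using assms by (simp add: o_def)
qed

lemma lcs_thread_space:
  assumes "I \<noteq> {}" and \<Delta>: "\<Delta> \<subseteq> I \<times> I" and S: "projective_system I \<Delta> Fi \<rho>\<rho>"
  shows "lcs (thread_space I \<Delta> Fi \<rho>\<rho>)" (is "lcs ?P")
proof -
  define k where "k i = (if i \<in> I then i else SOME i. i \<in> I)" for i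
  have kI: "k i \<in> I" for i using assms(1) by (auto simp: k_def some_in_eq)
  have kid: "k i = i" if "i \<in> I" for i using that by (simp add: k_def)
  have sP: "scl ?P = (\<lambda>c p i. scl (Fi (k i)) c (p i))" by (simp add: thread_space_def k_def)
  have L: "lcs (Fi i)" if "i \<in> I" for i using S that by (simp add: projective_system_def)
  have V: "vector_space (scl (Fi (k i)))" for i using L[OF kI] by (simp add: lcs_def)
  note vs = vector_space.vector_space_assms[OF V]
  have "vector_space (scl ?P)"
    unfolding vector_space_def by (auto simp: sP vs fun_eq_iff)
  then interpret P: vector_space "scl ?P" .
  have s0: "scl (Fi (k i)) c 0 = 0" for i c
  proof -
    interpret vector_space "scl (Fi (k i))" by (rule V)
    show ?thesis by simp
  qed
  have subF: "0 \<in> points (Fi i)" "\<And>x y. x \<in> points (Fi i) \<Longrightarrow> y \<in> points (Fi i) \<Longrightarrow> x + y \<in> points (Fi i)"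
    "\<And>c x. x \<in> points (Fi i) \<Longrightarrow> scl (Fi i) c x \<in> points (Fi i)" if "i \<in> I" for i
  proof -
    interpret vector_space "scl (Fi i)" using L[OF that] by (simp add: lcs_def)
    have *: "subspace (points (Fi i))" using L[OF that] by (simp add: lcs_def)
    show "0 \<in> points (Fi i)" "\<And>x y. x \<in> points (Fi i) \<Longrightarrow> y \<in> points (Fi i) \<Longrightarrow> x + y \<in> points (Fi i)"
      "\<And>c x. x \<in> points (Fi i) \<Longrightarrow> scl (Fi i) c x \<in> points (Fi i)"
      using * by (simp_all add: subspace_def)
  qed
  have rl: "linear_from_to (Fi j) (Fi i) (\<rho>\<rho> i j)" if "(i, j) \<in> \<Delta>" for i j
    using S that by (auto simp: projective_system_def cont_linear_def)
  have r0: "\<rho>\<rho> i j 0 = 0" if ij: "(i, j) \<in> \<Delta>" for i j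
  proof -
    have "j \<in> I" using ij \<Delta> by auto
    then have "\<rho>\<rho> i j (0 + 0) = \<rho>\<rho> i j 0 + \<rho>\<rho> i j 0"
      using rl[OF ij] subF(1)[of j] unfolding linear_from_to_def by blast
    then show ?thesis by simp
  qed
  have radd: "\<rho>\<rho> i j (x + y) = \<rho>\<rho> i j x + \<rho>\<rho> i j y" and rscl: "\<rho>\<rho> i j (scl (Fi j) c x) = scl (Fi i) c (\<rho>\<rho> i j x)"
    if "(i, j) \<in> \<Delta>" "x \<in> points (Fi j)" "y \<in> points (Fi j)" for i j x y c
    using rl[OF that(1)] that(2,3) by (auto simp: linear_from_to_def)
  have thrD: "x i = \<rho>\<rho> i j (x j)" "x j \<in> points (Fi j)" "i \<in> I" "j \<in> I"
    if "x \<in> points ?P" "(i, j) \<in> \<Delta>" for x i j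
    using that \<Delta> unfolding points_thread_space by blast+
  have addP: "x + y \<in> points ?P" if ab: "x \<in> points ?P" "y \<in> points ?P" for x y
  proof -
    have "x i + y i = \<rho>\<rho> i j (x j + y j)" if ij: "(i, j) \<in> \<Delta>" for i j
      using radd[OF ij thrD(2)[OF ab(1) ij] thrD(2)[OF ab(2) ij]]
        thrD(1)[OF ab(1) ij] thrD(1)[OF ab(2) ij] by simp
    then show ?thesis using ab subF(2) by (auto simp: points_thread_space)
  qed
  have sclP: "scl ?P c x \<in> points ?P" if a: "x \<in> points ?P" for c x
  proof -
    have "scl ?P c x i = \<rho>\<rho> i j (scl ?P c x j)" if ij: "(i, j) \<in> \<Delta>" for i j
      using rscl[OF ij thrD(2)[OF a ij] thrD(2)[OF a ij], of c] thrD[OF a ij]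
      by (simp add: sP kid)
    then show ?thesis using a subF(3) by (auto simp: points_thread_space sP kid s0)
  qed
  have zeroP: "0 \<in> points ?P"
    using subF(1) r0 by (auto simp: points_thread_space)
  have sub: "P.subspace (points ?P)"
    unfolding P.subspace_def using zeroP addP sclP by auto
  have H: "Hausdorff_space (topo ?P)"
    unfolding Hausdorff_space_def
  proof (intro allI impI, elim conjE)
    fix p q assume pq: "p \<in> points ?P" "q \<in> points ?P" "p \<noteq> q"
    have "\<exists>i\<in>I. p i \<noteq> q i"
    proof (rule ccontr)
      assume "\<not> ?thesis"
      then have "p i = q i" for i
        using pq(1,2) by (cases "i \<in> I") (auto simp: points_thread_space)
      then show False using pq(3) by auto
    qed
    then obtain i where i: "i \<in> I" "p i \<noteq> q i" by blast
    then have "p i \<in> points (Fi i)" "q i \<in> points (Fi i)"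
      using pq by (auto simp: points_thread_space)
    then obtain U W where UW: "openin (topo (Fi i)) U" "openin (topo (Fi i)) W" "p i \<in> U" "q i \<in> W" "disjnt U W"
      using L[OF i(1)] i(2) unfolding lcs_def Hausdorff_space_def by metis
    note c = continuous_map_thread_component[OF i(1), of \<Delta> Fi \<rho>\<rho>]
    show "\<exists>U V. openin (topo ?P) U \<and> openin (topo ?P) V \<and> p \<in> U \<and> q \<in> V \<and> disjnt U V"
      using openin_continuous_map_preimage[OF c UW(1)] openin_continuous_map_preimage[OF c UW(2)] UW(3-5) pq
      by (intro exI[of _ "{x \<in> points ?P. x i \<in> U}"] exI[of _ "{x \<in> points ?P. x i \<in> W}"])
        (auto simp: disjnt_iff)
  qed
  have add: "continuous_map (prod_topology (topo ?P) (topo ?P)) (topo ?P) (\<lambda>(x, y). x + y)"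
  proof (rule continuous_map_thread_space)
    show "(\<lambda>(x, y). x + y) \<in> topspace (prod_topology (topo ?P) (topo ?P)) \<rightarrow> points ?P"
      using addP by auto
    fix i assume i: "i \<in> I"
    note c = continuous_map_thread_component[OF i, of \<Delta> Fi \<rho>\<rho>]
    have "continuous_map (prod_topology (topo ?P) (topo ?P)) (topo (Fi i))
        ((\<lambda>(x, y). x + y) \<circ> (\<lambda>z. (fst z i, snd z i)))"
      using L[OF i] unfolding lcs_def
      by (intro continuous_map_compose[where X' = "prod_topology (topo (Fi i)) (topo (Fi i))"]
          continuous_map_pairedI continuous_map_compose[OF continuous_map_fst c, unfolded o_def]
          continuous_map_compose[OF continuous_map_snd c, unfolded o_def]) auto
    then show "continuous_map (prod_topology (topo ?P) (topo ?P)) (topo (Fi i)) (\<lambda>x. (case x of (x, y) \<Rightarrow> x + y) i)"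
      by (simp add: o_def case_prod_beta')
  qed
  have scal: "continuous_map (prod_topology euclidean (topo ?P)) (topo ?P) (\<lambda>(c, x). scl ?P c x)"
  proof (rule continuous_map_thread_space)
    show "(\<lambda>(c, x). scl ?P c x) \<in> topspace (prod_topology euclidean (topo ?P)) \<rightarrow> points ?P"
      using sclP by auto
    fix i assume i: "i \<in> I"
    note c = continuous_map_thread_component[OF i, of \<Delta> Fi \<rho>\<rho>]
    have "continuous_map (prod_topology euclidean (topo ?P)) (topo (Fi i))
        ((\<lambda>(c, x). scl (Fi i) c x) \<circ> (\<lambda>z. (fst z, snd z i)))"
      using L[OF i] unfolding lcs_def
      by (intro continuous_map_compose[where X' = "prod_topology euclidean (topo (Fi i))"]
          continuous_map_pairedI continuous_map_fst
          continuous_map_compose[OF continuous_map_snd c, unfolded o_def]) auto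
    then show "continuous_map (prod_topology euclidean (topo ?P)) (topo (Fi i)) (\<lambda>x. (case x of (c, x) \<Rightarrow> scl ?P c x) i)"
      by (simp add: o_def case_prod_beta' sP kid[OF i])
  qed
  have conv: "\<exists>V. zero_nbhd ?P V \<and> convex_in ?P V \<and> V \<subseteq> U" if U: "zero_nbhd ?P U" for U
  proof -
    obtain O' where O': "openin (topo ?P) O'" "0 \<in> O'" "O' \<subseteq> U"
      using U by (auto simp: zero_nbhd_def)
    then obtain Q where Q: "openin (product_topology (\<lambda>i. topo (Fi i)) I) Q"
      "O' = (\<lambda>p. restrict p I) -` Q \<inter> points ?P"
      unfolding points_thread_space by (auto simp: thread_space_def openin_pullback_topology)
    have "restrict 0 I \<in> Q" using O'(2) Q(2) by auto
    then obtain B where B: "finite {i \<in> I. B i \<noteq> points (Fi i)}" "\<forall>i\<in>I. openin (topo (Fi i)) (B i)"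
        "restrict 0 I \<in> Pi\<^sub>E I B" "Pi\<^sub>E I B \<subseteq> Q"
      using Q(1) unfolding openin_product_topology_alt by meson
    define J where "J = {i \<in> I. B i \<noteq> points (Fi i)}"
    have "\<exists>V. zero_nbhd (Fi i) V \<and> convex_in (Fi i) V \<and> V \<subseteq> B i" if i: "i \<in> I" for i
    proof -
      have "0 \<in> B i" using B(3) i by (auto simp: PiE_iff)
      then have "zero_nbhd (Fi i) (B i)" using B(2) i by (auto intro: zero_nbhd_openin)
      then show ?thesis using L[OF i] unfolding lcs_def by blast
    qed
    then obtain V where V: "\<And>i. i \<in> I \<Longrightarrow> zero_nbhd (Fi i) (V i) \<and> convex_in (Fi i) (V i) \<and> V i \<subseteq> B i"
      by metis
    then have "\<exists>P. openin (topo (Fi i)) P \<and> 0 \<in> P \<and> P \<subseteq> V i" if "i \<in> I" for i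
      using that unfolding zero_nbhd_def by blast
    then obtain P where P: "\<And>i. i \<in> I \<Longrightarrow> openin (topo (Fi i)) (P i) \<and> 0 \<in> P i \<and> P i \<subseteq> V i"
      by metis
    define VV where "VV = {p \<in> points ?P. \<forall>i\<in>J. p i \<in> V i}"
    define PP where "PP = topspace (topo ?P) \<inter> (\<Inter>i\<in>J. {p \<in> points ?P. p i \<in> P i})"
    have JI: "J \<subseteq> I" "finite J" using B(1) by (auto simp: J_def)
    have "openin (topo ?P) PP"
      unfolding PP_def
    proof (cases "J = {}")
      case False
      have "openin (topo ?P) (\<Inter>i\<in>J. {p \<in> points ?P. p i \<in> P i})"
        using False JI P
        by (intro openin_INT2 openin_continuous_map_preimage[OF continuous_map_thread_component]) auto
      then show "openin (topo ?P) (points ?P \<inter> (\<Inter>i\<in>J. {p \<in> points ?P. p i \<in> P i}))" by auto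
    qed simp
    moreover have "0 \<in> PP" "PP \<subseteq> VV" using zeroP P JI by (auto simp: PP_def VV_def)
    ultimately have "zero_nbhd ?P VV"
      unfolding zero_nbhd_def by (auto simp: VV_def)
    moreover have "convex_in ?P VV"
      unfolding convex_in_def
    proof (intro ballI allI impI)
      fix x y a b assume xy: "x \<in> VV" "y \<in> VV" and ab: "0 \<le> a \<and> 0 \<le> b \<and> a + b = (1::real)"
      have "(scl ?P (of_real a) x + scl ?P (of_real b) y) i \<in> V i" if "i \<in> J" for i
        using that JI V[of i] xy ab unfolding convex_in_def VV_def by (auto simp: sP kid)
      then show "scl ?P (of_real a) x + scl ?P (of_real b) y \<in> VV"
        using xy addP sclP by (auto simp: VV_def)
    qed
    moreover have "VV \<subseteq> U"
    proof
      fix p assume p: "p \<in> VV"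
      have "p i \<in> B i" if "i \<in> I" for i
        using p that V unfolding VV_def J_def points_thread_space by blast
      then have "restrict p I \<in> Q" using B(4) by auto
      then show "p \<in> U" using p Q(2) O'(3) by (auto simp: VV_def)
    qed
    ultimately show ?thesis by blast
  qed
  show ?thesis
    using P.vector_space_axioms sub H add scal conv by (simp add: lcs_def)
qed

theorem projective_limit_universal:
  fixes F :: "('k::real_or_complex, 'f::ab_group_add) tvs"
    and Fi :: "'i \<Rightarrow> ('k, 'x::ab_group_add) tvs"
  assumes "I \<noteq> {}" and "direction_on I \<Delta>" and S: "projective_system I \<Delta> Fi \<rho>\<rho>"
    and lim: "projective_limit I \<Delta> Fi \<rho>\<rho> F \<rho>"
  shows "universal_cone TYPE('g::ab_group_add) I \<Delta> Fi \<rho>\<rho> F \<rho>"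
proof -
  have \<Delta>: "\<Delta> \<subseteq> I \<times> I" using assms(2) by (simp add: direction_on_def)
  define P where "P = thread_space I \<Delta> Fi \<rho>\<rho>"
  have lP: "lcs P" unfolding P_def by (rule lcs_thread_space[OF assms(1) \<Delta> S])
  have cone: "proj_cone I \<Delta> Fi \<rho>\<rho> F \<rho>"
    using lim by (simp add: projective_limit_def universal_cone_def)
  have lF: "lcs F" and lQ: "lcs (F \<times>\<^sub>t P)"
    using cone lP by (simp_all add: proj_cone_def lcs_tvs_prod)
  have lFi: "lcs (Fi i)" if "i \<in> I" for i
    using S that by (simp add: projective_system_def)
  interpret F: vector_space "scl F" using lF by (simp add: lcs_def)
  interpret P: vector_space "scl P" using lP by (simp add: lcs_def)
  have F0: "0 \<in> points F" and P0: "0 \<in> points P"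
    using lF lP by (simp_all add: lcs_def F.subspace_def P.subspace_def)
  have sQ: "scl (F \<times>\<^sub>t P) c (y, p) = (scl F c y, scl P c p)" for c y p
    by (simp add: tvs_prod_def)
  have pQ: "points (F \<times>\<^sub>t P) = points F \<times> points P"
    and tQ: "topo (F \<times>\<^sub>t P) = prod_topology (topo F) (topo P)"
    by (simp_all add: tvs_prod_def)
  have comp: "cont_linear A C (\<lambda>x. g (h x))" if "cont_linear A B h" "cont_linear B C g"
    for A :: "('k, 'u::ab_group_add) tvs" and B :: "('k, 'v::ab_group_add) tvs"
      and C :: "('k, 'w::ab_group_add) tvs" and g h
    using that continuous_map_compose[of "topo A" "topo B" h "topo C" g]
    unfolding cont_linear_def linear_from_to_def o_def by (auto simp: Pi_iff)
  have cfst: "cont_linear (F \<times>\<^sub>t P) F fst" and csnd: "cont_linear (F \<times>\<^sub>t P) P snd"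
    unfolding cont_linear_def linear_from_to_def pQ tQ
    by (auto simp: sQ continuous_map_fst continuous_map_snd)
  have cinr: "cont_linear P (F \<times>\<^sub>t P) (\<lambda>p. (0, p))"
    unfolding cont_linear_def linear_from_to_def pQ tQ
    using F0 by (auto simp: sQ intro!: continuous_map_pairedI)
  have ccomp: "cont_linear P (Fi i) (\<lambda>p. p i)" if "i \<in> I" for i
    using that continuous_map_thread_component[OF that, of \<Delta> Fi \<rho>\<rho>]
    unfolding cont_linear_def linear_from_to_def
    by (auto simp: P_def points_thread_space) (simp add: thread_space_def)
  have into: "cont_linear G P (\<lambda>x i. if i \<in> I then \<sigma> i x else 0)"
    if G: "proj_cone I \<Delta> Fi \<rho>\<rho> G \<sigma>" for G :: "('k, 'h::ab_group_add) tvs" and \<sigma>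
  proof -
    have c: "cont_linear G (Fi i) (\<sigma> i)" if "i \<in> I" for i using G that by (simp add: proj_cone_def)
    have m: "(\<lambda>x i. if i \<in> I then \<sigma> i x else 0) \<in> points G \<rightarrow> points P"
      using c G \<Delta> unfolding P_def points_thread_space proj_cone_def cont_linear_def linear_from_to_def
      by (auto split: prod.splits simp: Pi_iff)
    have s0: "scl (Fi (SOME i. i \<in> I)) c 0 = 0" for c
    proof -
      have "(SOME i. i \<in> I) \<in> I" using assms(1) by (simp add: some_in_eq)
      then have "vector_space (scl (Fi (SOME i. i \<in> I)))" using lFi by (simp add: lcs_def)
      then interpret vector_space "scl (Fi (SOME i. i \<in> I))" .
      show ?thesis by simp
    qed
    have "continuous_map (topo G) (topo P) (\<lambda>x i. if i \<in> I then \<sigma> i x else 0)"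
      unfolding P_def
      by (rule continuous_map_thread_space)
        (use m c in \<open>auto simp: P_def cont_linear_def\<close>)
    then show ?thesis
      using m c unfolding cont_linear_def linear_from_to_def
      by (auto simp: fun_eq_iff) (auto simp: P_def thread_space_def s0)
  qed
  have univ: "\<exists>h. cont_linear (F \<times>\<^sub>t P) F h \<and> (\<forall>i\<in>I. \<forall>x\<in>points (F \<times>\<^sub>t P). \<rho> i (h x) = \<sigma> i x) \<and>
      (\<forall>h'. cont_linear (F \<times>\<^sub>t P) F h' \<and> (\<forall>i\<in>I. \<forall>x\<in>points (F \<times>\<^sub>t P). \<rho> i (h' x) = \<sigma> i x) \<longrightarrow>
         (\<forall>x\<in>points (F \<times>\<^sub>t P). h' x = h x))"
    if "proj_cone I \<Delta> Fi \<rho>\<rho> (F \<times>\<^sub>t P) \<sigma>" for \<sigma>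
    using lim that unfolding projective_limit_def universal_cone_def by blast
  have \<rho>: "cont_linear F (Fi i) (\<rho> i)" if "i \<in> I" for i
    using cone that by (simp add: proj_cone_def)
  have cone1: "proj_cone I \<Delta> Fi \<rho>\<rho> (F \<times>\<^sub>t P) (\<lambda>i q. \<rho> i (fst q))"
    using lQ cone comp[OF cfst] unfolding proj_cone_def pQ by auto
  have cone2: "proj_cone I \<Delta> Fi \<rho>\<rho> (F \<times>\<^sub>t P) (\<lambda>i q. snd q i)"
    using lQ comp[OF csnd ccomp] unfolding proj_cone_def pQ
    by (auto simp: P_def points_thread_space)
  obtain h where h: "cont_linear (F \<times>\<^sub>t P) F h"
      "\<And>i x. i \<in> I \<Longrightarrow> x \<in> points (F \<times>\<^sub>t P) \<Longrightarrow> \<rho> i (h x) = snd x i"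
    using univ[OF cone2] by blast
  let ?e = "\<lambda>y i. if i \<in> I then \<rho> i y else 0"
  have e: "cont_linear F P ?e" by (rule into[OF cone])
  have inv: "h (0, ?e y) = y" if y: "y \<in> points F" for y
  proof -
    obtain h1 where h1: "\<And>h'. cont_linear (F \<times>\<^sub>t P) F h' \<Longrightarrow>
        (\<forall>i\<in>I. \<forall>x\<in>points (F \<times>\<^sub>t P). \<rho> i (h' x) = \<rho> i (fst x)) \<Longrightarrow>
        (\<forall>x\<in>points (F \<times>\<^sub>t P). h' x = h1 x)"
      using univ[OF cone1] by blast
    have "cont_linear (F \<times>\<^sub>t P) F (\<lambda>q. h (0, ?e (fst q)))"
      by (rule comp[OF comp[OF comp[OF cfst e] cinr] h(1)])
    moreover have "\<forall>i\<in>I. \<forall>x\<in>points (F \<times>\<^sub>t P). \<rho> i (h (0, ?e (fst x))) = \<rho> i (fst x)"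
      using h(2) e F0 unfolding cont_linear_def linear_from_to_def pQ by (auto simp: Pi_iff)
    ultimately have "\<forall>x\<in>points (F \<times>\<^sub>t P). h (0, ?e (fst x)) = h1 x" by (rule h1)
    moreover have "\<forall>x\<in>points (F \<times>\<^sub>t P). fst x = h1 x" by (rule h1[OF cfst]) simp
    moreover have "(y, 0) \<in> points (F \<times>\<^sub>t P)" using y P0 by (simp add: pQ)
    ultimately have "h (0, ?e (fst (y, 0::'i \<Rightarrow> 'x))) = fst (y, 0::'i \<Rightarrow> 'x)" by metis
    then show ?thesis by (simp only: fst_conv)
  qed
  show ?thesis
    unfolding universal_cone_def
  proof (intro conjI allI impI cone)
    fix G :: "('k, 'g) tvs" and \<sigma>
    assume G: "proj_cone I \<Delta> Fi \<rho>\<rho> G \<sigma>"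
    let ?m = "\<lambda>x i. if i \<in> I then \<sigma> i x else 0"
    have m: "cont_linear G P ?m" by (rule into[OF G])
    show "\<exists>h. cont_linear G F h \<and> (\<forall>i\<in>I. \<forall>x\<in>points G. \<rho> i (h x) = \<sigma> i x) \<and>
       (\<forall>h'. cont_linear G F h' \<and> (\<forall>i\<in>I. \<forall>x\<in>points G. \<rho> i (h' x) = \<sigma> i x) \<longrightarrow>
          (\<forall>x\<in>points G. h' x = h x))"
    proof (intro exI[of _ "\<lambda>x. h (0, ?m x)"] conjI allI impI ballI)
      show "cont_linear G F (\<lambda>x. h (0, ?m x))"
        by (rule comp[OF comp[OF m cinr] h(1)])
      show "\<rho> i (h (0, ?m x)) = \<sigma> i x" if "i \<in> I" "x \<in> points G" for i x
        using h(2)[of i "(0, ?m x)"] that m F0 unfolding cont_linear_def linear_from_to_def pQ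
        by (auto simp: Pi_iff)
      fix h' x
      assume h': "cont_linear G F h' \<and> (\<forall>i\<in>I. \<forall>x\<in>points G. \<rho> i (h' x) = \<sigma> i x)" and x: "x \<in> points G"
      then have "h' x \<in> points F" by (auto simp: cont_linear_def linear_from_to_def)
      then have "h' x = h (0, ?e (h' x))" by (simp add: inv)
      also have "?e (h' x) = ?m x" using h' x by auto
      finally show "h' x = h (0, ?m x)" .
    qed
  qed
qed

section \<open>Extensible vector maps\<close>

definition Bp2_extension ::
  "'i set \<Rightarrow> ('i \<times> 'i) set \<Rightarrow> ('i \<Rightarrow> ('k::real_or_complex, 'x::ab_group_add) tvs) \<Rightarrow>
   ('i \<Rightarrow> 'i \<Rightarrow> 'x \<Rightarrow> 'x) \<Rightarrow> ('i \<Rightarrow> 'e \<times> 'x \<rightharpoonup> 'x) \<Rightarrow> ('i \<Rightarrow> 'f \<Rightarrow> 'x) \<Rightarrow>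
   ('k, 'e::ab_group_add) tvs \<Rightarrow> ('k, 'f::ab_group_add) tvs \<Rightarrow> ('e \<times> 'f \<rightharpoonup> 'f) \<Rightarrow> bool" where
  "Bp2_extension I \<Delta> Fi \<rho>\<rho> fi \<rho> E F f \<longleftrightarrow>
     vector_map (E \<times>\<^sub>t F) F f \<and>
     I \<noteq> {} \<and> direction_on I \<Delta> \<and>
     projective_system I \<Delta> Fi \<rho>\<rho> \<and> projective_limit I \<Delta> Fi \<rho>\<rho> F \<rho> \<and>
     (\<forall>i\<in>I. banachable (Fi i) \<and> vector_map (E \<times>\<^sub>t Fi i) (Fi i) (fi i) \<and>
        (\<forall>x y w. f (x, y) = Some w \<longrightarrow> fi i (x, \<rho> i y) = Some (\<rho> i w)))"

definition partial2 ::
  "('k::real_or_complex, 'x::ab_group_add) tvs \<Rightarrow> ('e \<times> 'x \<rightharpoonup> 'x) \<Rightarrow> 'e \<Rightarrow> 'x \<Rightarrow> ('x \<rightharpoonup> 'x)" where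
  "partial2 G g x y = (\<lambda>v. dir_deriv G G v (\<lambda>y'. g (x, y')) y) |` points G"

definition partial2_bijective ::
  "('k::real_or_complex, 'x::ab_group_add) tvs \<Rightarrow> ('e \<times> 'x \<rightharpoonup> 'x) \<Rightarrow> 'e \<Rightarrow> 'x \<Rightarrow> bool" where
  "partial2_bijective G g x y \<longleftrightarrow>
     dom (partial2 G g x y) = points G \<and>
     bij_betw (\<lambda>v. the (partial2 G g x y v)) (points G) (points G)"

text \<open>The index type \<open>'i\<close> and the type \<open>'x\<close> carrying the Banachable spaces occur only under the
  existential quantifier, hence the \<open>itself\<close> arguments. The equalities of partial functions
  include equality of domains because the functions are option-valued. The assumption that all
  evaluation points lie in the domain of \<open>f_i0\<close> is expressed by \<open>= Some _\<close>.\<close>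

definition Bd2_extensible ::
  "'i itself \<Rightarrow> 'x::ab_group_add itself \<Rightarrow> enat \<Rightarrow> ('k::real_or_complex, 'e::ab_group_add) tvs \<Rightarrow>
   ('k, 'f::ab_group_add) tvs \<Rightarrow> ('e \<times> 'f \<rightharpoonup> 'f) \<Rightarrow> 'e \<times> 'f \<Rightarrow> 'f \<Rightarrow> bool" where
  "Bd2_extensible _ _ k E F f = (\<lambda>(x0, y0) b.
     f (x0, y0) = Some b \<and>
     (\<exists>(I :: 'i set) \<Delta> (Fi :: 'i \<Rightarrow> ('k, 'x) tvs) \<rho>\<rho> fi \<rho> i0 W0.
        Bp2_extension I \<Delta> Fi \<rho>\<rho> fi \<rho> E F f \<and>
        (\<forall>i\<in>I. Ck_pi k (E \<times>\<^sub>t Fi i) (Fi i) (fi i)) \<and>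
        i0 \<in> I \<and> openin (topo (E \<times>\<^sub>t Fi i0)) W0 \<and> (x0, \<rho> i0 y0) \<in> W0 \<and> W0 \<subseteq> dom (fi i0) \<and>
        partial2_bijective (Fi i0) (fi i0) x0 (\<rho> i0 y0) \<and>
        (\<forall>j. (i0, j) \<in> \<Delta> \<longrightarrow>
           inj_on (\<rho>\<rho> i0 j) (points (Fi j)) \<and>
           (\<forall>x\<in>points E. \<forall>y\<in>points F. map_option (\<rho> j) (f (x, y)) = fi j (x, \<rho> j y)) \<and>
           (\<forall>x\<in>points E. \<forall>y\<in>points (Fi j).
              map_option (\<rho>\<rho> i0 j) (fi j (x, y)) = fi i0 (x, \<rho>\<rho> i0 j y)) \<and>
           (\<forall>x y. (x, y) \<in> dom (fi j) \<and> (x, \<rho>\<rho> i0 j y) \<in> W0 \<and>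
              partial2_bijective (Fi i0) (fi i0) x (\<rho>\<rho> i0 j y) \<longrightarrow>
              partial2_bijective (Fi j) (fi j) x y) \<and>
           (\<forall>x1\<in>points E. \<forall>y1\<in>points (Fi i0). \<forall>y :: nat \<Rightarrow> 'x.
              (\<forall>n\<ge>1. y n \<in> points (Fi j)) \<and>
              (\<forall>n\<ge>1. fi i0 (scl E (inverse (of_nat n)) x0 + scl E (1 - inverse (of_nat n)) x1,
                 \<rho>\<rho> i0 j (y n)) = Some (\<rho> i0 b)) \<and>
              fi i0 (x1, y1) = Some (\<rho> i0 b) \<and>
              limitin (topo (Fi i0)) (\<lambda>n. \<rho>\<rho> i0 j (y n)) y1 sequentially \<longrightarrow>
              y1 \<in> \<rho>\<rho> i0 j ` points (Fi j)))))"

end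

theory Submission
  imports Defs
begin

text \<open>On a Banachable level the contraction principle, the mean value inequality and the bounded inverse
  theorem give a continuous local solution \<open>g\<close> of \<open>f(x, g x) = b\<close>. Differentiating this equation
  repeatedly writes \<open>d\<^sup>lg\<close> as a finite sum, indexed by trees, of nested terms of the form
  \<open>- (\<partial>\<^sub>2f)\<^sup>-\<^sup>1 d\<^sup>mf(\<dots>)\<close> with \<open>m \<le> l\<close>; multilinearity, differentiability and Keller's continuity are
  proved for each term. The solution \<open>g\<close> at the index \<open>i\<^sub>0\<close> takes its values in the image of every \<open>F\<^sub>j\<close>
  above: along a segment from \<open>x\<^sup>0\<close> the parameters for which this holds form an open set by the implicit
  function theorem at \<open>j\<close> and condition (2), and a closed set by condition (3). By local uniqueness the lifted
  solutions are again \<open>C\<^sup>k\<close>; they form a thread, and a map into the projective limit is \<open>C\<^sup>k\<close> as soon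
  as its components are.\<close>

section \<open>Continuous seminorms\<close>

text \<open>For every \<open>j\<close> above \<open>i0\<close> the implicit function theorem yields
  a solution on some neighbourhood of \<open>x0\<close>, but these neighbourhoods may shrink as
  \<open>j\<close> grows, and their intersection need not be open. Hence the domain \<open>U\<close>
  is fixed once, at \<open>i0\<close>, and what is proved for each \<open>j\<close> is that
  \<open>g\<close> has preimages over all of this \<open>U\<close>. It is a seminorm ball, so the
  segments from \<open>x0\<close> stay inside.

  The other obstacle is that \<open>E\<close> need not be normable: without an operator norm the
  usual induction on \<open>k\<close>, which treats
  \<open>(\<partial>\<^sub>2f)\<^sup>-\<^sup>1\<close> as an operator-valued map, lacks a suitable
  codomain. For a normed target, however, Keller's condition provides one seminorm \<open>p\<close>,
  fixed before \<epsilon>, such that \<open>d\<^sup>lf(x + v) - d\<^sup>lf(x)\<close> is bounded by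
  \<epsilon> times the product of the \<open>p\<close>-values of its arguments for small
  \<open>v\<close>. All operators are therefore evaluated on vectors and compared through such
  estimates, and the inverse of \<open>\<partial>\<^sub>2f\<close> appears only as the solution of a
  linear equation.\<close>

locale lcs_space =
  fixes E :: "('k::real_or_complex, 'e::ab_group_add) tvs"
  assumes lcs: "lcs E"
begin

sublocale vector_space "scl E"
  using lcs by (simp add: lcs_def)

lemma subspace_points: "subspace (points E)"
  using lcs by (simp add: lcs_def)

lemma points_closed [simp, intro]:
  "0 \<in> points E"
  "x \<in> points E \<Longrightarrow> y \<in> points E \<Longrightarrow> x + y \<in> points E"
  "x \<in> points E \<Longrightarrow> y \<in> points E \<Longrightarrow> x - y \<in> points E"
  "x \<in> points E \<Longrightarrow> - x \<in> points E"
  "x \<in> points E \<Longrightarrow> scl E c x \<in> points E"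
  using subspace_points
  by (auto intro: subspace_0 subspace_add subspace_diff subspace_neg subspace_scale)

lemma sum_points [intro]: "(\<And>i. i \<in> A \<Longrightarrow> h i \<in> points E) \<Longrightarrow> sum h A \<in> points E"
  using subspace_points by (rule subspace_sum)

lemma sum_list_points [intro]: "set xs \<subseteq> points E \<Longrightarrow> sum_list xs \<in> points E"
  by (induction xs) auto

lemma continuous_map_translation:
  assumes "a \<in> points E"
  shows "continuous_map (topo E) (topo E) (\<lambda>x. a + x)"
proof -
  have "continuous_map (topo E) (topo E) ((\<lambda>(x, y). x + y) \<circ> (\<lambda>x. (a, x)))"
    using lcs assms unfolding lcs_def
    by (intro continuous_map_compose[where X' = "prod_topology (topo E) (topo E)"]
        continuous_map_pairedI) auto
  then show ?thesis by (simp add: o_def)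
qed

lemma continuous_map_dilation: "continuous_map (topo E) (topo E) (\<lambda>x. scl E c x)"
proof -
  have "continuous_map (topo E) (topo E) ((\<lambda>(c, x). scl E c x) \<circ> (\<lambda>x. (c, x)))"
    using lcs unfolding lcs_def
    by (intro continuous_map_compose[where X' = "prod_topology euclidean (topo E)"]
        continuous_map_pairedI) auto
  then show ?thesis by (simp add: o_def)
qed

lemma continuous_map_orbit:
  assumes "x \<in> points E"
  shows "continuous_map euclidean (topo E) (\<lambda>c. scl E c x)"
proof -
  have "continuous_map euclidean (topo E) ((\<lambda>(c, x). scl E c x) \<circ> (\<lambda>c. (c, x)))"
    using lcs assms unfolding lcs_def
    by (intro continuous_map_compose[where X' = "prod_topology euclidean (topo E)"]
        continuous_map_pairedI) auto
  then show ?thesis by (simp add: o_def)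
qed

end

text \<open>Local statements at a point \<open>x\<close> are phrased through increments
  \<open>v\<close> tending to 0, the form that Keller's condition has; one filter per space thus
  serves all points. The increment \<open>v = 0\<close> is not excluded, so limits along it express
  continuity.\<close>

abbreviation zero_filter :: "('k, 'e::zero) tvs \<Rightarrow> 'e filter" where "zero_filter E \<equiv> nhdsin (topo E) 0"

text \<open>The axioms are imposed on \<open>points E\<close> only. Continuity is encoded by the
  unit ball being a zero neighbourhood; homogeneity transports this to every radius and
  subadditivity to every point.\<close>

definition cont_seminorm :: "('k::real_or_complex, 'e::ab_group_add) tvs \<Rightarrow> ('e \<Rightarrow> real) \<Rightarrow> bool" where
  "cont_seminorm E p \<longleftrightarrow>
     (\<forall>x\<in>points E. 0 \<le> p x) \<and>
     (\<forall>x\<in>points E. \<forall>y\<in>points E. p (x + y) \<le> p x + p y) \<and>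
     (\<forall>c. \<forall>x\<in>points E. p (scl E c x) = norm c * p x) \<and>
     zero_nbhd E {x \<in> points E. p x < 1}"

section \<open>Minkowski functionals and operations on continuous seminorms\<close>

context lcs_space
begin

lemma cont_seminormD:
  assumes "cont_seminorm E p"
  shows seminorm_nonneg: "x \<in> points E \<Longrightarrow> 0 \<le> p x"
    and seminorm_add: "x \<in> points E \<Longrightarrow> y \<in> points E \<Longrightarrow> p (x + y) \<le> p x + p y"
    and seminorm_scale: "x \<in> points E \<Longrightarrow> p (scl E c x) = norm c * p x"
  using assms by (auto simp: cont_seminorm_def)

lemma seminorm_zero: "cont_seminorm E p \<Longrightarrow> p 0 = 0"
  using seminorm_scale[of p 0 0] by simp

lemma seminorm_scale_real: "cont_seminorm E p \<Longrightarrow> x \<in> points E \<Longrightarrow> 0 \<le> c \<Longrightarrow> p (scl E (of_real c) x) = c * p x"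
  using seminorm_scale[of p x "of_real c"] by simp

text \<open>\<open>B\<close> is the balanced core of a convex neighbourhood \<open>V\<close>: the
  points all of whose multiples by scalars of norm at most 1 lie in \<open>V\<close>. It inherits
  convexity, and continuity of scalar multiplication at \<open>(0, 0)\<close> makes it a
  neighbourhood.\<close>

lemma balanced_convex_nbhd:
  assumes "zero_nbhd E U"
  obtains B where "zero_nbhd E B" "convex_in E B" "B \<subseteq> U"
    "\<And>c x. x \<in> B \<Longrightarrow> norm c \<le> 1 \<Longrightarrow> scl E c x \<in> B"
proof -
  obtain V where V: "zero_nbhd E V" "convex_in E V" "V \<subseteq> U"
    using lcs assms unfolding lcs_def by blast
  define B where "B = {x \<in> points E. \<forall>c. norm c \<le> 1 \<longrightarrow> scl E c x \<in> V}"
  obtain O' where O': "openin (topo E) O'" "0 \<in> O'" "O' \<subseteq> V"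
    using V by (auto simp: zero_nbhd_def)
  let ?P = "{z \<in> topspace (prod_topology euclidean (topo E)). (\<lambda>(c, x). scl E c x) z \<in> O'}"
  have "openin (prod_topology euclidean (topo E)) ?P"
    using lcs O' unfolding lcs_def by (intro openin_continuous_map_preimage) auto
  moreover have "(0, 0) \<in> ?P" using O'(2) by simp
  ultimately have "\<exists>A O2. openin euclidean A \<and> openin (topo E) O2 \<and> 0 \<in> A \<and> 0 \<in> O2 \<and> A \<times> O2 \<subseteq> ?P"
    unfolding openin_prod_topology_alt by blast
  then obtain A O2 where A: "open A" "(0::'k) \<in> A" and O2: "openin (topo E) O2" "0 \<in> O2"
    and AO: "A \<times> O2 \<subseteq> ?P"
    unfolding open_openin[symmetric] by blast
  obtain d where d: "d > 0" "ball 0 d \<subseteq> A" using A open_contains_ball by blast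
  define r where "r = d / 2"
  have r: "r > 0" "r < d" using d by (auto simp: r_def)
  \<comment> \<open>Writing \<open>c x = (c r) ((1/r) x)\<close> puts \<open>c r\<close> into the
    ball of radius \<open>d\<close> whenever \<open>norm c\<close> is at most 1.\<close>
  let ?W = "{x \<in> points E. scl E (of_real (1 / r)) x \<in> O2}"
  have "openin (topo E) ?W" by (rule openin_continuous_map_preimage[OF continuous_map_dilation O2(1)])
  moreover have "?W \<subseteq> B"
  proof
    fix x assume x: "x \<in> ?W"
    have "scl E c x \<in> V" if "norm c \<le> 1" for c
    proof -
      have "norm (c * of_real r) \<le> 1 * r" using mult_right_mono[OF that, of r] r by (simp add: norm_mult)
      then have "norm (c * of_real r) < d" using r(2) by (metis le_less_trans mult_1)
      then have "c * of_real r \<in> ball 0 d" by simp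
      then have "(c * of_real r, scl E (of_real (1 / r)) x) \<in> ?P" using d x AO by blast
      then have "scl E (c * of_real r) (scl E (of_real (1 / r)) x) \<in> O'" by simp
      also have "scl E (c * of_real r) (scl E (of_real (1 / r)) x) = scl E (c * (of_real r * of_real (1 / r))) x"
        by (simp add: mult.assoc)
      also have "of_real r * of_real (1 / r) = (1 :: 'k)"
        using r by (simp flip: of_real_mult)
      finally show ?thesis using O' by auto
    qed
    then show "x \<in> B" using x by (auto simp: B_def)
  qed
  ultimately have "zero_nbhd E B"
    unfolding zero_nbhd_def using O2 by (intro conjI exI[of _ ?W]) (auto simp: B_def)
  moreover have "convex_in E B"
    unfolding convex_in_def
  proof (intro ballI allI impI)
    fix x y and a b :: real assume *: "x \<in> B" "y \<in> B" and ab: "0 \<le> a \<and> 0 \<le> b \<and> a + b = 1"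
    have "scl E c (scl E (of_real a) x + scl E (of_real b) y) \<in> V" if c: "norm c \<le> 1" for c
    proof -
      have "scl E (of_real a) (scl E c x) + scl E (of_real b) (scl E c y) \<in> V"
        using V(2) * ab c unfolding convex_in_def B_def by blast
      then show ?thesis by (simp add: scale_right_distrib mult.commute)
    qed
    then show "scl E (of_real a) x + scl E (of_real b) y \<in> B" using * by (auto simp: B_def)
  qed
  moreover have "B \<subseteq> U"
  proof
    fix x assume "x \<in> B"
    then have "scl E 1 x \<in> V" unfolding B_def by (metis (lifting) mem_Collect_eq norm_one order_refl)
    then show "x \<in> U" using V(3) by auto
  qed
  moreover have "scl E c x \<in> B" if "x \<in> B" "norm c \<le> 1" for c x
  proof -
    have "norm (a * c) \<le> 1" if "norm a \<le> 1" for a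
      using \<open>norm c \<le> 1\<close> that by (simp add: norm_mult mult_le_one)
    then show ?thesis using that by (auto simp: B_def)
  qed
  ultimately show thesis using that by blast
qed

text \<open>The seminorm is the Minkowski functional of a balanced convex neighbourhood: convexity
  yields subadditivity, balancedness yields homogeneity under real or complex scalars, and
  continuity of \<open>c \<mapsto> c x\<close> at 0 makes every \<open>S x\<close> nonempty.\<close>

lemma gauge:
  assumes "zero_nbhd E U"
  obtains p where "cont_seminorm E p" "{x \<in> points E. p x < 1} \<subseteq> U"
proof -
  obtain B where B: "zero_nbhd E B" "convex_in E B" "B \<subseteq> U"
    and bal: "\<And>c x. x \<in> B \<Longrightarrow> norm c \<le> 1 \<Longrightarrow> scl E c x \<in> B"
    using balanced_convex_nbhd[OF assms] by metis
  obtain Q where Q: "openin (topo E) Q" "0 \<in> Q" "Q \<subseteq> B" using B by (auto simp: zero_nbhd_def)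
  define S where "S x = {r::real. r > 0 \<and> scl E (of_real (1 / r)) x \<in> B}" for x
  define p where "p x = Inf (S x)" for x
  have bdd: "bdd_below (S x)" for x unfolding S_def by (rule bdd_belowI[of _ 0]) auto
  have ne: "S x \<noteq> {}" if x: "x \<in> points E" for x
  proof -
    have "open {c \<in> topspace euclidean. scl E c x \<in> Q}"
      using openin_continuous_map_preimage[OF continuous_map_orbit[OF x] Q(1)] open_openin by blast
    moreover have "0 \<in> {c \<in> topspace euclidean. scl E c x \<in> Q}" using Q by simp
    ultimately obtain d where d: "d > 0" "ball 0 d \<subseteq> {c \<in> topspace euclidean. scl E c x \<in> Q}"
      using open_contains_ball by blast
    have "of_real (1 / (2 / d)) \<in> ball (0::'k) d" using d(1) by simp
    then have "scl E (of_real (1 / (2 / d))) x \<in> B" using d Q by blast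
    moreover have "0 < 2 / d" using d(1) by simp
    ultimately have "2 / d \<in> S x" unfolding S_def by blast
    then show ?thesis by blast
  qed
  have up: "r' \<in> S x" if "r \<in> S x" "r \<le> r'" for r r' x
  proof -
    have r: "r > 0" "r' > 0" "scl E (of_real (1 / r)) x \<in> B" using that by (auto simp: S_def)
    have "scl E (of_real (r / r')) (scl E (of_real (1 / r)) x) \<in> B"
      by (rule bal[OF r(3)]) (use r that in \<open>simp add: norm_divide\<close>)
    moreover have "scl E (of_real (r / r')) (scl E (of_real (1 / r)) x) = scl E (of_real (1 / r')) x"
      using r by simp
    ultimately show ?thesis using r by (simp add: S_def)
  qed
  have less: "p x < r \<longleftrightarrow> (\<exists>s\<in>S x. s < r)" if "x \<in> points E" for x r
    unfolding p_def using ne[OF that] bdd by (rule cInf_less_iff)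
  have nonneg: "0 \<le> p x" if "x \<in> points E" for x
    unfolding p_def by (rule cInf_greatest[OF ne[OF that]]) (auto simp: S_def)
  have le: "p x \<le> r" if "r \<in> S x" for x r
    unfolding p_def using that bdd by (rule cInf_lower)
  have add: "p (x + y) \<le> p x + p y" if x: "x \<in> points E" and y: "y \<in> points E" for x y
  proof (rule field_le_epsilon)
    fix e :: real assume "e > 0"
    then obtain r s where r: "r \<in> S x" "r < p x + e / 2" and s: "s \<in> S y" "s < p y + e / 2"
      using less[OF x, of "p x + e / 2"] less[OF y, of "p y + e / 2"] by auto
    have rs: "r > 0" "s > 0" using r s by (auto simp: S_def)
    \<comment> \<open>\<open>(x + y) / (r + s)\<close> is the convex combination of
      \<open>x / r\<close> and \<open>y / s\<close> with weights \<open>r / (r + s)\<close> and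
      \<open>s / (r + s)\<close>.\<close>
    have "scl E (of_real (r / (r + s))) (scl E (of_real (1 / r)) x) +
        scl E (of_real (s / (r + s))) (scl E (of_real (1 / s)) y) \<in> B"
    proof (rule B(2)[unfolded convex_in_def, rule_format])
      show "0 \<le> r / (r + s) \<and> 0 \<le> s / (r + s) \<and> r / (r + s) + s / (r + s) = 1"
        using rs by (simp add: add_divide_distrib[symmetric])
    qed (use r s in \<open>simp_all add: S_def\<close>)
    moreover have "scl E (of_real (r / (r + s))) (scl E (of_real (1 / r)) x) = scl E (of_real (1 / (r + s))) x"
      "scl E (of_real (s / (r + s))) (scl E (of_real (1 / s)) y) = scl E (of_real (1 / (r + s))) y"
      using rs by simp_all
    ultimately have "r + s \<in> S (x + y)"
      using rs by (simp add: S_def scale_right_distrib)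
    from le[OF this] show "p (x + y) \<le> p x + p y + e" using r s by simp
  qed
  have S0: "S 0 = {0<..}" using Q by (auto simp: S_def)
  have p0: "p 0 = 0" unfolding p_def S0 by simp
  have scale_le: "p (scl E c x) \<le> norm c * p x" if x: "x \<in> points E" for c x
  proof (cases "c = 0")
    case True
    then show ?thesis by (simp add: p0)
  next
    case False
    show ?thesis
    proof (rule field_le_epsilon)
      fix e :: real assume e: "e > 0"
      then obtain r where r: "r \<in> S x" "r < p x + e / norm c"
        using less[OF x, of "p x + e / norm c"] False by auto
      have r0: "r > 0" using r by (auto simp: S_def)
      have "scl E (c / of_real (norm c)) (scl E (of_real (1 / r)) x) \<in> B"
        by (rule bal) (use r False in \<open>auto simp: S_def norm_divide\<close>)
      then have "norm c * r \<in> S (scl E c x)"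
        using False r0 by (simp add: S_def)
      then have "p (scl E c x) \<le> norm c * r" by (rule le)
      also have "\<dots> \<le> norm c * (p x + e / norm c)" using r by (intro mult_left_mono) auto
      also have "\<dots> = norm c * p x + e" using False by (simp add: field_simps)
      finally show "p (scl E c x) \<le> norm c * p x + e" .
    qed
  qed
  have scale: "p (scl E c x) = norm c * p x" if x: "x \<in> points E" for c x
  proof (cases "c = 0")
    case False
    \<comment> \<open>The reverse inequality is \<open>scale_le\<close> for the scalar
      \<open>inverse c\<close> at the point \<open>c x\<close>.\<close>
    have "p x \<le> norm (inverse c) * p (scl E c x)"
      using scale_le[of "scl E c x" "inverse c"] x False by simp
    then have "norm c * p x \<le> p (scl E c x)" using False by (simp add: norm_divide field_simps)
    then show ?thesis using scale_le[OF x, of c] by simp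
  qed (simp add: p0)
  have "zero_nbhd E {x \<in> points E. p x < 1}"
    unfolding zero_nbhd_def
  proof (intro conjI exI)
    \<comment> \<open>Membership in \<open>B\<close> bounds the gauge only by 1; passing to
      \<open>2 x\<close> gives \<open>1 / 2\<close> and hence the strict inequality.\<close>
    let ?W = "{x \<in> points E. scl E (of_real 2) x \<in> Q}"
    show "openin (topo E) ?W" by (rule openin_continuous_map_preimage[OF continuous_map_dilation Q(1)])
    show "0 \<in> ?W" using Q by simp
    show "?W \<subseteq> {x \<in> points E. p x < 1}"
    proof
      fix x assume x: "x \<in> ?W"
      have "(1::real) / (1 / 2) = 2" by simp
      then have "1 / 2 \<in> S x" using x Q(3) unfolding S_def by auto
      then have "p x \<le> 1 / 2" by (rule le)
      then show "x \<in> {x \<in> points E. p x < 1}" using x by simp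
    qed
  qed simp
  then have "cont_seminorm E p" using nonneg add scale by (simp add: cont_seminorm_def)
  moreover have "{x \<in> points E. p x < 1} \<subseteq> U"
  proof safe
    fix x assume x: "x \<in> points E" "p x < 1"
    then obtain r where "r \<in> S x" "r < 1" using less by blast
    then have "1 \<in> S x" using up by fastforce
    then show "x \<in> U" using B(3) by (auto simp: S_def)
  qed
  ultimately show thesis using that by blast
qed

lemma zero_nbhd_iff: "zero_nbhd E V \<longleftrightarrow> V \<subseteq> points E \<and> (\<exists>p. cont_seminorm E p \<and> (\<forall>v\<in>points E. p v < 1 \<longrightarrow> v \<in> V))"
proof
  assume V: "zero_nbhd E V"
  obtain p where "cont_seminorm E p" "{x \<in> points E. p x < 1} \<subseteq> V" using gauge[OF V] .
  moreover have "V \<subseteq> points E" using V by (simp add: zero_nbhd_def)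
  ultimately show "V \<subseteq> points E \<and> (\<exists>p. cont_seminorm E p \<and> (\<forall>v\<in>points E. p v < 1 \<longrightarrow> v \<in> V))"
    by auto
next
  assume "V \<subseteq> points E \<and> (\<exists>p. cont_seminorm E p \<and> (\<forall>v\<in>points E. p v < 1 \<longrightarrow> v \<in> V))"
  then obtain p where p: "V \<subseteq> points E" "cont_seminorm E p" "{x \<in> points E. p x < 1} \<subseteq> V" by blast
  then show "zero_nbhd E V" unfolding cont_seminorm_def zero_nbhd_def by (meson order_trans)
qed

lemma seminorm_cmult:
  assumes "cont_seminorm E p" "c > 0"
  shows "cont_seminorm E (\<lambda>x. c * p x)"
proof -
  let ?W = "{x \<in> points E. scl E (of_real c) x \<in> {x \<in> points E. p x < 1}}"
  obtain Q where Q: "openin (topo E) Q" "0 \<in> Q" "Q \<subseteq> {x \<in> points E. p x < 1}"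
    using assms by (auto simp: cont_seminorm_def zero_nbhd_def)
  have "openin (topo E) {x \<in> points E. scl E (of_real c) x \<in> Q}"
    by (rule openin_continuous_map_preimage[OF continuous_map_dilation Q(1)])
  moreover have "{x \<in> points E. scl E (of_real c) x \<in> Q} \<subseteq> {x \<in> points E. c * p x < 1}"
    using Q(3) seminorm_scale[OF assms(1), of _ "of_real c"] assms(2) by auto
  moreover have "0 \<in> {x \<in> points E. scl E (of_real c) x \<in> Q}" using Q by simp
  ultimately have "zero_nbhd E {x \<in> points E. c * p x < 1}"
    unfolding zero_nbhd_def by blast
  then show ?thesis
    using assms seminorm_add[OF assms(1)] unfolding cont_seminorm_def
    by (auto simp flip: distrib_left)
qed

lemma seminorm_plus:
  assumes "cont_seminorm E p" "cont_seminorm E q"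
  shows "cont_seminorm E (\<lambda>x. p x + q x)"
proof -
  note p2 = seminorm_cmult[OF assms(1), of 2] and q2 = seminorm_cmult[OF assms(2), of 2]
  obtain P where P: "openin (topo E) P" "0 \<in> P" "P \<subseteq> {x \<in> points E. 2 * p x < 1}"
    using p2 by (auto simp: cont_seminorm_def zero_nbhd_def)
  obtain Q where Q: "openin (topo E) Q" "0 \<in> Q" "Q \<subseteq> {x \<in> points E. 2 * q x < 1}"
    using q2 by (auto simp: cont_seminorm_def zero_nbhd_def)
  have "P \<inter> Q \<subseteq> {x \<in> points E. p x + q x < 1}" using P(3) Q(3) by fastforce
  then have "zero_nbhd E {x \<in> points E. p x + q x < 1}"
    unfolding zero_nbhd_def using P Q by (intro conjI exI[of _ "P \<inter> Q"]) auto
  moreover have "p (x + y) + q (x + y) \<le> p x + q x + (p y + q y)"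
    if "x \<in> points E" "y \<in> points E" for x y
    using seminorm_add[OF assms(1) that] seminorm_add[OF assms(2) that] by simp
  ultimately show ?thesis
    using assms unfolding cont_seminorm_def by (auto simp: distrib_left)
qed

lemma seminorm_exists: obtains p where "cont_seminorm E p"
  using gauge[of "points E"] zero_nbhd_openin[of E "points E"] by auto

text \<open>Finitely many seminorms are dominated by one, obtained by adding them. Different slots
  and different orders of differentiation can then share a seminorm.\<close>

lemma seminorm_sum_plus:
  assumes "finite A" "\<And>i. i \<in> A \<Longrightarrow> cont_seminorm E (p i)"
  obtains q where "cont_seminorm E q" "\<And>i x. i \<in> A \<Longrightarrow> x \<in> points E \<Longrightarrow> p i x \<le> q x"
proof -
  have "\<exists>q. cont_seminorm E q \<and> (\<forall>i\<in>A. \<forall>x\<in>points E. p i x \<le> q x)" using assms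
  proof (induction A rule: finite_induct)
    case empty
    then show ?case using seminorm_exists by auto
  next
    case (insert a A)
    then obtain q where q: "cont_seminorm E q" "\<forall>i\<in>A. \<forall>x\<in>points E. p i x \<le> q x" by auto
    have pa: "cont_seminorm E (p a)" using insert by simp
    have "\<forall>i\<in>insert a A. \<forall>x\<in>points E. p i x \<le> p a x + q x"
      using q seminorm_nonneg[OF pa] seminorm_nonneg[OF q(1)] by (auto intro: add_increasing)
    then show ?case using seminorm_plus[OF pa q(1)] by blast
  qed
  then show thesis using that by blast
qed

section \<open>Openness, limits and filters in terms of seminorms\<close>

lemma openin_iff:
  "openin (topo E) U \<longleftrightarrow>
    U \<subseteq> points E \<and> (\<forall>x\<in>U. \<exists>p. cont_seminorm E p \<and> (\<forall>v\<in>points E. p v < 1 \<longrightarrow> x + v \<in> U))"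
proof (intro iffI conjI ballI)
  assume U: "openin (topo E) U"
  then show sub: "U \<subseteq> points E" by (rule openin_subset)
  fix x assume x: "x \<in> U"
  then have "openin (topo E) {v \<in> points E. x + v \<in> U}"
    using U sub by (intro openin_continuous_map_preimage[OF continuous_map_translation]) auto
  then have "zero_nbhd E {v \<in> points E. x + v \<in> U}"
    using x by (intro zero_nbhd_openin) auto
  then show "\<exists>p. cont_seminorm E p \<and> (\<forall>v\<in>points E. p v < 1 \<longrightarrow> x + v \<in> U)"
    unfolding zero_nbhd_iff by auto
next
  assume *: "U \<subseteq> points E \<and> (\<forall>x\<in>U. \<exists>p. cont_seminorm E p \<and> (\<forall>v\<in>points E. p v < 1 \<longrightarrow> x + v \<in> U))"
  show "openin (topo E) U"
  proof (subst openin_subopen, intro ballI)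
    fix x assume x: "x \<in> U"
    then have xE: "x \<in> points E" using * by blast
    obtain p where p: "cont_seminorm E p" "\<forall>v\<in>points E. p v < 1 \<longrightarrow> x + v \<in> U" using * x by blast
    obtain Q where Q: "openin (topo E) Q" "0 \<in> Q" "Q \<subseteq> {x \<in> points E. p x < 1}"
      using p by (auto simp: cont_seminorm_def zero_nbhd_def)
    have "openin (topo E) {y \<in> points E. - x + y \<in> Q}"
      using xE by (intro openin_continuous_map_preimage[OF continuous_map_translation Q(1)]) auto
    moreover have "{y \<in> points E. - x + y \<in> Q} \<subseteq> U"
    proof
      fix y assume "y \<in> {y \<in> points E. - x + y \<in> Q}"
      then have "x + (- x + y) \<in> U" using p(2) Q(3) by blast
      then show "y \<in> U" by simp
    qed
    ultimately show "\<exists>T. openin (topo E) T \<and> x \<in> T \<and> T \<subseteq> U"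
      using xE Q by (intro exI[of _ "{y \<in> points E. - x + y \<in> Q}"]) auto
  qed
qed

lemma openin_seminorm_ball:
  assumes p: "cont_seminorm E p" and "x \<in> points E"
  shows "openin (topo E) {y \<in> points E. p (y - x) < r}"
  unfolding openin_iff
proof (intro conjI ballI)
  fix y assume y: "y \<in> {y \<in> points E. p (y - x) < r}"
  \<comment> \<open>Scales the remaining distance to the sphere of radius \<open>r\<close> to
    1.\<close>
  define c where "c = 1 / (r - p (y - x))"
  have c: "c > 0" using y by (simp add: c_def)
  show "\<exists>q. cont_seminorm E q \<and> (\<forall>v\<in>points E. q v < 1 \<longrightarrow> y + v \<in> {y \<in> points E. p (y - x) < r})"
  proof (intro exI[of _ "\<lambda>v. c * p v"] conjI ballI impI seminorm_cmult[OF p c])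
    fix v assume v: "v \<in> points E" "c * p v < 1"
    then have "p v < r - p (y - x)" using y by (simp add: c_def field_simps)
    moreover have "p (y + v - x) \<le> p (y - x) + p v"
      using seminorm_add[OF p, of "y - x" v] y v assms(2) by (simp add: algebra_simps)
    ultimately show "y + v \<in> {y \<in> points E. p (y - x) < r}" using y v by auto
  qed
qed auto

lemma openin_nbhd:
  assumes "openin (topo E) U" "x \<in> U"
  obtains p where "cont_seminorm E p" "\<And>v. v \<in> points E \<Longrightarrow> p v < 1 \<Longrightarrow> x + v \<in> U"
  using assms(1)[unfolded openin_iff] assms(2) that by blast

text \<open>Reduces limits in \<open>E\<close> to limits of real functions, where sandwich and
  arithmetic rules apply. Membership in \<open>points E\<close> has to be carried along since the
  topology lives on a subset of the type.\<close>

lemma limitin_iff: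
  "limitin (topo E) h L \<F> \<longleftrightarrow>
    L \<in> points E \<and> eventually (\<lambda>a. h a \<in> points E) \<F> \<and>
    (\<forall>p. cont_seminorm E p \<longrightarrow> ((\<lambda>a. p (h a - L)) \<longlongrightarrow> 0) \<F>)"
proof (intro iffI conjI allI impI)
  assume l: "limitin (topo E) h L \<F>"
  then show L: "L \<in> points E" by (simp add: limitin_def)
  show ev: "eventually (\<lambda>a. h a \<in> points E) \<F>" using l L by (auto simp: limitin_def)
  fix p assume p: "cont_seminorm E p"
  show "((\<lambda>a. p (h a - L)) \<longlongrightarrow> 0) \<F>"
  proof (rule order_tendstoI)
    fix r :: real assume "r < 0"
    then show "eventually (\<lambda>a. r < p (h a - L)) \<F>"
      by (intro eventually_mono[OF ev]) (use L seminorm_nonneg[OF p] in \<open>force intro: less_le_trans\<close>)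
  next
    fix r :: real assume r: "0 < r"
    have "L \<in> {y \<in> points E. p (y - L) < r}" using L r seminorm_zero[OF p] by simp
    then have "eventually (\<lambda>a. h a \<in> {y \<in> points E. p (y - L) < r}) \<F>"
      using l openin_seminorm_ball[OF p L, of r] unfolding limitin_def by blast
    then show "eventually (\<lambda>a. p (h a - L) < r) \<F>" by eventually_elim simp
  qed
next
  assume *: "L \<in> points E \<and> eventually (\<lambda>a. h a \<in> points E) \<F> \<and>
    (\<forall>p. cont_seminorm E p \<longrightarrow> ((\<lambda>a. p (h a - L)) \<longlongrightarrow> 0) \<F>)"
  show "limitin (topo E) h L \<F>"
    unfolding limitin_def
  proof (intro conjI allI impI)
    fix U assume U: "openin (topo E) U \<and> L \<in> U"
    then obtain p where p: "cont_seminorm E p" "\<And>v. v \<in> points E \<Longrightarrow> p v < 1 \<Longrightarrow> L + v \<in> U"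
      using openin_nbhd by blast
    have "eventually (\<lambda>a. p (h a - L) < 1) \<F>"
      using * p(1) by (auto intro: order_tendstoD)
    moreover have "eventually (\<lambda>a. h a \<in> points E) \<F>" using * by blast
    ultimately show "eventually (\<lambda>a. h a \<in> U) \<F>"
    proof eventually_elim
      case (elim a)
      then show ?case using p(2)[of "h a - L"] * by simp
    qed
  qed (use * in blast)
qed

lemma Hausdorff: "Hausdorff_space (topo E)"
  using lcs by (simp add: lcs_def)

lemma limitin_unique:
  "limitin (topo E) h L \<F> \<Longrightarrow> limitin (topo E) h L' \<F> \<Longrightarrow> \<F> \<noteq> bot \<Longrightarrow> L = L'"
  using limitin_Hausdorff_unique[OF _ _ _ Hausdorff] by blast

lemma tendsto_orbit:
  assumes "cont_seminorm E p" "x \<in> points E"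
  shows "((\<lambda>c. p (scl E c x)) \<longlongrightarrow> 0) (at 0)"
proof -
  have "((\<lambda>c::'k. norm c * p x) \<longlongrightarrow> norm (0::'k) * p x) (at 0)" by (intro tendsto_intros)
  then show ?thesis by (simp add: seminorm_scale[OF assms])
qed

lemma eventually_zero_filter:
  "eventually P (zero_filter E) \<longleftrightarrow> (\<exists>p. cont_seminorm E p \<and> (\<forall>v\<in>points E. p v < 1 \<longrightarrow> P v))"
proof
  assume "eventually P (zero_filter E)"
  then obtain S where S: "openin (topo E) S" "0 \<in> S" "\<forall>x\<in>S. P x"
    by (auto simp: eventually_nhdsin)
  then show "\<exists>p. cont_seminorm E p \<and> (\<forall>v\<in>points E. p v < 1 \<longrightarrow> P v)"
    using openin_nbhd[OF S(1,2)] by (metis add_0)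
next
  assume "\<exists>p. cont_seminorm E p \<and> (\<forall>v\<in>points E. p v < 1 \<longrightarrow> P v)"
  then obtain p where p: "cont_seminorm E p" "\<And>v. v\<in>points E \<Longrightarrow> p v < 1 \<Longrightarrow> P v" by blast
  then show "eventually P (zero_filter E)"
    using openin_seminorm_ball[OF p(1), of 0 1] seminorm_zero[OF p(1)] unfolding eventually_nhdsin
    by (intro disjI2 exI[of _ "{y \<in> points E. p (y - 0) < 1}"]) auto
qed

lemma eventually_zero_filter_zero_nbhd: "eventually P (zero_filter E) \<longleftrightarrow> (\<exists>V. zero_nbhd E V \<and> (\<forall>v\<in>V. P v))"
  unfolding eventually_nhdsin zero_nbhd_def
  by (meson openin_subset points_closed(1) subset_iff)

lemma filterlim_zero_filter:
  "filterlim h (zero_filter E) \<F> \<longleftrightarrow>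
    eventually (\<lambda>a. h a \<in> points E) \<F> \<and> (\<forall>p. cont_seminorm E p \<longrightarrow> ((\<lambda>a. p (h a)) \<longlongrightarrow> 0) \<F>)"
proof -
  have "filterlim h (zero_filter E) \<F> \<longleftrightarrow> limitin (topo E) h 0 \<F>"
  proof
    assume h: "filterlim h (zero_filter E) \<F>"
    show "limitin (topo E) h 0 \<F>"
      unfolding limitin_def
    proof (intro conjI allI impI)
      fix U assume "openin (topo E) U \<and> 0 \<in> U"
      then have "eventually (\<lambda>x. x \<in> U) (zero_filter E)" unfolding eventually_nhdsin by blast
      then show "eventually (\<lambda>a. h a \<in> U) \<F>" by (rule h[unfolded filterlim_iff, rule_format])
    qed simp
  next
    assume h: "limitin (topo E) h 0 \<F>"
    show "filterlim h (zero_filter E) \<F>"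
      unfolding filterlim_iff
    proof (intro allI impI)
      fix P assume "eventually P (zero_filter E)"
      then obtain S where S: "openin (topo E) S" "0 \<in> S" "\<forall>x\<in>S. P x"
        by (auto simp: eventually_nhdsin)
      then have "eventually (\<lambda>a. h a \<in> S) \<F>" using h by (simp add: limitin_def)
      then show "eventually (\<lambda>a. P (h a)) \<F>" by eventually_elim (use S(3) in blast)
    qed
  qed
  then show ?thesis by (simp add: limitin_iff)
qed

lemma eventually_zero_filter_points: "eventually (\<lambda>v. v \<in> points E) (zero_filter E)"
  using seminorm_exists unfolding eventually_zero_filter by auto

lemma eventually_zero_filter_add:
  assumes "openin (topo E) U" "x \<in> U"
  shows "eventually (\<lambda>v. x + v \<in> U) (zero_filter E)"
  using openin_nbhd[OF assms] unfolding eventually_zero_filter by metis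

lemma openin_eventually:
  "openin (topo E) U \<longleftrightarrow> U \<subseteq> points E \<and> (\<forall>x\<in>U. eventually (\<lambda>v. x + v \<in> U) (zero_filter E))"
  unfolding openin_iff eventually_zero_filter ..

lemma filterlim_scale_zero_filter: "x \<in> points E \<Longrightarrow> filterlim (\<lambda>c. scl E c x) (zero_filter E) (at 0)"
  unfolding filterlim_zero_filter by (auto intro: tendsto_orbit)

lemma eventually_at_line:
  assumes "openin (topo E) U" "x \<in> U" "u \<in> points E"
  shows "eventually (\<lambda>t. x + scl E t u \<in> U) (at 0)"
  using filterlim_scale_zero_filter[OF assms(3)] eventually_zero_filter_add[OF assms(1,2)]
  unfolding filterlim_iff by blast

lemma continuous_map_at:
  assumes "openin (topo E) U"
  shows "continuous_map (subtopology (topo E) U) Y g \<longleftrightarrow>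
     (\<forall>x\<in>U. limitin Y (\<lambda>v. g (x + v)) (g x) (zero_filter E))"
proof -
  have UE: "U \<subseteq> points E" using assms by (rule openin_subset)
  have top: "topspace (subtopology (topo E) U) = U" using UE by auto
  show ?thesis
  proof
    assume c: "continuous_map (subtopology (topo E) U) Y g"
    show "\<forall>x\<in>U. limitin Y (\<lambda>v. g (x + v)) (g x) (zero_filter E)"
      unfolding limitin_def
    proof (intro ballI conjI allI impI)
      fix x assume x: "x \<in> U"
      show "g x \<in> topspace Y" using c x top by (auto simp: continuous_map_def)
      fix V assume V: "openin Y V \<and> g x \<in> V"
      have "openin (subtopology (topo E) U) {x \<in> U. g x \<in> V}"
        using c V unfolding continuous_map_def top by blast
      then have "openin (topo E) {x \<in> U. g x \<in> V}"
        using assms openin_open_subtopology by blast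
      then have "eventually (\<lambda>v. x + v \<in> {x \<in> U. g x \<in> V}) (zero_filter E)"
        by (rule eventually_zero_filter_add) (use x V in simp)
      then show "eventually (\<lambda>v. g (x + v) \<in> V) (zero_filter E)" by eventually_elim simp
    qed
  next
    assume l: "\<forall>x\<in>U. limitin Y (\<lambda>v. g (x + v)) (g x) (zero_filter E)"
    have "openin (topo E) {x \<in> U. g x \<in> V}" if V: "openin Y V" for V
      unfolding openin_eventually
    proof (intro conjI ballI)
      fix x assume x: "x \<in> {x \<in> U. g x \<in> V}"
      then have "eventually (\<lambda>v. g (x + v) \<in> V) (zero_filter E)" using l V by (auto simp: limitin_def)
      moreover have "eventually (\<lambda>v. x + v \<in> U) (zero_filter E)" using assms x by (auto intro: eventually_zero_filter_add)
      ultimately show "eventually (\<lambda>v. x + v \<in> {x \<in> U. g x \<in> V}) (zero_filter E)" by eventually_elim simp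
    qed (use UE in auto)
    moreover have "g x \<in> topspace Y" if "x \<in> U" for x using l that by (auto simp: limitin_def)
    ultimately show "continuous_map (subtopology (topo E) U) Y g"
      unfolding continuous_map_def top using assms
      by (auto simp: openin_open_subtopology)
  qed
qed

end

section \<open>Derivatives as functions of lists of directions\<close>

text \<open>Directions are kept in lists because differentiating once more appends an element, and
  because a slot is addressed by a splitting \<open>as @ v # bs\<close>. For \<open>m = 0\<close>
  the map is a constant, which only has to lie in \<open>points F\<close>.\<close>

definition slot_linear ::
  "('k, 'a::ab_group_add) tvs \<Rightarrow> ('k, 'b::ab_group_add) tvs \<Rightarrow> nat \<Rightarrow> ('a list \<Rightarrow> 'b) \<Rightarrow> bool" where
  "slot_linear E F m \<phi> \<longleftrightarrow>
     (\<forall>us. set us \<subseteq> points E \<and> length us = m \<longrightarrow> \<phi> us \<in> points F) \<and>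
     (\<forall>as bs. set as \<subseteq> points E \<and> set bs \<subseteq> points E \<and> length as + Suc (length bs) = m \<longrightarrow>
        linear_from_to E F (\<lambda>v. \<phi> (as @ v # bs)))"

lemma tuple_list:
  assumes "u \<in> tuples S l"
  shows "set (map u [0..<l]) \<subseteq> S" "length (map u [0..<l]) = l"
  using assms by (auto simp: tuples_def PiE_iff)

lemma list_tuple:
  assumes "set us \<subseteq> S"
  obtains u where "u \<in> tuples S (length us)" "map u [0..<length us] = us"
proof
  show "restrict ((!) us) {..<length us} \<in> tuples S (length us)"
    using assms by (auto simp: tuples_def)
  show "map (restrict ((!) us) {..<length us}) [0..<length us] = us"
    by (intro nth_equalityI) auto
qed

lemma ball_tuples_iff:
  "(\<forall>u\<in>tuples S l. P (map u [0..<l])) \<longleftrightarrow> (\<forall>us. set us \<subseteq> S \<and> length us = l \<longrightarrow> P us)"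
  using tuple_list[of _ S l] list_tuple[of _ S] by metis

lemma map_fun_upd_upt:
  assumes "i < l"
  shows "map (u(i := v)) [0..<l] = map u [0..<i] @ v # map u [Suc i..<l]"
proof -
  have "[0..<l] = [0..<i] @ i # [Suc i..<l]"
    using assms upt_add_eq_append[of 0 i "l - i"] upt_conv_Cons[of i l] by simp
  then show ?thesis by simp
qed

lemma linear_from_to_cong:
  assumes "lcs E" "\<And>x. x \<in> points E \<Longrightarrow> h x = h' x"
  shows "linear_from_to E F h \<longleftrightarrow> linear_from_to E F h'"
proof -
  interpret lcs_space E by standard fact
  show ?thesis using assms(2) by (auto simp: linear_from_to_def Pi_iff)
qed

lemma multilinear_iff:
  assumes E: "lcs E" and \<phi>: "\<And>u. u \<in> tuples (points E) l \<Longrightarrow> \<phi> u = \<psi> (map u [0..<l])"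
  shows "multilinear E F l \<phi> \<longleftrightarrow> slot_linear E F l \<psi>"
proof -
  interpret lcs_space E by standard fact
  have upd: "u(i := v) \<in> tuples (points E) l" if "u \<in> tuples (points E) l" "i < l" "v \<in> points E" for u i v
    using that by (auto simp: tuples_def PiE_iff extensional_def)
  have 1: "\<phi> \<in> tuples (points E) l \<rightarrow> points F \<longleftrightarrow>
      (\<forall>us. set us \<subseteq> points E \<and> length us = l \<longrightarrow> \<psi> us \<in> points F)"
    unfolding ball_tuples_iff[symmetric] Pi_iff by (rule ball_cong[OF refl]) (simp add: \<phi>)
  have 2: "linear_from_to E F (\<lambda>v. \<phi> (u(i := v))) \<longleftrightarrow>
      linear_from_to E F (\<lambda>v. \<psi> (map u [0..<i] @ v # map u [Suc i..<l]))"
    if "u \<in> tuples (points E) l" "i < l" for u i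
    by (rule linear_from_to_cong[OF E]) (simp add: \<phi>[OF upd[OF that]] map_fun_upd_upt[OF that(2)])
  have 3: "(\<forall>u\<in>tuples (points E) l. \<forall>i<l. linear_from_to E F (\<lambda>v. \<phi> (u(i := v)))) \<longleftrightarrow>
    (\<forall>as bs. set as \<subseteq> points E \<and> set bs \<subseteq> points E \<and> length as + Suc (length bs) = l \<longrightarrow>
        linear_from_to E F (\<lambda>v. \<psi> (as @ v # bs)))" (is "?L \<longleftrightarrow> ?R")
  proof
    assume L: ?L
    show ?R
    proof (intro allI impI)
      fix as bs assume *: "set as \<subseteq> points E \<and> set bs \<subseteq> points E \<and> length as + Suc (length bs) = l"
      \<comment> \<open>The entry 0 only fills the slot that is going to vary; it completes the
        list, so that it comes from a tuple.\<close>
      let ?us = "as @ 0 # bs"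
      have "set ?us \<subseteq> points E" using * by auto
      then obtain u where u: "u \<in> tuples (points E) (length ?us)" "map u [0..<length ?us] = ?us"
        by (rule list_tuple)
      have len: "length ?us = l" using * by simp
      have i: "length as < l" using * by simp
      have "map (u(length as := 0)) [0..<l] = map u [0..<length as] @ 0 # map u [Suc (length as)..<l]"
        by (rule map_fun_upd_upt[OF i])
      moreover have "u(length as := 0) = u"
      proof -
        have "u (length as) = ?us ! length as"
          using u(2) i len by (metis add_0 diff_zero length_upt nth_map nth_upt)
        then show ?thesis by auto
      qed
      ultimately have "map u [0..<length as] @ 0 # map u [Suc (length as)..<l] = ?us"
        using u(2)[unfolded len] by simp
      then have "map u [0..<length as] = as" "map u [Suc (length as)..<l] = bs" by simp_all
      then show "linear_from_to E F (\<lambda>v. \<psi> (as @ v # bs))"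
        using L 2[of u "length as"] u(1) i len by simp
    qed
  next
    assume R: ?R
    show ?L
    proof (intro ballI allI impI)
      fix u i assume u: "u \<in> tuples (points E) l" and i: "i < l"
      have "set (map u [0..<i]) \<subseteq> points E" "set (map u [Suc i..<l]) \<subseteq> points E"
        using u i by (auto simp: tuples_def PiE_iff)
      then show "linear_from_to E F (\<lambda>v. \<phi> (u(i := v)))"
        unfolding 2[OF u i] using i by (intro R[rule_format]) auto
    qed
  qed
  show ?thesis unfolding multilinear_def slot_linear_def 1 3 ..
qed

text \<open>\<open>\<Phi> us x\<close> is a candidate for \<open>d(us)f(x)\<close>. Keller's
  conditions are imposed on the candidates, and the last clause links consecutive orders:
  differentiating \<open>\<Phi> us\<close> in direction \<open>v\<close> gives
  \<open>\<Phi> (us @ [v])\<close>. No iterated derivative occurs, so a family can be constructed by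
  any formula and checked afterwards.\<close>

definition Ck_at ::
  "enat \<Rightarrow> ('k::real_or_complex, 'a::ab_group_add) tvs \<Rightarrow> ('k, 'b::ab_group_add) tvs \<Rightarrow>
   ('a list \<Rightarrow> 'a \<Rightarrow> 'b) \<Rightarrow> 'a \<Rightarrow> bool" where
  "Ck_at k E F \<Phi> x \<longleftrightarrow>
     (\<forall>l. enat l \<le> k \<longrightarrow>
        slot_linear E F l (\<lambda>us. \<Phi> us x) \<and>
        continuous_map (product_topology (\<lambda>_. topo E) {..<l}) (topo F) (\<lambda>u. \<Phi> (map u [0..<l]) x) \<and>
        (\<forall>W. zero_nbhd F W \<longrightarrow> (\<exists>U. zero_nbhd E U \<and> (\<forall>\<epsilon>::real. \<epsilon> > 0 \<longrightarrow>
           eventually (\<lambda>v. \<forall>us. set us \<subseteq> U \<and> length us = l \<longrightarrow>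
             \<Phi> us (x + v) - \<Phi> us x \<in> scl F (of_real \<epsilon>) ` W) (zero_filter E))))) \<and>
     (\<forall>us v. set us \<subseteq> points E \<and> v \<in> points E \<and> enat (Suc (length us)) \<le> k \<longrightarrow>
        limitin (topo F) (\<lambda>t. scl F (inverse t) (\<Phi> us (x + scl E t v) - \<Phi> us x)) (\<Phi> (us @ [v]) x) (at 0))"

text \<open>The family that belongs to \<open>f\<close> itself. It is meaningful only where the
  iterated derivative exists; elsewhere \<open>the\<close> yields an unspecified value.\<close>

definition dlist ::
  "('k::real_or_complex, 'a::ab_group_add) tvs \<Rightarrow> ('k, 'b::ab_group_add) tvs \<Rightarrow> ('a \<rightharpoonup> 'b) \<Rightarrow>
   'a list \<Rightarrow> 'a \<Rightarrow> 'b" where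
  "dlist E F f us x = the (fold (dir_deriv E F) us f x)"

lemma dlist_Nil [simp]: "dlist E F f [] x = the (f x)"
  by (simp add: dlist_def)

lemma fold_tuple: "iter_deriv E F l u f = fold (dir_deriv E F) (map u [0..<l]) f"
  by (simp add: iter_deriv_def)

lemma enat_less_succ: "enat l < k + 1 \<longleftrightarrow> enat l \<le> k"
  by (cases k) (auto simp: one_enat_def)

lemma zero_nbhd_subset: "zero_nbhd E U \<Longrightarrow> U \<subseteq> points E"
  by (simp add: zero_nbhd_def)

lemma at_zero_neq_bot: "at (0::'k::real_or_complex) \<noteq> bot"
  by simp

lemma has_dir_deriv_unique:
  assumes "lcs F" "has_dir_deriv E F u f x L" "has_dir_deriv E F u f x L'"
  shows "L = L'"
proof -
  interpret F: lcs_space F by standard fact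
  show ?thesis
    using assms(2,3) F.limitin_unique[OF _ _ at_zero_neq_bot] unfolding has_dir_deriv_def by blast
qed

lemma dir_deriv_eq_Some_iff:
  assumes "lcs F"
  shows "dir_deriv E F u f x = Some L \<longleftrightarrow> has_dir_deriv E F u f x L"
proof
  assume "has_dir_deriv E F u f x L"
  then have "\<exists>L. has_dir_deriv E F u f x L" "(THE L. has_dir_deriv E F u f x L) = L"
    using has_dir_deriv_unique[OF assms] by blast+
  then show "dir_deriv E F u f x = Some L" by (simp add: dir_deriv_def)
next
  assume *: "dir_deriv E F u f x = Some L"
  then obtain L' where L': "has_dir_deriv E F u f x L'" by (auto simp: dir_deriv_def split: if_splits)
  then have "(THE L. has_dir_deriv E F u f x L) = L'"
    using has_dir_deriv_unique[OF assms] by blast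
  then show "has_dir_deriv E F u f x L" using * L' by (auto simp: dir_deriv_def split: if_splits)
qed

text \<open>Together with \<open>Ck_piI\<close> this replaces the definition of the class, which
  speaks of \<open>deriv_map\<close> on tuples, by the pointwise conditions \<open>Ck_at\<close> on
  lists.\<close>

lemma Ck_piD:
  fixes E :: "('k::real_or_complex, 'a::ab_group_add) tvs" and F :: "('k, 'b::ab_group_add) tvs"
  assumes f: "Ck_pi k E F f"
  shows "openin (topo E) (dom f)" "ran f \<subseteq> points F" "lcs E" "lcs F"
    "\<And>x. x \<in> dom f \<Longrightarrow> Ck_at k E F (dlist E F f) x"
    "\<And>us x. set us \<subseteq> points E \<Longrightarrow> enat (length us) \<le> k \<Longrightarrow> x \<in> dom f \<Longrightarrow>
       fold (dir_deriv E F) us f x = Some (dlist E F f us x)"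
proof -
  show o: "openin (topo E) (dom f)" and rf: "ran f \<subseteq> points F" and lE: "lcs E" and lF: "lcs F"
    using f by (auto simp: Ck_pi_def vector_map_def)
  interpret E: lcs_space E by standard fact
  interpret F: lcs_space F by standard fact
  let ?\<Phi> = "dlist E F f"
  have dd: "dom (deriv_map E F l f) = dom f" if "enat l \<le> k" for l
    using f that by (auto simp: Ck_pi_def enat_less_succ)
  have D: "(\<forall>u\<in>tuples (points E) l. x \<in> dom (iter_deriv E F l u f)) \<and>
        multilinear E F l (\<lambda>u. the (iter_deriv E F l u f x))"
    "deriv_map E F l f x = Some (\<lambda>u\<in>tuples (points E) l. ?\<Phi> (map u [0..<l]) x)"
    if l: "enat l \<le> k" and x: "x \<in> dom f" for l x
  proof -
    have "x \<in> dom (deriv_map E F l f)" using dd[OF l] x by simp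
    then have "deriv_map E F l f x \<noteq> None" by (rule domD[THEN exE]) simp
    then show "(\<forall>u\<in>tuples (points E) l. x \<in> dom (iter_deriv E F l u f)) \<and>
        multilinear E F l (\<lambda>u. the (iter_deriv E F l u f x))"
      unfolding deriv_map_def by (rule contrapos_np) (rule if_not_P)
    then show "deriv_map E F l f x = Some (\<lambda>u\<in>tuples (points E) l. ?\<Phi> (map u [0..<l]) x)"
      unfolding deriv_map_def fold_tuple dlist_def by simp
  qed
  show some: "fold (dir_deriv E F) us f x = Some (?\<Phi> us x)"
    if us: "set us \<subseteq> points E" and k: "enat (length us) \<le> k" and x: "x \<in> dom f" for us x
  proof -
    obtain u where u: "u \<in> tuples (points E) (length us)" "map u [0..<length us] = us"
      using us by (rule list_tuple)
    then have "x \<in> dom (fold (dir_deriv E F) us f)"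
      using D(1)[OF k x] by (auto simp: fold_tuple)
    then show ?thesis by (auto simp: dlist_def)
  qed
  show "Ck_at k E F ?\<Phi> x" if x: "x \<in> dom f" for x
    unfolding Ck_at_def
  proof (intro conjI allI impI; (elim conjE)?)
    fix l assume l: "enat l \<le> k"
    have l': "enat l < k + 1" using l by (simp add: enat_less_succ)
    show "slot_linear E F l (\<lambda>us. ?\<Phi> us x)"
      using D(1)[OF l x] multilinear_iff[OF lE, of l "\<lambda>u. the (iter_deriv E F l u f x)" "\<lambda>us. ?\<Phi> us x"]
      by (simp add: fold_tuple dlist_def)
    have "continuous_map (product_topology (\<lambda>_. topo E) {..<l}) (topo F) (the (deriv_map E F l f x))"
      using f l' x unfolding Ck_pi_def by blast
    then show "continuous_map (product_topology (\<lambda>_. topo E) {..<l}) (topo F) (\<lambda>u. ?\<Phi> (map u [0..<l]) x)"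
      by (rule continuous_map_eq) (simp add: D(2)[OF l x] tuples_def)
    fix W assume W: "zero_nbhd F W"
    then obtain U where U: "zero_nbhd E U" and V: "\<And>\<epsilon>::real. \<epsilon> > 0 \<Longrightarrow> (\<exists>V. zero_nbhd E V \<and>
                 (\<forall>v\<in>V. x + v \<in> dom f \<and>
                    (\<lambda>u. the (deriv_map E F l f (x + v)) u - the (deriv_map E F l f x) u)
                      ` tuples U l \<subseteq> scl F (of_real \<epsilon>) ` W))"
      using f l' x unfolding Ck_pi_def by meson
    show "\<exists>U. zero_nbhd E U \<and> (\<forall>\<epsilon>::real. \<epsilon> > 0 \<longrightarrow>
           eventually (\<lambda>v. \<forall>us. set us \<subseteq> U \<and> length us = l \<longrightarrow>
             ?\<Phi> us (x + v) - ?\<Phi> us x \<in> scl F (of_real \<epsilon>) ` W) (zero_filter E))"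
    proof (intro exI[of _ U] conjI allI impI U)
      fix \<epsilon> :: real assume "\<epsilon> > 0"
      then obtain V where V: "zero_nbhd E V" "\<And>v. v \<in> V \<Longrightarrow> x + v \<in> dom f"
        "\<And>v. v \<in> V \<Longrightarrow> (\<lambda>u. the (deriv_map E F l f (x + v)) u - the (deriv_map E F l f x) u)
                      ` tuples U l \<subseteq> scl F (of_real \<epsilon>) ` W"
        using V by blast
      show "eventually (\<lambda>v. \<forall>us. set us \<subseteq> U \<and> length us = l \<longrightarrow>
             ?\<Phi> us (x + v) - ?\<Phi> us x \<in> scl F (of_real \<epsilon>) ` W) (zero_filter E)"
        unfolding E.eventually_zero_filter_zero_nbhd ball_tuples_iff[symmetric]
      proof (intro exI[of _ V] conjI ballI V(1))
        fix v u assume v: "v \<in> V" and u: "u \<in> tuples U l"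
        have "tuples U l \<subseteq> tuples (points E) l"
          using zero_nbhd_subset[OF U] by (auto simp: tuples_def PiE_iff)
        then have "u \<in> tuples (points E) l" using u by blast
        then show "?\<Phi> (map u [0..<l]) (x + v) - ?\<Phi> (map u [0..<l]) x \<in> scl F (of_real \<epsilon>) ` W"
          using subsetD[OF V(3)[OF v] imageI[OF u]] by (simp add: D(2)[OF l x] D(2)[OF l V(2)[OF v]])
      qed
    qed
  next
    fix us v assume us: "set us \<subseteq> points E" "v \<in> points E" "enat (Suc (length us)) \<le> k"
    let ?h = "fold (dir_deriv E F) us f"
    have "fold (dir_deriv E F) (us @ [v]) f x = Some (?\<Phi> (us @ [v]) x)"
      using us x by (intro some) auto
    then have "has_dir_deriv E F v ?h x (?\<Phi> (us @ [v]) x)"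
      by (simp add: dir_deriv_eq_Some_iff[OF lF])
    then show "limitin (topo F) (\<lambda>t. scl F (inverse t) (?\<Phi> us (x + scl E t v) - ?\<Phi> us x))
       (?\<Phi> (us @ [v]) x) (at 0)"
      by (simp add: has_dir_deriv_def dlist_def)
  qed
qed

text \<open>Induction from the right, because \<open>fold\<close> applies the head first and the
  last direction is thus the outermost derivative. Openness of \<open>D\<close> makes the difference
  quotients at points of \<open>D\<close> depend on values inside \<open>D\<close> only.\<close>

lemma fold_dir_deriv_eq:
  fixes E :: "('k::real_or_complex, 'a::ab_group_add) tvs" and F :: "('k, 'b::ab_group_add) tvs"
  assumes "lcs E" "lcs F" and o: "openin (topo E) D" and f: "\<And>x. f x = (if x \<in> D then Some (\<Phi> [] x) else None)"
    and C: "\<And>us v x. x \<in> D \<Longrightarrow> set us \<subseteq> points E \<Longrightarrow> v \<in> points E \<Longrightarrow> enat (Suc (length us)) \<le> k \<Longrightarrow>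
        limitin (topo F) (\<lambda>t. scl F (inverse t) (\<Phi> us (x + scl E t v) - \<Phi> us x)) (\<Phi> (us @ [v]) x) (at 0)"
  shows "set us \<subseteq> points E \<Longrightarrow> enat (length us) \<le> k \<Longrightarrow>
    fold (dir_deriv E F) us f = (\<lambda>x. if x \<in> D then Some (\<Phi> us x) else None)"
proof (induction us rule: rev_induct)
  case Nil
  then show ?case using f by auto
next
  case (snoc v us)
  interpret E: lcs_space E by standard fact
  have k: "enat (Suc (length us)) \<le> k" using snoc.prems by simp
  then have "enat (length us) \<le> k" by (meson enat_ord_simps(1) le_SucI order_refl order_trans)
  then have IH: "fold (dir_deriv E F) us f = (\<lambda>x. if x \<in> D then Some (\<Phi> us x) else None)" (is "_ = ?h")
    using snoc by simp
  have "dir_deriv E F v ?h x = (if x \<in> D then Some (\<Phi> (us @ [v]) x) else None)" for x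
  proof (cases "x \<in> D")
    case True
    have ev: "eventually (\<lambda>t. x + scl E t v \<in> D) (at 0)"
      by (rule E.eventually_at_line[OF o True]) (use snoc.prems in auto)
    have l: "limitin (topo F) (\<lambda>t. scl F (inverse t) (\<Phi> us (x + scl E t v) - \<Phi> us x)) (\<Phi> (us @ [v]) x) (at 0)"
      using snoc.prems k True by (intro C) auto
    have "limitin (topo F) (\<lambda>t. scl F (inverse t) (the (?h (x + scl E t v)) - the (?h x))) (\<Phi> (us @ [v]) x) (at 0)"
      by (rule limitin_transform_eventually[OF _ l])
        (use ev in \<open>rule eventually_mono\<close>, use True in auto)
    then have "has_dir_deriv E F v ?h x (\<Phi> (us @ [v]) x)"
      using True ev by (auto simp: has_dir_deriv_def dom_def)
    then show ?thesis using True by (simp add: dir_deriv_eq_Some_iff[OF assms(2)])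
  next
    case False
    then show ?thesis by (auto simp: dir_deriv_def has_dir_deriv_def dom_def)
  qed
  then show ?case by (simp add: IH)
qed

lemma Ck_piI:
  fixes E :: "('k::real_or_complex, 'a::ab_group_add) tvs" and F :: "('k, 'b::ab_group_add) tvs"
  assumes lE: "lcs E" and lF: "lcs F" and o: "openin (topo E) D"
    and f: "\<And>x. f x = (if x \<in> D then Some (\<Phi> [] x) else None)"
    and C: "\<And>x. x \<in> D \<Longrightarrow> Ck_at k E F \<Phi> x"
  shows "Ck_pi k E F f"
proof -
  interpret E: lcs_space E by standard fact
  interpret F: lcs_space F by standard fact
  have lim: "limitin (topo F) (\<lambda>t. scl F (inverse t) (\<Phi> us (x + scl E t v) - \<Phi> us x)) (\<Phi> (us @ [v]) x) (at 0)"
    if "x \<in> D" "set us \<subseteq> points E" "v \<in> points E" "enat (Suc (length us)) \<le> k" for us v x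
    using C that unfolding Ck_at_def by blast
  have fd: "fold (dir_deriv E F) us f = (\<lambda>x. if x \<in> D then Some (\<Phi> us x) else None)"
    if "set us \<subseteq> points E" "enat (length us) \<le> k" for us
    using fold_dir_deriv_eq[OF lE lF o f lim] that by blast
  have dom: "dom f = D" by (auto simp: f split: if_splits)
  have it: "iter_deriv E F l u f x = (if x \<in> D then Some (\<Phi> (map u [0..<l]) x) else None)"
    if "u \<in> tuples (points E) l" "enat l \<le> k" for u l x
    using fd tuple_list[OF that(1)] that(2) by (simp add: fold_tuple)
  have ml: "multilinear E F l (\<lambda>u\<in>tuples (points E) l. \<Phi> (map u [0..<l]) x)"
    "multilinear E F l (\<lambda>u. the (iter_deriv E F l u f x))"
    if "x \<in> D" "enat l \<le> k" for l x
    using C that multilinear_iff[OF lE, of l _ "\<lambda>us. \<Phi> us x"] it unfolding Ck_at_def by simp_all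
  have dm: "deriv_map E F l f x = (if x \<in> D then Some (\<lambda>u\<in>tuples (points E) l. \<Phi> (map u [0..<l]) x) else None)"
    if l: "enat l \<le> k" for l x
  proof (cases "x \<in> D")
    case True
    have "(\<lambda>u\<in>tuples (points E) l. the (iter_deriv E F l u f x)) = (\<lambda>u\<in>tuples (points E) l. \<Phi> (map u [0..<l]) x)"
      by (rule restrict_ext) (simp add: it[OF _ l] True)
    then show ?thesis unfolding deriv_map_def using ml(2)[OF True l] it[OF _ l] True by (auto simp: domIff)
  next
    case False
    \<comment> \<open>Off \<open>D\<close> some tuple must witness that the derivative is undefined;
      the zero tuple exists in every space.\<close>
    obtain u where "u \<in> tuples (points E) (length (replicate l (0::'a)))"
      using list_tuple[of "replicate l 0" "points E"] by (metis E.points_closed(1) set_replicate_conv_if empty_subsetI insert_subset)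
    then have "u \<in> tuples (points E) l" by simp
    then show ?thesis using it[OF _ l] False unfolding deriv_map_def by (auto simp: domIff)
  qed
  have ran: "ran f \<subseteq> points F"
  proof -
    have "\<Phi> [] x \<in> points F" if "x \<in> D" for x
      using C[OF that] unfolding Ck_at_def slot_linear_def
      by (metis bot.extremum list.set(1) list.size(3) zero_enat_def zero_le)
    then show ?thesis by (auto simp: ran_def f split: if_splits)
  qed
  have "D \<subseteq> points E" using o by (rule openin_subset)
  then have vm: "vector_map E F f" using lE lF ran dom by (simp add: vector_map_def)
  show ?thesis
    unfolding Ck_pi_def enat_less_succ dom
  proof (intro conjI allI impI ballI vm o)
    fix l assume l: "enat l \<le> k"
    show "dom (deriv_map E F l f) = D" by (auto simp: dm[OF l] dom_def)
    fix x assume x: "x \<in> D"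
    show "multilinear E F l (the (deriv_map E F l f x))"
      using ml(1)[OF x l] x by (simp add: dm[OF l])
    have "continuous_map (product_topology (\<lambda>_. topo E) {..<l}) (topo F) (\<lambda>u. \<Phi> (map u [0..<l]) x)"
      using C[OF x] l unfolding Ck_at_def by blast
    then show "continuous_map (product_topology (\<lambda>_. topo E) {..<l}) (topo F) (the (deriv_map E F l f x))"
      by (rule continuous_map_eq) (simp add: dm[OF l] x tuples_def)
    fix W assume "zero_nbhd F W"
    then obtain U where U: "zero_nbhd E U" "\<And>\<epsilon>::real. \<epsilon> > 0 \<Longrightarrow>
           eventually (\<lambda>v. \<forall>us. set us \<subseteq> U \<and> length us = l \<longrightarrow>
             \<Phi> us (x + v) - \<Phi> us x \<in> scl F (of_real \<epsilon>) ` W) (zero_filter E)"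
      using C[OF x] l unfolding Ck_at_def by meson
    show "\<exists>U. zero_nbhd E U \<and> (\<forall>\<epsilon>::real. \<epsilon> > 0 \<longrightarrow> (\<exists>V. zero_nbhd E V \<and>
                 (\<forall>v\<in>V. x + v \<in> D \<and>
                    (\<lambda>u. the (deriv_map E F l f (x + v)) u - the (deriv_map E F l f x) u)
                      ` tuples U l \<subseteq> scl F (of_real \<epsilon>) ` W)))"
    proof (rule exI[of _ U], intro conjI allI impI U(1))
      fix \<epsilon> :: real assume "\<epsilon> > 0"
      have "eventually (\<lambda>v. x + v \<in> D \<and> (\<forall>us. set us \<subseteq> U \<and> length us = l \<longrightarrow>
             \<Phi> us (x + v) - \<Phi> us x \<in> scl F (of_real \<epsilon>) ` W)) (zero_filter E)"
        using U(2)[OF \<open>\<epsilon> > 0\<close>] E.eventually_zero_filter_add[OF o x] by eventually_elim simp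
      then obtain V where V: "zero_nbhd E V" "\<And>v. v \<in> V \<Longrightarrow> x + v \<in> D"
        "\<And>v u. v \<in> V \<Longrightarrow> u \<in> tuples U l \<Longrightarrow>
             \<Phi> (map u [0..<l]) (x + v) - \<Phi> (map u [0..<l]) x \<in> scl F (of_real \<epsilon>) ` W"
        unfolding E.eventually_zero_filter_zero_nbhd using tuple_list[of _ U l] by blast
      have "tuples U l \<subseteq> tuples (points E) l"
        using zero_nbhd_subset[OF U(1)] by (auto simp: tuples_def PiE_iff)
      then have "(\<lambda>u. the (deriv_map E F l f (x + v)) u - the (deriv_map E F l f x) u)
                      ` tuples U l \<subseteq> scl F (of_real \<epsilon>) ` W" if "v \<in> V" for v
        using V(3)[OF that] V(2)[OF that] x by (auto simp: dm[OF l] image_subset_iff)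
      then show "\<exists>V. zero_nbhd E V \<and> (\<forall>v\<in>V. x + v \<in> D \<and>
            (\<lambda>u. the (deriv_map E F l f (x + v)) u - the (deriv_map E F l f x) u)
                      ` tuples U l \<subseteq> scl F (of_real \<epsilon>) ` W)"
        using V(1,2) by blast
    qed
  qed
qed

lemma Ck_at_cong:
  assumes lE: "lcs E" and x: "x \<in> O'" "openin (topo E) O'"
    and eq: "\<And>us y. set us \<subseteq> points E \<Longrightarrow> y \<in> O' \<Longrightarrow> \<Phi>' us y = \<Phi> us y"
    and C: "Ck_at k E F \<Phi> x"
  shows "Ck_at k E F \<Phi>' x"
proof -
  interpret E: lcs_space E by standard fact
  show ?thesis
    unfolding Ck_at_def
  proof (intro conjI allI impI; (elim conjE)?)
    fix l assume l: "enat l \<le> k"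
    have eqx: "\<Phi>' us x = \<Phi> us x" if "set us \<subseteq> points E" for us using eq[OF that x(1)] .
    have "slot_linear E F l (\<lambda>us. \<Phi> us x)" using C l unfolding Ck_at_def by blast
    then show "slot_linear E F l (\<lambda>us. \<Phi>' us x)"
    proof -
      have "linear_from_to E F (\<lambda>v. \<Phi>' (as @ v # bs) x) \<longleftrightarrow> linear_from_to E F (\<lambda>v. \<Phi> (as @ v # bs) x)"
        if "set as \<subseteq> points E" "set bs \<subseteq> points E" for as bs
        by (rule linear_from_to_cong[OF lE]) (use that in \<open>auto intro!: eqx\<close>)
      then show ?thesis using \<open>slot_linear E F l (\<lambda>us. \<Phi> us x)\<close> eqx
        unfolding slot_linear_def by simp
    qed
    have "continuous_map (product_topology (\<lambda>_. topo E) {..<l}) (topo F) (\<lambda>u. \<Phi> (map u [0..<l]) x)"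
      using C l unfolding Ck_at_def by blast
    then show "continuous_map (product_topology (\<lambda>_. topo E) {..<l}) (topo F) (\<lambda>u. \<Phi>' (map u [0..<l]) x)"
      by (rule continuous_map_eq) (intro eqx[symmetric], auto simp: PiE_iff)
    fix W assume "zero_nbhd F W"
    then obtain U where U: "zero_nbhd E U" "\<And>\<epsilon>::real. \<epsilon> > 0 \<Longrightarrow>
           eventually (\<lambda>v. \<forall>us. set us \<subseteq> U \<and> length us = l \<longrightarrow>
             \<Phi> us (x + v) - \<Phi> us x \<in> scl F (of_real \<epsilon>) ` W) (zero_filter E)"
      using C l unfolding Ck_at_def by meson
    show "\<exists>U. zero_nbhd E U \<and> (\<forall>\<epsilon>::real. \<epsilon> > 0 \<longrightarrow>
           eventually (\<lambda>v. \<forall>us. set us \<subseteq> U \<and> length us = l \<longrightarrow>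
             \<Phi>' us (x + v) - \<Phi>' us x \<in> scl F (of_real \<epsilon>) ` W) (zero_filter E))"
    proof (intro exI[of _ U] conjI allI impI U(1))
      fix \<epsilon> :: real assume "\<epsilon> > 0"
      show "eventually (\<lambda>v. \<forall>us. set us \<subseteq> U \<and> length us = l \<longrightarrow>
             \<Phi>' us (x + v) - \<Phi>' us x \<in> scl F (of_real \<epsilon>) ` W) (zero_filter E)"
        using U(2)[OF \<open>\<epsilon> > 0\<close>] E.eventually_zero_filter_add[OF x(2,1)]
      proof eventually_elim
        case (elim v)
        show ?case
        proof (intro allI impI, elim conjE)
          fix us assume us: "set us \<subseteq> U" "length us = l"
          then have "set us \<subseteq> points E" using zero_nbhd_subset[OF U(1)] by blast
          then show "\<Phi>' us (x + v) - \<Phi>' us x \<in> scl F (of_real \<epsilon>) ` W"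
            using elim us eq x(1) by simp
        qed
      qed
    qed
  next
    fix us v assume us: "set us \<subseteq> points E" "v \<in> points E" "enat (Suc (length us)) \<le> k"
    have l: "limitin (topo F) (\<lambda>t. scl F (inverse t) (\<Phi> us (x + scl E t v) - \<Phi> us x)) (\<Phi> (us @ [v]) x) (at 0)"
      using C us unfolding Ck_at_def by blast
    have ev: "eventually (\<lambda>t. x + scl E t v \<in> O') (at 0)"
      by (rule E.eventually_at_line[OF x(2,1) us(2)])
    have "limitin (topo F) (\<lambda>t. scl F (inverse t) (\<Phi>' us (x + scl E t v) - \<Phi>' us x)) (\<Phi> (us @ [v]) x) (at 0)"
      by (rule limitin_transform_eventually[OF _ l])
        (use ev in \<open>rule eventually_mono\<close>, use us(1) x(1) eq in auto)
    moreover have "\<Phi>' (us @ [v]) x = \<Phi> (us @ [v]) x" using us x(1) by (intro eq) auto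
    ultimately show "limitin (topo F) (\<lambda>t. scl F (inverse t) (\<Phi>' us (x + scl E t v) - \<Phi>' us x)) (\<Phi>' (us @ [v]) x) (at 0)"
      by simp
  qed
qed

section \<open>Locality of derivatives and of Keller's class\<close>

lemma dir_deriv_local:
  assumes "lcs E" "lcs F" "openin (topo E) O'" "\<And>y. y \<in> O' \<Longrightarrow> f y = f' y" "u \<in> points E" "x \<in> O'"
  shows "dir_deriv E F u f x = dir_deriv E F u f' x"
proof -
  interpret E: lcs_space E by standard fact
  have ev: "eventually (\<lambda>t. x + scl E t u \<in> O') (at 0)"
    by (rule E.eventually_at_line) (use assms in auto)
  have imp: "has_dir_deriv E F u g' x L" if "has_dir_deriv E F u g x L" "\<And>y. y \<in> O' \<Longrightarrow> g y = g' y" for g g' L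
    unfolding has_dir_deriv_def
  proof (intro conjI)
    note g = that(1)[unfolded has_dir_deriv_def]
    show "x \<in> dom g'" using g that(2)[OF assms(6)] by (simp add: domIff)
    from g have "\<forall>\<^sub>F t in at 0. x + scl E t u \<in> dom g" by blast
    with ev show "\<forall>\<^sub>F t in at 0. x + scl E t u \<in> dom g'"
      by eventually_elim (use that(2) in \<open>simp add: domIff\<close>)
    from g have l: "limitin (topo F) (\<lambda>t. scl F (inverse t) (the (g (x + scl E t u)) - the (g x))) L (at 0)"
      by blast
    show "limitin (topo F) (\<lambda>t. scl F (inverse t) (the (g' (x + scl E t u)) - the (g' x))) L (at 0)"
      by (rule limitin_transform_eventually[OF _ l])
        (use ev in \<open>rule eventually_mono\<close>, use that(2) assms(6) in simp)
  qed
  have "has_dir_deriv E F u f x L \<longleftrightarrow> has_dir_deriv E F u f' x L" for L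
    using imp[of f L f'] imp[of f' L f] assms(4) by auto
  then have "has_dir_deriv E F u f x = has_dir_deriv E F u f' x" by (rule ext)
  then show ?thesis unfolding dir_deriv_def by simp
qed

lemma dlist_local:
  assumes "lcs E" "lcs F" "openin (topo E) O'" "\<And>y. y \<in> O' \<Longrightarrow> f y = f' y"
    "set us \<subseteq> points E" "x \<in> O'"
  shows "dlist E F f us x = dlist E F f' us x"
proof -
  have "\<forall>x\<in>O'. fold (dir_deriv E F) us f x = fold (dir_deriv E F) us f' x"
    using assms(5)
  proof (induction us rule: rev_induct)
    case (snoc v us)
    then have "\<And>y. y \<in> O' \<Longrightarrow> fold (dir_deriv E F) us f y = fold (dir_deriv E F) us f' y" by simp
    from dir_deriv_local[OF assms(1-3) this, where u = v] snoc.prems show ?case by simp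
  qed (use assms(4) in simp)
  then show ?thesis using assms(6) by (simp add: dlist_def)
qed

text \<open>The comparison function \<open>f'\<close> may change with the point. This glues
  solutions that are only known near each point, as happens for the lifts to higher indices.\<close>

lemma Ck_pi_local:
  assumes lE: "lcs E" and lF: "lcs F"
    and loc: "\<And>x. x \<in> dom f \<Longrightarrow> \<exists>f' O'. Ck_pi k E F f' \<and> openin (topo E) O' \<and> x \<in> O' \<and> O' \<subseteq> dom f \<and>
       (\<forall>y\<in>O'. f y = f' y)"
  shows "Ck_pi k E F f"
proof (rule Ck_piI[OF lE lF, where D = "dom f" and \<Phi> = "dlist E F f"])
  show "openin (topo E) (dom f)" by (subst openin_subopen) (use loc in blast)
  show "f x = (if x \<in> dom f then Some (dlist E F f [] x) else None)" for x by auto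
  fix x assume "x \<in> dom f"
  then obtain f' O' where *: "Ck_pi k E F f'" "openin (topo E) O'" "x \<in> O'" "O' \<subseteq> dom f" "\<forall>y\<in>O'. f y = f' y"
    using loc[OF \<open>x \<in> dom f\<close>] by (elim exE conjE)
  then have "x \<in> dom f'" using \<open>x \<in> dom f\<close> by (simp add: domIff)
  then have C: "Ck_at k E F (dlist E F f') x" by (rule Ck_piD(5)[OF *(1)])
  show "Ck_at k E F (dlist E F f) x"
  proof (rule Ck_at_cong[OF lE *(3,2) _ C])
    fix us y assume "set us \<subseteq> points E" "y \<in> O'"
    then show "dlist E F f us y = dlist E F f' us y"
      using *(5) by (intro dlist_local[OF lE lF *(2)]) auto
  qed
qed

section \<open>Banachable spaces\<close>

text \<open>A norm inducing the topology is fixed by choice. It is a norm on \<open>points G\<close>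
  only, hence \<open>Metric_space\<close> rather than a type class carries the analysis.\<close>

locale banach_tvs = lcs_space G
  for G :: "('k::real_or_complex, 'g::ab_group_add) tvs" +
  fixes N :: "'g \<Rightarrow> real"
  assumes N_eq_0: "x \<in> points G \<Longrightarrow> N x = 0 \<longleftrightarrow> x = 0"
    and N_scale: "x \<in> points G \<Longrightarrow> N (scl G c x) = norm c * N x"
    and N_add: "x \<in> points G \<Longrightarrow> y \<in> points G \<Longrightarrow> N (x + y) \<le> N x + N y"
    and N_metric: "Metric_space (points G) (\<lambda>x y. N (x - y))"
    and N_topo: "Metric_space.mtopology (points G) (\<lambda>x y. N (x - y)) = topo G"
    and N_complete: "Metric_space.mcomplete (points G) (\<lambda>x y. N (x - y))"

lemma banachable_banach_tvs: "banachable G \<Longrightarrow> \<exists>N. banach_tvs G N"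
  unfolding banachable_def banach_tvs_def lcs_space_def banach_tvs_axioms_def by auto

section \<open>Norm calculus and the mean value inequality for curves\<close>

context banach_tvs
begin

sublocale M: Metric_space "points G" "\<lambda>x y. N (x - y)"
  by (rule N_metric)

lemma N_zero [simp]: "N 0 = 0"
  using N_eq_0[of 0] by simp

lemma N_nonneg: "x \<in> points G \<Longrightarrow> 0 \<le> N x"
  using M.nonneg[of x 0] by simp

lemma N_minus: "x \<in> points G \<Longrightarrow> N (- x) = N x"
  using N_scale[of x "-1"] by simp

lemma N_diff: "x \<in> points G \<Longrightarrow> y \<in> points G \<Longrightarrow> N (x - y) \<le> N x + N y"
  using N_add[of x "- y"] N_minus[of y] by simp

lemma N_diff_commute: "x \<in> points G \<Longrightarrow> y \<in> points G \<Longrightarrow> N (x - y) = N (y - x)"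
  using N_minus[of "x - y"] by simp

lemma N_le_0_iff: "x \<in> points G \<Longrightarrow> N x \<le> 0 \<longleftrightarrow> x = 0"
  using N_nonneg[of x] N_eq_0[of x] by auto

lemma N_scale_real: "x \<in> points G \<Longrightarrow> 0 \<le> c \<Longrightarrow> N (scl G (of_real c) x) = c * N x"
  using N_scale[of x "of_real c"] by simp

lemma N_triangle:
  "x \<in> points G \<Longrightarrow> y \<in> points G \<Longrightarrow> z \<in> points G \<Longrightarrow> N (x - z) \<le> N (x - y) + N (y - z)"
  using N_add[of "x - y" "y - z"] by simp

lemma N_le_add_diff: "x \<in> points G \<Longrightarrow> y \<in> points G \<Longrightarrow> N x \<le> N y + N (x - y)"
  using N_add[of y "x - y"] by simp

lemma N_sum:
  assumes "\<And>i. i \<in> A \<Longrightarrow> h i \<in> points G"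
  shows "N (sum h A) \<le> (\<Sum>i\<in>A. N (h i))"
proof (cases "finite A")
  case True
  then show ?thesis using assms
  proof (induction A rule: finite_induct)
    case (insert a A)
    have "N (h a + sum h A) \<le> N (h a) + N (sum h A)"
      by (rule N_add) (use insert.prems in auto)
    also have "N (sum h A) \<le> (\<Sum>i\<in>A. N (h i))" by (rule insert.IH) (use insert.prems in auto)
    finally show ?case using insert.hyps by simp
  qed simp
qed simp

lemma seminorm_N: "cont_seminorm G N"
proof -
  have "openin (topo G) (M.mball 0 1)" using M.openin_mball[of 0 1] by (simp only: N_topo)
  moreover have "M.mball 0 1 = {x \<in> points G. N x < 1}" by (auto simp: M.mball_def N_minus)
  ultimately have "openin (topo G) {x \<in> points G. N x < 1}" by simp
  then have "zero_nbhd G {x \<in> points G. N x < 1}" by (rule zero_nbhd_openin) simp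
  then show ?thesis unfolding cont_seminorm_def using N_nonneg N_add N_scale by blast
qed

lemma seminorm_le_N:
  assumes p: "cont_seminorm G p"
  obtains C where "C > 0" "\<And>x. x \<in> points G \<Longrightarrow> p x \<le> C * N x"
proof -
  have "openin M.mtopology {y \<in> points G. p (y - 0) < 1}"
    unfolding N_topo by (rule openin_seminorm_ball[OF p]) simp
  moreover have "0 \<in> {y \<in> points G. p (y - 0) < 1}" using seminorm_zero[OF p] by simp
  ultimately obtain r where r: "r > 0" "M.mball 0 r \<subseteq> {y \<in> points G. p (y - 0) < 1}"
    unfolding M.openin_mtopology by blast
  show thesis
  proof
    \<comment> \<open>\<open>x\<close> is scaled to norm \<open>r / 2\<close>, strictly inside the
      ball, which costs the factor \<open>2 / r\<close>.\<close>
    show "2 / r > 0" using r by simp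
    fix x assume x: "x \<in> points G"
    show "p x \<le> 2 / r * N x"
    proof (cases "x = 0")
      case False
      then have N: "N x > 0" using N_nonneg[OF x] N_eq_0[OF x] by simp
      define c where "c = r / (2 * N x)"
      have c: "c > 0" using r N by (simp add: c_def)
      have "N (scl G (of_real c) x) = c * N x" using c by (intro N_scale_real[OF x]) simp
      also have "\<dots> = r / 2" using N by (simp add: c_def)
      finally have "N (scl G (of_real c) x) = r / 2" .
      then have "scl G (of_real c) x \<in> M.mball 0 r" using x r by (simp add: M.mball_def N_minus)
      then have "p (scl G (of_real c) x) < 1" using r by auto
      then have "c * p x < 1" using seminorm_scale[OF p x, of "of_real c"] c by simp
      then have "p x < 1 / c" using c by (simp add: field_simps)
      then show ?thesis by (simp add: c_def)
    qed (simp add: seminorm_zero[OF p])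
  qed
qed

lemma limitin_N:
  "limitin (topo G) h L \<F> \<longleftrightarrow>
    L \<in> points G \<and> eventually (\<lambda>a. h a \<in> points G) \<F> \<and> ((\<lambda>a. N (h a - L)) \<longlongrightarrow> 0) \<F>"
  (is "_ \<longleftrightarrow> ?R")
proof
  assume R: ?R
  have "((\<lambda>a. p (h a - L)) \<longlongrightarrow> 0) \<F>" if p: "cont_seminorm G p" for p
  proof -
    obtain C where C: "C > 0" "\<And>x. x \<in> points G \<Longrightarrow> p x \<le> C * N x" using seminorm_le_N[OF p] by metis
    have "((\<lambda>a. C * N (h a - L)) \<longlongrightarrow> C * 0) \<F>" using R by (intro tendsto_intros) auto
    then have lim: "((\<lambda>a. C * N (h a - L)) \<longlongrightarrow> 0) \<F>" by simp
    from R have ev: "eventually (\<lambda>a. h a \<in> points G) \<F>" by blast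
    have 1: "eventually (\<lambda>a. 0 \<le> p (h a - L)) \<F>"
      by (rule eventually_mono[OF ev]) (use R in \<open>auto intro: seminorm_nonneg[OF p]\<close>)
    have 2: "eventually (\<lambda>a. p (h a - L) \<le> C * N (h a - L)) \<F>"
      by (rule eventually_mono[OF ev]) (use R in \<open>auto intro: C(2)\<close>)
    show ?thesis by (rule tendsto_sandwich[OF 1 2 tendsto_const lim])
  qed
  then show "limitin (topo G) h L \<F>" using R by (simp add: limitin_iff)
qed (use seminorm_N in \<open>auto simp: limitin_iff\<close>)

lemma zero_nbhd_N: "zero_nbhd G W \<longleftrightarrow> W \<subseteq> points G \<and> (\<exists>r>0. \<forall>x\<in>points G. N x < r \<longrightarrow> x \<in> W)"
proof
  assume "zero_nbhd G W"
  then obtain p where p: "W \<subseteq> points G" "cont_seminorm G p" "\<forall>v\<in>points G. p v < 1 \<longrightarrow> v \<in> W"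
    unfolding zero_nbhd_iff by blast
  obtain C where C: "C > 0" "\<And>x. x \<in> points G \<Longrightarrow> p x \<le> C * N x" using seminorm_le_N[OF p(2)] by metis
  have "x \<in> W" if x: "x \<in> points G" "N x < 1 / C" for x
  proof -
    have "C * N x < 1" using x C by (simp add: field_simps)
    then have "p x < 1" using C(2)[OF x(1)] by linarith
    then show ?thesis using p x by blast
  qed
  moreover have "1 / C > 0" using C by simp
  ultimately show "W \<subseteq> points G \<and> (\<exists>r>0. \<forall>x\<in>points G. N x < r \<longrightarrow> x \<in> W)" using p(1) by blast
next
  assume "W \<subseteq> points G \<and> (\<exists>r>0. \<forall>x\<in>points G. N x < r \<longrightarrow> x \<in> W)"
  then obtain r where r: "W \<subseteq> points G" "r > 0" "\<forall>x\<in>points G. N x < r \<longrightarrow> x \<in> W" by blast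
  show "zero_nbhd G W"
    unfolding zero_nbhd_iff
    by (intro conjI r(1) exI[of _ "\<lambda>x. 1 / r * N x"] seminorm_cmult[OF seminorm_N])
      (use r in \<open>auto simp: field_simps\<close>)
qed

text \<open>Bisection replaces integration and linear functionals: the increment estimate with slack
  \<open>e\<close> is additive over adjacent intervals and holds on every short interval around a
  point by differentiability there, so \<open>Bolzano\<close> extends it to \<open>[0, 1]\<close>.
  The vector \<open>c\<close> turns the result into an estimate of a linearization error.\<close>

lemma mean_value_real:
  fixes h h' :: "real \<Rightarrow> 'g"
  assumes h: "\<And>s. 0 \<le> s \<Longrightarrow> s \<le> 1 \<Longrightarrow> h s \<in> points G \<and> h' s \<in> points G \<and> N (h' s - c) \<le> B \<and>
      limitin (topo G) (\<lambda>t. scl G (of_real (inverse t)) (h (s + t) - h s)) (h' s) (at 0)"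
    and c: "c \<in> points G"
  shows "N (h 1 - h 0 - c) \<le> B"
proof (rule field_le_epsilon)
  fix e :: real assume e: "e > 0"
  \<comment> \<open>\<open>Bolzano\<close> also tests intervals that protrude from
    \<open>[0, 1]\<close>; the guard makes \<open>P\<close> vacuous for them.\<close>
  define P where "P a b \<longleftrightarrow> (0 \<le> a \<and> a \<le> b \<and> b \<le> 1 \<longrightarrow>
    N (h b - h a - scl G (of_real (b - a)) c) \<le> (B + e) * (b - a))" for a b
  have "P 0 1"
  proof (rule Bolzano)
    show "(0::real) \<le> 1" by simp
    show "P a d" if "P a b" "P b d" "a \<le> b" "b \<le> d" for a b d
      unfolding P_def
    proof
      assume ad: "0 \<le> a \<and> a \<le> d \<and> d \<le> 1"
      have "h d - h a - scl G (of_real (d - a)) c =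
          (h b - h a - scl G (of_real (b - a)) c) + (h d - h b - scl G (of_real (d - b)) c)"
        by (simp add: scale_left_diff_distrib algebra_simps)
      also have "N \<dots> \<le> N (h b - h a - scl G (of_real (b - a)) c) + N (h d - h b - scl G (of_real (d - b)) c)"
        using h ad that c by (intro N_add) auto
      also have "\<dots> \<le> (B + e) * (b - a) + (B + e) * (d - b)"
        using that ad unfolding P_def by (intro add_mono) auto
      finally show "N (h d - h a - scl G (of_real (d - a)) c) \<le> (B + e) * (d - a)"
        by (simp add: algebra_simps)
    qed
  next
    fix x :: real assume x: "0 \<le> x" "x \<le> 1"
    have "limitin (topo G) (\<lambda>t. scl G (of_real (inverse t)) (h (x + t) - h x)) (h' x) (at 0)"
      using h x by blast
    then have "((\<lambda>t. N (scl G (of_real (inverse t)) (h (x + t) - h x) - h' x)) \<longlongrightarrow> 0) (at 0)"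
      unfolding limitin_N by blast
    then have "eventually (\<lambda>t. N (scl G (of_real (inverse t)) (h (x + t) - h x) - h' x) < e) (at 0)"
      using e by (rule order_tendstoD)
    then obtain d where d: "d > 0"
      "\<And>t. t \<noteq> 0 \<Longrightarrow> \<bar>t\<bar> < d \<Longrightarrow> N (scl G (of_real (inverse t)) (h (x + t) - h x) - h' x) < e"
      unfolding eventually_at by (auto simp: dist_real_def)
    \<comment> \<open>Both signs of \<open>t\<close> are needed: an interval around \<open>x\<close>
      is split at \<open>x\<close> into a forward and a backward increment.\<close>
    have est: "N (h (x + t) - h x - scl G (of_real t) c) \<le> (B + e) * \<bar>t\<bar>"
      if t: "\<bar>t\<bar> < d" "0 \<le> x + t" "x + t \<le> 1" for t
    proof (cases "t = 0")
      case False
      let ?q = "scl G (of_real (inverse t)) (h (x + t) - h x)"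
      have pts: "h (x + t) \<in> points G" "h x \<in> points G" "h' x \<in> points G" using h x t by auto
      have "scl G (of_real t) ?q = h (x + t) - h x"
        using False by (simp flip: of_real_mult)
      then have eq: "h (x + t) - h x - scl G (of_real t) c = scl G (of_real t) (?q - c)"
        by (simp add: scale_right_diff_distrib)
      have "N (?q - c) \<le> N (?q - h' x) + N (h' x - c)"
        using pts c by (intro N_triangle) auto
      also have "\<dots> \<le> e + B" using d(2)[OF False t(1)] h[OF x] by (intro add_mono) auto
      finally have le: "N (?q - c) \<le> e + B" .
      have "h (x + t) - h x - scl G (of_real t) c = scl G (of_real t) (?q - c)" by (rule eq)
      also have "N \<dots> = \<bar>t\<bar> * N (?q - c)"
        using pts c N_scale[of "?q - c" "of_real t"] by simp
      also have "\<bar>t\<bar> * N (?q - c) \<le> \<bar>t\<bar> * (e + B)" using le by (rule mult_left_mono) simp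
      finally show ?thesis by (simp add: mult.commute add.commute)
    qed simp
    show "\<exists>d>0. \<forall>a b. a \<le> x \<and> x \<le> b \<and> b - a < d \<longrightarrow> P a b"
    proof (intro exI[of _ d] conjI allI impI d(1))
      fix a b assume ab: "a \<le> x \<and> x \<le> b \<and> b - a < d"
      show "P a b"
        unfolding P_def
      proof
        assume ab': "0 \<le> a \<and> a \<le> b \<and> b \<le> 1"
        have 1: "N (h b - h x - scl G (of_real (b - x)) c) \<le> (B + e) * (b - x)"
          using est[of "b - x"] ab ab' x by simp
        have 2: "N (h a - h x - scl G (of_real (a - x)) c) \<le> (B + e) * (x - a)"
          using est[of "a - x"] ab ab' x by simp
        have "h b - h a - scl G (of_real (b - a)) c =
          (h b - h x - scl G (of_real (b - x)) c) - (h a - h x - scl G (of_real (a - x)) c)"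
          by (simp add: scale_left_diff_distrib algebra_simps)
        also have "N \<dots> \<le> N (h b - h x - scl G (of_real (b - x)) c) + N (h a - h x - scl G (of_real (a - x)) c)"
          using h ab ab' x c by (intro N_diff) auto
        also have "\<dots> \<le> (B + e) * (b - x) + (B + e) * (x - a)" using 1 2 by simp
        finally show "N (h b - h a - scl G (of_real (b - a)) c) \<le> (B + e) * (b - a)"
          by (simp add: algebra_simps)
      qed
    qed
  qed
  then show "N (h 1 - h 0 - c) \<le> B + e" by (simp add: P_def)
qed

subsection \<open>The bounded inverse theorem\<close>

lemma linear_from_toD:
  assumes "linear_from_to E' G A"
  shows "v \<in> points E' \<Longrightarrow> A v \<in> points G"
    "v \<in> points E' \<Longrightarrow> w \<in> points E' \<Longrightarrow> A (v + w) = A v + A w"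
    "v \<in> points E' \<Longrightarrow> A (scl E' c v) = scl G c (A v)"
  using assms by (auto simp: linear_from_to_def)

lemma linear_diff:
  assumes "lcs E'" "linear_from_to E' G A" "v \<in> points E'" "w \<in> points E'"
  shows "A (v - w) = A v - A w" "A 0 = 0" "A (- v) = - A v"
proof -
  interpret E': lcs_space E' by standard fact
  have "A (v - w + w) = A (v - w) + A w" using linear_from_toD(2)[OF assms(2)] assms by blast
  then show "A (v - w) = A v - A w" by simp
  show 0: "A 0 = 0" using linear_from_toD(2)[OF assms(2), of 0 0] by simp
  have "A (- v + v) = A (- v) + A v" using linear_from_toD(2)[OF assms(2)] assms by blast
  then show "A (- v) = - A v" using 0 by (simp add: eq_neg_iff_add_eq_0)
qed

text \<open>Comparison with the geometric series: partial sums beyond \<open>m\<close> differ by at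
  most \<open>2 * C * (1 / 2) ^ m\<close>, which gives the Cauchy property and, at
  \<open>m = 0\<close>, the bound on the sum.\<close>

lemma summable_N:
  assumes v: "\<And>k. v k \<in> points G" "\<And>k. N (v k) \<le> C * (1 / 2) ^ k"
  obtains s where "s \<in> points G" "((\<lambda>n. N ((\<Sum>k<n. v k) - s)) \<longlongrightarrow> 0) sequentially" "N s \<le> 2 * C"
proof -
  let ?S = "\<lambda>n. \<Sum>k<n. v k"
  have S: "?S n \<in> points G" for n using v(1) by (intro sum_points)
  have C: "C \<ge> 0" using v(2)[of 0] N_nonneg[OF v(1)[of 0]] by simp
  have geo: "(\<Sum>k<n. (1 / 2 :: real) ^ k) = 2 * (1 - (1 / 2) ^ n)" for n
    by (induction n) (simp_all add: algebra_simps)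
  have le: "N (?S n - ?S m) \<le> 2 * C * (1 / 2) ^ m" if "m \<le> n" for m n
  proof -
    have "?S n - ?S m = (\<Sum>k=m..<n. v k)"
      using that by (metis atLeast0LessThan le0 sum_diff_nat_ivl)
    also have "N \<dots> \<le> (\<Sum>k=m..<n. N (v k))" using v(1) by (intro N_sum)
    also have "\<dots> \<le> (\<Sum>k=m..<n. C * (1 / 2) ^ k)" using v(2) by (intro sum_mono)
    also have "\<dots> = C * ((\<Sum>k<n. (1 / 2) ^ k) - (\<Sum>k<m. (1 / 2) ^ k))"
      using that by (metis atLeast0LessThan le0 sum_diff_nat_ivl sum_distrib_left)
    also have "\<dots> = 2 * C * (1 / 2) ^ m - 2 * C * (1 / 2) ^ n"
      by (simp add: geo algebra_simps)
    finally show ?thesis using C by (simp add: order_trans)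
  qed
  have lim0: "((\<lambda>m. 2 * C * (1 / 2) ^ m) \<longlongrightarrow> 0) sequentially"
    by (intro tendsto_mult_right_zero LIMSEQ_realpow_zero) auto
  have "M.MCauchy ?S"
    unfolding M.MCauchy_def
  proof (intro conjI allI impI)
    show "range ?S \<subseteq> points G" using S by auto
    fix \<epsilon> :: real assume "\<epsilon> > 0"
    then have "eventually (\<lambda>m. 2 * C * (1 / 2) ^ m < \<epsilon>) sequentially"
      using lim0 by (auto intro: order_tendstoD)
    then obtain m0 where m0: "\<And>m. m \<ge> m0 \<Longrightarrow> 2 * C * (1 / 2) ^ m < \<epsilon>"
      by (auto simp: eventually_sequentially)
    show "\<exists>m0. \<forall>n n'. m0 \<le> n \<longrightarrow> m0 \<le> n' \<longrightarrow> N (?S n - ?S n') < \<epsilon>"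
    proof (intro exI[of _ m0] allI impI)
      fix n n' assume nn: "m0 \<le> n" "m0 \<le> n'"
      show "N (?S n - ?S n') < \<epsilon>"
      proof (cases "n \<le> n'")
        case True
        then show ?thesis using le[OF True] m0[OF nn(1)] N_diff_commute[OF S S, of n n'] by linarith
      next
        case False
        then show ?thesis using le[of n' n] m0[OF nn(2)] by linarith
      qed
    qed
  qed
  then obtain s where "limitin M.mtopology ?S s sequentially"
    using N_complete unfolding M.mcomplete_def by blast
  then have s: "s \<in> points G" "((\<lambda>n. N (?S n - s)) \<longlongrightarrow> 0) sequentially"
    unfolding N_topo limitin_N by blast+
  have "N s \<le> 2 * C"
  proof (rule tendsto_lowerbound)
    show "((\<lambda>n. 2 * C + N (?S n - s)) \<longlongrightarrow> 2 * C) sequentially"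
      using tendsto_add[OF tendsto_const s(2), of "2 * C"] by simp
    have "N s \<le> 2 * C + N (?S n - s)" for n
      using N_le_add_diff[OF s(1) S[of n]] le[of 0 n] N_diff_commute[OF S[of n] s(1)] by simp
    then show "eventually (\<lambda>n. N s \<le> 2 * C + N (?S n - s)) sequentially" by simp
  qed simp
  then show thesis using that s by blast
qed

text \<open>Baire's theorem gives approximate preimages of controlled norm; iterating the
  approximation on the residual gives exact ones.\<close>

lemma approximate_preimage:
  assumes A: "linear_from_to G G A" and surj: "A ` points G = points G"
  obtains L where "L > 0"
    "\<And>y e. y \<in> points G \<Longrightarrow> e > 0 \<Longrightarrow> \<exists>v\<in>points G. N v \<le> L * N y \<and> N (y - A v) < e"
proof -
  note A_in = linear_from_toD(1)[OF A] and A_scale = linear_from_toD(3)[OF A]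
  define S where "S n = M.mtopology closure_of (A ` {v \<in> points G. N v \<le> real n})" for n
  have cover: "\<Union> (range S) = points G"
  proof
    show "\<Union> (range S) \<subseteq> points G"
      using closure_of_subset_topspace[of M.mtopology] by (auto simp: S_def)
    show "points G \<subseteq> \<Union> (range S)"
    proof
      fix y assume "y \<in> points G"
      then obtain v where v: "v \<in> points G" "y = A v" using surj by blast
      obtain n :: nat where "N v \<le> real n" using real_arch_simple by blast
      moreover have "A ` {v \<in> points G. N v \<le> real n} \<subseteq> S n"
        unfolding S_def using A_in by (intro closure_of_subset) auto
      ultimately show "y \<in> \<Union> (range S)" using v by blast
    qed
  qed
  have "\<exists>n. M.mtopology interior_of (S n) \<noteq> {}"
  proof (rule ccontr)
    assume "\<not> ?thesis"
    then have "M.mtopology interior_of (\<Union> (range S)) = {}"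
      by (intro M.metric_Baire_category_alt[OF N_complete]) (auto simp: S_def)
    then show False
      unfolding cover by (metis M.topspace_mtopology empty_iff interior_of_topspace points_closed(1))
  qed
  then obtain n y0 where "y0 \<in> M.mtopology interior_of (S n)" by blast
  then have "\<exists>r>0. M.mball y0 r \<subseteq> M.mtopology interior_of (S n)"
    using M.openin_mtopology[of "M.mtopology interior_of (S n)", THEN iffD1, OF openin_interior_of] by simp
  then obtain r where r: "r > 0" "M.mball y0 r \<subseteq> M.mtopology interior_of (S n)" by blast
  have rS: "M.mball y0 r \<subseteq> S n" by (rule subset_trans[OF r(2) interior_of_subset])
  have y0: "y0 \<in> points G" using subsetD[OF interior_of_subset_topspace \<open>y0 \<in> _\<close>] by simp
  have dense: "\<exists>v\<in>points G. N v \<le> n \<and> N (y - A v) < e"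
    if "y \<in> points G" "N (y - y0) < r" "e > 0" for y e
  proof -
    have "y \<in> M.mball y0 r" using that y0 by (simp add: M.mball_def N_diff_commute)
    then have "y \<in> S n" using rS by blast
    then have "\<exists>z \<in> A ` {v \<in> points G. N v \<le> real n}. z \<in> M.mball y e"
      using that(3) unfolding S_def M.metric_closure_of by simp
    then show ?thesis by (auto simp: M.mball_def)
  qed
  \<comment> \<open>The ball provided by Baire's theorem is centred at \<open>y0\<close>;
    subtracting an approximation of \<open>y0\<close> from one of \<open>y0 + y\<close> recentres it
    at 0 and doubles the norm bound.\<close>
  have ball: "\<exists>v\<in>points G. N v \<le> 2 * real n \<and> N (y - A v) < e"
    if y: "y \<in> points G" "N y < r" and e: "e > 0" for y e
  proof -
    obtain v where v: "v \<in> points G" "N v \<le> n" "N (y0 + y - A v) < e / 2"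
      using dense[of "y0 + y" "e / 2"] y e y0 by auto
    obtain w where w: "w \<in> points G" "N w \<le> n" "N (y0 - A w) < e / 2"
      using dense[of y0 "e / 2"] e y0 r by auto
    have "y - A (v - w) = (y0 + y - A v) - (y0 - A w)"
      using linear_diff(1)[OF lcs A v(1) w(1)] by simp
    also have "N \<dots> \<le> N (y0 + y - A v) + N (y0 - A w)"
      using v w y y0 A_in by (intro N_diff) auto
    finally have "N (y - A (v - w)) < e" using v w by linarith
    moreover have "N (v - w) \<le> 2 * real n" using N_diff[OF v(1) w(1)] v w by linarith
    ultimately show ?thesis using v w by blast
  qed
  \<comment> \<open>Scaling \<open>y\<close> to norm \<open>r / 2\<close> and back turns the bound
    \<open>2 n\<close> into \<open>4 n / r * N y\<close>; the added 1 keeps \<open>L\<close>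
    positive if \<open>n = 0\<close>.\<close>
  define L where "L = (4 * real n + 1) / r"
  have L: "L > 0" using r by (simp add: L_def add_nonneg_pos)
  have "\<exists>v\<in>points G. N v \<le> L * N y \<and> N (y - A v) < e" if y: "y \<in> points G" and e: "e > 0" for y e
  proof (cases "y = 0")
    case True
    then show ?thesis using e linear_diff(2)[OF lcs A, of 0 0] by (intro bexI[of _ 0]) auto
  next
    case False
    then have Ny: "N y > 0" using N_nonneg[OF y] N_eq_0[OF y] by simp
    define c where "c = r / (2 * N y)"
    have c: "c > 0" using r Ny by (simp add: c_def)
    have "N (scl G (of_real c) y) = c * N y" using c by (intro N_scale_real[OF y]) simp
    also have "\<dots> = r / 2" using Ny by (simp add: c_def)
    finally have "N (scl G (of_real c) y) < r" using r by simp
    then obtain v where v: "v \<in> points G" "N v \<le> 2 * real n" "N (scl G (of_real c) y - A v) < c * e"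
      using ball[of "scl G (of_real c) y" "c * e"] y c e by auto
    let ?w = "scl G (of_real (1 / c)) v"
    have "scl G (of_real (1 / c)) (scl G (of_real c) y) = y" using c by (simp flip: of_real_mult)
    then have "y - A ?w = scl G (of_real (1 / c)) (scl G (of_real c) y - A v)"
      using A_scale[OF v(1)] by (simp only: scale_right_diff_distrib)
    then have "N (y - A ?w) = 1 / c * N (scl G (of_real c) y - A v)"
      using N_scale[of "scl G (of_real c) y - A v" "of_real (1 / c)"] c y v A_in
      by (simp add: norm_divide)
    also have "\<dots> < e" using v c by (simp add: field_simps)
    finally have "N (y - A ?w) < e" .
    moreover have "N ?w \<le> L * N y"
    proof -
      have "N ?w = 1 / c * N v" using N_scale[OF v(1), of "of_real (1 / c)"] c by (simp add: norm_divide)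
      also have "\<dots> \<le> 1 / c * (2 * real n)" using v c by (intro mult_left_mono) auto
      also have "\<dots> = 4 * real n / r * N y" by (simp add: c_def)
      also have "\<dots> \<le> L * N y" unfolding L_def using r Ny by (intro mult_right_mono divide_right_mono) auto
      finally show ?thesis .
    qed
    ultimately show ?thesis using v by blast
  qed
  then show thesis using that L by blast
qed

lemma bounded_inverse:
  assumes A: "linear_from_to G G A" and bij: "bij_betw A (points G) (points G)"
    and K: "\<And>v. v \<in> points G \<Longrightarrow> N (A v) \<le> K * N v"
  obtains M where "M > 0" "\<And>v. v \<in> points G \<Longrightarrow> N v \<le> M * N (A v)"
proof -
  note A_in = linear_from_toD(1)[OF A]
  have surj: "A ` points G = points G" using bij by (simp add: bij_betw_def)
  obtain L where L: "L > 0" and ap: "\<And>y e. y \<in> points G \<Longrightarrow> e > 0 \<Longrightarrow>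
      \<exists>v\<in>points G. N v \<le> L * N y \<and> N (y - A v) < e"
    using approximate_preimage[OF A surj] by metis
  have "\<exists>v\<in>points G. N v \<le> L * N y \<and> N (y - A v) \<le> N y / 2" if y: "y \<in> points G" for y
  proof (cases "y = 0")
    case True
    then show ?thesis using linear_diff(2)[OF lcs A, of 0 0] by (intro bexI[of _ 0]) auto
  next
    case False
    then have "N y / 2 > 0" using N_nonneg[OF y] N_eq_0[OF y] by simp
    from ap[OF y this] show ?thesis by (meson less_imp_le)
  qed
  \<comment> \<open>\<open>V\<close> is the correction step: it removes at least half of the
    residual \<open>y\<close> at a cost of \<open>L * N y\<close>.\<close>
  then obtain V where V: "\<And>y. y \<in> points G \<Longrightarrow> V y \<in> points G \<and> N (V y) \<le> L * N y \<and> N (y - A (V y)) \<le> N y / 2"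
    by metis
  have "N v \<le> 2 * L * N (A v)" if v: "v \<in> points G" for v
  proof -
    define y where "y = A v"
    have y: "y \<in> points G" using A_in v by (simp add: y_def)
    \<comment> \<open>The residual after \<open>k\<close> corrections. The corrections
      \<open>V (r k)\<close> decay geometrically and form a convergent series.\<close>
    define r where "r k = ((\<lambda>y. y - A (V y)) ^^ k) y" for k
    have r_Suc: "r (Suc k) = r k - A (V (r k))" and r0: "r 0 = y" for k by (simp_all add: r_def)
    have r_in: "r k \<in> points G" for k
      by (induction k) (auto simp: r_Suc r0 y V A_in)
    have r_le: "N (r k) \<le> N y * (1 / 2) ^ k" for k
    proof (induction k)
      case (Suc k)
      have "N (r (Suc k)) \<le> N (r k) / 2" using V[OF r_in[of k]] by (simp add: r_Suc)
      then show ?case using Suc by simp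
    qed (simp add: r0)
    have "N (V (r k)) \<le> (L * N y) * (1 / 2) ^ k" for k
    proof -
      have "N (V (r k)) \<le> L * N (r k)" using V[OF r_in] by blast
      also have "\<dots> \<le> L * (N y * (1 / 2) ^ k)" using r_le L by (intro mult_left_mono) auto
      finally show ?thesis by (simp add: mult.assoc)
    qed
    then obtain s where s: "s \<in> points G" "((\<lambda>n. N ((\<Sum>k<n. V (r k)) - s)) \<longlongrightarrow> 0) sequentially"
      "N s \<le> 2 * (L * N y)"
      using summable_N[of "\<lambda>k. V (r k)" "L * N y"] V r_in by metis
    have Sin: "(\<Sum>k<n. V (r k)) \<in> points G" for n using V r_in by (intro sum_points) auto
    have AS: "A (\<Sum>k<n. V (r k)) = y - r n" for n
    proof (induction n)
      case 0
      then show ?case using linear_diff(2)[OF lcs A s(1) s(1)] by (simp add: r0)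
    next
      case (Suc n)
      have "A (\<Sum>k<Suc n. V (r k)) = A (\<Sum>k<n. V (r k)) + A (V (r n))"
        using linear_from_toD(2)[OF A] Sin V r_in by simp
      then show ?case using Suc by (simp add: r_Suc)
    qed
    \<comment> \<open>\<open>A\<close> maps the partial sums to \<open>y - r n\<close>. Boundedness
      by \<open>K\<close> carries this over to the limit \<open>s\<close>, and injectivity then
      identifies \<open>s\<close> with \<open>v\<close>.\<close>
    have "N (y - A s) \<le> 0"
    proof (rule tendsto_lowerbound)
      have "((\<lambda>n. N y * (1 / 2) ^ n + K * N ((\<Sum>k<n. V (r k)) - s)) \<longlongrightarrow> N y * 0 + K * 0) sequentially"
        using s(2) by (intro tendsto_intros LIMSEQ_realpow_zero) auto
      then show "((\<lambda>n. N y * (1 / 2) ^ n + K * N ((\<Sum>k<n. V (r k)) - s)) \<longlongrightarrow> 0) sequentially" by simp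
      have "N (y - A s) \<le> N y * (1 / 2) ^ n + K * N ((\<Sum>k<n. V (r k)) - s)" for n
      proof -
        have "y - A s = r n + A ((\<Sum>k<n. V (r k)) - s)"
          using linear_diff(1)[OF lcs A Sin s(1)] AS by simp
        also have "N \<dots> \<le> N (r n) + N (A ((\<Sum>k<n. V (r k)) - s))"
          using r_in A_in Sin s by (intro N_add) auto
        also have "\<dots> \<le> N y * (1 / 2) ^ n + K * N ((\<Sum>k<n. V (r k)) - s)"
          using r_le K Sin s by (intro add_mono) auto
        finally show ?thesis .
      qed
      then show "eventually (\<lambda>n. N (y - A s) \<le> N y * (1 / 2) ^ n + K * N ((\<Sum>k<n. V (r k)) - s)) sequentially"
        by simp
    qed simp
    then have "y - A s = 0" using N_le_0_iff[of "y - A s"] y s A_in by simp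
    then have "A v = A s" by (simp add: y_def)
    then have "v = s" using bij v s unfolding bij_betw_def inj_on_def by blast
    then show ?thesis using s by (simp add: y_def mult.assoc)
  qed
  then show thesis using that[of "2 * L"] L by simp
qed

text \<open>Simplified Newton iteration
  \<open>y \<mapsto> y - A\<^sup>-\<^sup>1 (\<phi> y - b)\<close>. A deviation from \<open>A\<close>
  of at most \<open>1 / (2 * M)\<close> makes it a contraction with factor \<open>1 / 2\<close>; the
  centre moves by at most \<open>M * (r / (2 * M)) = r / 2\<close>, so the closed ball of radius
  \<open>r\<close> is mapped into itself.\<close>

lemma near_linear_solve:
  assumes A: "linear_from_to G G A" and bij: "bij_betw A (points G) (points G)"
    and M: "M > 0" "\<And>v. v \<in> points G \<Longrightarrow> N v \<le> M * N (A v)"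
    and y0: "y0 \<in> points G" and b: "b \<in> points G" and r: "0 \<le> r"
    and \<phi>: "\<And>y. y \<in> points G \<Longrightarrow> N (y - y0) \<le> r \<Longrightarrow> \<phi> y \<in> points G"
    and con: "\<And>y y'. y \<in> points G \<Longrightarrow> N (y - y0) \<le> r \<Longrightarrow> y' \<in> points G \<Longrightarrow> N (y' - y0) \<le> r \<Longrightarrow>
        N (\<phi> y - \<phi> y' - A (y - y')) \<le> 1 / (2 * M) * N (y - y')"
    and start: "N (\<phi> y0 - b) \<le> r / (2 * M)"
  obtains y where "y \<in> points G" "N (y - y0) \<le> r" "\<phi> y = b"
proof -
  define T where "T = inv_into (points G) A"
  have T: "T w \<in> points G" "A (T w) = w" if "w \<in> points G" for w
    using bij that unfolding T_def bij_betw_def by (auto intro: inv_into_into f_inv_into_f)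
  have TN: "N (T w - T w') \<le> M * N (w - w')" if "w \<in> points G" "w' \<in> points G" for w w'
    using M(2)[of "T w - T w'"] T[OF that(1)] T[OF that(2)] linear_diff(1)[OF lcs A, of "T w" "T w'"] by simp
  have Tadd: "T (A v) = v" if "v \<in> points G" for v
    using bij that unfolding T_def bij_betw_def by auto
  define S where "S = M.mcball y0 r"
  have S: "y \<in> S \<longleftrightarrow> y \<in> points G \<and> N (y - y0) \<le> r" for y
    using y0 by (auto simp: S_def M.mcball_def N_diff_commute)
  have SG: "S \<subseteq> points G" using S by auto
  \<comment> \<open>Banach's fixed point theorem is applied in the closed ball, which inherits
    completeness as a closed subset.\<close>
  interpret Sub: Submetric "points G" "\<lambda>x y. N (x - y)" S by unfold_locales (rule SG)
  have comp: "Sub.sub.mcomplete"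
    by (rule Sub.closedin_mcomplete_imp_mcomplete[OF _ N_complete]) (simp add: S_def)
  let ?f = "\<lambda>y. T (A y - (\<phi> y - b))"
  have A_in: "A v \<in> points G" if "v \<in> points G" for v using linear_from_toD(1)[OF A that] .
  have lip: "N (?f y - ?f y') \<le> 1 / 2 * N (y - y')" if y: "y \<in> S" "y' \<in> S" for y y'
  proof -
    have pts: "y \<in> points G" "y' \<in> points G" "\<phi> y \<in> points G" "\<phi> y' \<in> points G"
      using y \<phi> by (auto simp: S)
    have "N (?f y - ?f y') \<le> M * N (A y - (\<phi> y - b) - (A y' - (\<phi> y' - b)))"
      using pts b A_in by (intro TN) auto
    also have "A y - (\<phi> y - b) - (A y' - (\<phi> y' - b)) = - (\<phi> y - \<phi> y' - A (y - y'))"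
      using linear_diff(1)[OF lcs A pts(1,2)] by simp
    also have "N \<dots> = N (\<phi> y - \<phi> y' - A (y - y'))" using pts A_in by (intro N_minus) auto
    also have "\<dots> \<le> 1 / (2 * M) * N (y - y')" using con y by (auto simp: S)
    finally show ?thesis using M(1) by (simp add: mult_left_mono)
  qed
  have y0S: "y0 \<in> S" using S y0 r by simp
  have maps: "?f \<in> S \<rightarrow> S"
  proof
    fix y assume y: "y \<in> S"
    have pts: "y \<in> points G" "\<phi> y \<in> points G" "\<phi> y0 \<in> points G" using y y0S \<phi> by (auto simp: S)
    have fin: "?f y \<in> points G" "?f y0 \<in> points G" using pts A_in b y0 by (auto intro!: T)
    have "N (?f y0 - y0) = N (?f y0 - T (A y0))" using Tadd y0 by simp
    also have "\<dots> \<le> M * N (A y0 - (\<phi> y0 - b) - A y0)" using pts A_in b y0 by (intro TN) auto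
    also have "N (A y0 - (\<phi> y0 - b) - A y0) = N (\<phi> y0 - b)"
      using N_minus[of "\<phi> y0 - b"] pts b by (simp add: algebra_simps)
    also have "M * \<dots> \<le> M * (r / (2 * M))" using start M(1) by (intro mult_left_mono) auto
    also have "\<dots> = r / 2" using M(1) by simp
    finally have 1: "N (?f y0 - y0) \<le> r / 2" .
    have "N (?f y - y0) \<le> N (?f y - ?f y0) + N (?f y0 - y0)"
      using fin y0 by (intro N_triangle)
    also have "\<dots> \<le> 1 / 2 * N (y - y0) + r / 2" using lip[OF y y0S] 1 by linarith
    also have "\<dots> \<le> r" using y by (simp add: S)
    finally show "?f y \<in> S" using fin by (simp add: S)
  qed
  obtain y where y: "y \<in> S" "?f y = y"
  proof (rule Sub.sub.Banach_fixedpoint_thm[OF comp _ maps])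
    show "S \<noteq> {}" using y0S by blast
    show "(1 / 2 :: real) < 1" by simp
  qed (use lip in blast)+
  have pts: "y \<in> points G" "\<phi> y \<in> points G" using y \<phi> by (auto simp: S)
  have "A y = A (?f y)" using y by simp
  also have "\<dots> = A y - (\<phi> y - b)" using pts A_in b by (intro T) auto
  finally have "\<phi> y = b" by (simp add: algebra_simps)
  then show thesis using that y by (auto simp: S)
qed

text \<open>Stability of invertibility. The relative error \<open>1 / (2 * M)\<close> is absorbed
  into the lower bound of \<open>A\<close> at the price of doubling \<open>M\<close>; this yields
  injectivity, and surjectivity is \<open>near_linear_solve\<close> for the linear map
  \<open>B\<close>.\<close>

lemma perturbed_bij:
  assumes A: "linear_from_to G G A" and bij: "bij_betw A (points G) (points G)"
    and M: "M > 0" "\<And>v. v \<in> points G \<Longrightarrow> N v \<le> M * N (A v)"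
    and B: "linear_from_to G G B"
    and near: "\<And>v. v \<in> points G \<Longrightarrow> N (B v - A v) \<le> 1 / (2 * M) * N v"
  shows "bij_betw B (points G) (points G)" "\<And>v. v \<in> points G \<Longrightarrow> N v \<le> 2 * M * N (B v)"
proof -
  have A_in: "A v \<in> points G" and B_in: "B v \<in> points G" if "v \<in> points G" for v
    using linear_from_toD(1)[OF A that] linear_from_toD(1)[OF B that] by auto
  show le: "N v \<le> 2 * M * N (B v)" if v: "v \<in> points G" for v
  proof -
    have "N (A v) \<le> N (B v) + N (B v - A v)"
      using N_le_add_diff[OF A_in[OF v] B_in[OF v]] N_diff_commute[OF A_in[OF v] B_in[OF v]] by simp
    also have "\<dots> \<le> N (B v) + 1 / (2 * M) * N v" using near[OF v] by simp
    finally have "M * N (A v) \<le> M * (N (B v) + 1 / (2 * M) * N v)" using M by simp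
    also have "\<dots> = M * N (B v) + N v / 2" using M by (simp add: algebra_simps)
    finally show ?thesis using M(2)[OF v] by simp
  qed
  have "inj_on B (points G)"
  proof (rule inj_onI)
    fix v w assume *: "v \<in> points G" "w \<in> points G" "B v = B w"
    then have "N (v - w) \<le> 0"
      using le[of "v - w"] linear_diff(1)[OF lcs B, of v w] by simp
    then show "v = w" using * N_le_0_iff[of "v - w"] by simp
  qed
  moreover have "B ` points G = points G"
  proof
    show "B ` points G \<subseteq> points G" using B_in by auto
    show "points G \<subseteq> B ` points G"
    proof
      fix w assume w: "w \<in> points G"
      have B0: "B 0 = 0" using linear_diff(2)[OF lcs B w w] .
      \<comment> \<open>The centre 0 has defect \<open>N (B 0 - w) = N w\<close>, so
        \<open>2 * M * N w\<close> is the smallest radius that meets the starting condition.\<close>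
      obtain y where "y \<in> points G" "N (y - 0) \<le> 2 * M * N w" "B y = w"
      proof (rule near_linear_solve[OF A bij M, of 0 w "2 * M * N w" B])
        fix y y' assume y: "y \<in> points G" "y' \<in> points G"
        have "B y - B y' - A (y - y') = B (y - y') - A (y - y')"
          using linear_diff(1)[OF lcs B y] by simp
        then show "N (B y - B y' - A (y - y')) \<le> 1 / (2 * M) * N (y - y')"
          using near[of "y - y'"] y by simp
      qed (use w B_in B0 M N_nonneg[OF w] in \<open>auto simp: N_minus\<close>)
      then show "w \<in> B ` points G" by blast
    qed
  qed
  ultimately show "bij_betw B (points G) (points G)" by (simp add: bij_betw_def)
qed

end

section \<open>Bounded multilinear maps\<close>

text \<open>The substitute for an operator norm on a space without a norm: \<open>K\<close> bounds a
  multilinear map relative to the seminorm \<open>p\<close>.\<close>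

definition mbound :: "'a set \<Rightarrow> ('a \<Rightarrow> real) \<Rightarrow> ('b \<Rightarrow> real) \<Rightarrow> nat \<Rightarrow> real \<Rightarrow> ('a list \<Rightarrow> 'b) \<Rightarrow> bool" where
  "mbound S p N m K \<phi> \<longleftrightarrow>
     (\<forall>us. set us \<subseteq> S \<and> length us = m \<longrightarrow> N (\<phi> us) \<le> K * prod_list (map p us))"

lemma mboundD:
  "mbound S p N m K \<phi> \<Longrightarrow> set us \<subseteq> S \<Longrightarrow> length us = m \<Longrightarrow> N (\<phi> us) \<le> K * prod_list (map p us)"
  by (simp add: mbound_def)

lemma prod_list_nonneg: "(\<And>x. x \<in> set xs \<Longrightarrow> 0 \<le> (p x :: real)) \<Longrightarrow> 0 \<le> prod_list (map p xs)"
  by (induction xs) auto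

lemma prod_list_mono:
  "(\<And>x. x \<in> set xs \<Longrightarrow> 0 \<le> (p x :: real) \<and> p x \<le> q x) \<Longrightarrow> prod_list (map p xs) \<le> prod_list (map q xs)"
proof (induction xs)
  case (Cons a xs)
  then show ?case by (auto intro!: mult_mono prod_list_nonneg intro: order_trans)
qed simp

lemma prod_list_le_power:
  assumes "\<And>x. x \<in> set xs \<Longrightarrow> 0 \<le> (p x :: real) \<and> p x \<le> B"
  shows "prod_list (map p xs) \<le> B ^ length xs"
  using prod_list_mono[of xs p "\<lambda>_. B"] assms by (simp add: map_replicate_const)

lemma slot_linearD:
  assumes "slot_linear E F m \<phi>"
  shows "set us \<subseteq> points E \<Longrightarrow> length us = m \<Longrightarrow> \<phi> us \<in> points F"
    "set as \<subseteq> points E \<Longrightarrow> set bs \<subseteq> points E \<Longrightarrow> length as + Suc (length bs) = m \<Longrightarrow>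
      linear_from_to E F (\<lambda>v. \<phi> (as @ v # bs))"
  using assms by (auto simp: slot_linear_def)

locale to_banach = E: lcs_space E + banach_tvs G N
  for E :: "('k::real_or_complex, 'e::ab_group_add) tvs"
    and G :: "('k, 'g::ab_group_add) tvs" and N
begin

lemma slot_diff:
  assumes "slot_linear E G m \<phi>" "set as \<subseteq> points E" "set bs \<subseteq> points E"
    "length as + Suc (length bs) = m" "v \<in> points E" "w \<in> points E"
  shows "\<phi> (as @ (v - w) # bs) = \<phi> (as @ v # bs) - \<phi> (as @ w # bs)"
  using linear_diff(1)[OF E.lcs slot_linearD(2)[OF assms(1-4)] assms(5,6)] by simp

lemma slot_zero:
  assumes "slot_linear E G m \<phi>" "set as \<subseteq> points E" "set bs \<subseteq> points E"
    "length as + Suc (length bs) = m"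
  shows "\<phi> (as @ 0 # bs) = 0"
  using linear_diff(2)[OF E.lcs slot_linearD(2)[OF assms(1-4)], of 0 0] by simp

lemma slot_add:
  assumes "slot_linear E G m \<phi>" "set as \<subseteq> points E" "set bs \<subseteq> points E"
    "length as + Suc (length bs) = m" "v \<in> points E" "w \<in> points E"
  shows "\<phi> (as @ (v + w) # bs) = \<phi> (as @ v # bs) + \<phi> (as @ w # bs)"
  using linear_from_toD(2)[OF slot_linearD(2)[OF assms(1-4)] assms(5,6)] by simp

lemma slot_scale:
  assumes "slot_linear E G m \<phi>" "set as \<subseteq> points E" "set bs \<subseteq> points E"
    "length as + Suc (length bs) = m" "v \<in> points E"
  shows "\<phi> (as @ scl E c v # bs) = scl G c (\<phi> (as @ v # bs))"
  using linear_from_toD(3)[OF slot_linearD(2)[OF assms(1-4)] assms(5)] by simp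

lemma slot_linear_diff:
  assumes "slot_linear E G m \<phi>" "slot_linear E G m \<psi>"
  shows "slot_linear E G m (\<lambda>us. \<phi> us - \<psi> us)"
  using assms unfolding slot_linear_def linear_from_to_def
  by (auto simp: scale_right_diff_distrib)

lemma slot_scale_all:
  assumes "slot_linear E G m \<phi>" "set as \<subseteq> points E" "set us \<subseteq> points E" "length as + length us = m"
  shows "\<phi> (as @ map (\<lambda>u. scl E (c u) u) us) = scl G (prod_list (map c us)) (\<phi> (as @ us))"
  using assms(2-4)
proof (induction us arbitrary: as)
  case (Cons a us)
  have "\<phi> (as @ map (\<lambda>u. scl E (c u) u) (a # us)) =
      \<phi> (as @ scl E (c a) a # map (\<lambda>u. scl E (c u) u) us)" by simp
  also have "\<dots> = scl G (c a) (\<phi> (as @ a # map (\<lambda>u. scl E (c u) u) us))"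
    using Cons.prems by (intro slot_scale[OF assms(1)]) auto
  also have "\<phi> (as @ a # map (\<lambda>u. scl E (c u) u) us) = scl G (prod_list (map c us)) (\<phi> (as @ a # us))"
    using Cons.IH[of "as @ [a]"] Cons.prems by simp
  finally show ?case by simp
qed simp

text \<open>Homogeneity extends a bound on the unit ball of \<open>p\<close> to all arguments. Since
  \<open>p u\<close> may vanish, the arguments are divided by \<open>p u + d\<close>, and
  \<open>d\<close> tends to 0 from the right at the end.\<close>

lemma mbound_of_ball:
  assumes p: "cont_seminorm E p" and \<phi>: "slot_linear E G m \<phi>"
    and K: "\<And>us. set us \<subseteq> points E \<Longrightarrow> length us = m \<Longrightarrow> \<forall>u\<in>set us. p u < 1 \<Longrightarrow> N (\<phi> us) \<le> K"
  shows "mbound (points E) p N m K \<phi>"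
  unfolding mbound_def
proof (intro allI impI, elim conjE)
  fix us assume us: "set us \<subseteq> points E" "length us = m"
  have pn: "0 \<le> p u" if "u \<in> set us" for u using E.seminorm_nonneg[OF p] us that by auto
  have le: "N (\<phi> us) \<le> K * prod_list (map (\<lambda>u. p u + d) us)" if d: "d > 0" for d
  proof -
    let ?us = "map (\<lambda>u. scl E (of_real (1 / (p u + d))) u) us"
    have in': "set ?us \<subseteq> points E" using us by auto
    have pd: "p u + d > 0" if "u \<in> set us" for u using pn[OF that] d by simp
    have "\<forall>u\<in>set ?us. p u < 1"
    proof
      fix v assume "v \<in> set ?us"
      then obtain u where u: "u \<in> set us" "v = scl E (of_real (1 / (p u + d))) u" by auto
      have "p v = 1 / (p u + d) * p u"
        unfolding u(2) using u(1) us pd by (intro E.seminorm_scale_real[OF p]) (auto simp: less_imp_le)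
      then show "p v < 1" using pd[OF u(1)] d by simp
    qed
    then have "N (\<phi> ?us) \<le> K" using us in' by (intro K) auto
    moreover have "N (\<phi> ?us) = prod_list (map (\<lambda>u. 1 / (p u + d)) us) * N (\<phi> us)"
    proof -
      have "\<phi> ?us = scl G (prod_list (map (\<lambda>u. of_real (1 / (p u + d))) us)) (\<phi> us)"
        using slot_scale_all[OF \<phi>, of "[]" us "\<lambda>u. of_real (1 / (p u + d))"] us by simp
      also have "prod_list (map (\<lambda>u. of_real (1 / (p u + d))) us) =
          (of_real (prod_list (map (\<lambda>u. 1 / (p u + d)) us)) :: 'k)"
        by (induction us) simp_all
      also have "N (scl G \<dots> (\<phi> us)) = prod_list (map (\<lambda>u. 1 / (p u + d)) us) * N (\<phi> us)"
        using us pd slot_linearD(1)[OF \<phi>]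
        by (intro N_scale_real prod_list_nonneg) (auto simp: less_imp_le)
      finally show ?thesis .
    qed
    ultimately have 1: "prod_list (map (\<lambda>u. 1 / (p u + d)) us) * N (\<phi> us) \<le> K" by simp
    have inv: "prod_list (map (\<lambda>u. p u + d) us) * prod_list (map (\<lambda>u. 1 / (p u + d)) us) = 1"
      using pd
    proof (induction us)
      case (Cons a us)
      have "p a + d \<noteq> 0" using Cons.prems[of a] by simp
      moreover have "prod_list (map (\<lambda>u. p u + d) us) * prod_list (map (\<lambda>u. 1 / (p u + d)) us) = 1"
        using Cons by simp
      ultimately show ?case by (simp add: field_simps)
    qed simp
    have nn: "0 \<le> prod_list (map (\<lambda>u. p u + d) us)"
      using pd by (intro prod_list_nonneg) (auto simp: less_imp_le)
    have "N (\<phi> us) = prod_list (map (\<lambda>u. p u + d) us) * (prod_list (map (\<lambda>u. 1 / (p u + d)) us) * N (\<phi> us))"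
      using inv by (simp add: mult.assoc[symmetric])
    also have "\<dots> \<le> prod_list (map (\<lambda>u. p u + d) us) * K" using 1 nn by (rule mult_left_mono)
    finally show ?thesis by (simp add: mult.commute)
  qed
  show "N (\<phi> us) \<le> K * prod_list (map p us)"
  proof (rule tendsto_lowerbound)
    have "((\<lambda>d. prod_list (map (\<lambda>u. p u + d) us)) \<longlongrightarrow> prod_list (map (\<lambda>u. p u + 0) us)) (at_right (0::real))"
    proof (induction us)
      case (Cons a us)
      have "((\<lambda>d::real. p a + d) \<longlongrightarrow> p a + 0) (at_right 0)" by (intro tendsto_intros)
      from tendsto_mult[OF this Cons.IH] show ?case by simp
    qed simp
    then show "((\<lambda>d. K * prod_list (map (\<lambda>u. p u + d) us)) \<longlongrightarrow> K * prod_list (map p us)) (at_right 0)"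
      by (intro tendsto_intros) simp
    show "eventually (\<lambda>d. N (\<phi> us) \<le> K * prod_list (map (\<lambda>u. p u + d) us)) (at_right 0)"
      using le by (auto simp: eventually_at intro!: exI[of _ 1])
  qed simp
qed

lemma mbound_mono:
  assumes "mbound (points E) p N m K \<phi>" "0 \<le> K"
    "cont_seminorm E p" "\<And>x. x \<in> points E \<Longrightarrow> p x \<le> q x" "K \<le> K'"
  shows "mbound (points E) q N m K' \<phi>"
  unfolding mbound_def
proof (intro allI impI, elim conjE)
  fix us assume us: "set us \<subseteq> points E" "length us = m"
  have pp: "0 \<le> p u \<and> p u \<le> q u" if "u \<in> set us" for u
    using us that assms(4) E.seminorm_nonneg[OF assms(3)] by auto
  have "N (\<phi> us) \<le> K * prod_list (map p us)" by (rule mboundD[OF assms(1) us])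
  also have "\<dots> \<le> K' * prod_list (map q us)"
    using pp assms(2,5) by (intro mult_mono prod_list_mono prod_list_nonneg) auto
  finally show "N (\<phi> us) \<le> K' * prod_list (map q us)" .
qed

text \<open>One argument is exchanged at a time: in term \<open>i\<close> the earlier slots already
  contain \<open>vs\<close> and the later ones still contain \<open>us\<close>.\<close>

lemma telescope:
  assumes \<phi>: "slot_linear E G m \<phi>" and us: "set us \<subseteq> points E" "length us = m"
    and vs: "set vs \<subseteq> points E" "length vs = m"
  shows "\<phi> us - \<phi> vs = (\<Sum>i<m. \<phi> (take i vs @ (us ! i - vs ! i) # drop (Suc i) us))"
proof -
  let ?a = "\<lambda>i. \<phi> (take i vs @ drop i us)"
  have "\<phi> (take i vs @ (us ! i - vs ! i) # drop (Suc i) us) = ?a i - ?a (Suc i)" if i: "i < m" for i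
  proof -
    have pts: "set (take i vs) \<subseteq> points E" "set (drop (Suc i) us) \<subseteq> points E"
      "us ! i \<in> points E" "vs ! i \<in> points E"
      using us vs i set_take_subset[of i vs] set_drop_subset[of "Suc i" us]
      by (auto dest: nth_mem simp: subset_iff)
    have "\<phi> (take i vs @ (us ! i - vs ! i) # drop (Suc i) us) =
       \<phi> (take i vs @ us ! i # drop (Suc i) us) - \<phi> (take i vs @ vs ! i # drop (Suc i) us)"
      using us vs i pts by (intro slot_diff[OF \<phi>]) auto
    also have "us ! i # drop (Suc i) us = drop i us" using i us by (simp add: Cons_nth_drop_Suc)
    also have "take i vs @ vs ! i # drop (Suc i) us = take (Suc i) vs @ drop (Suc i) us"
      using i vs by (simp add: take_Suc_conv_app_nth)
    finally show ?thesis .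
  qed
  then have "(\<Sum>i<m. \<phi> (take i vs @ (us ! i - vs ! i) # drop (Suc i) us)) = (\<Sum>i<m. ?a i - ?a (Suc i))"
    by (intro sum.cong) auto
  also have "\<dots> = ?a 0 - ?a m" by (rule sum_lessThan_telescope')
  finally show ?thesis using us vs by simp
qed

text \<open>Lipschitz estimate on a ball of the seminorm, read off from \<open>telescope\<close>.
  Each term has \<open>m - 1\<close> unchanged slots; \<open>1 \<le> B\<close> allows the plainer
  exponent \<open>m\<close>.\<close>

lemma mbound_diff:
  assumes p: "cont_seminorm E p" and \<phi>: "slot_linear E G m \<phi>" and K: "mbound (points E) p N m K \<phi>" "0 \<le> K"
    and us: "set us \<subseteq> points E" "length us = m" and vs: "set vs \<subseteq> points E" "length vs = m"
    and B: "1 \<le> B" "\<And>i. i < m \<Longrightarrow> p (us ! i) \<le> B" "\<And>i. i < m \<Longrightarrow> p (vs ! i) \<le> B"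
  shows "N (\<phi> us - \<phi> vs) \<le> K * B ^ m * (\<Sum>i<m. p (us ! i - vs ! i))"
proof -
  have uB: "0 \<le> p x \<and> p x \<le> B" if "x \<in> set us" for x
    using B(2) us that E.seminorm_nonneg[OF p] by (metis in_set_conv_nth subsetD)
  have vB: "0 \<le> p x \<and> p x \<le> B" if "x \<in> set vs" for x
    using B(3) vs that E.seminorm_nonneg[OF p] by (metis in_set_conv_nth subsetD)
  have pts: "set (take i vs @ (us ! i - vs ! i) # drop (Suc i) us) \<subseteq> points E" if "i < m" for i
  proof -
    have "us ! i \<in> points E" "vs ! i \<in> points E"
      using us vs that nth_mem[of i us] nth_mem[of i vs] by auto
    then have "us ! i - vs ! i \<in> points E" by (rule E.points_closed)
    then show ?thesis using us vs set_take_subset[of i vs] set_drop_subset[of "Suc i" us] by auto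
  qed
  have "N (\<phi> us - \<phi> vs) \<le> (\<Sum>i<m. N (\<phi> (take i vs @ (us ! i - vs ! i) # drop (Suc i) us)))"
    unfolding telescope[OF \<phi> us vs]
  proof (rule N_sum)
    fix i assume "i \<in> {..<m}"
    then show "\<phi> (take i vs @ (us ! i - vs ! i) # drop (Suc i) us) \<in> points G"
      using us vs pts[of i] by (intro slot_linearD(1)[OF \<phi>]) auto
  qed
  also have "\<dots> \<le> (\<Sum>i<m. K * B ^ m * p (us ! i - vs ! i))"
  proof (rule sum_mono)
    fix i assume "i \<in> {..<m}"
    then have i: "i < m" by simp
    have d: "0 \<le> p (us ! i - vs ! i)" using pts[OF i] by (intro E.seminorm_nonneg[OF p]) auto
    have 1: "prod_list (map p (take i vs)) \<le> B ^ i"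
      using prod_list_le_power[of "take i vs" p B] vB i vs by (auto dest: in_set_takeD)
    have 2: "prod_list (map p (drop (Suc i) us)) \<le> B ^ (m - Suc i)"
      using prod_list_le_power[of "drop (Suc i) us" p B] uB us by (auto dest: in_set_dropD)
    have nn: "0 \<le> prod_list (map p (take i vs))" "0 \<le> prod_list (map p (drop (Suc i) us))"
      using uB vB set_take_subset[of i vs] set_drop_subset[of "Suc i" us]
      by (auto intro!: prod_list_nonneg)
    have "N (\<phi> (take i vs @ (us ! i - vs ! i) # drop (Suc i) us)) \<le>
        K * prod_list (map p (take i vs @ (us ! i - vs ! i) # drop (Suc i) us))"
      using us vs i pts[OF i] by (intro mboundD[OF K(1)]) auto
    also have "\<dots> = K * (prod_list (map p (take i vs)) * prod_list (map p (drop (Suc i) us)) * p (us ! i - vs ! i))"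
      by simp
    also have "\<dots> \<le> K * (B ^ i * B ^ (m - Suc i) * p (us ! i - vs ! i))"
      using 1 2 nn d K(2) B(1) by (intro mult_left_mono mult_right_mono mult_mono) auto
    also have "\<dots> \<le> K * (B ^ m * p (us ! i - vs ! i))"
    proof -
      have "B ^ i * B ^ (m - Suc i) = B ^ (m - 1)" using i by (simp flip: power_add)
      also have "\<dots> \<le> B ^ m" using B(1) by (intro power_increasing) auto
      finally show ?thesis using d K(2) by (intro mult_left_mono mult_right_mono) auto
    qed
    finally show "N (\<phi> (take i vs @ (us ! i - vs ! i) # drop (Suc i) us)) \<le> K * B ^ m * p (us ! i - vs ! i)"
      by (simp add: mult.assoc)
  qed
  finally show ?thesis by (simp add: sum_distrib_left)
qed

lemma mbound_max:
  assumes "cont_seminorm E p" "mbound (points E) p N m K \<phi>"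
  shows "mbound (points E) p N m (max K 0) \<phi>"
  unfolding mbound_def
proof (intro allI impI, elim conjE)
  fix us assume us: "set us \<subseteq> points E" "length us = m"
  have "0 \<le> prod_list (map p us)"
    using us E.seminorm_nonneg[OF assms(1)] by (intro prod_list_nonneg) auto
  then have "K * prod_list (map p us) \<le> max K 0 * prod_list (map p us)" by (intro mult_right_mono) auto
  then show "N (\<phi> us) \<le> max K 0 * prod_list (map p us)" using mboundD[OF assms(2) us] by simp
qed

lemma eventually_ball_less_1:
  assumes "\<And>i. i < m \<Longrightarrow> (q i \<longlongrightarrow> 0) \<F>"
  shows "eventually (\<lambda>a. \<forall>i\<in>{..<m::nat}. q i a < (1::real)) \<F>"
proof (intro eventually_ball_finite ballI)
  fix i assume "i \<in> {..<m}"
  then have "(q i \<longlongrightarrow> 0) \<F>" by (intro assms) simp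
  then show "eventually (\<lambda>a. q i a < 1) \<F>" by (rule order_tendstoD) simp
qed simp

text \<open>The reference arguments \<open>vs a\<close> may vary with \<open>a\<close>; they only
  have to stay bounded in \<open>p\<close>. This is the form that uniform statements over sets of
  directions require.\<close>

lemma tendsto_multilinear:
  assumes p: "cont_seminorm E p" and \<phi>: "slot_linear E G m \<phi>" and K: "mbound (points E) p N m K \<phi>"
    and ws: "eventually (\<lambda>a. set (ws a) \<subseteq> points E \<and> length (ws a) = m \<and>
        set (vs a) \<subseteq> points E \<and> length (vs a) = m \<and> (\<forall>i<m. p (vs a ! i) \<le> B)) \<F>"
    and lim: "\<And>i. i < m \<Longrightarrow> ((\<lambda>a. p (ws a ! i - vs a ! i)) \<longlongrightarrow> 0) \<F>"
  shows "((\<lambda>a. N (\<phi> (ws a) - \<phi> (vs a))) \<longlongrightarrow> 0) \<F>"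
proof -
  \<comment> \<open>The bounds must be nonnegative for monotonicity, and the 1 in \<open>B'\<close>
    makes room for \<open>ws\<close>, whose entries eventually differ from those of
    \<open>vs\<close> by less than 1.\<close>
  define K' where "K' = max K 0"
  define B' where "B' = max B 0 + 1"
  have K'0: "0 \<le> K'" "K \<le> K'" and B': "1 \<le> B'" "B + 1 \<le> B'" by (auto simp: K'_def B'_def)
  have K': "mbound (points E) p N m K' \<phi>" unfolding K'_def by (rule mbound_max[OF p K])
  have "eventually (\<lambda>a. \<forall>i\<in>{..<m}. p (ws a ! i - vs a ! i) < 1) \<F>"
    by (rule eventually_ball_less_1) (rule lim)
  with ws have ev: "eventually (\<lambda>a. N (\<phi> (ws a) - \<phi> (vs a)) \<le>
      K' * B' ^ m * (\<Sum>i<m. p (ws a ! i - vs a ! i))) \<F>"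
  proof eventually_elim
    case (elim a)
    have "p (ws a ! i) \<le> B'" if i: "i < m" for i
    proof -
      have "ws a ! i \<in> points E" "vs a ! i \<in> points E" using elim i nth_mem by (auto simp: subset_iff)
      then have "p (vs a ! i + (ws a ! i - vs a ! i)) \<le> p (vs a ! i) + p (ws a ! i - vs a ! i)"
        by (intro E.seminorm_add[OF p]) auto
      moreover have "p (vs a ! i) \<le> B" "p (ws a ! i - vs a ! i) < 1" using elim i by auto
      ultimately show ?thesis using B' by simp
    qed
    moreover have "p (vs a ! i) \<le> B'" if i: "i < m" for i
      using elim i B' by fastforce
    ultimately show ?case using elim by (intro mbound_diff[OF p \<phi> K' K'0(1) _ _ _ _ B'(1)]) auto
  qed
  have ev0: "eventually (\<lambda>a. 0 \<le> N (\<phi> (ws a) - \<phi> (vs a))) \<F>"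
    using ws by eventually_elim (use slot_linearD(1)[OF \<phi>] in \<open>auto intro!: N_nonneg\<close>)
  have "((\<lambda>a. K' * B' ^ m * (\<Sum>i<m. p (ws a ! i - vs a ! i))) \<longlongrightarrow> K' * B' ^ m * (\<Sum>i<m. 0)) \<F>"
    using lim by (intro tendsto_intros) auto
  then have "((\<lambda>a. K' * B' ^ m * (\<Sum>i<m. p (ws a ! i - vs a ! i))) \<longlongrightarrow> 0) \<F>" by simp
  then show ?thesis by (rule tendsto_sandwich[OF ev0 ev tendsto_const])
qed

lemma continuous_map_multilinear:
  assumes p: "cont_seminorm E p" and \<phi>: "slot_linear E G m \<phi>" and K: "mbound (points E) p N m K \<phi>"
  shows "continuous_map (product_topology (\<lambda>_. topo E) {..<m}) (topo G) (\<lambda>u. \<phi> (map u [0..<m]))"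
  unfolding continuous_map_atin
proof
  let ?X = "product_topology (\<lambda>_::nat. topo E) {..<m}"
  fix u0 assume u0: "u0 \<in> topspace ?X"
  then have u0': "set (map u0 [0..<m]) \<subseteq> points E" by (auto simp: PiE_iff)
  have ev: "eventually (\<lambda>u. u \<in> topspace ?X) (atin ?X u0)"
    unfolding eventually_atin
    by (rule disjI2, rule exI[of _ "topspace ?X"], intro conjI openin_topspace u0) blast
  have pts: "set (map u [0..<m]) \<subseteq> points E" if "u \<in> topspace ?X" for u
    using that by (auto simp: PiE_iff)
  have lim: "((\<lambda>u. p (u i - u0 i)) \<longlongrightarrow> 0) (atin ?X u0)" if i: "i < m" for i
  proof -
    have "continuous_map ?X (topo E) (\<lambda>u. u i)" using i by (intro continuous_map_product_projection) auto
    then have "limitin (topo E) (\<lambda>u. u i) (u0 i) (atin ?X u0)"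
      by (rule limitin_continuous_map[OF _ u0 refl])
    then show ?thesis using p by (simp add: E.limitin_iff)
  qed
  have "((\<lambda>u. N (\<phi> (map u [0..<m]) - \<phi> (map u0 [0..<m]))) \<longlongrightarrow> 0) (atin ?X u0)"
  proof (rule tendsto_multilinear[OF p \<phi> K])
    let ?B = "Max (insert 0 (p ` set (map u0 [0..<m])))"
    have "p (map u0 [0..<m] ! i) \<le> ?B" if "i < m" for i
      using that by (intro Max_ge) auto
    then show "eventually (\<lambda>a. set (map a [0..<m]) \<subseteq> points E \<and> length (map a [0..<m]) = m \<and>
        set (map u0 [0..<m]) \<subseteq> points E \<and> length (map u0 [0..<m]) = m \<and>
        (\<forall>i<m. p (map u0 [0..<m] ! i) \<le> ?B)) (atin ?X u0)"
      using ev by (intro eventually_mono[OF ev]) (use pts u0' in simp)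
  qed (use lim in simp)
  moreover have "eventually (\<lambda>u. \<phi> (map u [0..<m]) \<in> points G) (atin ?X u0)"
    by (rule eventually_mono[OF ev]) (use pts slot_linearD(1)[OF \<phi>] in simp)
  moreover have "\<phi> (map u0 [0..<m]) \<in> points G" using u0' slot_linearD(1)[OF \<phi>] by simp
  ultimately show "limitin (topo G) (\<lambda>u. \<phi> (map u [0..<m])) (\<phi> (map u0 [0..<m])) (atin ?X u0)"
    by (simp add: limitin_N)
qed

text \<open>Continuity at the zero tuple suffices: a basic neighbourhood restricts each of the
  finitely many slots, one seminorm dominates those of all slots, and homogeneity does the
  rest.\<close>

lemma mbound_of_continuous:
  assumes \<phi>: "slot_linear E G m \<phi>"
    and c: "continuous_map (product_topology (\<lambda>_. topo E) {..<m}) (topo G) (\<lambda>u. \<phi> (map u [0..<m]))"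
  obtains p K where "cont_seminorm E p" "mbound (points E) p N m K \<phi>"
proof -
  let ?X = "product_topology (\<lambda>_::nat. topo E) {..<m}"
  let ?u0 = "\<lambda>i\<in>{..<m}. (0::'e)"
  define y0 where "y0 = \<phi> (map ?u0 [0..<m])"
  let ?U = "{y \<in> points G. N (y - y0) < 1}"
  have u0: "?u0 \<in> topspace ?X" by (auto simp: PiE_iff)
  have y0: "y0 \<in> points G" using c u0 by (auto simp: y0_def continuous_map_def Pi_iff)
  have U: "openin (topo G) ?U" by (rule openin_seminorm_ball[OF seminorm_N y0])
  have "openin ?X {u \<in> topspace ?X. \<phi> (map u [0..<m]) \<in> ?U}"
    by (rule openin_continuous_map_preimage[OF c U])
  moreover have "?u0 \<in> {u \<in> topspace ?X. \<phi> (map u [0..<m]) \<in> ?U}"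
    using u0 y0 y0_def by simp
  ultimately obtain B where B: "\<forall>i\<in>{..<m}. openin (topo E) (B i)" "?u0 \<in> Pi\<^sub>E {..<m} B"
      "Pi\<^sub>E {..<m} B \<subseteq> {u \<in> topspace ?X. \<phi> (map u [0..<m]) \<in> ?U}"
    unfolding openin_product_topology_alt by meson
  have "\<exists>q. cont_seminorm E q \<and> (\<forall>v\<in>points E. q v < 1 \<longrightarrow> v \<in> B i)" if i: "i < m" for i
  proof -
    have "0 \<in> B i" using B(2) i by (auto simp: PiE_iff)
    moreover have "openin (topo E) (B i)" using B(1) i by simp
    ultimately show ?thesis using E.openin_nbhd by (metis add_0)
  qed
  then obtain q where q: "\<And>i. i < m \<Longrightarrow> cont_seminorm E (q i)" "\<And>i v. i < m \<Longrightarrow> v \<in> points E \<Longrightarrow> q i v < 1 \<Longrightarrow> v \<in> B i"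
    by metis
  obtain p where p: "cont_seminorm E p" "\<And>i x. i \<in> {..<m} \<Longrightarrow> x \<in> points E \<Longrightarrow> q i x \<le> p x"
    using E.seminorm_sum_plus[of "{..<m}" q] q(1) by auto
  \<comment> \<open>For \<open>m > 0\<close> the value \<open>y0\<close> at the zero tuple is 0; the
    term \<open>N y0\<close> matters for constants, that is for \<open>m = 0\<close>.\<close>
  have "mbound (points E) p N m (N y0 + 1) \<phi>"
  proof (rule mbound_of_ball[OF p(1) \<phi>])
    fix us assume us: "set us \<subseteq> points E" "length us = m" "\<forall>u\<in>set us. p u < 1"
    then obtain u where u: "u \<in> tuples (points E) m" "map u [0..<m] = us" using list_tuple by metis
    have "u i \<in> B i" if i: "i < m" for i
    proof -
      have "u i = us ! i" using u(2) i by auto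
      then have "u i \<in> set us" using i us by simp
      then have "u i \<in> points E" "p (u i) < 1" using us by auto
      then show ?thesis using q(2)[OF i] p(2)[of i "u i"] i by auto
    qed
    then have "u \<in> Pi\<^sub>E {..<m} B" using u(1) by (auto simp: tuples_def PiE_iff)
    then have "\<phi> us \<in> ?U" using B(3) u(2) by auto
    then show "N (\<phi> us) \<le> N y0 + 1" using N_le_add_diff[of "\<phi> us" y0] y0 by auto
  qed
  then show thesis using that p(1) by blast
qed

text \<open>Keller's condition for a normed target. The neighbourhood \<open>U\<close> that is
  chosen before \<epsilon> becomes the unit ball of one seminorm \<open>p\<close>, and the condition
  says that the derivative of order \<open>l\<close> is continuous at \<open>x\<close> with respect
  to the operator bound relative to \<open>p\<close>.\<close>

definition Ck_norm_at :: "enat \<Rightarrow> ('e list \<Rightarrow> 'e \<Rightarrow> 'g) \<Rightarrow> 'e \<Rightarrow> bool" where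
  "Ck_norm_at k \<Phi> x \<longleftrightarrow>
     (\<forall>l. enat l \<le> k \<longrightarrow> slot_linear E G l (\<lambda>us. \<Phi> us x) \<and>
        (\<exists>p K. cont_seminorm E p \<and> mbound (points E) p N l K (\<lambda>us. \<Phi> us x) \<and>
          (\<forall>\<epsilon>>0. eventually (\<lambda>v. mbound (points E) p N l \<epsilon> (\<lambda>us. \<Phi> us (x + v) - \<Phi> us x)) (zero_filter E)))) \<and>
     (\<forall>us v. set us \<subseteq> points E \<and> v \<in> points E \<and> enat (Suc (length us)) \<le> k \<longrightarrow>
        limitin (topo G) (\<lambda>t. scl G (inverse t) (\<Phi> us (x + scl E t v) - \<Phi> us x)) (\<Phi> (us @ [v]) x) (at 0))"

lemma Ck_norm_at_of_Ck_at:
  assumes o: "openin (topo E) D" and C: "\<And>x. x \<in> D \<Longrightarrow> Ck_at k E G \<Phi> x" and x: "x \<in> D"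
  shows "Ck_norm_at k \<Phi> x"
  unfolding Ck_norm_at_def
proof (intro conjI allI impI)
  fix l assume l: "enat l \<le> k"
  have sl: "slot_linear E G l (\<lambda>us. \<Phi> us y)" if "y \<in> D" for y
    using C[OF that] l unfolding Ck_at_def by blast
  show "slot_linear E G l (\<lambda>us. \<Phi> us x)" using sl[OF x] .
  obtain p1 K where p1: "cont_seminorm E p1" "mbound (points E) p1 N l K (\<lambda>us. \<Phi> us x)"
    using mbound_of_continuous[OF sl[OF x]] C[OF x] l unfolding Ck_at_def by blast
  \<comment> \<open>The unit ball is enough as \<open>W\<close>: scaling by \<epsilon> produces all
    other balls. The resulting \<open>p2\<close> is added to the seminorm \<open>p1\<close> that
    bounds the derivative at \<open>x\<close> itself.\<close>
  have "zero_nbhd G {y \<in> points G. N y < 1}" using seminorm_N by (simp add: cont_seminorm_def)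
  then obtain U where U: "zero_nbhd E U" "\<And>\<epsilon>::real. \<epsilon> > 0 \<Longrightarrow>
           eventually (\<lambda>v. \<forall>us. set us \<subseteq> U \<and> length us = l \<longrightarrow>
             \<Phi> us (x + v) - \<Phi> us x \<in> scl G (of_real \<epsilon>) ` {y \<in> points G. N y < 1}) (zero_filter E)"
    using C[OF x] l unfolding Ck_at_def by meson
  obtain p2 where p2: "cont_seminorm E p2" "{u \<in> points E. p2 u < 1} \<subseteq> U" using E.gauge[OF U(1)] by metis
  define p where "p u = p1 u + p2 u" for u
  have p: "cont_seminorm E p" unfolding p_def using p1(1) p2(1) by (rule E.seminorm_plus)
  have le: "p1 u \<le> p u" "p2 u \<le> p u" if "u \<in> points E" for u
    using E.seminorm_nonneg[OF p1(1) that] E.seminorm_nonneg[OF p2(1) that] by (auto simp: p_def)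
  show "\<exists>p K. cont_seminorm E p \<and> mbound (points E) p N l K (\<lambda>us. \<Phi> us x) \<and>
          (\<forall>\<epsilon>>0. eventually (\<lambda>v. mbound (points E) p N l \<epsilon> (\<lambda>us. \<Phi> us (x + v) - \<Phi> us x)) (zero_filter E))"
  proof (intro exI conjI allI impI)
    show "cont_seminorm E p" by fact
    show "mbound (points E) p N l (max K 0) (\<lambda>us. \<Phi> us x)"
    proof (rule mbound_of_ball[OF p sl[OF x]])
      fix us assume us: "set us \<subseteq> points E" "length us = l" "\<forall>u\<in>set us. p u < 1"
      have 01: "0 \<le> p1 u \<and> p1 u \<le> 1" if "u \<in> set us" for u
        using us that le(1)[of u] E.seminorm_nonneg[OF p1(1), of u] by fastforce
      have "prod_list (map p1 us) \<le> 1 ^ length us" by (rule prod_list_le_power[OF 01])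
      moreover have "0 \<le> prod_list (map p1 us)" using 01 by (intro prod_list_nonneg) blast
      ultimately have "K * prod_list (map p1 us) \<le> max K 0 * 1"
        by (intro mult_mono) auto
      then show "N (\<Phi> us x) \<le> max K 0" using mboundD[OF p1(2) us(1,2)] by simp
    qed
    fix \<epsilon> :: real assume "\<epsilon> > 0"
    show "eventually (\<lambda>v. mbound (points E) p N l \<epsilon> (\<lambda>us. \<Phi> us (x + v) - \<Phi> us x)) (zero_filter E)"
      using U(2)[OF \<open>\<epsilon> > 0\<close>] E.eventually_zero_filter_add[OF o x]
    proof eventually_elim
      case (elim v)
      show ?case
      proof (rule mbound_of_ball[OF p slot_linear_diff[OF sl[OF elim(2)] sl[OF x]]])
        fix us assume us: "set us \<subseteq> points E" "length us = l" "\<forall>u\<in>set us. p u < 1"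
        have "set us \<subseteq> U"
        proof
          fix u assume "u \<in> set us"
          then have "u \<in> points E" "p u < 1" using us by auto
          then show "u \<in> U" using p2(2) le(2)[of u] by auto
        qed
        then have "\<Phi> us (x + v) - \<Phi> us x \<in> scl G (of_real \<epsilon>) ` {y \<in> points G. N y < 1}"
          using elim(1) us(2) by blast
        then obtain y where y: "y \<in> points G" "N y < 1" "\<Phi> us (x + v) - \<Phi> us x = scl G (of_real \<epsilon>) y" by auto
        then show "N (\<Phi> us (x + v) - \<Phi> us x) \<le> \<epsilon>"
          using N_scale_real[OF y(1), of \<epsilon>] \<open>\<epsilon> > 0\<close> by simp
      qed
    qed
  qed
next
  fix us v assume "set us \<subseteq> points E \<and> v \<in> points E \<and> enat (Suc (length us)) \<le> k"
  then show "limitin (topo G) (\<lambda>t. scl G (inverse t) (\<Phi> us (x + scl E t v) - \<Phi> us x)) (\<Phi> (us @ [v]) x) (at 0)"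
    using C[OF x] unfolding Ck_at_def by blast
qed

lemma Ck_at_of_Ck_norm_at:
  assumes o: "openin (topo E) D" and C: "\<And>x. x \<in> D \<Longrightarrow> Ck_norm_at k \<Phi> x" and x: "x \<in> D"
  shows "Ck_at k E G \<Phi> x"
  unfolding Ck_at_def
proof (intro conjI allI impI)
  fix l assume l: "enat l \<le> k"
  have sl: "slot_linear E G l (\<lambda>us. \<Phi> us y)" if "y \<in> D" for y
    using C[OF that] l unfolding Ck_norm_at_def by blast
  show "slot_linear E G l (\<lambda>us. \<Phi> us x)" using sl[OF x] .
  obtain p K where p: "cont_seminorm E p" "mbound (points E) p N l K (\<lambda>us. \<Phi> us x)"
    and ev: "\<And>\<epsilon>. \<epsilon> > 0 \<Longrightarrow> eventually (\<lambda>v. mbound (points E) p N l \<epsilon> (\<lambda>us. \<Phi> us (x + v) - \<Phi> us x)) (zero_filter E)"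
    using C[OF x] l unfolding Ck_norm_at_def by blast
  show "continuous_map (product_topology (\<lambda>_. topo E) {..<l}) (topo G) (\<lambda>u. \<Phi> (map u [0..<l]) x)"
    by (rule continuous_map_multilinear[OF p(1) sl[OF x] p(2)])
  fix W assume "zero_nbhd G W"
  then obtain r where r: "r > 0" "\<And>y. y \<in> points G \<Longrightarrow> N y < r \<Longrightarrow> y \<in> W"
    unfolding zero_nbhd_N by blast
  show "\<exists>U. zero_nbhd E U \<and> (\<forall>\<epsilon>::real. \<epsilon> > 0 \<longrightarrow>
           eventually (\<lambda>v. \<forall>us. set us \<subseteq> U \<and> length us = l \<longrightarrow>
             \<Phi> us (x + v) - \<Phi> us x \<in> scl G (of_real \<epsilon>) ` W) (zero_filter E))"
  proof (intro exI conjI allI impI)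
    show "zero_nbhd E {u \<in> points E. p u < 1}" using p(1) by (simp add: cont_seminorm_def)
    fix \<epsilon> :: real assume e: "\<epsilon> > 0"
    \<comment> \<open>After division by \<epsilon> the increment must have norm strictly below
      \<open>r\<close>; half of \<open>r\<close> guarantees this.\<close>
    then have "\<epsilon> * r / 2 > 0" using r by simp
    from ev[OF this] E.eventually_zero_filter_add[OF o x]
    show "eventually (\<lambda>v. \<forall>us. set us \<subseteq> {u \<in> points E. p u < 1} \<and> length us = l \<longrightarrow>
             \<Phi> us (x + v) - \<Phi> us x \<in> scl G (of_real \<epsilon>) ` W) (zero_filter E)"
    proof eventually_elim
      case (elim v)
      show ?case
      proof (intro allI impI, elim conjE)
        fix us assume us: "set us \<subseteq> {u \<in> points E. p u < 1}" "length us = l"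
        let ?d = "\<Phi> us (x + v) - \<Phi> us x"
        have us': "set us \<subseteq> points E" using us by auto
        have d: "?d \<in> points G"
          using slot_linearD(1)[OF sl[OF x] us' us(2)] slot_linearD(1)[OF sl[OF elim(2)] us' us(2)] by simp
        have 01: "0 \<le> p u \<and> p u \<le> 1" if "u \<in> set us" for u
          using us that E.seminorm_nonneg[OF p(1), of u] by fastforce
        have "prod_list (map p us) \<le> 1 ^ length us" by (rule prod_list_le_power[OF 01])
        then have "\<epsilon> * r / 2 * prod_list (map p us) \<le> \<epsilon> * r / 2 * 1"
          using e r by (intro mult_left_mono) auto
        then have Nd: "N ?d \<le> \<epsilon> * r / 2" using mboundD[OF elim(1) us' us(2)] by simp
        have "N (scl G (of_real (1 / \<epsilon>)) ?d) = 1 / \<epsilon> * N ?d"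
          using e d by (intro N_scale_real) auto
        also have "\<dots> \<le> 1 / \<epsilon> * (\<epsilon> * r / 2)" using Nd e by (intro mult_left_mono) auto
        also have "\<dots> < r" using e r by simp
        finally have "scl G (of_real (1 / \<epsilon>)) ?d \<in> W" using d by (intro r(2)) auto
        moreover have "?d = scl G (of_real \<epsilon>) (scl G (of_real (1 / \<epsilon>)) ?d)"
          using e by (simp flip: of_real_mult)
        ultimately show "?d \<in> scl G (of_real \<epsilon>) ` W" by blast
      qed
    qed
  qed
next
  fix us v assume "set us \<subseteq> points E \<and> v \<in> points E \<and> enat (Suc (length us)) \<le> k"
  then show "limitin (topo G) (\<lambda>t. scl G (inverse t) (\<Phi> us (x + scl E t v) - \<Phi> us x)) (\<Phi> (us @ [v]) x) (at 0)"
    using C[OF x] unfolding Ck_norm_at_def by blast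
qed

end

section \<open>The chain rule\<close>

lemma limitin_compose_filterlim:
  assumes "limitin X f l F" "filterlim g F F'"
  shows "limitin X (\<lambda>x. f (g x)) l F'"
  using assms unfolding limitin_def filterlim_iff by blast

section \<open>Limits of quotients and arithmetic of limits\<close>

context lcs_space
begin

lemma limitin_of_quotient:
  assumes a0: "a0 \<in> points E" and ev: "eventually (\<lambda>t. a t \<in> points E) (at 0)"
    and l: "limitin (topo E) (\<lambda>t. scl E (inverse t) (a t - a0)) l (at 0)"
  shows "limitin (topo E) a a0 (at 0)"
  unfolding limitin_iff
proof (intro conjI allI impI a0 ev)
  fix p assume p: "cont_seminorm E p"
  let ?q = "\<lambda>t. scl E (inverse t) (a t - a0)"
  have lE: "l \<in> points E" using l by (simp add: limitin_iff)
  have ql: "((\<lambda>t. p (?q t - l)) \<longlongrightarrow> 0) (at 0)" using l p by (simp add: limitin_iff)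
  have nz: "eventually (\<lambda>t::'k. t \<noteq> 0) (at 0)" by (simp add: eventually_at_filter)
  have 2: "eventually (\<lambda>t. p (a t - a0) \<le> norm t * (p (?q t - l) + p l)) (at 0)"
    using ev nz
  proof eventually_elim
    case (elim t)
    have q: "?q t \<in> points E" using elim a0 by auto
    have "a t - a0 = scl E t (?q t)" using elim by simp
    then have "p (a t - a0) = norm t * p (?q t)" using seminorm_scale[OF p q, of t] by (simp only:)
    also have "p (?q t) \<le> p (?q t - l) + p l" using seminorm_add[OF p, of "?q t - l" l] q lE by simp
    finally show ?case by (simp add: mult_left_mono)
  qed
  have "((\<lambda>t. norm t * (p (?q t - l) + p l)) \<longlongrightarrow> norm (0::'k) * (0 + p l)) (at 0)"
    by (intro tendsto_intros ql)
  then have 3: "((\<lambda>t. norm t * (p (?q t - l) + p l)) \<longlongrightarrow> 0) (at 0)" by simp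
  have 1: "eventually (\<lambda>t. 0 \<le> p (a t - a0)) (at 0)"
    using ev by eventually_elim (use a0 seminorm_nonneg[OF p] in auto)
  show "((\<lambda>t. p (a t - a0)) \<longlongrightarrow> 0) (at 0)"
    by (rule tendsto_sandwich[OF 1 2 tendsto_const 3])
qed

lemma limitin_add:
  assumes "limitin (topo E) a l \<F>" "limitin (topo E) a' l' \<F>"
  shows "limitin (topo E) (\<lambda>x. a x + a' x) (l + l') \<F>"
  unfolding limitin_iff
proof (intro conjI allI impI)
  note A = assms[unfolded limitin_iff]
  show "l + l' \<in> points E" using A by auto
  have ev: "eventually (\<lambda>x. a x \<in> points E \<and> a' x \<in> points E) \<F>" using A by (auto intro: eventually_conj)
  then show "eventually (\<lambda>x. a x + a' x \<in> points E) \<F>" by eventually_elim auto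
  fix p assume p: "cont_seminorm E p"
  have "((\<lambda>x. p (a x - l) + p (a' x - l')) \<longlongrightarrow> 0 + 0) \<F>" using A p by (intro tendsto_intros) auto
  then have 3: "((\<lambda>x. p (a x - l) + p (a' x - l')) \<longlongrightarrow> 0) \<F>" by simp
  have 2: "eventually (\<lambda>x. p (a x + a' x - (l + l')) \<le> p (a x - l) + p (a' x - l')) \<F>"
    using ev
  proof eventually_elim
    case (elim x)
    then show ?case using seminorm_add[OF p, of "a x - l" "a' x - l'"] A by (simp add: algebra_simps)
  qed
  have 1: "eventually (\<lambda>x. 0 \<le> p (a x + a' x - (l + l'))) \<F>"
    using ev by eventually_elim (use A in \<open>auto intro!: seminorm_nonneg[OF p]\<close>)
  show "((\<lambda>x. p (a x + a' x - (l + l'))) \<longlongrightarrow> 0) \<F>"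
    by (rule tendsto_sandwich[OF 1 2 tendsto_const 3])
qed

lemma limitin_scale:
  assumes "limitin (topo E) a l \<F>"
  shows "limitin (topo E) (\<lambda>x. scl E c (a x)) (scl E c l) \<F>"
  unfolding limitin_iff
proof (intro conjI allI impI)
  note A = assms[unfolded limitin_iff]
  show "scl E c l \<in> points E" using A by auto
  from A have ev: "eventually (\<lambda>x. a x \<in> points E) \<F>" by blast
  then show "eventually (\<lambda>x. scl E c (a x) \<in> points E) \<F>" by eventually_elim auto
  fix p assume p: "cont_seminorm E p"
  have "((\<lambda>x. norm c * p (a x - l)) \<longlongrightarrow> norm c * 0) \<F>" using A p by (intro tendsto_intros) auto
  then have "((\<lambda>x. norm c * p (a x - l)) \<longlongrightarrow> 0) \<F>" by simp
  moreover have "eventually (\<lambda>x. norm c * p (a x - l) = p (scl E c (a x) - scl E c l)) \<F>"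
    using ev
  proof eventually_elim
    case (elim x)
    then show ?case using seminorm_scale[OF p, of "a x - l" c] A by (simp add: scale_right_diff_distrib)
  qed
  ultimately show "((\<lambda>x. p (scl E c (a x) - scl E c l)) \<longlongrightarrow> 0) \<F>" by (rule Lim_transform_eventually)
qed

lemma limitin_minus: "limitin (topo E) a l \<F> \<Longrightarrow> limitin (topo E) (\<lambda>x. - a x) (- l) \<F>"
  using limitin_scale[of a l \<F> "-1"] by simp

lemma limitin_diff:
  "limitin (topo E) a l \<F> \<Longrightarrow> limitin (topo E) a' l' \<F> \<Longrightarrow> limitin (topo E) (\<lambda>x. a x - a' x) (l - l') \<F>"
  using limitin_add[of a l \<F> "\<lambda>x. - a' x" "- l'"] limitin_minus[of a' l' \<F>] by simp

lemma limitin_sum: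
  "(\<And>i. i \<in> A \<Longrightarrow> limitin (topo E) (a i) (l i) \<F>) \<Longrightarrow>
    limitin (topo E) (\<lambda>x. \<Sum>i\<in>A. a i x) (\<Sum>i\<in>A. l i) \<F>"
  by (induction A rule: infinite_finite_induct) (simp_all add: limitin_add)

lemma limitin_sum_list:
  "(\<And>i. i \<in> set xs \<Longrightarrow> limitin (topo E) (a i) (l i) \<F>) \<Longrightarrow>
    limitin (topo E) (\<lambda>x. \<Sum>i\<leftarrow>xs. a i x) (\<Sum>i\<leftarrow>xs. l i) \<F>"
  by (induction xs) (simp_all add: limitin_add)

end

section \<open>Mean value inequality, Keller seminorms and the chain rule\<close>

context to_banach
begin

text \<open>Restriction to the segment from \<open>z\<close> to \<open>z + d\<close>. Its parameter
  is real even over the complex scalars, so the difference quotients over the field are pulled back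
  along \<open>of_real\<close>.\<close>

lemma mean_value:
  assumes C: "\<And>s. 0 \<le> s \<Longrightarrow> s \<le> 1 \<Longrightarrow> Ck_norm_at k \<Phi> (z + scl E (of_real s) d)"
    and d: "d \<in> points E" and ws: "set ws \<subseteq> points E" "enat (Suc (length ws)) \<le> k" and c: "c \<in> points G"
    and B: "\<And>s. 0 \<le> s \<Longrightarrow> s \<le> 1 \<Longrightarrow> N (\<Phi> (ws @ [d]) (z + scl E (of_real s) d) - c) \<le> B"
  shows "N (\<Phi> ws (z + d) - \<Phi> ws z - c) \<le> B"
proof -
  let ?y = "\<lambda>s. z + scl E (of_real s) d"
  have k: "enat (length ws) \<le> k"
    using ws(2) by (meson enat_ord_simps(1) le_SucI order_refl order_trans)
  have "N (\<Phi> ws (?y 1) - \<Phi> ws (?y 0) - c) \<le> B"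
  proof (rule mean_value_real[OF _ c])
    fix s :: real assume s: "0 \<le> s" "s \<le> 1"
    note Cs = C[OF s, unfolded Ck_norm_at_def]
    have "slot_linear E G (length ws) (\<lambda>us. \<Phi> us (?y s))"
      "slot_linear E G (Suc (length ws)) (\<lambda>us. \<Phi> us (?y s))"
      using Cs k ws by blast+
    then have in1: "\<Phi> ws (?y s) \<in> points G" "\<Phi> (ws @ [d]) (?y s) \<in> points G"
      using slot_linearD(1)[of E G "length ws" "\<lambda>us. \<Phi> us (?y s)" ws]
        slot_linearD(1)[of E G "Suc (length ws)" "\<lambda>us. \<Phi> us (?y s)" "ws @ [d]"] ws d by auto
    have "limitin (topo G) (\<lambda>t. scl G (inverse t) (\<Phi> ws (?y s + scl E t d) - \<Phi> ws (?y s)))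
       (\<Phi> (ws @ [d]) (?y s)) (at 0)" using Cs ws d by blast
    moreover have "filterlim (of_real :: real \<Rightarrow> 'k) (at 0) (at 0)"
      unfolding filterlim_at by (auto simp: eventually_at_filter intro!: tendsto_eq_intros)
    ultimately have "limitin (topo G) (\<lambda>t. scl G (inverse (of_real t)) (\<Phi> ws (?y s + scl E (of_real t) d) - \<Phi> ws (?y s)))
       (\<Phi> (ws @ [d]) (?y s)) (at (0::real))"
      by (rule limitin_compose_filterlim)
    moreover have "?y s + scl E (of_real t) d = ?y (s + t)" for t
      by (simp add: E.scale_left_distrib add.assoc)
    ultimately have "limitin (topo G) (\<lambda>t. scl G (of_real (inverse t)) (\<Phi> ws (?y (s + t)) - \<Phi> ws (?y s)))
       (\<Phi> (ws @ [d]) (?y s)) (at (0::real))" by simp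
    then show "\<Phi> ws (?y s) \<in> points G \<and> \<Phi> (ws @ [d]) (?y s) \<in> points G \<and> N (\<Phi> (ws @ [d]) (?y s) - c) \<le> B \<and>
      limitin (topo G) (\<lambda>t. scl G (of_real (inverse t)) (\<Phi> ws (?y (s + t)) - \<Phi> ws (?y s)))
       (\<Phi> (ws @ [d]) (?y s)) (at (0::real))"
      using in1 B[OF s] by blast
  qed
  then show ?thesis by simp
qed

text \<open>One seminorm that serves all orders \<open>m \<le> L\<close> at the point
  \<open>z\<close>. Derivatives of different orders occur nested in each other later on, and their
  estimates must be comparable.\<close>

definition Keller_seminorm :: "('e list \<Rightarrow> 'e \<Rightarrow> 'g) \<Rightarrow> 'e \<Rightarrow> nat \<Rightarrow> ('e \<Rightarrow> real) \<Rightarrow> bool" where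
  "Keller_seminorm \<Phi> z L p \<longleftrightarrow> cont_seminorm E p \<and> (\<forall>m\<le>L. slot_linear E G m (\<lambda>us. \<Phi> us z) \<and>
     (\<exists>K\<ge>0. mbound (points E) p N m K (\<lambda>us. \<Phi> us z)) \<and>
     (\<forall>\<epsilon>>0. eventually (\<lambda>v. mbound (points E) p N m \<epsilon> (\<lambda>us. \<Phi> us (z + v) - \<Phi> us z)) (zero_filter E)))"

lemma Keller_seminorm_exists:
  assumes C: "Ck_norm_at k \<Phi> z" and L: "enat L \<le> k"
  obtains p where "Keller_seminorm \<Phi> z L p"
proof -
  have m: "enat m \<le> k" if "m \<le> L" for m using that L by (meson enat_ord_simps(1) order_trans)
  define Q where "Q m p \<longleftrightarrow> cont_seminorm E p \<and> (\<exists>K. mbound (points E) p N m K (\<lambda>us. \<Phi> us z)) \<and>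
          (\<forall>\<epsilon>>0. eventually (\<lambda>v. mbound (points E) p N m \<epsilon> (\<lambda>us. \<Phi> us (z + v) - \<Phi> us z)) (zero_filter E))" for m p
  have "\<exists>p. Q m p" if "m \<le> L" for m
    using C m[OF that] unfolding Ck_norm_at_def Q_def by blast
  then obtain p where Q: "\<And>m. m \<le> L \<Longrightarrow> Q m (p m)" by metis
  have p: "cont_seminorm E (p m)" "\<exists>K. mbound (points E) (p m) N m K (\<lambda>us. \<Phi> us z)"
    "\<And>\<epsilon>. \<epsilon> > 0 \<Longrightarrow> eventually (\<lambda>v. mbound (points E) (p m) N m \<epsilon> (\<lambda>us. \<Phi> us (z + v) - \<Phi> us z)) (zero_filter E)"
    if "m \<le> L" for m
    using Q[OF that] unfolding Q_def by blast+
  obtain q where q: "cont_seminorm E q" "\<And>m x. m \<in> {..L} \<Longrightarrow> x \<in> points E \<Longrightarrow> p m x \<le> q x"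
    using E.seminorm_sum_plus[of "{..L}" p] p(1) by auto
  have "Keller_seminorm \<Phi> z L q"
    unfolding Keller_seminorm_def
  proof (intro conjI allI impI q(1))
    fix m assume mL: "m \<le> L"
    show "slot_linear E G m (\<lambda>us. \<Phi> us z)" using C m[OF mL] unfolding Ck_norm_at_def by blast
    obtain K where K: "mbound (points E) (p m) N m K (\<lambda>us. \<Phi> us z)" using p(2)[OF mL] by blast
    have "mbound (points E) q N m (max K 0) (\<lambda>us. \<Phi> us z)"
      using mbound_mono[OF mbound_max[OF p(1)[OF mL] K] _ p(1)[OF mL], of q "max K 0"] q(2) mL by auto
    then show "\<exists>K\<ge>0. mbound (points E) q N m K (\<lambda>us. \<Phi> us z)" by (intro exI[of _ "max K 0"]) auto
    fix \<epsilon> :: real assume e: "\<epsilon> > 0"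
    show "eventually (\<lambda>v. mbound (points E) q N m \<epsilon> (\<lambda>us. \<Phi> us (z + v) - \<Phi> us z)) (zero_filter E)"
      using p(3)[OF mL e]
    proof eventually_elim
      case (elim v)
      show ?case using mbound_mono[OF elim _ p(1)[OF mL], of q \<epsilon>] q(2) mL e by auto
    qed
  qed
  then show thesis using that by blast
qed

lemma Keller_seminormD:
  assumes "Keller_seminorm \<Phi> z L p"
  shows "cont_seminorm E p" "m \<le> L \<Longrightarrow> slot_linear E G m (\<lambda>us. \<Phi> us z)"
    "m \<le> L \<Longrightarrow> \<exists>K\<ge>0. mbound (points E) p N m K (\<lambda>us. \<Phi> us z)"
    "m \<le> L \<Longrightarrow> \<epsilon> > 0 \<Longrightarrow>
      eventually (\<lambda>v. mbound (points E) p N m \<epsilon> (\<lambda>us. \<Phi> us (z + v) - \<Phi> us z)) (zero_filter E)"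
  using assms by (auto simp: Keller_seminorm_def)

text \<open>The families below may be indexed by an arbitrary filter, so uniformity in a parameter
  \<open>u \<in> Q\<close> is convergence along a product with \<open>principal Q\<close>.\<close>

lemma Keller_seminorm_tendsto:
  assumes p: "Keller_seminorm \<Phi> z L p" and m: "m \<le> L"
    and y: "filterlim y (zero_filter E) \<F>"
    and sl: "eventually (\<lambda>a. slot_linear E G m (\<lambda>us. \<Phi> us (z + y a))) \<F>"
    and ws: "eventually (\<lambda>a. set (ws a) \<subseteq> points E \<and> length (ws a) = m \<and>
        set (vs a) \<subseteq> points E \<and> length (vs a) = m \<and> (\<forall>i<m. p (vs a ! i) \<le> B)) \<F>"
    and lim: "\<And>i. i < m \<Longrightarrow> ((\<lambda>a. p (ws a ! i - vs a ! i)) \<longlongrightarrow> 0) \<F>"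
  shows "((\<lambda>a. N (\<Phi> (ws a) (z + y a) - \<Phi> (vs a) z)) \<longlongrightarrow> 0) \<F>"
proof -
  note g = Keller_seminormD[OF p]
  obtain K where K: "K \<ge> 0" "mbound (points E) p N m K (\<lambda>us. \<Phi> us z)" using g(3)[OF m] by blast
  define B' where "B' = max B 0 + 1"
  have B': "B' > 0" "B + 1 \<le> B'" by (auto simp: B'_def)
  have fixed: "((\<lambda>a. N (\<Phi> (ws a) z - \<Phi> (vs a) z)) \<longlongrightarrow> 0) \<F>"
    by (rule tendsto_multilinear[OF g(1) g(2)[OF m] K(2) ws lim])
  have lt: "eventually (\<lambda>a. \<forall>i\<in>{..<m}. p (ws a ! i - vs a ! i) < 1) \<F>"
    by (rule eventually_ball_less_1) (rule lim)
  show ?thesis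
  proof (rule tendstoI)
    fix e :: real assume e: "e > 0"
    define \<epsilon> where "\<epsilon> = e / (2 * B' ^ m)"
    have eps: "\<epsilon> > 0" "\<epsilon> * B' ^ m = e / 2" using e B' by (simp_all add: \<epsilon>_def)
    have 1: "eventually (\<lambda>a. N (\<Phi> (ws a) z - \<Phi> (vs a) z) < e / 2) \<F>"
      using fixed by (rule order_tendstoD) (use e in simp)
    have 2: "eventually (\<lambda>a. mbound (points E) p N m \<epsilon> (\<lambda>us. \<Phi> us (z + y a) - \<Phi> us z)) \<F>"
      using g(4)[OF m eps(1)] y unfolding filterlim_iff by blast
    show "eventually (\<lambda>a. dist (N (\<Phi> (ws a) (z + y a) - \<Phi> (vs a) z)) 0 < e) \<F>"
      using 1 2 ws lt sl
    proof eventually_elim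
      case (elim a)
      have wsB: "0 \<le> p w \<and> p w \<le> B'" if "w \<in> set (ws a)" for w
      proof -
        obtain i where i: "i < m" "w = ws a ! i" using \<open>w \<in> set (ws a)\<close> elim by (metis in_set_conv_nth)
        have "ws a ! i \<in> points E" "vs a ! i \<in> points E" using elim i nth_mem by (auto simp: subset_iff)
        then have "p (vs a ! i + (ws a ! i - vs a ! i)) \<le> p (vs a ! i) + p (ws a ! i - vs a ! i)"
          by (intro E.seminorm_add[OF g(1)]) auto
        moreover have "p (vs a ! i) \<le> B" "p (ws a ! i - vs a ! i) < 1" using elim i by auto
        ultimately show ?thesis using B' i \<open>ws a ! i \<in> points E\<close> E.seminorm_nonneg[OF g(1)] by simp
      qed
      have pts: "\<Phi> (ws a) (z + y a) \<in> points G" "\<Phi> (ws a) z \<in> points G" "\<Phi> (vs a) z \<in> points G"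
        using elim slot_linearD(1)[OF elim(5)] slot_linearD(1)[OF g(2)[OF m]] by auto
      have "N (\<Phi> (ws a) (z + y a) - \<Phi> (ws a) z) \<le> \<epsilon> * prod_list (map p (ws a))"
        using elim by (intro mboundD[OF elim(2)]) auto
      also have "\<dots> \<le> \<epsilon> * B' ^ m"
        using prod_list_le_power[OF wsB] elim eps(1) by (intro mult_left_mono) auto
      finally have "N (\<Phi> (ws a) (z + y a) - \<Phi> (ws a) z) \<le> e / 2" using eps by simp
      then have "N (\<Phi> (ws a) (z + y a) - \<Phi> (vs a) z) < e"
        using N_triangle[OF pts] elim(1) by linarith
      then show ?case using N_nonneg[of "\<Phi> (ws a) (z + y a) - \<Phi> (vs a) z"] pts by simp
    qed
  qed
qed

lemma Keller_seminorm_bounded: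
  assumes p: "Keller_seminorm \<Phi> z L p" and m: "m \<le> L"
  obtains B' where "\<And>ws. set ws \<subseteq> points E \<Longrightarrow> length ws = m \<Longrightarrow> (\<And>i. i < m \<Longrightarrow> p (ws ! i) \<le> B) \<Longrightarrow>
    N (\<Phi> ws z) \<le> B'"
proof -
  note g = Keller_seminormD[OF p]
  obtain K where K: "K \<ge> 0" "mbound (points E) p N m K (\<lambda>us. \<Phi> us z)" using g(3)[OF m] by blast
  have "N (\<Phi> ws z) \<le> K * B ^ m"
    if ws: "set ws \<subseteq> points E" "length ws = m" "\<And>i. i < m \<Longrightarrow> p (ws ! i) \<le> B" for ws
  proof -
    have "0 \<le> p w \<and> p w \<le> B" if "w \<in> set ws" for w
      using that ws E.seminorm_nonneg[OF g(1)] by (metis in_set_conv_nth subsetD)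
    then have "prod_list (map p ws) \<le> B ^ m" using prod_list_le_power[of ws p B] ws by simp
    then have "K * prod_list (map p ws) \<le> K * B ^ m" using K(1) by (rule mult_left_mono)
    then show ?thesis using mboundD[OF K(2) ws(1,2)] by simp
  qed
  then show thesis using that by blast
qed

text \<open>The base point moves along \<open>z + t \<delta>(t)\<close>, where \<delta> merely
  converges, and the arguments \<open>ws t\<close> are differentiable at 0. This is how a point of
  the graph of \<open>g\<close> moves when nothing but the convergence of the difference quotient of
  \<open>g\<close> is known.\<close>

lemma chain_rule:
  assumes o: "openin (topo E) D" and z: "z \<in> D" and C: "\<And>y. y \<in> D \<Longrightarrow> Ck_norm_at k \<Phi> y"
    and k: "enat (Suc m) \<le> k"
    and \<delta>: "limitin (topo E) \<delta> d (at (0::'k))"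
    and w0: "set w0 \<subseteq> points E" "length w0 = m"
    and ws: "\<And>t. length (ws t) = m" "eventually (\<lambda>t. set (ws t) \<subseteq> points E) (at 0)"
    and w': "\<And>i. i < m \<Longrightarrow> limitin (topo E) (\<lambda>t. scl E (inverse t) (ws t ! i - w0 ! i)) (w' i) (at 0)"
  shows "limitin (topo G) (\<lambda>t. scl G (inverse t) (\<Phi> (ws t) (z + scl E t (\<delta> t)) - \<Phi> w0 z))
     (\<Phi> (w0 @ [d]) z + (\<Sum>i<m. \<Phi> (w0[i := w' i]) z)) (at 0)"
proof -
  have km: "enat m \<le> k" using k by (meson enat_ord_simps(1) le_SucI order_refl order_trans)
  have zE: "z \<in> points E" using o z openin_subset by blast
  obtain p where p: "Keller_seminorm \<Phi> z (Suc m) p" using Keller_seminorm_exists[OF C[OF z] k] .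
  note g = Keller_seminormD[OF p]
  have slm: "slot_linear E G m (\<lambda>us. \<Phi> us z)" "slot_linear E G (Suc m) (\<lambda>us. \<Phi> us z)" using g(2) by simp_all
  obtain K1 where K1: "mbound (points E) p N m K1 (\<lambda>us. \<Phi> us z)" using g(3)[of m] by auto
  obtain K2 where K2: "mbound (points E) p N (Suc m) K2 (\<lambda>us. \<Phi> us z)" using g(3)[of "Suc m"] by auto
  have d: "d \<in> points E" using \<delta> by (simp add: E.limitin_iff)
  have \<delta>E: "eventually (\<lambda>t. \<delta> t \<in> points E) (at 0)" using \<delta> by (simp add: E.limitin_iff)
  have nz: "eventually (\<lambda>t::'k. t \<noteq> 0) (at 0)" by (simp add: eventually_at_filter)
  have w'E: "w' i \<in> points E" if "i < m" for i using w'[OF that] by (simp add: E.limitin_iff)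
  have wsi: "limitin (topo E) (\<lambda>t. ws t ! i) (w0 ! i) (at 0)" if i: "i < m" for i
  proof (rule E.limitin_of_quotient[OF _ _ w'[OF i]])
    show "w0 ! i \<in> points E" using w0 i by (metis nth_mem subsetD)
    show "eventually (\<lambda>t. ws t ! i \<in> points E) (at 0)"
      using ws(2) by eventually_elim (metis ws(1) i nth_mem subsetD)
  qed
  have wlim: "((\<lambda>t. p (ws t ! i - w0 ! i)) \<longlongrightarrow> 0) (at 0)" if "i < m" for i
    using wsi[OF that] g(1) by (simp add: E.limitin_iff)
  define B where "B = Max (insert (p d) (insert 1 (p ` (set w0 \<union> w' ` {..<m})))) "
  have fB: "finite (insert (p d) (insert 1 (p ` (set w0 \<union> w' ` {..<m}))))" by simp
  have B: "1 \<le> B" "p d \<le> B" "\<And>i. i < m \<Longrightarrow> p (w0 ! i) \<le> B" "\<And>i. i < m \<Longrightarrow> p (w' i) \<le> B"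
    unfolding B_def by (intro Max_ge[OF fB]; use w0 in simp)+
  have \<delta>lim: "((\<lambda>t. p (\<delta> t - d)) \<longlongrightarrow> 0) (at 0)" using \<delta> g(1) by (simp add: E.limitin_iff)
  \<comment> \<open>The quotient is \<open>?T1 + ?T2\<close> plus the sum of the
    \<open>?T3 i\<close>: linearization error in the base point, derivative along the actual
    direction \<open>\<delta> t\<close>, and the change of the arguments exchanged slot by
    slot.\<close>
  let ?T1 = "\<lambda>t. scl G (inverse t) (\<Phi> (ws t) (z + scl E t (\<delta> t)) - \<Phi> (ws t) z) - \<Phi> (ws t @ [\<delta> t]) z"
  let ?T2 = "\<lambda>t. \<Phi> (ws t @ [\<delta> t]) z"
  let ?T3 = "\<lambda>i t. \<Phi> (take i w0 @ scl E (inverse t) (ws t ! i - w0 ! i) # drop (Suc i) (ws t)) z"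
  have lim2: "limitin (topo G) ?T2 (\<Phi> (w0 @ [d]) z) (at 0)"
    unfolding limitin_N
  proof (intro conjI)
    show "\<Phi> (w0 @ [d]) z \<in> points G" using w0 d by (intro slot_linearD(1)[OF slm(2)]) auto
    show "eventually (\<lambda>t. ?T2 t \<in> points G) (at 0)"
      using ws(2) \<delta>E by eventually_elim (use ws(1) in \<open>auto intro!: slot_linearD(1)[OF slm(2)]\<close>)
    show "((\<lambda>t. N (?T2 t - \<Phi> (w0 @ [d]) z)) \<longlongrightarrow> 0) (at 0)"
    proof (rule tendsto_multilinear[OF g(1) slm(2) K2])
      show "eventually (\<lambda>t. set (ws t @ [\<delta> t]) \<subseteq> points E \<and> length (ws t @ [\<delta> t]) = Suc m \<and>
        set (w0 @ [d]) \<subseteq> points E \<and> length (w0 @ [d]) = Suc m \<and> (\<forall>i<Suc m. p ((w0 @ [d]) ! i) \<le> B)) (at 0)"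
        using ws(2) \<delta>E by eventually_elim (use ws(1) w0 d B in \<open>auto simp: nth_append less_Suc_eq\<close>)
      fix i assume "i < Suc m"
      then show "((\<lambda>t. p ((ws t @ [\<delta> t]) ! i - (w0 @ [d]) ! i)) \<longlongrightarrow> 0) (at 0)"
        using wlim[of i] \<delta>lim ws(1) w0(2) by (cases "i < m") (auto simp: nth_append less_Suc_eq)
    qed
  qed
  have lim3: "limitin (topo G) (?T3 i) (\<Phi> (w0[i := w' i]) z) (at 0)" if i: "i < m" for i
    unfolding limitin_N
  proof (intro conjI)
    have upd: "w0[i := w' i] = take i w0 @ w' i # drop (Suc i) w0"
      using i w0 by (simp add: upd_conv_take_nth_drop)
    have upd_in: "set (w0[i := w' i]) \<subseteq> points E"
      using w0 w'E[OF i] set_update_subset_insert[of w0 i "w' i"] by auto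
    show "\<Phi> (w0[i := w' i]) z \<in> points G" using w0 upd_in by (intro slot_linearD(1)[OF slm(1)]) auto
    let ?l = "\<lambda>t. take i w0 @ scl E (inverse t) (ws t ! i - w0 ! i) # drop (Suc i) (ws t)"
    have ev: "eventually (\<lambda>t. set (?l t) \<subseteq> points E \<and> length (?l t) = m) (at 0)"
      using ws(2)
    proof eventually_elim
      case (elim t)
      have "ws t ! i \<in> points E" "w0 ! i \<in> points E" using elim ws(1)[of t] w0 i nth_mem[of i "ws t"] nth_mem[of i w0] by auto
      then have "scl E (inverse t) (ws t ! i - w0 ! i) \<in> points E" by auto
      then show ?case using elim ws(1)[of t] w0 i set_take_subset[of i w0] set_drop_subset[of "Suc i" "ws t"] by auto
    qed
    show "eventually (\<lambda>t. ?T3 i t \<in> points G) (at 0)"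
      using ev by eventually_elim (intro slot_linearD(1)[OF slm(1)]; blast)
    show "((\<lambda>t. N (?T3 i t - \<Phi> (w0[i := w' i]) z)) \<longlongrightarrow> 0) (at 0)"
    proof (rule tendsto_multilinear[OF g(1) slm(1) K1])
      have le: "p (w0[i := w' i] ! j) \<le> B" if "j < m" for j
        using that i B w0 by (cases "i = j") auto
      show "eventually (\<lambda>t. set (?l t) \<subseteq> points E \<and> length (?l t) = m \<and> set (w0[i := w' i]) \<subseteq> points E \<and>
         length (w0[i := w' i]) = m \<and> (\<forall>j<m. p (w0[i := w' i] ! j) \<le> B)) (at 0)"
        by (rule eventually_mono[OF ev]) (use upd_in w0 le in simp)
      fix j assume j: "j < m"
      consider "j < i" | "j = i" | "j > i" by linarith
      then show "((\<lambda>t. p (?l t ! j - w0[i := w' i] ! j)) \<longlongrightarrow> 0) (at 0)"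
      proof cases
        case 1
        then have "?l t ! j - w0[i := w' i] ! j = 0" for t using i w0 by (simp add: nth_append)
        then show ?thesis using E.seminorm_zero[OF g(1)] by simp
      next
        case 2
        then have "?l t ! j - w0[i := w' i] ! j = scl E (inverse t) (ws t ! i - w0 ! i) - w' i" for t
          using i w0 by (simp add: nth_append)
        then show ?thesis using w'[OF i] g(1) by (simp add: E.limitin_iff)
      next
        case 3
        then have "?l t ! j - w0[i := w' i] ! j = ws t ! j - w0 ! j" for t
          using i j w0 ws(1)[of t] by (simp add: nth_append nth_Cons' )
        then show ?thesis using wlim[OF j] by simp
      qed
    qed
  qed
  have lim1: "limitin (topo G) ?T1 0 (at 0)"
  proof -
    \<comment> \<open>Bounds the multilinear factor in the estimate of \<open>?T1\<close> for small
      \<open>t\<close>; the entries eventually differ from their limits by less than 1.\<close>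
    have pB: "eventually (\<lambda>t. prod_list (map p (ws t)) * p (\<delta> t) \<le> (B + 1) ^ Suc m) (at 0)"
    proof -
      have "eventually (\<lambda>t. \<forall>i\<in>{..<m}. p (ws t ! i - w0 ! i) < 1) (at 0)"
    by (rule eventually_ball_less_1) (rule wlim)
      moreover have "eventually (\<lambda>t. p (\<delta> t - d) < 1) (at 0)" using \<delta>lim by (rule order_tendstoD) simp
      ultimately show ?thesis using ws(2) \<delta>E
      proof eventually_elim
        case (elim t)
        have le: "p x \<le> B + 1" if "x \<in> points E" "y \<in> points E" "p (x - y) < 1" "p y \<le> B" for x y
          using E.seminorm_add[OF g(1), of "x - y" y] that by simp
        have "0 \<le> p x \<and> p x \<le> B + 1" if x: "x \<in> set (ws t)" for x
        proof -
          obtain i where i: "i < m" "x = ws t ! i" using x ws(1) by (metis in_set_conv_nth)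
          have "x \<in> points E" "w0 ! i \<in> points E" using x elim w0 i nth_mem[of i w0] by auto
          then show ?thesis using le[of x "w0 ! i"] i elim B E.seminorm_nonneg[OF g(1)] by auto
        qed
        then have 1: "prod_list (map p (ws t)) \<le> (B + 1) ^ m" "0 \<le> prod_list (map p (ws t))"
          using prod_list_le_power[of "ws t" p "B + 1"] ws(1) by (auto intro: prod_list_nonneg)
        have 2: "p (\<delta> t) \<le> B + 1" "0 \<le> p (\<delta> t)" using le[of "\<delta> t" d] elim d B E.seminorm_nonneg[OF g(1)] by auto
        have "prod_list (map p (ws t)) * p (\<delta> t) \<le> (B + 1) ^ m * (B + 1)"
          using 1 2 B by (intro mult_mono) auto
        then show ?case by (simp add: mult.commute)
      qed
    qed
    have t\<delta>: "filterlim (\<lambda>t. scl E t (\<delta> t)) (zero_filter E) (at 0)"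
      unfolding E.filterlim_zero_filter
    proof (intro conjI allI impI)
      show "eventually (\<lambda>t. scl E t (\<delta> t) \<in> points E) (at 0)" using \<delta>E by eventually_elim auto
      fix q assume q: "cont_seminorm E q"
      have "((\<lambda>t. q (\<delta> t - d)) \<longlongrightarrow> 0) (at 0)" using \<delta> q by (simp add: E.limitin_iff)
      then have "((\<lambda>t. norm t * (q (\<delta> t - d) + q d)) \<longlongrightarrow> norm (0::'k) * (0 + q d)) (at 0)"
        by (intro tendsto_intros)
      then have l0: "((\<lambda>t. norm t * (q (\<delta> t - d) + q d)) \<longlongrightarrow> 0) (at 0)" by simp
      have 1: "eventually (\<lambda>t. 0 \<le> q (scl E t (\<delta> t))) (at 0)"
        using \<delta>E by eventually_elim (auto intro: E.seminorm_nonneg[OF q])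
      have 2: "eventually (\<lambda>t. q (scl E t (\<delta> t)) \<le> norm t * (q (\<delta> t - d) + q d)) (at 0)"
        using \<delta>E
      proof eventually_elim
        case (elim t)
        have "q (\<delta> t) \<le> q (\<delta> t - d) + q d" using E.seminorm_add[OF q, of "\<delta> t - d" d] elim d by simp
        then show ?case using E.seminorm_scale[OF q elim, of t] by (simp add: mult_left_mono)
      qed
      show "((\<lambda>t. q (scl E t (\<delta> t))) \<longlongrightarrow> 0) (at 0)"
        by (rule tendsto_sandwich[OF 1 2 tendsto_const l0])
    qed
    have in1: "eventually (\<lambda>t. ?T1 t \<in> points G) (at 0)"
    proof -
      have "eventually (\<lambda>t. z + scl E t (\<delta> t) \<in> D) (at 0)"
        using t\<delta> E.eventually_zero_filter_add[OF o z] unfolding filterlim_iff by blast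
      then show ?thesis using ws(2) \<delta>E
      proof eventually_elim
        case (elim t)
        have sl: "slot_linear E G m (\<lambda>us. \<Phi> us (z + scl E t (\<delta> t)))"
          using C[OF elim(1)] km unfolding Ck_norm_at_def by blast
        have "\<Phi> (ws t) (z + scl E t (\<delta> t)) \<in> points G" "\<Phi> (ws t) z \<in> points G" "\<Phi> (ws t @ [\<delta> t]) z \<in> points G"
          using elim ws(1)[of t] slot_linearD(1)[OF sl] slot_linearD(1)[OF slm(1)] slot_linearD(1)[OF slm(2)] by auto
        then show ?case by auto
      qed
    qed
    have "((\<lambda>t. N (?T1 t)) \<longlongrightarrow> 0) (at 0)"
    proof (rule tendstoI)
      fix e :: real assume e: "e > 0"
      \<comment> \<open>The arguments contribute at most \<open>(B + 1) ^ Suc m\<close>, so this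
        \<epsilon> leads to the final bound \<open>e / 2\<close>.\<close>
      define \<epsilon> where "\<epsilon> = e / (2 * (B + 1) ^ Suc m)"
      have eps: "\<epsilon> > 0" "\<epsilon> * (B + 1) ^ Suc m = e / 2" using e B(1) by (simp_all add: \<epsilon>_def)
      have "eventually (\<lambda>v. z + v \<in> D \<and> mbound (points E) p N (Suc m) \<epsilon> (\<lambda>us. \<Phi> us (z + v) - \<Phi> us z)) (zero_filter E)"
        using E.eventually_zero_filter_add[OF o z] g(4)[of "Suc m" \<epsilon>] eps(1) by (auto intro: eventually_conj)
      then obtain q where q: "cont_seminorm E q" "\<And>v. v \<in> points E \<Longrightarrow> q v < 1 \<Longrightarrow> z + v \<in> D"
        "\<And>v. v \<in> points E \<Longrightarrow> q v < 1 \<Longrightarrow> mbound (points E) p N (Suc m) \<epsilon> (\<lambda>us. \<Phi> us (z + v) - \<Phi> us z)"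
        unfolding E.eventually_zero_filter by blast
      have q1: "eventually (\<lambda>t. q (scl E t (\<delta> t)) < 1) (at 0)"
        using t\<delta> q(1) unfolding E.filterlim_zero_filter by (auto intro: order_tendstoD)
      show "eventually (\<lambda>t. dist (N (?T1 t)) 0 < e) (at 0)"
        using q1 pB ws(2) \<delta>E nz in1
      proof eventually_elim
        case (elim t)
        let ?v = "scl E t (\<delta> t)"
        have v: "?v \<in> points E" using elim by auto
        have sv: "scl E (of_real s) ?v \<in> points E" "q (scl E (of_real s) ?v) < 1" if "0 \<le> s" "s \<le> 1" for s
        proof -
          show "scl E (of_real s) ?v \<in> points E" using v by (rule E.points_closed)
          have "q (scl E (of_real s) ?v) = s * q ?v" by (rule E.seminorm_scale_real[OF q(1) v \<open>0 \<le> s\<close>])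
          also have "\<dots> \<le> 1 * q ?v" using that E.seminorm_nonneg[OF q(1) v] by (intro mult_right_mono) auto
          finally show "q (scl E (of_real s) ?v) < 1" using elim by simp
        qed
        let ?c = "\<Phi> (ws t @ [?v]) z"
        let ?P = "prod_list (map p (ws t)) * p ?v"
        have c: "?c \<in> points G" using elim ws(1)[of t] v by (intro slot_linearD(1)[OF slm(2)]) auto
        \<comment> \<open>The increment is \<open>?v = t \<delta>(t)\<close>. Its seminorm
          contributes the factor \<open>norm t\<close>, which cancels the division by
          \<open>t\<close>.\<close>
        have "N (\<Phi> (ws t) (z + ?v) - \<Phi> (ws t) z - ?c) \<le> \<epsilon> * ?P"
        proof (rule mean_value[where k = k])
          fix s :: real assume s: "0 \<le> s" "s \<le> 1"
          show "Ck_norm_at k \<Phi> (z + scl E (of_real s) ?v)" using q(2)[OF sv[OF s]] by (rule C)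
          have "N (\<Phi> (ws t @ [?v]) (z + scl E (of_real s) ?v) - \<Phi> (ws t @ [?v]) z) \<le>
              \<epsilon> * prod_list (map p (ws t @ [?v]))"
            using elim ws(1)[of t] v by (intro mboundD[OF q(3)[OF sv[OF s]]]) auto
          then show "N (\<Phi> (ws t @ [?v]) (z + scl E (of_real s) ?v) - ?c) \<le> \<epsilon> * ?P" by simp
        qed (use v c elim ws(1)[of t] k in auto)
        moreover have "?T1 t = scl G (inverse t) (\<Phi> (ws t) (z + ?v) - \<Phi> (ws t) z - ?c)"
        proof -
          have "?c = scl G t (\<Phi> (ws t @ [\<delta> t]) z)"
            using slot_scale[OF slm(2), of "ws t" "[]" "\<delta> t" t] elim ws(1)[of t] by simp
          then show ?thesis using elim by (simp add: scale_right_diff_distrib)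
        qed
        moreover have "\<Phi> (ws t) (z + ?v) - \<Phi> (ws t) z - ?c \<in> points G"
        proof -
          have "slot_linear E G m (\<lambda>us. \<Phi> us (z + ?v))"
            using C[of "z + ?v"] q(2)[of ?v] v elim km unfolding Ck_norm_at_def by blast
          then have "\<Phi> (ws t) (z + ?v) \<in> points G" using elim ws(1)[of t] by (intro slot_linearD(1)) auto
          moreover have "\<Phi> (ws t) z \<in> points G" using elim ws(1)[of t] by (intro slot_linearD(1)[OF slm(1)]) auto
          ultimately show ?thesis using c by auto
        qed
        ultimately have "N (?T1 t) \<le> norm (inverse t) * (\<epsilon> * ?P)"
          using N_scale by (simp add: mult_left_mono)
        also have "?P = norm t * (prod_list (map p (ws t)) * p (\<delta> t))"
          using E.seminorm_scale[OF g(1), of "\<delta> t" t] elim by simp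
        also have "norm (inverse t) * (\<epsilon> * \<dots>) = \<epsilon> * (prod_list (map p (ws t)) * p (\<delta> t))"
          using elim by (simp add: norm_inverse)
        also have "\<dots> \<le> \<epsilon> * (B + 1) ^ Suc m" using elim eps(1) by (intro mult_left_mono) auto
        finally have "N (?T1 t) < e" using eps e by simp
        then show ?case using N_nonneg elim by simp
      qed
    qed
    then show ?thesis using in1 by (simp add: limitin_N)
  qed
  have "limitin (topo G) (\<lambda>t. ?T1 t + ?T2 t + (\<Sum>i<m. ?T3 i t))
      (0 + \<Phi> (w0 @ [d]) z + (\<Sum>i<m. \<Phi> (w0[i := w' i]) z)) (at 0)"
    by (intro limitin_add limitin_sum lim1 lim2 lim3) simp
  then have all: "limitin (topo G) (\<lambda>t. ?T1 t + ?T2 t + (\<Sum>i<m. ?T3 i t))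
      (\<Phi> (w0 @ [d]) z + (\<Sum>i<m. \<Phi> (w0[i := w' i]) z)) (at 0)" by simp
  have eq: "eventually (\<lambda>t. ?T1 t + ?T2 t + (\<Sum>i<m. ?T3 i t) =
      scl G (inverse t) (\<Phi> (ws t) (z + scl E t (\<delta> t)) - \<Phi> w0 z)) (at 0)"
    using ws(2)
  proof eventually_elim
    case (elim t)
    have "scl G (inverse t) (\<Phi> (ws t) z - \<Phi> w0 z) =
        scl G (inverse t) (\<Sum>i<m. \<Phi> (take i w0 @ (ws t ! i - w0 ! i) # drop (Suc i) (ws t)) z)"
      by (subst telescope[OF slm(1) elim ws(1) w0]) simp
    also have "\<dots> = (\<Sum>i<m. ?T3 i t)"
      unfolding scale_sum_right
    proof (rule sum.cong[OF refl])
      fix i assume "i \<in> {..<m}"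
      then have i: "i < m" by simp
      have "ws t ! i \<in> points E" "w0 ! i \<in> points E" using elim ws(1)[of t] w0 i nth_mem[of i "ws t"] nth_mem[of i w0] by auto
      then show "scl G (inverse t) (\<Phi> (take i w0 @ (ws t ! i - w0 ! i) # drop (Suc i) (ws t)) z) = ?T3 i t"
        using elim ws(1)[of t] w0 i set_take_subset[of i w0] set_drop_subset[of "Suc i" "ws t"]
        by (intro slot_scale[OF slm(1), symmetric]) auto
    qed
    finally show ?case by (simp add: scale_right_diff_distrib algebra_simps)
  qed
  show ?thesis by (rule limitin_transform_eventually[OF eq all])
qed

end

section \<open>Products\<close>

lemma points_prod: "points (E \<times>\<^sub>t G) = points E \<times> points G"
  by (simp add: tvs_prod_def)

lemma topo_prod: "topo (E \<times>\<^sub>t G) = prod_topology (topo E) (topo G)"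
  by (simp add: tvs_prod_def)

lemma scl_prod: "scl (E \<times>\<^sub>t G) c (x, y) = (scl E c x, scl G c y)"
  by (simp add: tvs_prod_def)

lemma seminorm_pullback:
  assumes "lcs E" "lcs G" and p: "cont_seminorm G p" and i: "cont_linear E G i"
  shows "cont_seminorm E (\<lambda>u. p (i u))"
proof -
  interpret E: lcs_space E by standard fact
  interpret G: lcs_space G by standard fact
  note lin = i[unfolded cont_linear_def linear_from_to_def]
  have iE: "i u \<in> points G" if "u \<in> points E" for u using lin that by blast
  obtain Q where Q: "openin (topo G) Q" "0 \<in> Q" "Q \<subseteq> {x \<in> points G. p x < 1}"
    using p by (auto simp: cont_seminorm_def zero_nbhd_def)
  have c: "continuous_map (topo E) (topo G) i" using lin by blast
  have i0: "i 0 = 0"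
  proof -
    have "i (0 + 0) = i 0 + i 0" using lin E.points_closed(1) by blast
    then show ?thesis by simp
  qed
  have "openin (topo E) {u \<in> points E. i u \<in> Q}" by (rule openin_continuous_map_preimage[OF c Q(1)])
  moreover have "{u \<in> points E. i u \<in> Q} \<subseteq> {u \<in> points E. p (i u) < 1}" using Q(3) by blast
  moreover have "0 \<in> {u \<in> points E. i u \<in> Q}" using Q(2) i0 by simp
  ultimately have "zero_nbhd E {u \<in> points E. p (i u) < 1}" unfolding zero_nbhd_def by blast
  then show ?thesis
    unfolding cont_seminorm_def using lin iE G.seminorm_nonneg[OF p] G.seminorm_add[OF p] G.seminorm_scale[OF p] by simp
qed

lemma cont_linear_inl: "lcs E \<Longrightarrow> lcs G \<Longrightarrow> cont_linear E (E \<times>\<^sub>t G) (\<lambda>u. (u, 0))"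
proof -
  assume "lcs E" "lcs G"
  then interpret E: lcs_space E + G: lcs_space G by unfold_locales
  show ?thesis
    unfolding cont_linear_def linear_from_to_def points_prod topo_prod
    by (auto simp: scl_prod intro!: continuous_map_pairedI)
qed

lemma cont_linear_inr: "lcs E \<Longrightarrow> lcs G \<Longrightarrow> cont_linear G (E \<times>\<^sub>t G) (\<lambda>v. (0, v))"
proof -
  assume "lcs E" "lcs G"
  then interpret E: lcs_space E + G: lcs_space G by unfold_locales
  show ?thesis
    unfolding cont_linear_def linear_from_to_def points_prod topo_prod
    by (auto simp: scl_prod intro!: continuous_map_pairedI)
qed

lemma seminorm_inl: "lcs E \<Longrightarrow> lcs G \<Longrightarrow> cont_seminorm (E \<times>\<^sub>t G) p \<Longrightarrow> cont_seminorm E (\<lambda>u. p (u, 0))"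
  by (rule seminorm_pullback[OF _ _ _ cont_linear_inl]) (auto intro: lcs_tvs_prod)

lemma seminorm_inr: "lcs E \<Longrightarrow> lcs G \<Longrightarrow> cont_seminorm (E \<times>\<^sub>t G) p \<Longrightarrow> cont_seminorm G (\<lambda>v. p (0, v))"
  by (rule seminorm_pullback[OF _ _ _ cont_linear_inr]) (auto intro: lcs_tvs_prod)

text \<open>Separates the coordinates: the first is measured by a seminorm of \<open>E\<close>; the
  second, for a Banachable factor, by its norm through \<open>seminorm_le_N\<close>.\<close>

lemma seminorm_pair_le:
  assumes "lcs E" "lcs G" "cont_seminorm (E \<times>\<^sub>t G) p" "u \<in> points E" "v \<in> points G"
  shows "p (u, v) \<le> p (u, 0) + p (0, v)"
proof -
  interpret E: lcs_space E by standard fact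
  interpret G: lcs_space G by standard fact
  interpret H: lcs_space "E \<times>\<^sub>t G" by standard (intro lcs_tvs_prod assms)
  show ?thesis using H.seminorm_add[OF assms(3), of "(u, 0)" "(0, v)"] assms(4,5) by (simp add: points_prod)
qed

section \<open>Differentiating an implicitly defined function\<close>

text \<open>Isolates what the differentiation of \<open>g\<close> uses: a continuous solution on
  \<open>U\<close> and invertibility of the partial derivative along its graph. The bound
  \<open>M\<close> on the inverses is uniform on \<open>U\<close>, which lets convergence be
  transferred from images to preimages while the base point moves. Outside \<open>U\<close> the
  function \<open>g\<close> is arbitrary.\<close>

locale implicit_map = E: lcs_space E + banach_tvs G N
  for E :: "('k::real_or_complex, 'e::ab_group_add) tvs"
    and G :: "('k, 'g::ab_group_add) tvs" and N +
  fixes D :: "('e \<times> 'g) set" and \<Phi> :: "('e \<times> 'g) list \<Rightarrow> 'e \<times> 'g \<Rightarrow> 'g"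
    and k :: enat and b :: 'g and U :: "'e set" and g :: "'e \<Rightarrow> 'g" and M :: real
  assumes D: "openin (topo (E \<times>\<^sub>t G)) D"
    and C: "z \<in> D \<Longrightarrow> to_banach.Ck_norm_at (E \<times>\<^sub>t G) G N k \<Phi> z"
    and k: "1 \<le> k"
    and U: "openin (topo E) U"
    and gD: "x \<in> U \<Longrightarrow> (x, g x) \<in> D"
    and g_cont: "x \<in> U \<Longrightarrow> limitin (topo G) (\<lambda>v. g (x + v)) (g x) (zero_filter E)"
    and g_sol: "x \<in> U \<Longrightarrow> \<Phi> [] (x, g x) = b"
    and M: "M > 0"
    and bij: "x \<in> U \<Longrightarrow> bij_betw (\<lambda>v. \<Phi> [(0, v)] (x, g x)) (points G) (points G)"
    and bound: "x \<in> U \<Longrightarrow> v \<in> points G \<Longrightarrow> N v \<le> M * N (\<Phi> [(0, v)] (x, g x))"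
begin

section \<open>Linear equations along the graph and their dependence on the base point\<close>

lemma lcs_prod: "lcs (E \<times>\<^sub>t G)"
  by (rule lcs_tvs_prod[OF E.lcs lcs])

sublocale H: to_banach "E \<times>\<^sub>t G" G N
  by unfold_locales (rule lcs_prod)

abbreviation h :: "'e \<Rightarrow> 'e \<times> 'g" where "h x \<equiv> (x, g x)"

lemma UE: "x \<in> U \<Longrightarrow> x \<in> points E"
  using U openin_subset by blast

lemma gG: "x \<in> U \<Longrightarrow> g x \<in> points G"
  using g_cont by (simp add: limitin_iff)

lemma slot: "x \<in> U \<Longrightarrow> enat m \<le> k \<Longrightarrow> slot_linear (E \<times>\<^sub>t G) G m (\<lambda>us. \<Phi> us (h x))"
  using C[OF gD] unfolding H.Ck_norm_at_def by blast

lemma k': "enat (Suc 0) \<le> k" "enat 0 \<le> k"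
  using k by (simp_all add: one_enat_def flip: zero_enat_def)

lemma Q_linear:
  assumes x: "x \<in> U"
  shows "linear_from_to G G (\<lambda>v. \<Phi> [(0, v)] (h x))"
proof -
  note sl = slot[OF x k'(1)]
  have "\<Phi> [(0, v + w)] (h x) = \<Phi> [(0, v)] (h x) + \<Phi> [(0, w)] (h x)" if "v \<in> points G" "w \<in> points G" for v w
    using H.slot_add[OF sl, of "[]" "[]" "(0, v)" "(0, w)"] that by (simp add: points_prod)
  moreover have "\<Phi> [(0, scl G c v)] (h x) = scl G c (\<Phi> [(0, v)] (h x))" if "v \<in> points G" for v c
    using H.slot_scale[OF sl, of "[]" "[]" "(0, v)" c] that by (simp add: points_prod scl_prod)
  moreover have "\<Phi> [(0, v)] (h x) \<in> points G" if "v \<in> points G" for v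
    using slot_linearD(1)[OF sl, of "[(0, v)]"] that by (simp add: points_prod)
  ultimately show ?thesis by (simp add: linear_from_to_def)
qed

lemma Q_in: "x \<in> U \<Longrightarrow> v \<in> points G \<Longrightarrow> \<Phi> [(0, v)] (h x) \<in> points G"
  using linear_from_toD(1)[OF Q_linear] .

text \<open>The unique solution \<open>w\<close> of \<open>\<partial>\<^sub>2f(x, g x) w = - d\<^sup>mf(x, g x)(ws)\<close>; all derivatives of \<open>g\<close> are
  sums of nested terms of this form.\<close>

definition solve :: "'e \<Rightarrow> ('e \<times> 'g) list \<Rightarrow> 'g" where
  "solve x ws = inv_into (points G) (\<lambda>v. \<Phi> [(0, v)] (h x)) (- \<Phi> ws (h x))"

lemma solve:
  assumes x: "x \<in> U" and ws: "set ws \<subseteq> points (E \<times>\<^sub>t G)" "enat (length ws) \<le> k"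
  shows "solve x ws \<in> points G" "\<Phi> [(0, solve x ws)] (h x) = - \<Phi> ws (h x)"
proof -
  have "- \<Phi> ws (h x) \<in> points G" using slot_linearD(1)[OF slot[OF x ws(2)] ws(1)] by auto
  then have "- \<Phi> ws (h x) \<in> (\<lambda>v. \<Phi> [(0, v)] (h x)) ` points G" using bij[OF x] by (simp add: bij_betw_def)
  then show "solve x ws \<in> points G" "\<Phi> [(0, solve x ws)] (h x) = - \<Phi> ws (h x)"
    unfolding solve_def by (auto intro: inv_into_into f_inv_into_f)
qed

lemma Q_inj: "x \<in> U \<Longrightarrow> v \<in> points G \<Longrightarrow> w \<in> points G \<Longrightarrow> \<Phi> [(0, v)] (h x) = \<Phi> [(0, w)] (h x) \<Longrightarrow> v = w"
  using bij by (auto simp: bij_betw_def inj_on_def)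

lemma solve_eqI:
  "x \<in> U \<Longrightarrow> set ws \<subseteq> points (E \<times>\<^sub>t G) \<Longrightarrow> enat (length ws) \<le> k \<Longrightarrow> w \<in> points G \<Longrightarrow>
    \<Phi> [(0, w)] (h x) = - \<Phi> ws (h x) \<Longrightarrow> solve x ws = w"
  using solve Q_inj by metis

text \<open>The right-hand side is linear in each slot, and injectivity of the partial derivative
  transfers this to the solution.\<close>

lemma solve_slot_linear:
  assumes x: "x \<in> U" and m: "enat m \<le> k"
  shows "slot_linear (E \<times>\<^sub>t G) G m (solve x)"
  unfolding slot_linear_def linear_from_to_def
proof (intro conjI allI impI ballI; (elim conjE)?)
  note sl = slot[OF x m]
  show "solve x us \<in> points G" if "set us \<subseteq> points (E \<times>\<^sub>t G)" "length us = m" for us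
    using solve(1)[OF x that(1)] that(2) m by simp
  fix as bs assume ab: "set as \<subseteq> points (E \<times>\<^sub>t G)" "set bs \<subseteq> points (E \<times>\<^sub>t G)" "length as + Suc (length bs) = m"
  have L: "set (as @ v # bs) \<subseteq> points (E \<times>\<^sub>t G)" "enat (length (as @ v # bs)) \<le> k" if "v \<in> points (E \<times>\<^sub>t G)" for v
    using ab that m by auto
  show "(\<lambda>v. solve x (as @ v # bs)) \<in> points (E \<times>\<^sub>t G) \<rightarrow> points G"
    using solve(1)[OF x L] by blast
  fix v assume v: "v \<in> points (E \<times>\<^sub>t G)"
  show "solve x (as @ (v + w) # bs) = solve x (as @ v # bs) + solve x (as @ w # bs)" if w: "w \<in> points (E \<times>\<^sub>t G)" for w
  proof (rule solve_eqI[OF x])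
    have vw: "v + w \<in> points (E \<times>\<^sub>t G)" using v w by (rule H.E.points_closed)
    show "set (as @ (v + w) # bs) \<subseteq> points (E \<times>\<^sub>t G)" "enat (length (as @ (v + w) # bs)) \<le> k" using L[OF vw] .
    note ov = solve[OF x L[OF v]] and ow = solve[OF x L[OF w]]
    show "solve x (as @ v # bs) + solve x (as @ w # bs) \<in> points G" using ov ow by auto
    have "\<Phi> [(0, solve x (as @ v # bs) + solve x (as @ w # bs))] (h x) = - (\<Phi> (as @ v # bs) (h x) + \<Phi> (as @ w # bs) (h x))"
      using linear_from_toD(2)[OF Q_linear[OF x] ov(1) ow(1)] ov ow by simp
    also have "\<Phi> (as @ v # bs) (h x) + \<Phi> (as @ w # bs) (h x) = \<Phi> (as @ (v + w) # bs) (h x)"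
      using H.slot_add[OF sl ab v w] by simp
    finally show "\<Phi> [(0, solve x (as @ v # bs) + solve x (as @ w # bs))] (h x) = - \<Phi> (as @ (v + w) # bs) (h x)" .
  qed
next
  note sl = slot[OF x m]
  fix as bs c v assume ab: "set as \<subseteq> points (E \<times>\<^sub>t G)" "set bs \<subseteq> points (E \<times>\<^sub>t G)" "length as + Suc (length bs) = m"
    and v: "v \<in> points (E \<times>\<^sub>t G)"
  have L: "set (as @ v # bs) \<subseteq> points (E \<times>\<^sub>t G)" "enat (length (as @ v # bs)) \<le> k" if "v \<in> points (E \<times>\<^sub>t G)" for v
    using ab that m by auto
  have cv: "scl (E \<times>\<^sub>t G) c v \<in> points (E \<times>\<^sub>t G)" using v by (rule H.E.points_closed)
  note ov = solve[OF x L[OF v]]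
  show "solve x (as @ scl (E \<times>\<^sub>t G) c v # bs) = scl G c (solve x (as @ v # bs))"
  proof (rule solve_eqI[OF x L[OF cv]])
    show "scl G c (solve x (as @ v # bs)) \<in> points G" using ov by auto
    show "\<Phi> [(0, scl G c (solve x (as @ v # bs)))] (h x) = - \<Phi> (as @ scl (E \<times>\<^sub>t G) c v # bs) (h x)"
      using linear_from_toD(3)[OF Q_linear[OF x] ov(1), of c] ov H.slot_scale[OF sl ab v, of c] by simp
  qed
qed

text \<open>Continuity of \<open>g\<close> in the form that lets Keller's condition for
  \<open>f\<close> at \<open>h x\<close> be evaluated along the graph.\<close>

lemma filterlim_graph:
  assumes x: "x \<in> U" and y: "filterlim y (zero_filter E) \<F>"
  shows "filterlim (\<lambda>a. (y a, g (x + y a) - g x)) (zero_filter (E \<times>\<^sub>t G)) \<F>"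
  unfolding H.E.filterlim_zero_filter
proof (intro conjI allI impI)
  note y' = y[unfolded E.filterlim_zero_filter]
  have gl: "limitin (topo G) (\<lambda>a. g (x + y a)) (g x) \<F>"
    by (rule limitin_compose_filterlim[OF g_cont[OF x] y])
  note gl' = gl[unfolded limitin_N]
  have ev: "eventually (\<lambda>a. y a \<in> points E \<and> g (x + y a) - g x \<in> points G) \<F>"
    using y' gl' by (auto elim: eventually_elim2)
  then show "eventually (\<lambda>a. (y a, g (x + y a) - g x) \<in> points (E \<times>\<^sub>t G)) \<F>"
    by (simp add: points_prod)
  fix p assume p: "cont_seminorm (E \<times>\<^sub>t G) p"
  have "cont_seminorm E (\<lambda>u. p (u, 0))" "cont_seminorm G (\<lambda>v. p (0, v))"
    using seminorm_inl[OF E.lcs lcs p] seminorm_inr[OF E.lcs lcs p] .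
  then have "((\<lambda>a. p (y a, 0) + p (0, g (x + y a) - g x)) \<longlongrightarrow> 0 + 0) \<F>"
    using y' gl[unfolded limitin_iff] by (intro tendsto_add) auto
  then have l: "((\<lambda>a. p (y a, 0) + p (0, g (x + y a) - g x)) \<longlongrightarrow> 0) \<F>" by simp
  have 1: "eventually (\<lambda>a. 0 \<le> p (y a, g (x + y a) - g x)) \<F>"
    using ev by eventually_elim (use H.E.seminorm_nonneg[OF p] in \<open>auto simp: points_prod\<close>)
  have 2: "eventually (\<lambda>a. p (y a, g (x + y a) - g x) \<le> p (y a, 0) + p (0, g (x + y a) - g x)) \<F>"
    using ev by eventually_elim (use seminorm_pair_le[OF E.lcs lcs p] in auto)
  show "((\<lambda>a. p (y a, g (x + y a) - g x)) \<longlongrightarrow> 0) \<F>"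
    by (rule tendsto_sandwich[OF 1 2 tendsto_const l])
qed

text \<open>Continuity of inversion in terms of vectors: \<open>w - w0\<close> is bounded by
  \<open>M\<close> times its image under the moved operator, and this image differs from the
  quantity assumed to tend to 0 only by the change of the operator on the bounded family
  \<open>w0\<close>, which Keller's condition makes small.\<close>

lemma solution_tendsto:
  assumes x: "x \<in> U" and y: "filterlim y (zero_filter E) \<F>"
    and p: "H.Keller_seminorm \<Phi> (h x) L p" "1 \<le> L"
    and w: "eventually (\<lambda>a. w a \<in> points G \<and> w0 a \<in> points G \<and> N (w0 a) \<le> B) \<F>"
    and lim: "((\<lambda>a. N (\<Phi> [(0, w a)] (h (x + y a)) - \<Phi> [(0, w0 a)] (h x))) \<longlongrightarrow> 0) \<F>"
  shows "((\<lambda>a. N (w a - w0 a)) \<longlongrightarrow> 0) \<F>"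
proof -
  have "cont_seminorm G (\<lambda>v. p (0, v))" by (rule seminorm_inr[OF E.lcs lcs H.Keller_seminormD(1)[OF p(1)]])
  then obtain c where c: "c > 0" "\<And>v. v \<in> points G \<Longrightarrow> p (0, v) \<le> c * N v" using seminorm_le_N by metis
  let ?d = "\<lambda>a. (y a, g (x + y a) - g x)"
  have hd: "h x + ?d a = h (x + y a)" for a by simp
  have xU: "eventually (\<lambda>a. x + y a \<in> U) \<F>"
    using y E.eventually_zero_filter_add[OF U x] unfolding filterlim_iff by blast
  have "((\<lambda>a. N (\<Phi> [(0, w0 a)] (h x + ?d a) - \<Phi> [(0, w0 a)] (h x))) \<longlongrightarrow> 0) \<F>"
  proof (rule H.Keller_seminorm_tendsto[OF p(1) p(2) filterlim_graph[OF x y]])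
    show "eventually (\<lambda>a. slot_linear (E \<times>\<^sub>t G) G 1 (\<lambda>us. \<Phi> us (h x + ?d a))) \<F>"
      unfolding hd using xU by eventually_elim (use slot k' in auto)
    show "eventually (\<lambda>a. set [(0, w0 a)] \<subseteq> points (E \<times>\<^sub>t G) \<and> length [(0, w0 a)] = 1 \<and>
        set [(0, w0 a)] \<subseteq> points (E \<times>\<^sub>t G) \<and> length [(0, w0 a)] = 1 \<and> (\<forall>i<1. p ([(0, w0 a)] ! i) \<le> c * B)) \<F>"
      using w
    proof eventually_elim
      case (elim a)
      then have "p (0, w0 a) \<le> c * N (w0 a)" "c * N (w0 a) \<le> c * B" using c by auto
      then show ?case using elim by (auto simp: points_prod)
    qed
    show "((\<lambda>a. p ([(0, w0 a)] ! i - [(0, w0 a)] ! i)) \<longlongrightarrow> 0) \<F>" for i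
      using H.E.seminorm_zero[OF H.Keller_seminormD(1)[OF p(1)]] by simp
  qed
  then have l2: "((\<lambda>a. N (\<Phi> [(0, w0 a)] (h (x + y a)) - \<Phi> [(0, w0 a)] (h x))) \<longlongrightarrow> 0) \<F>" unfolding hd .
  have "((\<lambda>a. M * (N (\<Phi> [(0, w a)] (h (x + y a)) - \<Phi> [(0, w0 a)] (h x)) +
      N (\<Phi> [(0, w0 a)] (h (x + y a)) - \<Phi> [(0, w0 a)] (h x)))) \<longlongrightarrow> M * (0 + 0)) \<F>"
    by (intro tendsto_intros lim l2)
  then have l: "((\<lambda>a. M * (N (\<Phi> [(0, w a)] (h (x + y a)) - \<Phi> [(0, w0 a)] (h x)) +
      N (\<Phi> [(0, w0 a)] (h (x + y a)) - \<Phi> [(0, w0 a)] (h x)))) \<longlongrightarrow> 0) \<F>" by simp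
  have 1: "eventually (\<lambda>a. 0 \<le> N (w a - w0 a)) \<F>" using w by eventually_elim (auto intro!: N_nonneg)
  have 2: "eventually (\<lambda>a. N (w a - w0 a) \<le> M * (N (\<Phi> [(0, w a)] (h (x + y a)) - \<Phi> [(0, w0 a)] (h x)) +
      N (\<Phi> [(0, w0 a)] (h (x + y a)) - \<Phi> [(0, w0 a)] (h x)))) \<F>"
    using w xU
  proof eventually_elim
    case (elim a)
    have pts: "\<Phi> [(0, w a)] (h (x + y a)) \<in> points G" "\<Phi> [(0, w0 a)] (h (x + y a)) \<in> points G"
      "\<Phi> [(0, w0 a)] (h x) \<in> points G" using elim x by (auto intro: Q_in)
    have "N (w a - w0 a) \<le> M * N (\<Phi> [(0, w a - w0 a)] (h (x + y a)))"
      using elim by (intro bound) auto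
    also have "\<Phi> [(0, w a - w0 a)] (h (x + y a)) = \<Phi> [(0, w a)] (h (x + y a)) - \<Phi> [(0, w0 a)] (h (x + y a))"
      using elim by (intro linear_diff(1)[OF lcs Q_linear]) auto
    also have "M * N \<dots> \<le> M * (N (\<Phi> [(0, w a)] (h (x + y a)) - \<Phi> [(0, w0 a)] (h x)) +
      N (\<Phi> [(0, w0 a)] (h x) - \<Phi> [(0, w0 a)] (h (x + y a))))"
      using M pts by (intro mult_left_mono N_triangle) auto
    finally show ?case using N_diff_commute[OF pts(2,3)] by simp
  qed
  show ?thesis by (rule tendsto_sandwich[OF 1 2 tendsto_const l])
qed

text \<open>Joint continuity of \<open>solve\<close> in base point and arguments. The reference
  arguments stay in a \<open>p\<close>-bounded set but may vary, which makes the statement uniform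
  over families of directions.\<close>

lemma solve_tendsto:
  assumes x: "x \<in> U" and y: "filterlim y (zero_filter E) \<F>"
    and p: "H.Keller_seminorm \<Phi> (h x) L p" "1 \<le> L" "m \<le> L" "enat L \<le> k"
    and ws: "eventually (\<lambda>a. set (ws a) \<subseteq> points (E \<times>\<^sub>t G) \<and> length (ws a) = m \<and>
        set (vs a) \<subseteq> points (E \<times>\<^sub>t G) \<and> length (vs a) = m \<and> (\<forall>i<m. p (vs a ! i) \<le> B)) \<F>"
    and lim: "\<And>i. i < m \<Longrightarrow> ((\<lambda>a. p (ws a ! i - vs a ! i)) \<longlongrightarrow> 0) \<F>"
  shows "((\<lambda>a. N (solve (x + y a) (ws a) - solve x (vs a))) \<longlongrightarrow> 0) \<F>"
proof -
  let ?d = "\<lambda>a. (y a, g (x + y a) - g x)"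
  have hd: "h x + ?d a = h (x + y a)" for a by simp
  have km: "enat m \<le> k" using p(3,4) by (meson enat_ord_simps(1) order_trans)
  have xU: "eventually (\<lambda>a. x + y a \<in> U) \<F>"
    using y E.eventually_zero_filter_add[OF U x] unfolding filterlim_iff by blast
  have "((\<lambda>a. N (\<Phi> (ws a) (h x + ?d a) - \<Phi> (vs a) (h x))) \<longlongrightarrow> 0) \<F>"
  proof (rule H.Keller_seminorm_tendsto[OF p(1) p(3) filterlim_graph[OF x y] _ ws lim])
    show "eventually (\<lambda>a. slot_linear (E \<times>\<^sub>t G) G m (\<lambda>us. \<Phi> us (h x + ?d a))) \<F>"
      unfolding hd using xU by eventually_elim (use slot km in auto)
  qed
  then have l: "((\<lambda>a. N (\<Phi> (ws a) (h (x + y a)) - \<Phi> (vs a) (h x))) \<longlongrightarrow> 0) \<F>" unfolding hd .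
  obtain B' where B': "\<And>us. set us \<subseteq> points (E \<times>\<^sub>t G) \<Longrightarrow> length us = m \<Longrightarrow> (\<And>i. i < m \<Longrightarrow> p (us ! i) \<le> B) \<Longrightarrow>
    N (\<Phi> us (h x)) \<le> B'" using H.Keller_seminorm_bounded[OF p(1,3)] by metis
  show ?thesis
  proof (rule solution_tendsto[OF x y p(1,2)])
    show "eventually (\<lambda>a. solve (x + y a) (ws a) \<in> points G \<and> solve x (vs a) \<in> points G \<and> N (solve x (vs a)) \<le> M * B') \<F>"
      using ws xU
    proof eventually_elim
      case (elim a)
      have o: "solve (x + y a) (ws a) \<in> points G" "solve x (vs a) \<in> points G"
        using elim x km by (auto intro!: solve(1))
      have "N (solve x (vs a)) \<le> M * N (- \<Phi> (vs a) (h x))"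
        using bound[OF x o(2)] solve(2)[OF x, of "vs a"] elim km by simp
      also have "N (- \<Phi> (vs a) (h x)) = N (\<Phi> (vs a) (h x))"
        using elim slot_linearD(1)[OF slot[OF x km]] by (intro N_minus) auto
      also have "M * \<dots> \<le> M * B'" using elim M by (intro mult_left_mono B') auto
      finally show ?case using o by simp
    qed
    have ev: "eventually (\<lambda>a. N (\<Phi> (ws a) (h (x + y a)) - \<Phi> (vs a) (h x)) =
       N (\<Phi> [(0, solve (x + y a) (ws a))] (h (x + y a)) - \<Phi> [(0, solve x (vs a))] (h x))) \<F>"
      using ws xU
    proof eventually_elim
      case (elim a)
      have pts: "\<Phi> (ws a) (h (x + y a)) \<in> points G" "\<Phi> (vs a) (h x) \<in> points G"
        using elim slot_linearD(1)[OF slot[OF x km]] slot_linearD(1)[OF slot[OF elim(2) km]] by auto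
      have "\<Phi> [(0, solve (x + y a) (ws a))] (h (x + y a)) = - \<Phi> (ws a) (h (x + y a))"
        "\<Phi> [(0, solve x (vs a))] (h x) = - \<Phi> (vs a) (h x)"
        using elim x km by (auto intro!: solve(2))
      then show ?case using N_diff_commute[OF pts] by simp
    qed
    show "((\<lambda>a. N (\<Phi> [(0, solve (x + y a) (ws a))] (h (x + y a)) - \<Phi> [(0, solve x (vs a))] (h x))) \<longlongrightarrow> 0) \<F>"
      by (rule Lim_transform_eventually[OF l ev])
  qed
qed

text \<open>\<open>f\<close> is constant along the graph, so linearizing \<open>f\<close> at
  \<open>h x\<close> along the secant leaves an error of size \<epsilon> times the seminorm of the
  secant. This seminorm contains the quotient of \<open>g\<close> itself, whose boundedness is not
  known beforehand; its contribution is absorbed into the left-hand side.\<close>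

lemma g_deriv:
  assumes x: "x \<in> U" and u: "u \<in> points E"
  shows "limitin (topo G) (\<lambda>t. scl G (inverse t) (g (x + scl E t u) - g x)) (solve x [(u, 0)]) (at 0)"
proof -
  define w where "w = solve x [(u, 0)]"
  have u0: "set [(u, 0)] \<subseteq> points (E \<times>\<^sub>t G)" "enat (length [(u, 0)]) \<le> k"
    using u k' by (auto simp: points_prod)
  have w: "w \<in> points G" "\<Phi> [(0, w)] (h x) = - \<Phi> [(u, 0)] (h x)"
    using solve[OF x u0] by (simp_all add: w_def)
  obtain p where p: "H.Keller_seminorm \<Phi> (h x) (Suc 0) p" using H.Keller_seminorm_exists[OF C[OF gD[OF x]] k'(1)] .
  note ks = H.Keller_seminormD[OF p]
  have sl: "slot_linear (E \<times>\<^sub>t G) G (Suc 0) (\<lambda>us. \<Phi> us (h x))" using ks(2) by simp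
  have "cont_seminorm G (\<lambda>v. p (0, v))" by (rule seminorm_inr[OF E.lcs lcs ks(1)])
  then obtain c where c: "c > 0" "\<And>v. v \<in> points G \<Longrightarrow> p (0, v) \<le> c * N v" using seminorm_le_N by metis
  have xt: "filterlim (\<lambda>t. scl E t u) (zero_filter E) (at 0)" by (rule E.filterlim_scale_zero_filter[OF u])
  have xU: "eventually (\<lambda>t. x + scl E t u \<in> U) (at 0)" by (rule E.eventually_at_line[OF U x u])
  have nz: "eventually (\<lambda>t::'k. t \<noteq> 0) (at 0)" by (simp add: eventually_at_filter)
  let ?\<eta> = "\<lambda>t. scl G (inverse t) (g (x + scl E t u) - g x)"
  let ?v = "\<lambda>t. (scl E t u, g (x + scl E t u) - g x)"
  have ev: "eventually (\<lambda>t. ?\<eta> t \<in> points G) (at 0)"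
    using xU by eventually_elim (use gG x in auto)
  have "((\<lambda>t. N (?\<eta> t - w)) \<longlongrightarrow> 0) (at 0)"
  proof (rule tendstoI)
    fix e :: real assume e: "e > 0"
    define R where "R = p (u, 0) + c * N w + 1"
    have R: "R > 0" using H.E.seminorm_nonneg[OF ks(1), of "(u, 0)"] u c(1) N_nonneg[OF w(1)]
      by (auto simp: R_def points_prod intro!: add_nonneg_pos add_nonneg_nonneg)
    \<comment> \<open>The first bound allows \<open>M * \<epsilon> * c * N (?\<eta> t - w)\<close>
      to be absorbed with factor \<open>1 / 2\<close>; the second keeps the remaining terms,
      collected in \<open>R\<close>, below \<open>e / 4\<close>. The 1 in \<open>R\<close> makes it
      positive.\<close>
    define \<epsilon> where "\<epsilon> = min (1 / (2 * M * c)) (e / (4 * M * R))"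
    have eps: "\<epsilon> > 0" "M * \<epsilon> * c \<le> 1 / 2" "M * \<epsilon> * R \<le> e / 4"
    proof -
      show "\<epsilon> > 0" using M c e R by (simp add: \<epsilon>_def)
      have "M * \<epsilon> * c \<le> M * (1 / (2 * M * c)) * c" unfolding \<epsilon>_def using M c by (intro mult_right_mono mult_left_mono) auto
      then show "M * \<epsilon> * c \<le> 1 / 2" using M c by simp
      have "M * \<epsilon> * R \<le> M * (e / (4 * M * R)) * R" unfolding \<epsilon>_def using M R by (intro mult_right_mono mult_left_mono) auto
      then show "M * \<epsilon> * R \<le> e / 4" using M R by simp
    qed
    have "eventually (\<lambda>v. h x + v \<in> D \<and> mbound (points (E \<times>\<^sub>t G)) p N (Suc 0) \<epsilon> (\<lambda>us. \<Phi> us (h x + v) - \<Phi> us (h x)))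
        (zero_filter (E \<times>\<^sub>t G))"
      using H.E.eventually_zero_filter_add[OF D gD[OF x]] ks(4)[of "Suc 0" \<epsilon>] eps(1) by (auto intro: eventually_conj)
    then obtain q where q: "cont_seminorm (E \<times>\<^sub>t G) q" "\<And>v. v \<in> points (E \<times>\<^sub>t G) \<Longrightarrow> q v < 1 \<Longrightarrow> h x + v \<in> D"
      "\<And>v. v \<in> points (E \<times>\<^sub>t G) \<Longrightarrow> q v < 1 \<Longrightarrow>
         mbound (points (E \<times>\<^sub>t G)) p N (Suc 0) \<epsilon> (\<lambda>us. \<Phi> us (h x + v) - \<Phi> us (h x))"
      unfolding H.E.eventually_zero_filter by blast
    have q1: "eventually (\<lambda>t. ?v t \<in> points (E \<times>\<^sub>t G) \<and> q (?v t) < 1) (at 0)"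
      using filterlim_graph[OF x xt] q(1) unfolding H.E.filterlim_zero_filter
      by (auto intro!: eventually_conj order_tendstoD)
    show "eventually (\<lambda>t. dist (N (?\<eta> t - w)) 0 < e) (at 0)"
      using q1 xU nz ev
    proof eventually_elim
      case (elim t)
      let ?d = "?v t"
      have v: "?d \<in> points (E \<times>\<^sub>t G)" using elim by blast
      have sv: "scl (E \<times>\<^sub>t G) (of_real s) ?d \<in> points (E \<times>\<^sub>t G)" "q (scl (E \<times>\<^sub>t G) (of_real s) ?d) < 1"
        if "0 \<le> s" "s \<le> 1" for s
      proof -
        show "scl (E \<times>\<^sub>t G) (of_real s) ?d \<in> points (E \<times>\<^sub>t G)" using v by (rule H.E.points_closed)
        have "q (scl (E \<times>\<^sub>t G) (of_real s) ?d) = s * q ?d" by (rule H.E.seminorm_scale_real[OF q(1) v \<open>0 \<le> s\<close>])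
        also have "\<dots> \<le> 1 * q ?d" using that H.E.seminorm_nonneg[OF q(1) v] by (intro mult_right_mono) auto
        finally show "q (scl (E \<times>\<^sub>t G) (of_real s) ?d) < 1" using elim by simp
      qed
      have c1: "\<Phi> [?d] (h x) \<in> points G" using v by (intro slot_linearD(1)[OF sl]) auto
      have "N (\<Phi> [] (h x + ?d) - \<Phi> [] (h x) - \<Phi> [?d] (h x)) \<le> \<epsilon> * p ?d"
      proof (rule H.mean_value[where k = k])
        fix s :: real assume s: "0 \<le> s" "s \<le> 1"
        show "H.Ck_norm_at k \<Phi> (h x + scl (E \<times>\<^sub>t G) (of_real s) ?d)" using q(2)[OF sv[OF s]] by (rule C)
        show "N (\<Phi> ([] @ [?d]) (h x + scl (E \<times>\<^sub>t G) (of_real s) ?d) - \<Phi> [?d] (h x)) \<le> \<epsilon> * p ?d"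
          using mboundD[OF q(3)[OF sv[OF s]], of "[?d]"] v by simp
      qed (use v c1 k' in auto)
      moreover have "h x + ?d = h (x + scl E t u)" by simp
      \<comment> \<open>Both endpoints of the secant lie on the solution set, so the values of
        \<open>f\<close> cancel.\<close>
      ultimately have "N (- \<Phi> [?d] (h x)) \<le> \<epsilon> * p ?d" using g_sol x elim by simp
      then have le: "N (\<Phi> [?d] (h x)) \<le> \<epsilon> * p ?d" using N_minus[OF c1] by simp
      let ?e = "(u, ?\<eta> t)"
      have e_in: "?e \<in> points (E \<times>\<^sub>t G)" using u elim by (simp add: points_prod)
      have de: "?d = scl (E \<times>\<^sub>t G) t ?e" using elim by (simp add: scl_prod)
      have "\<Phi> [?d] (h x) = scl G t (\<Phi> [?e] (h x))"
        using H.slot_scale[OF sl, of "[]" "[]" ?e t] e_in unfolding de by simp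
      moreover have e1: "\<Phi> [?e] (h x) \<in> points G" using e_in by (intro slot_linearD(1)[OF sl]) auto
      ultimately have "norm t * N (\<Phi> [?e] (h x)) \<le> \<epsilon> * (norm t * p ?e)"
        using le H.E.seminorm_scale[OF ks(1) e_in, of t] N_scale[OF e1, of t] unfolding de by simp
      then have le2: "N (\<Phi> [?e] (h x)) \<le> \<epsilon> * p ?e" using elim by (simp add: mult.left_commute)
      have "\<Phi> [?e] (h x) = \<Phi> [(u, 0)] (h x) + \<Phi> [(0, ?\<eta> t)] (h x)"
        using H.slot_add[OF sl, of "[]" "[]" "(u, 0)" "(0, ?\<eta> t)"] u elim by (simp add: points_prod)
      also have "\<dots> = \<Phi> [(0, ?\<eta> t)] (h x) - \<Phi> [(0, w)] (h x)" using w(2) by simp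
      also have "\<dots> = \<Phi> [(0, ?\<eta> t - w)] (h x)"
        using elim w by (intro linear_diff(1)[OF lcs Q_linear[OF x], symmetric]) auto
      finally have "N (?\<eta> t - w) \<le> M * N (\<Phi> [?e] (h x))"
        using bound[OF x, of "?\<eta> t - w"] elim w by simp
      also have "\<dots> \<le> M * (\<epsilon> * p ?e)" using le2 M by (intro mult_left_mono) auto
      also have "p ?e \<le> p (u, 0) + p (0, ?\<eta> t)" using u elim by (intro seminorm_pair_le[OF E.lcs lcs ks(1)]) auto
      also have "p (0, ?\<eta> t) \<le> c * N (?\<eta> t)" using elim by (intro c(2)) auto
      also have "N (?\<eta> t) \<le> N w + N (?\<eta> t - w)" using elim w by (intro N_le_add_diff) auto
      finally have "N (?\<eta> t - w) \<le> M * (\<epsilon> * (p (u, 0) + c * (N w + N (?\<eta> t - w))))"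
        using M eps(1) c(1) by (simp add: mult_left_mono)
      also have "\<dots> = M * \<epsilon> * (p (u, 0) + c * N w) + M * \<epsilon> * c * N (?\<eta> t - w)" by (simp add: algebra_simps)
      also have "\<dots> \<le> M * \<epsilon> * R + 1 / 2 * N (?\<eta> t - w)"
        using eps M N_nonneg[of "?\<eta> t - w"] elim w
        by (intro add_mono mult_left_mono mult_right_mono) (auto simp: R_def)
      finally have "N (?\<eta> t - w) \<le> e / 2" using eps(3) by simp
      then show ?case using e N_nonneg[of "?\<eta> t - w"] elim w by simp
    qed
  qed
  then show ?thesis using w ev by (simp add: limitin_N w_def)
qed

lemma limitin_pair:
  assumes "limitin (topo E) a l \<F>" "limitin (topo G) a' l' \<F>"
  shows "limitin (topo (E \<times>\<^sub>t G)) (\<lambda>t. (a t, a' t)) (l, l') \<F>"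
  using assms by (simp add: topo_prod limitin_pairwise o_def)

text \<open>The derivative of \<open>h\<close> at \<open>x\<close> in direction \<open>u\<close>, by
  \<open>g_deriv\<close>: the tangent vector of the graph.\<close>

definition tangent :: "'e \<Rightarrow> 'e \<Rightarrow> 'e \<times> 'g" where
  "tangent x u = (u, solve x [(u, 0)])"

lemma tangent_in: "x \<in> U \<Longrightarrow> u \<in> points E \<Longrightarrow> tangent x u \<in> points (E \<times>\<^sub>t G)"
  using solve(1)[of x "[(u, 0)]"] k' by (simp add: tangent_def points_prod)

text \<open>Differentiates the equation that defines \<open>solve\<close>. The base point of the
  right-hand side, its arguments and the base point of the operator each contribute; the minus sign
  inside \<open>solve\<close> makes all contributions appear with a plus. The last one is a second
  derivative of \<open>f\<close>, hence the hypothesis \<open>enat 2 \<le> k\<close>.\<close>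

lemma solve_deriv:
  assumes x: "x \<in> U" and u: "u \<in> points E" and k2: "enat (Suc m) \<le> k" "enat 2 \<le> k"
    and w0: "set w0 \<subseteq> points (E \<times>\<^sub>t G)" "length w0 = m"
    and ws: "\<And>t. length (ws t) = m" "eventually (\<lambda>t. set (ws t) \<subseteq> points (E \<times>\<^sub>t G)) (at 0)"
    and w': "\<And>i. i < m \<Longrightarrow>
      limitin (topo (E \<times>\<^sub>t G)) (\<lambda>t. scl (E \<times>\<^sub>t G) (inverse t) (ws t ! i - w0 ! i)) (w' i) (at 0)"
  shows "limitin (topo G) (\<lambda>t. scl G (inverse t) (solve (x + scl E t u) (ws t) - solve x w0))
     (solve x (w0 @ [tangent x u]) + (\<Sum>i<m. solve x (w0[i := w' i])) + solve x [(0, solve x w0), tangent x u]) (at 0)"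
proof -
  let ?T = "tangent x u"
  let ?\<delta> = "\<lambda>t. (u, scl G (inverse t) (g (x + scl E t u) - g x))"
  let ?Z = "solve x w0" and ?Zt = "\<lambda>t. solve (x + scl E t u) (ws t)"
  have km: "enat m \<le> k" using k2(1) by (meson enat_ord_simps(1) le_SucI order_refl order_trans)
  have T: "?T \<in> points (E \<times>\<^sub>t G)" using tangent_in[OF x u] .
  have xU: "eventually (\<lambda>t. x + scl E t u \<in> U) (at 0)" by (rule E.eventually_at_line[OF U x u])
  have nz: "eventually (\<lambda>t::'k. t \<noteq> 0) (at 0)" by (simp add: eventually_at_filter)
  have w'in: "w' i \<in> points (E \<times>\<^sub>t G)" if "i < m" for i using w'[OF that] by (simp add: H.E.limitin_iff)
  have \<delta>: "limitin (topo (E \<times>\<^sub>t G)) ?\<delta> ?T (at 0)"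
    unfolding tangent_def by (intro limitin_pair g_deriv[OF x u]) (use u in simp)
  have W0: "?Z \<in> points G" "\<Phi> [(0, ?Z)] (h x) = - \<Phi> w0 (h x)" using solve[OF x w0(1)] w0(2) km by simp_all
  have L0: "set [(0, ?Z)] \<subseteq> points (E \<times>\<^sub>t G)" using W0 by (simp add: points_prod)
  have hx: "h x + scl (E \<times>\<^sub>t G) t (?\<delta> t) = h (x + scl E t u)" if "t \<noteq> 0" for t
    using that by (simp add: scl_prod)
  have lim1: "limitin (topo G) (\<lambda>t. scl G (inverse t) (\<Phi> (ws t) (h x + scl (E \<times>\<^sub>t G) t (?\<delta> t)) - \<Phi> w0 (h x)))
     (\<Phi> (w0 @ [?T]) (h x) + (\<Sum>i<m. \<Phi> (w0[i := w' i]) (h x))) (at 0)"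
    by (rule H.chain_rule[OF D gD[OF x] C k2(1) \<delta> w0 ws w'])
  \<comment> \<open>The operator is differentiated on the fixed vector \<open>?Z\<close>, so its
    argument has derivative 0.\<close>
  have lim2: "limitin (topo G) (\<lambda>t. scl G (inverse t) (\<Phi> [(0, ?Z)] (h x + scl (E \<times>\<^sub>t G) t (?\<delta> t)) - \<Phi> [(0, ?Z)] (h x)))
     (\<Phi> ([(0, ?Z)] @ [?T]) (h x) + (\<Sum>i<Suc 0. \<Phi> ([(0, ?Z)][i := 0]) (h x))) (at 0)"
  proof (rule H.chain_rule[OF D gD[OF x] C _ \<delta> L0])
    show "enat (Suc (Suc 0)) \<le> k" using k2(2) by (simp add: numeral_2_eq_2)
    show "eventually (\<lambda>t. set [(0, ?Z)] \<subseteq> points (E \<times>\<^sub>t G)) (at (0::'k))" using L0 by simp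
    show "limitin (topo (E \<times>\<^sub>t G)) (\<lambda>t. scl (E \<times>\<^sub>t G) (inverse t) ([(0, ?Z)] ! i - [(0, ?Z)] ! i)) 0 (at (0::'k))" for i
      by simp
  qed simp_all
  have z0: "\<Phi> [0] (h x) = 0"
    using H.slot_zero[OF slot[OF x k'(1)], of "[]" "[]"] by simp
  have lim2': "limitin (topo G) (\<lambda>t. scl G (inverse t) (\<Phi> [(0, ?Z)] (h x + scl (E \<times>\<^sub>t G) t (?\<delta> t)) - \<Phi> [(0, ?Z)] (h x)))
     (\<Phi> [(0, ?Z), ?T] (h x)) (at 0)" using lim2 z0 by simp
  let ?q' = "\<Phi> (w0 @ [?T]) (h x) + (\<Sum>i<m. \<Phi> (w0[i := w' i]) (h x))"
  let ?R = "- ?q' - \<Phi> [(0, ?Z), ?T] (h x)"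
  let ?y = "solve x (w0 @ [?T]) + (\<Sum>i<m. solve x (w0[i := w' i])) + solve x [(0, ?Z), ?T]"
  have upd: "set (w0[i := w' i]) \<subseteq> points (E \<times>\<^sub>t G)" "enat (length (w0[i := w' i])) \<le> k" if "i < m" for i
    using w0 w'in[OF that] set_update_subset_insert[of w0 i "w' i"] km by auto
  have L1: "set (w0 @ [?T]) \<subseteq> points (E \<times>\<^sub>t G)" "enat (length (w0 @ [?T])) \<le> k" using w0 T k2(1) by auto
  have L2: "set [(0, ?Z), ?T] \<subseteq> points (E \<times>\<^sub>t G)" "enat (length [(0, ?Z), ?T]) \<le> k"
    using L0 T k2(2) by (auto simp: numeral_2_eq_2)
  have sumG: "(\<Sum>i<m. solve x (w0[i := w' i])) \<in> points G" using solve(1)[OF x upd] by (intro sum_points) auto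
  have yG: "?y \<in> points G" using solve(1)[OF x L1] solve(1)[OF x L2] sumG by auto
  have Qsum: "\<Phi> [(0, \<Sum>i\<in>A. a i)] (h x) = (\<Sum>i\<in>A. \<Phi> [(0, a i)] (h x))"
    if "finite A" "\<And>i. i \<in> A \<Longrightarrow> a i \<in> points G" for A :: "nat set" and a
    using that
  proof (induction A rule: finite_induct)
    case empty
    then show ?case using linear_diff(2)[OF lcs Q_linear[OF x], of 0 0] by simp
  next
    case (insert j A)
    have "a j \<in> points G" "(\<Sum>i\<in>A. a i) \<in> points G" using insert.prems by (auto intro!: sum_points)
    then have "\<Phi> [(0, a j + (\<Sum>i\<in>A. a i))] (h x) = \<Phi> [(0, a j)] (h x) + \<Phi> [(0, \<Sum>i\<in>A. a i)] (h x)"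
      by (rule linear_from_toD(2)[OF Q_linear[OF x]])
    then show ?case using insert by simp
  qed
  have "\<Phi> [(0, \<Sum>i<m. solve x (w0[i := w' i]))] (h x) = (\<Sum>i<m. - \<Phi> (w0[i := w' i]) (h x))"
    using solve[OF x upd] by (subst Qsum) (auto intro!: sum.cong)
  then have Qy: "\<Phi> [(0, ?y)] (h x) = ?R"
    using linear_from_toD(2)[OF Q_linear[OF x]] solve[OF x L1] solve[OF x L2] sumG
    by (simp add: sum_negf)
  obtain p where p: "H.Keller_seminorm \<Phi> (h x) 1 p" using H.Keller_seminorm_exists[OF C[OF gD[OF x]], of 1] k' by auto
  have Win: "eventually (\<lambda>t. ?Zt t \<in> points G \<and> \<Phi> [(0, ?Zt t)] (h (x + scl E t u)) = - \<Phi> (ws t) (h (x + scl E t u))) (at 0)"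
    using xU ws(2) by eventually_elim (use solve ws(1) km in simp)
  \<comment> \<open>The quotient itself solves a linear equation: with \<open>Q\<^sub>t\<close> the
    partial derivative at \<open>h (x + t u)\<close>, its image under \<open>Q\<^sub>t\<close> is
    minus the quotient of the right-hand sides minus the quotient of the operators on
    \<open>?Z\<close>. The limit \<open>?R\<close> of this image is the image of \<open>?y\<close>
    under \<open>Q\<^sub>0\<close>.\<close>
  have "((\<lambda>t. N (scl G (inverse t) (?Zt t - ?Z) - ?y)) \<longlongrightarrow> 0) (at 0)"
  proof (rule solution_tendsto[OF x E.filterlim_scale_zero_filter[OF u] p])
    show "eventually (\<lambda>t. scl G (inverse t) (?Zt t - ?Z) \<in> points G \<and> ?y \<in> points G \<and> N ?y \<le> N ?y) (at 0)"
      using Win by eventually_elim (use W0 yG in auto)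
    have "limitin (topo G) (\<lambda>t. - scl G (inverse t) (\<Phi> (ws t) (h x + scl (E \<times>\<^sub>t G) t (?\<delta> t)) - \<Phi> w0 (h x))
       - scl G (inverse t) (\<Phi> [(0, ?Z)] (h x + scl (E \<times>\<^sub>t G) t (?\<delta> t)) - \<Phi> [(0, ?Z)] (h x))) ?R (at 0)"
      by (intro limitin_diff limitin_minus lim1 lim2')
    moreover have "eventually (\<lambda>t. - scl G (inverse t) (\<Phi> (ws t) (h x + scl (E \<times>\<^sub>t G) t (?\<delta> t)) - \<Phi> w0 (h x))
       - scl G (inverse t) (\<Phi> [(0, ?Z)] (h x + scl (E \<times>\<^sub>t G) t (?\<delta> t)) - \<Phi> [(0, ?Z)] (h x)) =
       \<Phi> [(0, scl G (inverse t) (?Zt t - ?Z))] (h (x + scl E t u))) (at 0)"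
      using Win xU nz
    proof eventually_elim
      case (elim t)
      have "\<Phi> [(0, scl G (inverse t) (?Zt t - ?Z))] (h (x + scl E t u)) =
          scl G (inverse t) (\<Phi> [(0, ?Zt t)] (h (x + scl E t u)) - \<Phi> [(0, ?Z)] (h (x + scl E t u)))"
        using linear_from_toD(3)[OF Q_linear[OF elim(2)], of "?Zt t - ?Z" "inverse t"]
          linear_diff(1)[OF lcs Q_linear[OF elim(2)], of "?Zt t" ?Z] elim W0 by simp
      also have "\<dots> = scl G (inverse t) (- (\<Phi> (ws t) (h (x + scl E t u)) - \<Phi> w0 (h x))
          - (\<Phi> [(0, ?Z)] (h (x + scl E t u)) - \<Phi> [(0, ?Z)] (h x)))"
        using elim W0 by simp
      finally show ?case unfolding hx[OF elim(3)] by (simp only: scale_right_diff_distrib scale_minus_right)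
    qed
    ultimately have "limitin (topo G) (\<lambda>t. \<Phi> [(0, scl G (inverse t) (?Zt t - ?Z))] (h (x + scl E t u))) ?R (at 0)"
      by (rule limitin_transform_eventually[rotated])
    then show "((\<lambda>t. N (\<Phi> [(0, scl G (inverse t) (?Zt t - ?Z))] (h (x + scl E t u)) - \<Phi> [(0, ?y)] (h x))) \<longlongrightarrow> 0) (at 0)"
      unfolding Qy limitin_N by blast
  qed simp
  moreover have "eventually (\<lambda>t. scl G (inverse t) (?Zt t - ?Z) \<in> points G) (at 0)"
    using Win by eventually_elim (use W0 in auto)
  ultimately show ?thesis using yG by (simp add: limitin_N)
qed

end

section \<open>Higher derivatives indexed by trees\<close>

text \<open>The derivative of order \<open>l\<close> of an implicitly defined function is a sum of terms obtained by
  nesting the operation \<open>solve\<close>. A tree records the nesting, its leaves are the directions.\<close>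

datatype tree = Leaf nat | Node "tree list"

text \<open>\<open>L\<close> bounds the branching, that is the order of the derivatives of
  \<open>f\<close> that a tree uses, so evaluation makes sense for \<open>L\<close> up to
  \<open>k\<close>; \<open>n\<close> bounds the labels of directions already used.\<close>

fun well_formed :: "nat \<Rightarrow> nat \<Rightarrow> tree \<Rightarrow> bool" where
  "well_formed L n (Leaf i) \<longleftrightarrow> i < n"
| "well_formed L n (Node ts) \<longleftrightarrow> length ts \<le> L \<and> (\<forall>t\<in>set ts. well_formed L n t)"

text \<open>Differentiation in the new direction \<open>n\<close>, following
  \<open>solve_deriv\<close>: the operator moves, giving a binary node on top; the base point of the
  right-hand side moves, giving a new last argument; or one of the subtrees is differentiated. For a
  leaf the first two contributions merge into one binary node by linearity in the first
  slot.\<close>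

function tree_deriv :: "nat \<Rightarrow> tree \<Rightarrow> tree list" where
  "tree_deriv n (Leaf i) = [Node [Leaf i, Leaf n]]"
| "tree_deriv n (Node ts) = Node [Node ts, Leaf n] # Node (ts @ [Leaf n]) #
     concat (map (\<lambda>i. map (\<lambda>t'. Node (ts[i := t'])) (tree_deriv n (ts ! i))) [0..<length ts])"
  by pat_completeness auto
termination
proof (relation "inv_image less_than (size \<circ> snd)")
  fix n :: nat and ts :: "tree list" and i assume "i \<in> set [0..<length ts]"
  then have "ts ! i \<in> set ts" by simp
  then have "size (ts ! i) \<le> size_list size ts" by (rule size_list_estimation') simp
  then show "((n, ts ! i), n, Node ts) \<in> inv_image less_than (size \<circ> snd)" by simp
qed simp

text \<open>The \<open>E\<close>-component of the argument that a subtree contributes. A leaf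
  contributes a tangent vector of the graph; higher derivatives of
  \<open>x \<mapsto> (x, g x)\<close> have \<open>E\<close>-component 0.\<close>

fun lead :: "(nat \<Rightarrow> 'e::zero) \<Rightarrow> tree \<Rightarrow> 'e" where
  "lead \<sigma> (Leaf i) = \<sigma> i"
| "lead \<sigma> (Node ts) = 0"

text \<open>Order 0 is \<open>g\<close> itself, which is no tree value; the empty list is a filler
  there, and \<open>\<Gamma>\<close> treats this order apart. Order 1 is the leaf, whose value is
  the first derivative.\<close>

fun derivative_trees :: "nat \<Rightarrow> tree list" where
  "derivative_trees 0 = []"
| "derivative_trees (Suc 0) = [Leaf 0]"
| "derivative_trees (Suc (Suc n)) = concat (map (tree_deriv (Suc n)) (derivative_trees (Suc n)))"

lemma well_formed_mono: "well_formed L n T \<Longrightarrow> L \<le> L' \<Longrightarrow> n \<le> n' \<Longrightarrow> well_formed L' n' T"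
  by (induction T) auto

text \<open>Each differentiation raises the branching by at most one; \<open>1 \<le> L\<close>
  accounts for the new binary nodes.\<close>

lemma well_formed_tree_deriv: "well_formed L n T \<Longrightarrow> 1 \<le> L \<Longrightarrow> T' \<in> set (tree_deriv n T) \<Longrightarrow> well_formed (Suc L) (Suc n) T'"
proof (induction T arbitrary: T')
  case (Node ts)
  have ts: "well_formed (Suc L) (Suc n) t" if "t \<in> set ts" for t
    using Node.prems(1) that by (auto intro: well_formed_mono)
  have "T' = Node [Node ts, Leaf n] \<or> T' = Node (ts @ [Leaf n]) \<or>
      (\<exists>i t'. i < length ts \<and> t' \<in> set (tree_deriv n (ts ! i)) \<and> T' = Node (ts[i := t']))"
    using Node.prems(3) by auto
  then show ?case
  proof (elim disjE exE conjE)
    fix i t' assume i: "i < length ts" and t': "t' \<in> set (tree_deriv n (ts ! i))" and T': "T' = Node (ts[i := t'])"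
    have "well_formed (Suc L) (Suc n) t'"
      using Node.IH[of "ts ! i" t'] i t' Node.prems by auto
    then show ?thesis
      using ts Node.prems(1) set_update_subset_insert[of ts i t'] unfolding T' by auto
  qed (use Node.prems ts in auto)
qed auto

lemma lead_tree_deriv: "T' \<in> set (tree_deriv n T) \<Longrightarrow> lead \<sigma> T' = 0"
  by (cases T) auto

lemma well_formed_derivative_trees: "T \<in> set (derivative_trees (Suc n)) \<Longrightarrow> well_formed (Suc n) (Suc n) T"
proof (induction n arbitrary: T)
  case (Suc n)
  then obtain T0 where "T0 \<in> set (derivative_trees (Suc n))" "T \<in> set (tree_deriv (Suc n) T0)" by auto
  then show ?case using well_formed_tree_deriv[OF Suc.IH, of T0 T] by simp
qed simp

lemma lead_cong: "well_formed L n T \<Longrightarrow> (\<And>i. i < n \<Longrightarrow> \<sigma> i = \<sigma>' i) \<Longrightarrow> lead \<sigma> T = lead \<sigma>' T"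
  by (cases T) auto

lemma sum_list_concat_map: "sum_list (map f (concat (map h xs))) = (\<Sum>x\<leftarrow>xs. \<Sum>y\<leftarrow>h x. f y)"
  by (induction xs) auto

lemma linear_from_to_compose:
  "linear_from_to A B a \<Longrightarrow> linear_from_to B C' c \<Longrightarrow> linear_from_to A C' (\<lambda>v. c (a v))"
  unfolding linear_from_to_def by (simp add: Pi_iff)

context lcs_space
begin

lemma linear_from_to_add:
  "linear_from_to A E a \<Longrightarrow> linear_from_to A E c \<Longrightarrow> linear_from_to A E (\<lambda>v. a v + c v)"
  unfolding linear_from_to_def by (auto simp: scale_right_distrib algebra_simps)

lemma linear_from_to_sum_list:
  "(\<And>i. i \<in> set xs \<Longrightarrow> linear_from_to A E (a i)) \<Longrightarrow> linear_from_to A E (\<lambda>v. \<Sum>i\<leftarrow>xs. a i v)"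
proof (induction xs)
  case Nil
  then show ?case by (auto simp: linear_from_to_def)
next
  case (Cons i xs)
  then show ?case using linear_from_to_add[of A "a i" "\<lambda>v. \<Sum>i\<leftarrow>xs. a i v"] by simp
qed

lemma scale_sum_list: "scl E c (\<Sum>i\<leftarrow>xs. a i) = (\<Sum>i\<leftarrow>xs. scl E c (a i))"
  by (induction xs) (simp_all add: scale_right_distrib)

end

lemma sum_list_map_diff: "(\<Sum>i\<leftarrow>xs. a i) - (\<Sum>i\<leftarrow>xs. c i) = (\<Sum>i\<leftarrow>xs. a i - (c i :: 'a::ab_group_add))"
  by (induction xs) (simp_all add: algebra_simps)

section \<open>Evaluation of trees: derivative and linearity\<close>

context implicit_map
begin

sublocale EG: to_banach E G N ..

text \<open>A leaf evaluates to the first derivative of \<open>g\<close>, so that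
  \<open>node x \<sigma> (Leaf i)\<close> is the tangent vector
  \<open>tangent x (\<sigma> i)\<close>.\<close>

fun tree_value :: "'e \<Rightarrow> (nat \<Rightarrow> 'e) \<Rightarrow> tree \<Rightarrow> 'g" where
  "tree_value x \<sigma> (Leaf i) = solve x [(\<sigma> i, 0)]"
| "tree_value x \<sigma> (Node ts) = solve x (map (\<lambda>t. (lead \<sigma> t, tree_value x \<sigma> t)) ts)"

abbreviation node :: "'e \<Rightarrow> (nat \<Rightarrow> 'e) \<Rightarrow> tree \<Rightarrow> 'e \<times> 'g" where
  "node x \<sigma> t \<equiv> (lead \<sigma> t, tree_value x \<sigma> t)"

lemma tree_value_cong: "well_formed L n T \<Longrightarrow> (\<And>i. i < n \<Longrightarrow> \<sigma> i = \<sigma>' i) \<Longrightarrow> tree_value x \<sigma> T = tree_value x \<sigma>' T"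
proof (induction T)
  case (Node ts)
  have "map (node x \<sigma>) ts = map (node x \<sigma>') ts"
    using Node lead_cong[of L n _ \<sigma> \<sigma>'] by simp
  then show ?case by (simp only: tree_value.simps)
qed simp

lemma enat_le_trans: "m \<le> L \<Longrightarrow> enat L \<le> k \<Longrightarrow> enat m \<le> k"
  by (meson enat_ord_simps(1) order_trans)

lemma lead_in: "(\<And>i. i < n \<Longrightarrow> \<sigma> i \<in> points E) \<Longrightarrow> well_formed L n T \<Longrightarrow> lead \<sigma> T \<in> points E"
  by (cases T) auto

lemma tree_value_in:
  assumes x: "x \<in> U" and L: "enat L \<le> k" and \<sigma>: "\<And>i. i < n \<Longrightarrow> \<sigma> i \<in> points E"
  shows "well_formed L n T \<Longrightarrow> tree_value x \<sigma> T \<in> points G"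
proof (induction T)
  case (Leaf i)
  then show ?case using \<sigma> k' x solve(1)[of x "[(\<sigma> i, 0)]"] by (simp add: points_prod)
next
  case (Node ts)
  have "node x \<sigma> t \<in> points (E \<times>\<^sub>t G)" if "t \<in> set ts" for t
    using Node that lead_in[of n \<sigma> L t] \<sigma> by (auto simp: points_prod)
  then have "set (map (node x \<sigma>) ts) \<subseteq> points (E \<times>\<^sub>t G)" by auto
  then show ?case using solve(1)[OF x, of "map (node x \<sigma>) ts"] Node.prems enat_le_trans[OF _ L] by simp
qed

lemma node_in:
  assumes "x \<in> U" "enat L \<le> k" "\<And>i. i < n \<Longrightarrow> \<sigma> i \<in> points E" "well_formed L n T"
  shows "node x \<sigma> T \<in> points (E \<times>\<^sub>t G)"
  using tree_value_in[OF assms(1-3)] lead_in[of n \<sigma> L T] assms(3,4) by (simp add: points_prod)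

lemma map_node_in:
  assumes "x \<in> U" "enat L \<le> k" "\<And>i. i < n \<Longrightarrow> \<sigma> i \<in> points E" "\<forall>t\<in>set ts. well_formed L n t"
  shows "set (map (node x \<sigma>) ts) \<subseteq> points (E \<times>\<^sub>t G)"
  using node_in[OF assms(1-3)] assms(4) by auto

lemma solve_update_linear:
  assumes x: "x \<in> U" and w: "set w \<subseteq> points (E \<times>\<^sub>t G)" "enat (length w) \<le> k" "i < length w"
  shows "linear_from_to (E \<times>\<^sub>t G) G (\<lambda>v. solve x (w[i := v]))"
proof -
  have "linear_from_to (E \<times>\<^sub>t G) G (\<lambda>v. solve x (take i w @ v # drop (Suc i) w))"
    using w set_take_subset[of i w] set_drop_subset[of "Suc i" w]
    by (intro slot_linearD(2)[OF solve_slot_linear[OF x w(2)]]) auto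
  then show ?thesis using w(3) by (simp add: upd_conv_take_nth_drop)
qed

lemma inr_linear: "linear_from_to G (E \<times>\<^sub>t G) (\<lambda>v. (0, v))"
  using cont_linear_inr[OF E.lcs lcs] by (simp add: cont_linear_def)

lemma inl_linear: "linear_from_to E (E \<times>\<^sub>t G) (\<lambda>v. (v, 0))"
  using cont_linear_inl[OF E.lcs lcs] by (simp add: cont_linear_def)

text \<open>Differentiating a subtree puts a sum of trees into one slot of its parent; linearity
  pulls the sum out.\<close>

lemma solve_update_sum_list:
  assumes x: "x \<in> U" and w: "set w \<subseteq> points (E \<times>\<^sub>t G)" "enat (length w) \<le> k" "i < length w"
    and ys: "set ys \<subseteq> points G"
  shows "solve x (w[i := (0, sum_list ys)]) = (\<Sum>y\<leftarrow>ys. solve x (w[i := (0, y)]))"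
proof -
  note L = linear_from_to_compose[OF inr_linear solve_update_linear[OF x w]]
  show ?thesis using ys
  proof (induction ys)
    case Nil
    then show ?case using linear_diff(2)[OF lcs L, of 0 0] by simp
  next
    case (Cons y ys)
    then have "sum_list ys \<in> points G" by auto
    then show ?case using Cons linear_from_toD(2)[OF L, of y "sum_list ys"] by simp
  qed
qed

lemma tangent_linear:
  assumes x: "x \<in> U"
  shows "linear_from_to E (E \<times>\<^sub>t G) (tangent x)"
proof -
  have "linear_from_to (E \<times>\<^sub>t G) G (\<lambda>v. solve x ([] @ v # []))"
    by (rule slot_linearD(2)[OF solve_slot_linear[OF x k'(1)]]) auto
  then have "linear_from_to (E \<times>\<^sub>t G) G (\<lambda>v. solve x [v])" by simp
  from linear_from_to_compose[OF inl_linear this] show ?thesis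
    unfolding linear_from_to_def points_prod tangent_def by (auto simp: scl_prod)
qed

text \<open>Matches the syntactic derivative of a node with the contributions in
  \<open>solve_deriv\<close>. Derived subtrees are always nodes, so their \<open>lead\<close> is 0,
  as the derivative of an argument requires.\<close>

lemma sum_tree_deriv_Node:
  assumes x: "x \<in> U" and L: "enat L \<le> k" and L': "enat (Suc L') \<le> k"
    and ts: "\<forall>t\<in>set ts. well_formed L' n' t" and \<sigma>: "\<And>i. i < Suc n \<Longrightarrow> \<sigma> i \<in> points E"
    and len: "length ts \<le> L" and n': "n' \<le> n" "1 \<le> L'"
    and okn: "\<forall>t\<in>set ts. well_formed L' n t"
  shows "(\<Sum>T'\<leftarrow>tree_deriv n (Node ts). tree_value x \<sigma> T') =
     solve x (map (node x \<sigma>) ts @ [tangent x (\<sigma> n)]) +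
     (\<Sum>i<length ts. solve x ((map (node x \<sigma>) ts)[i := (0, \<Sum>T'\<leftarrow>tree_deriv n (ts ! i). tree_value x \<sigma> T')])) +
     solve x [(0, solve x (map (node x \<sigma>) ts)), tangent x (\<sigma> n)]"
proof -
  let ?w = "map (node x \<sigma>) ts"
  have w: "set ?w \<subseteq> points (E \<times>\<^sub>t G)"
    using \<sigma> okn L' by (intro map_node_in[OF x, of L' n] enat_le_trans[OF _ L']) auto
  have "(\<Sum>t'\<leftarrow>tree_deriv n (ts ! i). tree_value x \<sigma> (Node (ts[i := t']))) =
      solve x (?w[i := (0, \<Sum>T'\<leftarrow>tree_deriv n (ts ! i). tree_value x \<sigma> T')])" if i: "i < length ts" for i
  proof -
    have ti: "well_formed L' n (ts ! i)" using okn i by simp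
    have ys: "set (map (tree_value x \<sigma>) (tree_deriv n (ts ! i))) \<subseteq> points G"
    proof
      fix y assume "y \<in> set (map (tree_value x \<sigma>) (tree_deriv n (ts ! i)))"
      then obtain t' where t': "t' \<in> set (tree_deriv n (ts ! i))" "y = tree_value x \<sigma> t'" by auto
      have "well_formed (Suc L') (Suc n) t'" by (rule well_formed_tree_deriv[OF ti n'(2) t'(1)])
      then show "y \<in> points G" using tree_value_in[OF x L', of "Suc n" \<sigma>] \<sigma> t'(2) by blast
    qed
    have "solve x (?w[i := (0, \<Sum>T'\<leftarrow>tree_deriv n (ts ! i). tree_value x \<sigma> T')]) =
        (\<Sum>y\<leftarrow>map (tree_value x \<sigma>) (tree_deriv n (ts ! i)). solve x (?w[i := (0, y)]))"
      using i len enat_le_trans[OF len L] by (intro solve_update_sum_list[OF x w _ _ ys]) auto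
    also have "\<dots> = (\<Sum>t'\<leftarrow>tree_deriv n (ts ! i). solve x (?w[i := (0, tree_value x \<sigma> t')]))" by (simp add: o_def)
    also have "\<dots> = (\<Sum>t'\<leftarrow>tree_deriv n (ts ! i). tree_value x \<sigma> (Node (ts[i := t'])))"
      by (intro arg_cong[where f = sum_list] map_cong refl) (simp add: map_update lead_tree_deriv)
    finally show ?thesis ..
  qed
  then have "(\<Sum>i\<leftarrow>[0..<length ts]. \<Sum>t'\<leftarrow>tree_deriv n (ts ! i). tree_value x \<sigma> (Node (ts[i := t']))) =
      (\<Sum>i<length ts. solve x (?w[i := (0, \<Sum>T'\<leftarrow>tree_deriv n (ts ! i). tree_value x \<sigma> T')]))"
    by (simp add: sum_list_distinct_conv_sum_set atLeast0LessThan)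
  moreover have "(\<Sum>T'\<leftarrow>tree_deriv n (Node ts). tree_value x \<sigma> T') =
      solve x [(0, solve x ?w), tangent x (\<sigma> n)] + (solve x (?w @ [tangent x (\<sigma> n)]) +
      (\<Sum>i\<leftarrow>[0..<length ts]. \<Sum>t'\<leftarrow>tree_deriv n (ts ! i). tree_value x \<sigma> (Node (ts[i := t']))))"
  proof -
    have "(\<Sum>T'\<leftarrow>tree_deriv n (Node ts). tree_value x \<sigma> T') = tree_value x \<sigma> (Node [Node ts, Leaf n]) + (tree_value x \<sigma> (Node (ts @ [Leaf n])) +
      (\<Sum>i\<leftarrow>[0..<length ts]. \<Sum>t'\<leftarrow>tree_deriv n (ts ! i). tree_value x \<sigma> (Node (ts[i := t']))))"
      by (simp add: sum_list_concat_map o_def del: tree_value.simps)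
    then show ?thesis by (simp add: tangent_def)
  qed
  ultimately show ?thesis by (simp add: algebra_simps)
qed

lemma tree_value_deriv:
  assumes x: "x \<in> U" and L: "1 \<le> L" "enat (Suc L) \<le> k" and \<sigma>: "\<And>i. i < Suc n \<Longrightarrow> \<sigma> i \<in> points E"
  shows "well_formed L n T \<Longrightarrow> limitin (topo G) (\<lambda>t. scl G (inverse t) (tree_value (x + scl E t (\<sigma> n)) \<sigma> T - tree_value x \<sigma> T))
     (\<Sum>T'\<leftarrow>tree_deriv n T. tree_value x \<sigma> T') (at 0)"
proof (induction T)
  case (Leaf i)
  have k2: "enat 2 \<le> k" using L enat_le_trans[of 2 "Suc L"] by simp
  have i: "\<sigma> i \<in> points E" "\<sigma> n \<in> points E" using Leaf \<sigma> by auto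
  let ?w = "[(\<sigma> i, 0)]"
  have w: "set ?w \<subseteq> points (E \<times>\<^sub>t G)" using i by (simp add: points_prod)
  have "limitin (topo G) (\<lambda>t. scl G (inverse t) (solve (x + scl E t (\<sigma> n)) ?w - solve x ?w))
     (solve x (?w @ [tangent x (\<sigma> n)]) + (\<Sum>j<Suc 0. solve x (?w[j := 0])) + solve x [(0, solve x ?w), tangent x (\<sigma> n)]) (at 0)"
  proof (rule solve_deriv[OF x i(2) _ k2 w])
    show "enat (Suc (Suc 0)) \<le> k" using k2 by (simp add: numeral_2_eq_2)
    show "eventually (\<lambda>t. set ?w \<subseteq> points (E \<times>\<^sub>t G)) (at (0::'k))" using w by simp
  qed simp_all
  moreover have "solve x [0] = 0"
    using H.slot_zero[OF solve_slot_linear[OF x k'(1)], of "[]" "[]"] by simp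
  \<comment> \<open>Linearity in the first slot merges two terms of \<open>solve_deriv\<close> into
    the single tree that \<open>tree_deriv\<close> prescribes for a leaf.\<close>
  moreover have "solve x [(\<sigma> i, solve x ?w), tangent x (\<sigma> n)] =
      solve x [(\<sigma> i, 0), tangent x (\<sigma> n)] + solve x [(0, solve x ?w), tangent x (\<sigma> n)]"
  proof -
    have o: "solve x ?w \<in> points G" using solve(1)[OF x w] k' by simp
    show ?thesis
      using H.slot_add[OF solve_slot_linear[OF x k2], of "[]" "[tangent x (\<sigma> n)]" "(\<sigma> i, 0)" "(0, solve x ?w)"]
        tangent_in[OF x i(2)] i o by (simp add: points_prod)
  qed
  ultimately show ?case by (simp add: tangent_def)
next
  case (Node ts)
  have k2: "enat 2 \<le> k" using L enat_le_trans[of 2 "Suc L"] by simp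
  have Lk: "enat L \<le> k" using L(2) by (rule enat_le_trans[rotated]) simp
  have n: "\<sigma> n \<in> points E" using \<sigma> by simp
  have \<sigma>': "\<sigma> i \<in> points E" if "i < n" for i using \<sigma> that by simp
  have len: "length ts \<le> L" and ts: "\<forall>t\<in>set ts. well_formed L n t" using Node.prems by auto
  let ?w = "map (node x \<sigma>) ts"
  have w: "set ?w \<subseteq> points (E \<times>\<^sub>t G)" by (rule map_node_in[OF x Lk \<sigma>' ts])
  have xU: "eventually (\<lambda>t. x + scl E t (\<sigma> n) \<in> U) (at 0)" by (rule E.eventually_at_line[OF U x n])
  have "limitin (topo G) (\<lambda>t. scl G (inverse t) (solve (x + scl E t (\<sigma> n)) (map (node (x + scl E t (\<sigma> n)) \<sigma>) ts) - solve x ?w))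
     (solve x (?w @ [tangent x (\<sigma> n)]) + (\<Sum>i<length ts. solve x (?w[i := (0, \<Sum>T'\<leftarrow>tree_deriv n (ts ! i). tree_value x \<sigma> T')])) +
       solve x [(0, solve x ?w), tangent x (\<sigma> n)]) (at 0)"
  proof (rule solve_deriv[OF x n _ k2 w])
    show "enat (Suc (length ts)) \<le> k" using len by (intro enat_le_trans[OF _ L(2)]) simp
    show "eventually (\<lambda>t. set (map (node (x + scl E t (\<sigma> n)) \<sigma>) ts) \<subseteq> points (E \<times>\<^sub>t G)) (at 0)"
      using xU by eventually_elim (rule map_node_in[OF _ Lk \<sigma>' ts])
    fix i assume i: "i < length ts"
    \<comment> \<open>The \<open>E\<close>-component of an argument does not depend on the base
      point, hence its quotient vanishes.\<close>
    have "limitin (topo (E \<times>\<^sub>t G)) (\<lambda>t. (0, scl G (inverse t) (tree_value (x + scl E t (\<sigma> n)) \<sigma> (ts ! i) - tree_value x \<sigma> (ts ! i))))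
       (0, \<Sum>T'\<leftarrow>tree_deriv n (ts ! i). tree_value x \<sigma> T') (at 0)"
      by (intro limitin_pair Node.IH) (use i ts in auto)
    then show "limitin (topo (E \<times>\<^sub>t G)) (\<lambda>t. scl (E \<times>\<^sub>t G) (inverse t)
       (map (node (x + scl E t (\<sigma> n)) \<sigma>) ts ! i - ?w ! i)) (0, \<Sum>T'\<leftarrow>tree_deriv n (ts ! i). tree_value x \<sigma> T') (at 0)"
      using i by (simp add: scl_prod)
  qed simp_all
  then show ?case
    using sum_tree_deriv_Node[where \<sigma> = \<sigma> and n = n, OF x Lk L(2) ts \<sigma> len order_refl L(1) ts]
    by (simp del: tree_deriv.simps)
qed

text \<open>The labels of \<open>T\<close> are below \<open>n\<close>, so \<open>v\<close> enters
  only through the newly attached leaf, which occurs once in each derived tree.\<close>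

lemma tree_deriv_linear:
  assumes x: "x \<in> U" and L: "1 \<le> L" "enat (Suc L) \<le> k" and \<sigma>: "\<And>i. i < n \<Longrightarrow> \<sigma> i \<in> points E"
  shows "well_formed L n T \<Longrightarrow> linear_from_to E G (\<lambda>v. \<Sum>T'\<leftarrow>tree_deriv n T. tree_value x (\<sigma>(n := v)) T')"
proof (induction T)
  case (Leaf i)
  have k2: "enat 2 \<le> k" using L enat_le_trans[of 2 "Suc L"] by simp
  have i: "\<sigma> i \<in> points E" "i \<noteq> n" using Leaf \<sigma> by auto
  have "linear_from_to (E \<times>\<^sub>t G) G (\<lambda>v. solve x ([tangent x (\<sigma> i)] @ v # []))"
    by (rule slot_linearD(2)[OF solve_slot_linear[OF x k2]]) (use tangent_in[OF x i(1)] in auto)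
  from linear_from_to_compose[OF tangent_linear[OF x] this] show ?case
    using i(2) by (simp add: tangent_def)
next
  case (Node ts)
  have k2: "enat 2 \<le> k" using L enat_le_trans[of 2 "Suc L"] by simp
  have Lk: "enat L \<le> k" using L(2) by (rule enat_le_trans[rotated]) simp
  have len: "length ts \<le> L" and ts: "\<forall>t\<in>set ts. well_formed L n t" using Node.prems by auto
  let ?w = "map (node x \<sigma>) ts"
  have w: "set ?w \<subseteq> points (E \<times>\<^sub>t G)" by (rule map_node_in[OF x Lk \<sigma> ts])
  have wk: "enat (length ?w) \<le> k" "enat (Suc (length ts)) \<le> k"
    using len enat_le_trans[OF _ L(2)] by auto
  have oG: "solve x ?w \<in> points G" using solve(1)[OF x w wk(1)] .
  have cong: "map (node x (\<sigma>(n := v))) ts = ?w" for v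
  proof -
    have "node x (\<sigma>(n := v)) t = node x \<sigma> t" if "t \<in> set ts" for t
    proof -
      have "well_formed L n t" using ts that by blast
      from tree_value_cong[OF this, of "\<sigma>(n := v)" \<sigma>] lead_cong[OF this, of "\<sigma>(n := v)" \<sigma>] show ?thesis by simp
    qed
    then show ?thesis by simp
  qed
  have eq: "(\<Sum>T'\<leftarrow>tree_deriv n (Node ts). tree_value x (\<sigma>(n := v)) T') =
     solve x (?w @ [tangent x v]) +
     (\<Sum>i\<leftarrow>[0..<length ts]. solve x (?w[i := (0, \<Sum>T'\<leftarrow>tree_deriv n (ts ! i). tree_value x (\<sigma>(n := v)) T')])) +
     solve x [(0, solve x ?w), tangent x v]" if v: "v \<in> points E" for v
  proof -
    have s: "(\<sigma>(n := v)) i \<in> points E" if "i < Suc n" for i using \<sigma> v that by (auto simp: less_Suc_eq)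
    show ?thesis
      using sum_tree_deriv_Node[where \<sigma> = "\<sigma>(n := v)" and n = n, OF x Lk L(2) ts s len order_refl L(1) ts]
      unfolding cong by (simp add: sum_list_distinct_conv_sum_set atLeast0LessThan del: tree_deriv.simps)
  qed
  have 1: "linear_from_to E G (\<lambda>v. solve x (?w @ [tangent x v]))"
    using w by (intro linear_from_to_compose[OF tangent_linear[OF x], of G "\<lambda>v. solve x (?w @ [v])"]
        slot_linearD(2)[OF solve_slot_linear[OF x wk(2)]]) auto
  have 2: "linear_from_to E G (\<lambda>v. solve x [(0, solve x ?w), tangent x v])"
    using slot_linearD(2)[OF solve_slot_linear[OF x k2], of "[(0, solve x ?w)]" "[]"] oG
    by (intro linear_from_to_compose[OF tangent_linear[OF x], of G "\<lambda>v. solve x [(0, solve x ?w), v]"])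
      (simp add: points_prod)
  have 3: "linear_from_to E G (\<lambda>v. solve x (?w[i := (0, \<Sum>T'\<leftarrow>tree_deriv n (ts ! i). tree_value x (\<sigma>(n := v)) T')]))"
    if i: "i < length ts" for i
  proof -
    have "linear_from_to E G (\<lambda>v. \<Sum>T'\<leftarrow>tree_deriv n (ts ! i). tree_value x (\<sigma>(n := v)) T')"
      using i ts by (intro Node.IH) auto
    from linear_from_to_compose[OF linear_from_to_compose[OF this inr_linear] solve_update_linear[OF x w wk(1)]]
    show ?thesis using i by simp
  qed
  have lin: "linear_from_to E G (\<lambda>v. solve x (?w @ [tangent x v]) +
     (\<Sum>i\<leftarrow>[0..<length ts]. solve x (?w[i := (0, \<Sum>T'\<leftarrow>tree_deriv n (ts ! i). tree_value x (\<sigma>(n := v)) T')])) +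
     solve x [(0, solve x ?w), tangent x v])"
    by (intro linear_from_to_add linear_from_to_sum_list 1 2 3) simp
  show ?case by (rule iffD2[OF linear_from_to_cong[OF E.lcs] lin]) (rule eq)
qed

section \<open>The family of all derivatives of the solution\<close>

definition \<Gamma> :: "'e list \<Rightarrow> 'e \<Rightarrow> 'g" where
  "\<Gamma> us x = (if us = [] then g x else \<Sum>T\<leftarrow>derivative_trees (length us). tree_value x ((!) us) T)"

lemma \<Gamma>_in:
  assumes x: "x \<in> U" and us: "set us \<subseteq> points E" "enat (length us) \<le> k"
  shows "\<Gamma> us x \<in> points G"
proof (cases "length us")
  case 0
  then show ?thesis using gG[OF x] by (simp add: \<Gamma>_def)
next
  case (Suc n)
  have s: "us ! i \<in> points E" if "i < Suc n" for i using us Suc that nth_mem by (metis subsetD)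
  have "tree_value x ((!) us) T \<in> points G" if "T \<in> set (derivative_trees (Suc n))" for T
    using tree_value_in[OF x, of "Suc n" "Suc n" "(!) us" T] us(2) Suc s well_formed_derivative_trees[OF that] by simp
  then have "set (map (tree_value x ((!) us)) (derivative_trees (Suc n))) \<subseteq> points G" by auto
  from sum_list_points[OF this] show ?thesis using Suc by (auto simp: \<Gamma>_def)
qed

lemma \<Gamma>_Suc:
  assumes "length us = Suc n" "y \<in> U"
  shows "\<Gamma> (us @ [v]) y = (\<Sum>T\<leftarrow>derivative_trees (Suc n). \<Sum>T'\<leftarrow>tree_deriv (Suc n) T. tree_value y ((!) (us @ [v])) T')"
    "\<Gamma> us y = (\<Sum>T\<leftarrow>derivative_trees (Suc n). tree_value y ((!) (us @ [v])) T)"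
proof -
  show "\<Gamma> (us @ [v]) y = (\<Sum>T\<leftarrow>derivative_trees (Suc n). \<Sum>T'\<leftarrow>tree_deriv (Suc n) T. tree_value y ((!) (us @ [v])) T')"
    using assms by (simp add: \<Gamma>_def sum_list_concat_map)
  have "tree_value y ((!) us) T = tree_value y ((!) (us @ [v])) T" if "T \<in> set (derivative_trees (Suc n))" for T
    by (rule tree_value_cong[OF well_formed_derivative_trees[OF that]]) (use assms in \<open>simp add: nth_append\<close>)
  then show "\<Gamma> us y = (\<Sum>T\<leftarrow>derivative_trees (Suc n). tree_value y ((!) (us @ [v])) T)"
    using assms by (auto simp: \<Gamma>_def intro!: arg_cong[where f = sum_list])
qed

lemma \<Gamma>_deriv:
  assumes x: "x \<in> U" and us: "set us \<subseteq> points E" and v: "v \<in> points E" and k1: "enat (Suc (length us)) \<le> k"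
  shows "limitin (topo G) (\<lambda>t. scl G (inverse t) (\<Gamma> us (x + scl E t v) - \<Gamma> us x)) (\<Gamma> (us @ [v]) x) (at 0)"
proof (cases "length us")
  case 0
  then show ?thesis using g_deriv[OF x v] by (simp add: \<Gamma>_def)
next
  case (Suc n)
  let ?\<sigma> = "(!) (us @ [v])"
  have s: "?\<sigma> i \<in> points E" if "i < Suc (Suc n)" for i
    using that us v Suc nth_mem[of i "us @ [v]"] by auto
  have sn: "?\<sigma> (Suc n) = v" using Suc by (simp add: nth_append)
  have "limitin (topo G) (\<lambda>t. \<Sum>T\<leftarrow>derivative_trees (Suc n).
      scl G (inverse t) (tree_value (x + scl E t (?\<sigma> (Suc n))) ?\<sigma> T - tree_value x ?\<sigma> T))
     (\<Sum>T\<leftarrow>derivative_trees (Suc n). \<Sum>T'\<leftarrow>tree_deriv (Suc n) T. tree_value x ?\<sigma> T') (at 0)"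
  proof (intro limitin_sum_list tree_value_deriv[OF x, where L = "Suc n"] s)
    show "enat (Suc (Suc n)) \<le> k" using k1 Suc by simp
  qed (auto intro: well_formed_derivative_trees)
  then have l: "limitin (topo G) (\<lambda>t. \<Sum>T\<leftarrow>derivative_trees (Suc n).
      scl G (inverse t) (tree_value (x + scl E t v) ?\<sigma> T - tree_value x ?\<sigma> T)) (\<Gamma> (us @ [v]) x) (at 0)"
    unfolding sn \<Gamma>_Suc(1)[OF Suc x, of v] .
  have xU: "eventually (\<lambda>t. x + scl E t v \<in> U) (at 0)" by (rule E.eventually_at_line[OF U x v])
  have eq: "eventually (\<lambda>t. (\<Sum>T\<leftarrow>derivative_trees (Suc n). scl G (inverse t) (tree_value (x + scl E t v) ?\<sigma> T - tree_value x ?\<sigma> T)) =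
      scl G (inverse t) (\<Gamma> us (x + scl E t v) - \<Gamma> us x)) (at 0)"
    using xU
  proof eventually_elim
    case (elim t)
    show ?case
      unfolding \<Gamma>_Suc(2)[OF Suc elim, of v] \<Gamma>_Suc(2)[OF Suc x, of v] sum_list_map_diff scale_sum_list ..
  qed
  show ?thesis by (rule limitin_transform_eventually[OF eq l])
qed

lemma \<Gamma>_last_linear:
  assumes x: "x \<in> U" and us: "set us \<subseteq> points E" and k1: "enat (Suc (length us)) \<le> k"
  shows "linear_from_to E G (\<lambda>v. \<Gamma> (us @ [v]) x)"
proof (cases "length us")
  case 0
  have "linear_from_to (E \<times>\<^sub>t G) G (\<lambda>v. solve x ([] @ v # []))"
    by (rule slot_linearD(2)[OF solve_slot_linear[OF x k'(1)]]) auto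
  from linear_from_to_compose[OF inl_linear this] show ?thesis using 0 by (simp add: \<Gamma>_def)
next
  case (Suc n)
  let ?\<sigma> = "(!) us"
  have s: "?\<sigma> i \<in> points E" if "i < Suc n" for i
    using that us Suc nth_mem[of i us] by auto
  have eq: "\<Gamma> (us @ [v]) x = (\<Sum>T\<leftarrow>derivative_trees (Suc n). \<Sum>T'\<leftarrow>tree_deriv (Suc n) T. tree_value x (?\<sigma>(Suc n := v)) T')" for v
  proof -
    have "tree_value x ((!) (us @ [v])) T' = tree_value x (?\<sigma>(Suc n := v)) T'"
      if "T \<in> set (derivative_trees (Suc n))" "T' \<in> set (tree_deriv (Suc n) T)" for T T'
    proof (rule tree_value_cong)
      show "well_formed (Suc (Suc n)) (Suc (Suc n)) T'" using well_formed_tree_deriv[OF well_formed_derivative_trees[OF that(1)] _ that(2)] by simp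
      show "(us @ [v]) ! i = (?\<sigma>(Suc n := v)) i" if "i < Suc (Suc n)" for i
        using that Suc by (auto simp: nth_append less_Suc_eq)
    qed
    then show ?thesis unfolding \<Gamma>_Suc(1)[OF Suc x]
      by (intro arg_cong[where f = sum_list] map_cong refl)
  qed
  have "linear_from_to E G (\<lambda>v. \<Sum>T\<leftarrow>derivative_trees (Suc n). \<Sum>T'\<leftarrow>tree_deriv (Suc n) T. tree_value x (?\<sigma>(Suc n := v)) T')"
  proof (rule linear_from_to_sum_list)
    fix T assume "T \<in> set (derivative_trees (Suc n))"
    then show "linear_from_to E G (\<lambda>v. \<Sum>T'\<leftarrow>tree_deriv (Suc n) T. tree_value x (?\<sigma>(Suc n := v)) T')"
      using k1 Suc by (intro tree_deriv_linear[OF x, where L = "Suc n"] s well_formed_derivative_trees) auto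
  qed
  then show ?thesis unfolding eq .
qed

text \<open>Linearity in the last direction is read off the trees; in the earlier ones it is inherited
  from the derivative of lower order by passing to the limit.\<close>

lemma \<Gamma>_slot_linear: "x \<in> U \<Longrightarrow> enat n \<le> k \<Longrightarrow> slot_linear E G n (\<lambda>us. \<Gamma> us x)"
proof (induction n arbitrary: x)
  case 0
  then show ?case using gG by (simp add: slot_linear_def \<Gamma>_def)
next
  case (Suc n)
  note x = Suc.prems(1)
  have kn: "enat n \<le> k" using Suc.prems(2) by (rule enat_le_trans[rotated]) simp
  show ?case
    unfolding slot_linear_def
  proof (intro conjI allI impI; elim conjE)
    fix us assume us: "set us \<subseteq> points E" "length us = Suc n"
    then show "\<Gamma> us x \<in> points G" using \<Gamma>_in[OF x] Suc.prems(2) by simp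
  next
    fix as bs assume ab: "set as \<subseteq> points E" "set bs \<subseteq> points E" "length as + Suc (length bs) = Suc n"
    show "linear_from_to E G (\<lambda>v. \<Gamma> (as @ v # bs) x)"
    proof (cases bs rule: rev_cases)
      case Nil
      then show ?thesis using \<Gamma>_last_linear[OF x ab(1)] ab(3) Suc.prems(2) by simp
    next
      case (snoc bs' w)
      have w: "w \<in> points E" "set bs' \<subseteq> points E" using ab snoc by auto
      have len: "length as + Suc (length bs') = n" using ab(3) snoc by simp
      have xU: "eventually (\<lambda>t. x + scl E t w \<in> U) (at 0)" by (rule E.eventually_at_line[OF U x w(1)])
      let ?q = "\<lambda>v t. scl G (inverse t) (\<Gamma> (as @ v # bs') (x + scl E t w) - \<Gamma> (as @ v # bs') x)"
      have lim: "limitin (topo G) (?q v) (\<Gamma> (as @ v # bs) x) (at 0)" if "v \<in> points E" for v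
        using \<Gamma>_deriv[OF x, of "as @ v # bs'" w] that ab w len snoc Suc.prems(2) by simp
      have lin: "linear_from_to E G (\<lambda>v. \<Gamma> (as @ v # bs') y)" if "y \<in> U" for y
        using slot_linearD(2)[OF Suc.IH[OF that kn] ab(1) w(2) len] .
      have add: "\<Gamma> (as @ (v + v') # bs) x = \<Gamma> (as @ v # bs) x + \<Gamma> (as @ v' # bs) x"
        if v: "v \<in> points E" "v' \<in> points E" for v v'
      proof (rule limitin_unique[OF lim _ at_zero_neq_bot])
        show "v + v' \<in> points E" using v by auto
        have "eventually (\<lambda>t. ?q v t + ?q v' t = ?q (v + v') t) (at 0)"
          using xU
        proof eventually_elim
          case (elim t)
          show ?case
            using linear_from_toD(2)[OF lin[OF elim] v] linear_from_toD(2)[OF lin[OF x] v]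
            by (simp add: scale_right_distrib scale_right_diff_distrib)
        qed
        from limitin_transform_eventually[OF this limitin_add[OF lim[OF v(1)] lim[OF v(2)]]]
        show "limitin (topo G) (?q (v + v')) (\<Gamma> (as @ v # bs) x + \<Gamma> (as @ v' # bs) x) (at 0)" .
      qed
      have scale: "\<Gamma> (as @ scl E c v # bs) x = scl G c (\<Gamma> (as @ v # bs) x)"
        if v: "v \<in> points E" for v c
      proof (rule limitin_unique[OF lim _ at_zero_neq_bot])
        show "scl E c v \<in> points E" using v by auto
        have "eventually (\<lambda>t. scl G c (?q v t) = ?q (scl E c v) t) (at 0)"
          using xU
        proof eventually_elim
          case (elim t)
          show ?case
            using linear_from_toD(3)[OF lin[OF elim] v] linear_from_toD(3)[OF lin[OF x] v]
            by (simp flip: scale_right_diff_distrib add: mult.commute)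
        qed
        from limitin_transform_eventually[OF this limitin_scale[OF lim[OF v]]]
        show "limitin (topo G) (?q (scl E c v)) (scl G c (\<Gamma> (as @ v # bs) x)) (at 0)" .
      qed
      have "\<Gamma> (as @ v # bs) x \<in> points G" if "v \<in> points E" for v
        using lim[OF that] by (simp add: limitin_def)
      then show ?thesis using add scale by (simp add: linear_from_to_def)
    qed
  qed
qed

text \<open>Both claims go through one induction: the bound on a subtree keeps the arguments of its
  parent in a \<open>p\<close>-bounded set, which \<open>solve_tendsto\<close> needs. All tuples in
  \<open>Q\<close> come from the unit ball of \<open>p\<close> on \<open>E\<close>, and the
  convergence is uniform over them.\<close>

lemma tree_value_tendsto:
  assumes x: "x \<in> U" and p: "H.Keller_seminorm \<Phi> (h x) L p" "1 \<le> L" "enat L \<le> k"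
    and Q: "\<And>us. us \<in> Q \<Longrightarrow> set us \<subseteq> {u \<in> points E. p (u, 0) < 1} \<and> length us = n"
  shows "well_formed L n T \<Longrightarrow> (\<exists>B. \<forall>us\<in>Q. N (tree_value x ((!) us) T) \<le> B) \<and>
    ((\<lambda>(v, us). N (tree_value (x + v) ((!) us) T - tree_value x ((!) us) T)) \<longlongrightarrow> 0) (zero_filter E \<times>\<^sub>F principal Q)"
proof (induction T)
  let ?F = "zero_filter E \<times>\<^sub>F principal Q"
  have p': "cont_seminorm (E \<times>\<^sub>t G) p" by (rule H.Keller_seminormD(1)[OF p(1)])
  have fst: "filterlim fst (zero_filter E) ?F" by (rule filterlim_fst)
  have snd: "eventually (\<lambda>a. snd a \<in> Q) ?F"
    unfolding eventually_prod_filter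
    by (rule exI[of _ "\<lambda>_. True"], rule exI[of _ "\<lambda>us. us \<in> Q"]) (simp add: eventually_principal)
  have xU: "eventually (\<lambda>a. x + fst a \<in> U) ?F"
    using fst E.eventually_zero_filter_add[OF U x] unfolding filterlim_iff by blast
  \<comment> \<open>\<open>solve x\<close> maps \<open>p\<close>-bounded arguments to
    \<open>N\<close>-bounded values, with a constant that depends only on the bound and the
    arity.\<close>
  have opb: "\<exists>B'. \<forall>ws. set ws \<subseteq> points (E \<times>\<^sub>t G) \<and> length ws = m \<and> (\<forall>i<m. p (ws ! i) \<le> B) \<longrightarrow> N (solve x ws) \<le> B'"
    if m: "m \<le> L" for m B
  proof -
    have km: "enat m \<le> k" using enat_le_trans[OF m p(3)] .
    obtain B' where B': "\<And>us. set us \<subseteq> points (E \<times>\<^sub>t G) \<Longrightarrow> length us = m \<Longrightarrow> (\<And>i. i < m \<Longrightarrow> p (us ! i) \<le> B) \<Longrightarrow>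
      N (\<Phi> us (h x)) \<le> B'" using H.Keller_seminorm_bounded[OF p(1) m] by metis
    have "N (solve x ws) \<le> M * B'"
      if ws: "set ws \<subseteq> points (E \<times>\<^sub>t G)" "length ws = m" "\<forall>i<m. p (ws ! i) \<le> B" for ws
    proof -
      have o: "solve x ws \<in> points G" "\<Phi> [(0, solve x ws)] (h x) = - \<Phi> ws (h x)"
        using solve[OF x ws(1)] ws(2) km by auto
      have "N (solve x ws) \<le> M * N (- \<Phi> ws (h x))" using bound[OF x o(1)] o(2) by simp
      also have "N (- \<Phi> ws (h x)) = N (\<Phi> ws (h x))"
        using slot_linearD(1)[OF slot[OF x km] ws(1,2)] by (rule N_minus)
      also have "M * \<dots> \<le> M * B'" using ws M by (intro mult_left_mono B') auto
      finally show ?thesis .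
    qed
    then show ?thesis by blast
  qed
  have Qi: "us ! i \<in> points E" "p (us ! i, 0) < 1" if "us \<in> Q" "i < n" for us i
  proof -
    have "us ! i \<in> {u \<in> points E. p (u, 0) < 1}" using Q[OF that(1)] that(2) by (metis nth_mem subsetD)
    then show "us ! i \<in> points E" "p (us ! i, 0) < 1" by auto
  qed
  {
    case (Leaf i)
    then have i: "i < n" by simp
    have "\<forall>us\<in>Q. set [(us ! i, 0)] \<subseteq> points (E \<times>\<^sub>t G) \<and> length [(us ! i, 0::'g)] = 1 \<and>
        (\<forall>j<1. p ([(us ! i, 0)] ! j) \<le> 1)"
      using Qi[OF _ i] by (auto simp: points_prod less_imp_le)
    moreover obtain B' where "\<And>ws. set ws \<subseteq> points (E \<times>\<^sub>t G) \<and> length ws = 1 \<and> (\<forall>j<1. p (ws ! j) \<le> 1) \<Longrightarrow>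
        N (solve x ws) \<le> B'" using opb[OF p(2), of 1] by blast
    ultimately have "\<forall>us\<in>Q. N (tree_value x ((!) us) (Leaf i)) \<le> B'" by simp
    then have "\<exists>B. \<forall>us\<in>Q. N (tree_value x ((!) us) (Leaf i)) \<le> B" by blast
    moreover have "((\<lambda>a. N (solve (x + fst a) [(snd a ! i, 0)] - solve x [(snd a ! i, 0)])) \<longlongrightarrow> 0) ?F"
    proof (rule solve_tendsto[OF x fst p(1,2) p(2,3)])
      show "eventually (\<lambda>a. set [(snd a ! i, 0)] \<subseteq> points (E \<times>\<^sub>t G) \<and> length [(snd a ! i, 0::'g)] = 1 \<and>
        set [(snd a ! i, 0)] \<subseteq> points (E \<times>\<^sub>t G) \<and> length [(snd a ! i, 0::'g)] = 1 \<and>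
        (\<forall>j<1. p ([(snd a ! i, 0)] ! j) \<le> 1)) ?F"
        using snd by eventually_elim (use Qi[OF _ i] in \<open>auto simp: points_prod less_imp_le\<close>)
      show "((\<lambda>a. p ([(snd a ! i, 0)] ! j - [(snd a ! i, 0)] ! j)) \<longlongrightarrow> 0) ?F" for j
        using H.E.seminorm_zero[OF p'] by simp
    qed
    ultimately show ?case by (simp add: case_prod_beta')
  next
    case (Node ts)
    have len: "length ts \<le> L" and ts: "\<And>t. t \<in> set ts \<Longrightarrow> well_formed L n t" using Node.prems by auto
    have "cont_seminorm G (\<lambda>v. p (0, v))" by (rule seminorm_inr[OF E.lcs lcs p'])
    then obtain c where c: "c > 0" "\<And>v. v \<in> points G \<Longrightarrow> p (0, v) \<le> c * N v" using seminorm_le_N by metis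
    have "\<forall>t\<in>set ts. \<exists>B. \<forall>us\<in>Q. N (tree_value x ((!) us) t) \<le> B" using Node.IH ts by blast
    then obtain Bf where Bf: "\<And>t us. t \<in> set ts \<Longrightarrow> us \<in> Q \<Longrightarrow> N (tree_value x ((!) us) t) \<le> Bf t" by metis
    define B where "B = Max (insert 0 (Bf ` set ts))"
    have B: "N (tree_value x ((!) us) t) \<le> B" if "t \<in> set ts" "us \<in> Q" for t us
    proof -
      have "Bf t \<le> B" unfolding B_def by (rule Max_ge) (use that in auto)
      then show ?thesis using Bf[OF that] by linarith
    qed
    have hin: "node y ((!) us) t \<in> points (E \<times>\<^sub>t G)" if "t \<in> set ts" "us \<in> Q" "y \<in> U" for t us y
      using node_in[OF that(3) p(3), of n "(!) us" t] Qi(1)[OF that(2)] ts[OF that(1)] by blast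
    \<comment> \<open>The \<open>E\<close>-part of an argument is a direction in the unit ball or 0,
      the \<open>G\<close>-part is bounded by \<open>c * B\<close>.\<close>
    have hB: "p (node x ((!) us) t) \<le> 1 + c * B" if t: "t \<in> set ts" "us \<in> Q" for t us
    proof -
      have "lead ((!) us) t \<in> points E" "tree_value x ((!) us) t \<in> points G" using hin[OF t x] by (auto simp: points_prod)
      then have "p (node x ((!) us) t) \<le> p (lead ((!) us) t, 0) + p (0, tree_value x ((!) us) t)"
        by (rule seminorm_pair_le[OF E.lcs lcs p'])
      also have "p (lead ((!) us) t, 0) \<le> 1"
        using ts[OF t(1)] Qi(2)[OF t(2)] H.E.seminorm_zero[OF p'] by (cases t) (auto simp: zero_prod_def less_imp_le)
      also have "p (0, tree_value x ((!) us) t) \<le> c * N (tree_value x ((!) us) t)"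
        using hin[OF t x] by (intro c(2)) (auto simp: points_prod)
      also have "\<dots> \<le> c * B" using B[OF t] c(1) by simp
      finally show ?thesis by simp
    qed
    have L1: "set (map (node y ((!) us)) ts) \<subseteq> points (E \<times>\<^sub>t G)" if "us \<in> Q" "y \<in> U" for us y
      using hin that by auto
    have "\<exists>B. \<forall>us\<in>Q. N (tree_value x ((!) us) (Node ts)) \<le> B"
    proof -
      obtain B' where "\<And>ws. set ws \<subseteq> points (E \<times>\<^sub>t G) \<and> length ws = length ts \<and> (\<forall>i<length ts. p (ws ! i) \<le> 1 + c * B) \<Longrightarrow>
          N (solve x ws) \<le> B'" using opb[OF len, of "1 + c * B"] by blast
      then have "N (tree_value x ((!) us) (Node ts)) \<le> B'" if "us \<in> Q" for us
        using L1[OF that x] hB[OF _ that] by simp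
      then show ?thesis by blast
    qed
    moreover have "((\<lambda>a. N (solve (x + fst a) (map (node (x + fst a) ((!) (snd a))) ts) - solve x (map (node x ((!) (snd a))) ts))) \<longlongrightarrow> 0) ?F"
    proof (rule solve_tendsto[OF x fst p(1,2) len p(3)])
      show "eventually (\<lambda>a. set (map (node (x + fst a) ((!) (snd a))) ts) \<subseteq> points (E \<times>\<^sub>t G) \<and>
        length (map (node (x + fst a) ((!) (snd a))) ts) = length ts \<and>
        set (map (node x ((!) (snd a))) ts) \<subseteq> points (E \<times>\<^sub>t G) \<and> length (map (node x ((!) (snd a))) ts) = length ts \<and>
        (\<forall>i<length ts. p (map (node x ((!) (snd a))) ts ! i) \<le> 1 + c * B)) ?F"
        using snd xU by eventually_elim (use L1 x hB in simp)
      fix i assume i: "i < length ts"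
      then have ti: "ts ! i \<in> set ts" by simp
      have "((\<lambda>a. c * N (tree_value (x + fst a) ((!) (snd a)) (ts ! i) - tree_value x ((!) (snd a)) (ts ! i))) \<longlongrightarrow> c * 0) ?F"
        using Node.IH[OF ti] ts[OF ti] by (intro tendsto_intros) (simp add: case_prod_beta')
      then have l: "((\<lambda>a. c * N (tree_value (x + fst a) ((!) (snd a)) (ts ! i) - tree_value x ((!) (snd a)) (ts ! i))) \<longlongrightarrow> 0) ?F"
        by simp
      have in2: "eventually (\<lambda>a. tree_value (x + fst a) ((!) (snd a)) (ts ! i) - tree_value x ((!) (snd a)) (ts ! i) \<in> points G) ?F"
        using snd xU
      proof eventually_elim
        case (elim a)
        show ?case using hin[OF ti elim] hin[OF ti elim(1) x] by (auto simp: points_prod)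
      qed
      have eq: "p (map (node (x + fst a) ((!) (snd a))) ts ! i - map (node x ((!) (snd a))) ts ! i) =
          p (0, tree_value (x + fst a) ((!) (snd a)) (ts ! i) - tree_value x ((!) (snd a)) (ts ! i))" for a
        using i by simp
      show "((\<lambda>a. p (map (node (x + fst a) ((!) (snd a))) ts ! i - map (node x ((!) (snd a))) ts ! i)) \<longlongrightarrow> 0) ?F"
        unfolding eq
      proof (rule tendsto_sandwich[OF _ _ tendsto_const l])
        show "eventually (\<lambda>a. 0 \<le> p (0, tree_value (x + fst a) ((!) (snd a)) (ts ! i) - tree_value x ((!) (snd a)) (ts ! i))) ?F"
          by (rule eventually_mono[OF in2]) (auto intro!: H.E.seminorm_nonneg[OF p'] simp: points_prod)
        show "eventually (\<lambda>a. p (0, tree_value (x + fst a) ((!) (snd a)) (ts ! i) - tree_value x ((!) (snd a)) (ts ! i)) \<le>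
           c * N (tree_value (x + fst a) ((!) (snd a)) (ts ! i) - tree_value x ((!) (snd a)) (ts ! i))) ?F"
          by (rule eventually_mono[OF in2]) (rule c(2))
      qed
    qed
    ultimately show ?case by (simp add: case_prod_beta')
  }
qed

text \<open>Order 0 is continuity of \<open>g\<close>. For higher orders the seminorm on
  \<open>E\<close> is the restriction of a Keller seminorm of \<open>f\<close> to the first factor,
  and the estimates for the trees are added up.\<close>

lemma \<Gamma>_Keller:
  assumes x: "x \<in> U" and l: "enat l \<le> k"
  shows "\<exists>p K. cont_seminorm E p \<and> mbound (points E) p N l K (\<lambda>us. \<Gamma> us x) \<and>
          (\<forall>\<epsilon>>0. eventually (\<lambda>v. mbound (points E) p N l \<epsilon> (\<lambda>us. \<Gamma> us (x + v) - \<Gamma> us x)) (zero_filter E))"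
proof (cases l)
  case 0
  obtain p where p: "cont_seminorm E p" by (rule E.seminorm_exists)
  have "mbound (points E) p N 0 (N (g x)) (\<lambda>us. \<Gamma> us x)" by (simp add: mbound_def \<Gamma>_def)
  moreover have "eventually (\<lambda>v. mbound (points E) p N 0 \<epsilon> (\<lambda>us. \<Gamma> us (x + v) - \<Gamma> us x)) (zero_filter E)"
    if "\<epsilon> > 0" for \<epsilon>
  proof -
    have "((\<lambda>v. N (g (x + v) - g x)) \<longlongrightarrow> 0) (zero_filter E)" using g_cont[OF x] by (simp add: limitin_N)
    then have "eventually (\<lambda>v. N (g (x + v) - g x) < \<epsilon>) (zero_filter E)" using that by (rule order_tendstoD)
    then show ?thesis by eventually_elim (simp add: mbound_def \<Gamma>_def)
  qed
  ultimately show ?thesis using p 0 by blast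
next
  case (Suc n)
  have Lk: "enat (Suc n) \<le> k" using l Suc by simp
  obtain p where p: "H.Keller_seminorm \<Phi> (h x) (Suc n) p" using H.Keller_seminorm_exists[OF C[OF gD[OF x]] Lk] .
  define q where "q u = p (u, 0)" for u
  have q: "cont_seminorm E q" unfolding q_def by (rule seminorm_inl[OF E.lcs lcs H.Keller_seminormD(1)[OF p]])
  define Q where "Q = {us. set us \<subseteq> {u \<in> points E. p (u, 0) < 1} \<and> length us = Suc n}"
  have Q: "set us \<subseteq> {u \<in> points E. p (u, 0) < 1} \<and> length us = Suc n" if "us \<in> Q" for us
    using that by (simp add: Q_def)
  let ?TR = "derivative_trees (Suc n)" and ?F = "zero_filter E \<times>\<^sub>F principal Q"
  have "(\<exists>B. \<forall>us\<in>Q. N (tree_value x ((!) us) T) \<le> B) \<and>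
    ((\<lambda>(v, us). N (tree_value (x + v) ((!) us) T - tree_value x ((!) us) T)) \<longlongrightarrow> 0) ?F" if T: "T \<in> set ?TR" for T
    using tree_value_tendsto[OF x p _ Lk Q well_formed_derivative_trees[OF T]] by simp
  then have T1: "\<And>T. T \<in> set ?TR \<Longrightarrow> \<exists>B. \<forall>us\<in>Q. N (tree_value x ((!) us) T) \<le> B"
    and T2: "\<And>T. T \<in> set ?TR \<Longrightarrow> ((\<lambda>a. N (tree_value (x + fst a) ((!) (snd a)) T - tree_value x ((!) (snd a)) T)) \<longlongrightarrow> 0) ?F"
    by (simp_all add: case_prod_beta')
  have pts: "tree_value y ((!) us) T \<in> points G" if "T \<in> set ?TR" "us \<in> Q" "y \<in> U" for T us y
    using tree_value_in[OF that(3) Lk, of "Suc n" "(!) us" T] well_formed_derivative_trees[OF that(1)] Q[OF that(2)] nth_mem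
    by (auto simp: subset_iff)
  have N_sum_list: "N (\<Sum>T\<leftarrow>xs. a T) \<le> (\<Sum>T\<leftarrow>xs. N (a T))" if "\<And>T. T \<in> set xs \<Longrightarrow> a T \<in> points G" for xs :: "tree list" and a
    using that
  proof (induction xs)
    case (Cons T xs)
    have "a T \<in> points G" "(\<Sum>T\<leftarrow>xs. a T) \<in> points G" using Cons.prems by (auto intro!: sum_list_points)
    then show ?case using N_add[of "a T" "\<Sum>T\<leftarrow>xs. a T"] Cons by simp
  qed simp
  obtain Bf where Bf: "\<And>T us. T \<in> set ?TR \<Longrightarrow> us \<in> Q \<Longrightarrow> N (tree_value x ((!) us) T) \<le> Bf T" using T1 by metis
  have bd: "mbound (points E) q N (Suc n) (\<Sum>T\<leftarrow>?TR. Bf T) (\<lambda>us. \<Gamma> us x)"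
  proof (rule EG.mbound_of_ball[OF q \<Gamma>_slot_linear[OF x Lk]])
    fix us assume us: "set us \<subseteq> points E" "length us = Suc n" "\<forall>u\<in>set us. q u < 1"
    then have usQ: "us \<in> Q" by (auto simp: Q_def q_def)
    have "N (\<Gamma> us x) \<le> (\<Sum>T\<leftarrow>?TR. N (tree_value x ((!) us) T))"
      using us pts[OF _ usQ x] by (auto simp: \<Gamma>_def intro!: N_sum_list simp del: derivative_trees.simps)
    also have "\<dots> \<le> (\<Sum>T\<leftarrow>?TR. Bf T)" using Bf usQ by (intro sum_list_mono) auto
    finally show "N (\<Gamma> us x) \<le> (\<Sum>T\<leftarrow>?TR. Bf T)" .
  qed
  moreover have "eventually (\<lambda>v. mbound (points E) q N (Suc n) \<epsilon> (\<lambda>us. \<Gamma> us (x + v) - \<Gamma> us x)) (zero_filter E)"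
    if eps: "\<epsilon> > 0" for \<epsilon>
  proof -
    have "((\<lambda>a. \<Sum>T\<leftarrow>xs. N (tree_value (x + fst a) ((!) (snd a)) T - tree_value x ((!) (snd a)) T)) \<longlongrightarrow> 0) ?F"
      if "set xs \<subseteq> set ?TR" for xs
      using that
    proof (induction xs)
      case (Cons T xs)
      then have "((\<lambda>a. N (tree_value (x + fst a) ((!) (snd a)) T - tree_value x ((!) (snd a)) T) +
          (\<Sum>T\<leftarrow>xs. N (tree_value (x + fst a) ((!) (snd a)) T - tree_value x ((!) (snd a)) T))) \<longlongrightarrow> 0 + 0) ?F"
        by (intro tendsto_add T2) auto
      then show ?case by simp
    qed simp
    from order_tendstoD(2)[OF this[OF order_refl] eps]
    have "eventually (\<lambda>a. (\<Sum>T\<leftarrow>?TR. N (tree_value (x + fst a) ((!) (snd a)) T - tree_value x ((!) (snd a)) T)) < \<epsilon>) ?F" .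
    \<comment> \<open>A product with a principal filter splits into a neighbourhood \<open>P\<close>
      for \<open>v\<close> and all of \<open>Q\<close>, so one neighbourhood serves all
      directions.\<close>
    then obtain P R where P: "eventually P (zero_filter E)" and R: "eventually R (principal Q)"
      and PR: "\<And>v us. P v \<Longrightarrow> R us \<Longrightarrow> (\<Sum>T\<leftarrow>?TR. N (tree_value (x + v) ((!) us) T - tree_value x ((!) us) T)) < \<epsilon>"
      unfolding eventually_prod_filter by auto
    show ?thesis
      using P E.eventually_zero_filter_add[OF U x]
    proof eventually_elim
      case (elim v)
      show ?case
      proof (rule EG.mbound_of_ball[OF q EG.slot_linear_diff[OF \<Gamma>_slot_linear[OF elim(2) Lk] \<Gamma>_slot_linear[OF x Lk]]])
        fix us assume us: "set us \<subseteq> points E" "length us = Suc n" "\<forall>u\<in>set us. q u < 1"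
        then have usQ: "us \<in> Q" by (auto simp: Q_def q_def)
        then have Rus: "R us" using R by (simp add: eventually_principal)
        have "\<Gamma> us (x + v) - \<Gamma> us x = (\<Sum>T\<leftarrow>?TR. tree_value (x + v) ((!) us) T - tree_value x ((!) us) T)"
          using us unfolding \<Gamma>_def sum_list_map_diff[symmetric] by auto
        also have "N \<dots> \<le> (\<Sum>T\<leftarrow>?TR. N (tree_value (x + v) ((!) us) T - tree_value x ((!) us) T))"
          using pts[OF _ usQ x] pts[OF _ usQ elim(2)] by (intro N_sum_list) auto
        finally show "N (\<Gamma> us (x + v) - \<Gamma> us x) \<le> \<epsilon>" using PR[OF elim(1) Rus] by linarith
      qed
    qed
  qed
  ultimately show ?thesis using q Suc by blast
qed

lemma \<Gamma>_Ck: "x \<in> U \<Longrightarrow> EG.Ck_norm_at k \<Gamma> x"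
  unfolding EG.Ck_norm_at_def using \<Gamma>_slot_linear \<Gamma>_Keller \<Gamma>_deriv by blast

theorem implicit_Ck_pi: "Ck_pi k E G (\<lambda>x. if x \<in> U then Some (g x) else None)"
  by (rule Ck_piI[OF E.lcs lcs U, where \<Phi> = \<Gamma>])
    (simp_all add: \<Gamma>_def[of "[]"] EG.Ck_at_of_Ck_norm_at[OF U \<Gamma>_Ck])

end

section \<open>The implicit function theorem for Banachable targets\<close>

text \<open>The difference quotients of \<open>f\<close> in direction \<open>(0, v)\<close> and
  those of the partial map \<open>y' \<mapsto> f (x, y')\<close> are the same terms.\<close>

lemma partial2_eq:
  assumes f: "Ck_pi k (E \<times>\<^sub>t G) G f" and k: "1 \<le> k" and lE: "lcs E"
    and xy: "(x, y) \<in> dom f" and v: "v \<in> points G"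
  shows "partial2 G f x y v = Some (dlist (E \<times>\<^sub>t G) G f [(0, v)] (x, y))"
proof -
  interpret E: lcs_space E by standard fact
  have "has_dir_deriv G G v (\<lambda>y'. f (x, y')) y L \<longleftrightarrow> has_dir_deriv (E \<times>\<^sub>t G) G (0, v) f (x, y) L" for L
    unfolding has_dir_deriv_def by (simp add: scl_prod domIff)
  then have "has_dir_deriv G G v (\<lambda>y'. f (x, y')) y = has_dir_deriv (E \<times>\<^sub>t G) G (0, v) f (x, y)" by (rule ext)
  then have "dir_deriv G G v (\<lambda>y'. f (x, y')) y = dir_deriv (E \<times>\<^sub>t G) G (0, v) f (x, y)"
    by (simp add: dir_deriv_def)
  moreover have "fold (dir_deriv (E \<times>\<^sub>t G) G) [(0, v)] f (x, y) = Some (dlist (E \<times>\<^sub>t G) G f [(0, v)] (x, y))"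
    using k v by (intro Ck_piD(6)[OF f _ _ xy]) (auto simp: points_prod one_enat_def)
  ultimately show ?thesis using v by (simp add: partial2_def restrict_map_def)
qed

lemma partial2_bijective_iff:
  assumes f: "Ck_pi k (E \<times>\<^sub>t G) G f" and k: "1 \<le> k" and lE: "lcs E" and xy: "(x, y) \<in> dom f"
  shows "partial2_bijective G f x y \<longleftrightarrow>
    bij_betw (\<lambda>v. dlist (E \<times>\<^sub>t G) G f [(0, v)] (x, y)) (points G) (points G)"
proof -
  note eq = partial2_eq[OF f k lE xy]
  have "dom (partial2 G f x y) = points G"
    using eq by (auto simp: dom_def partial2_def restrict_map_def split: if_splits)
  moreover have "bij_betw (\<lambda>v. the (partial2 G f x y v)) (points G) (points G) \<longleftrightarrow>
    bij_betw (\<lambda>v. dlist (E \<times>\<^sub>t G) G f [(0, v)] (x, y)) (points G) (points G)"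
    by (rule bij_betw_cong) (simp add: eq)
  ultimately show ?thesis by (simp add: partial2_bijective_def)
qed

text \<open>Beyond the solution the conclusion records what the lifting to higher indices uses:
  \<open>U\<close> is star-shaped about \<open>x0\<close>, the solution is unique in all of
  \<open>V\<close>, and the partial derivative stays bijective on \<open>U \<times> V\<close>, not
  only along the graph.\<close>

theorem implicit_function:
  fixes E :: "('k::real_or_complex, 'e::ab_group_add) tvs" and G :: "('k, 'g::ab_group_add) tvs"
  assumes lE: "lcs E" and bG: "banachable G" and f: "Ck_pi k (E \<times>\<^sub>t G) G f" and k: "1 \<le> k"
    and z0: "f (x0, y0) = Some b" and bij0: "partial2_bijective G f x0 y0"
    and W0: "openin (topo (E \<times>\<^sub>t G)) W0" "(x0, y0) \<in> W0"
  obtains U V g where "openin (topo E) U" "x0 \<in> U" "openin (topo G) V" "y0 \<in> V"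
    "\<And>x s. x \<in> U \<Longrightarrow> 0 \<le> s \<Longrightarrow> s \<le> 1 \<Longrightarrow> x0 + scl E (of_real s) (x - x0) \<in> U"
    "U \<times> V \<subseteq> W0 \<inter> dom f" "\<And>x. x \<in> U \<Longrightarrow> g x \<in> V"
    "\<And>x y. x \<in> U \<Longrightarrow> y \<in> V \<Longrightarrow> f (x, y) = Some b \<longleftrightarrow> y = g x"
    "\<And>x y. x \<in> U \<Longrightarrow> y \<in> V \<Longrightarrow> partial2_bijective G f x y"
    "\<And>x. x \<in> U \<Longrightarrow> limitin (topo G) (\<lambda>v. g (x + v)) (g x) (zero_filter E)"
    "Ck_pi k E G (\<lambda>x. if x \<in> U then Some (g x) else None)"
proof -
  obtain N where "banach_tvs G N" using banachable_banach_tvs[OF bG] by blast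
  then interpret G: banach_tvs G N .
  interpret E: lcs_space E by standard fact
  interpret H: to_banach "E \<times>\<^sub>t G" G N by unfold_locales (rule lcs_tvs_prod[OF lE G.lcs])
  let ?\<Phi> = "dlist (E \<times>\<^sub>t G) G f" and ?D = "dom f" and ?z0 = "(x0, y0)"
  have oD: "openin (topo (E \<times>\<^sub>t G)) ?D" using f by (rule Ck_piD)
  have C: "H.Ck_norm_at k ?\<Phi> z" if "z \<in> ?D" for z
    by (rule H.Ck_norm_at_of_Ck_at[OF oD Ck_piD(5)[OF f] that])
  have k0: "enat 0 \<le> k" "enat 1 \<le> k" "enat (Suc 0) \<le> k" using k by (auto simp: one_enat_def zero_enat_def[symmetric])
  have slot: "slot_linear (E \<times>\<^sub>t G) G m (\<lambda>us. ?\<Phi> us z)" if "z \<in> ?D" "enat m \<le> k" for z m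
    using C[OF that(1)] that(2) unfolding H.Ck_norm_at_def by blast
  have f_eq: "f z = Some (?\<Phi> [] z)" if "z \<in> ?D" for z using that by auto
  have zD: "?z0 \<in> ?D" using z0 by blast
  then have zH: "?z0 \<in> points (E \<times>\<^sub>t G)" using oD openin_subset by blast
  then have x0: "x0 \<in> points E" and y0: "y0 \<in> points G" by (simp_all add: points_prod)
  have bG': "b \<in> points G" using Ck_piD(2)[OF f] z0 by (auto simp: ran_def)
  have Q_linear: "linear_from_to G G (\<lambda>v. ?\<Phi> [(0, v)] z)" if z: "z \<in> ?D" for z
  proof -
    have "linear_from_to (E \<times>\<^sub>t G) G (\<lambda>v. ?\<Phi> ([] @ v # []) z)"
      by (rule slot_linearD(2)[OF slot[OF z k0(2)]]) auto
    moreover have "linear_from_to G (E \<times>\<^sub>t G) (\<lambda>v. (0, v))"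
      using cont_linear_inr[OF lE G.lcs] by (simp add: cont_linear_def)
    ultimately show ?thesis by (auto dest: linear_from_to_compose)
  qed
  obtain p where p: "H.Keller_seminorm ?\<Phi> ?z0 1 p" using H.Keller_seminorm_exists[OF C[OF zD] k0(2)] .
  note ks = H.Keller_seminormD[OF p]
  define A where "A v = ?\<Phi> [(0, v)] ?z0" for v
  have A: "linear_from_to G G A" unfolding A_def by (rule Q_linear[OF zD])
  have Abij: "bij_betw A (points G) (points G)"
    using bij0 partial2_bijective_iff[OF f k lE zD] unfolding A_def by simp
  have "cont_seminorm G (\<lambda>v. p (0, v))" by (rule seminorm_inr[OF lE G.lcs ks(1)])
  then obtain c where c: "c > 0" "\<And>v. v \<in> points G \<Longrightarrow> p (0, v) \<le> c * N v" using G.seminorm_le_N by metis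
  obtain K where K: "K \<ge> 0" "mbound (points (E \<times>\<^sub>t G)) p N 1 K (\<lambda>us. ?\<Phi> us ?z0)" using ks(3)[of 1] by auto
  have AK: "N (A v) \<le> K * c * N v" if v: "v \<in> points G" for v
  proof -
    have "N (A v) \<le> K * p (0, v)"
      using mboundD[OF K(2), of "[(0, v)]"] v by (simp add: A_def points_prod)
    also have "\<dots> \<le> K * (c * N v)" using c(2)[OF v] K(1) by (rule mult_left_mono)
    finally show ?thesis by (simp add: mult.assoc)
  qed
  obtain M where M: "M > 0" "\<And>v. v \<in> points G \<Longrightarrow> N v \<le> M * N (A v)"
    using G.bounded_inverse[OF A Abij AK] by metis
  \<comment> \<open>Since \<open>p (0, v) \<le> c * N v\<close>, this \<epsilon> keeps the partial
    derivative within \<open>1 / (2 * M)\<close> of \<open>A\<close>, the tolerance of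
    \<open>perturbed_bij\<close> and \<open>near_linear_solve\<close>.\<close>
  define \<epsilon> where "\<epsilon> = 1 / (2 * M * c)"
  have eps: "\<epsilon> > 0" using M c by (simp add: \<epsilon>_def)
  have "eventually (\<lambda>v. ?z0 + v \<in> ?D \<and> ?z0 + v \<in> W0 \<and>
      mbound (points (E \<times>\<^sub>t G)) p N 1 \<epsilon> (\<lambda>us. ?\<Phi> us (?z0 + v) - ?\<Phi> us ?z0)) (zero_filter (E \<times>\<^sub>t G))"
    using H.E.eventually_zero_filter_add[OF oD zD] H.E.eventually_zero_filter_add[OF W0] ks(4)[of 1 \<epsilon>] eps
    by (auto intro: eventually_conj)
  then obtain q where q: "cont_seminorm (E \<times>\<^sub>t G) q" "\<And>v. v \<in> points (E \<times>\<^sub>t G) \<Longrightarrow> q v < 1 \<Longrightarrow> ?z0 + v \<in> ?D"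
    "\<And>v. v \<in> points (E \<times>\<^sub>t G) \<Longrightarrow> q v < 1 \<Longrightarrow> ?z0 + v \<in> W0"
    "\<And>v. v \<in> points (E \<times>\<^sub>t G) \<Longrightarrow> q v < 1 \<Longrightarrow>
       mbound (points (E \<times>\<^sub>t G)) p N 1 \<epsilon> (\<lambda>us. ?\<Phi> us (?z0 + v) - ?\<Phi> us ?z0)"
    unfolding H.E.eventually_zero_filter by blast
  have "cont_seminorm G (\<lambda>v. q (0, v))" by (rule seminorm_inr[OF lE G.lcs q(1)])
  then obtain cq where cq: "cq > 0" "\<And>v. v \<in> points G \<Longrightarrow> q (0, v) \<le> cq * N v" using G.seminorm_le_N by metis
  \<comment> \<open>The unit ball of \<open>q\<close> is shared equally: \<open>V\<close> uses one
    half, \<open>U\<close> the other.\<close>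
  define r where "r = 1 / (2 * cq)"
  have r: "r > 0" "cq * r = 1 / 2" using cq by (simp_all add: r_def)
  \<comment> \<open>This is the starting defect \<open>(r / 2) / (2 * M)\<close> that
    \<open>near_linear_solve\<close> allows for radius \<open>r / 2\<close>. Order 0 of Keller's
    condition is continuity of \<open>f\<close> at the base point.\<close>
  have "r / (4 * M) > 0" using r M by simp
  from ks(4)[of 0, OF _ this] obtain q' where q': "cont_seminorm (E \<times>\<^sub>t G) q'"
    "\<And>v. v \<in> points (E \<times>\<^sub>t G) \<Longrightarrow> q' v < 1 \<Longrightarrow>
       mbound (points (E \<times>\<^sub>t G)) p N 0 (r / (4 * M)) (\<lambda>us. ?\<Phi> us (?z0 + v) - ?\<Phi> us ?z0)"
    unfolding H.E.eventually_zero_filter by auto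
  define s where "s u = q (u, 0) + q' (u, 0)" for u
  have s: "cont_seminorm E s" unfolding s_def
    by (intro E.seminorm_plus seminorm_inl[OF lE G.lcs] q(1) q'(1))
  have s_le: "q (u, 0) \<le> s u" "q' (u, 0) \<le> s u" if "u \<in> points E" for u
    using H.E.seminorm_nonneg[OF q(1), of "(u, 0)"] H.E.seminorm_nonneg[OF q'(1), of "(u, 0)"] that
    by (simp_all add: s_def points_prod)
  \<comment> \<open>A seminorm ball about \<open>x0\<close>, hence star-shaped; the summand
    \<open>q'\<close> of \<open>s\<close> controls the starting defect.\<close>
  define U where "U = {x \<in> points E. s (x - x0) < 1 / 2}"
  define V where "V = {y \<in> points G. N (y - y0) < r}"
  have U: "openin (topo E) U" "x0 \<in> U" and UE: "\<And>x. x \<in> U \<Longrightarrow> x \<in> points E"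
    using E.openin_seminorm_ball[OF s x0, of "1 / 2"] x0 E.seminorm_zero[OF s] by (auto simp: U_def)
  have V: "openin (topo G) V" "y0 \<in> V" and VG: "\<And>y. y \<in> V \<Longrightarrow> y \<in> points G"
    using G.openin_seminorm_ball[OF G.seminorm_N y0, of r] y0 r by (auto simp: V_def)
  have UV: "(x - x0, y - y0) \<in> points (E \<times>\<^sub>t G)" "q (x - x0, y - y0) < 1"
    "?z0 + (x - x0, y - y0) = (x, y)" if "x \<in> U" "y \<in> V" for x y
  proof -
    have xy: "x - x0 \<in> points E" "y - y0 \<in> points G" using UE[OF that(1)] VG[OF that(2)] x0 y0 by auto
    then show "(x - x0, y - y0) \<in> points (E \<times>\<^sub>t G)" by (simp add: points_prod)
    have "cq * N (y - y0) < cq * r" using that(2) cq(1) by (simp add: V_def)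
    then have "q (0, y - y0) < 1 / 2" using cq(2)[OF xy(2)] r by linarith
    moreover have "q (x - x0, 0) < 1 / 2" using s_le[OF xy(1)] that(1) by (auto simp: U_def)
    ultimately show "q (x - x0, y - y0) < 1" using seminorm_pair_le[OF lE G.lcs q(1) xy] by linarith
  qed simp
  have UVD: "(x, y) \<in> ?D" "(x, y) \<in> W0" if "x \<in> U" "y \<in> V" for x y
    using q(2,3)[OF UV(1,2)[OF that]] UV(3)[OF that] by auto
  have near: "N (?\<Phi> [(0, v)] (x, y) - A v) \<le> 1 / (2 * M) * N v"
    if xy: "x \<in> U" "y \<in> V" and v: "v \<in> points G" for x y v
  proof -
    have "N (?\<Phi> [(0, v)] (x, y) - A v) \<le> \<epsilon> * p (0, v)"
      using mboundD[OF q(4)[OF UV(1,2)[OF xy]], of "[(0, v)]"] v UV(3)[OF xy]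
      by (simp add: A_def points_prod)
    also have "\<dots> \<le> \<epsilon> * (c * N v)" using c(2)[OF v] eps by (intro mult_left_mono) auto
    also have "\<dots> = 1 / (2 * M) * N v" using c M by (simp add: \<epsilon>_def)
    finally show ?thesis .
  qed
  have bij: "bij_betw (\<lambda>v. ?\<Phi> [(0, v)] (x, y)) (points G) (points G)"
    and bound: "\<And>v. v \<in> points G \<Longrightarrow> N v \<le> 2 * M * N (?\<Phi> [(0, v)] (x, y))"
    if xy: "x \<in> U" "y \<in> V" for x y
    using G.perturbed_bij[OF A Abij M Q_linear[OF UVD(1)[OF xy]] near[OF xy]] by auto
  have \<Phi>0: "?\<Phi> [] (x, y) \<in> points G" if "x \<in> U" "y \<in> V" for x y
    using slot_linearD(1)[OF slot[OF UVD(1)[OF that] k0(1)], of "[]"] by simp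
  \<comment> \<open>The segment between \<open>y'\<close> and \<open>y\<close> stays in the ball
    \<open>V\<close>, so the mean value inequality applies with \<open>A (y - y')\<close> as the
    linear part.\<close>
  have lip: "N (?\<Phi> [] (x, y) - ?\<Phi> [] (x, y') - A (y - y')) \<le> 1 / (2 * M) * N (y - y')"
    if x: "x \<in> U" and y: "y \<in> V" "y' \<in> V" for x y y'
  proof -
    let ?d = "(0, y - y')"
    have yy: "y - y' \<in> points G" using VG y by auto
    have Vs: "y' + scl G (of_real t) (y - y') \<in> V" if t: "0 \<le> t" "t \<le> 1" for t
    proof -
      have "y' + scl G (of_real t) (y - y') - y0 = scl G (of_real t) (y - y0) + scl G (of_real (1 - t)) (y' - y0)"
        by (simp add: G.scale_right_diff_distrib G.scale_left_diff_distrib)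
      also have "N \<dots> \<le> N (scl G (of_real t) (y - y0)) + N (scl G (of_real (1 - t)) (y' - y0))"
        using VG y y0 by (intro G.N_add) auto
      also have "\<dots> = t * N (y - y0) + (1 - t) * N (y' - y0)"
        using VG y y0 t by (simp only: G.N_scale_real G.points_closed diff_ge_0_iff_ge)
      also have "\<dots> < r"
        using y t by (intro convex_bound_lt) (auto simp: V_def)
      finally show ?thesis using VG y unfolding V_def by blast
    qed
    have seg: "(x, y') + scl (E \<times>\<^sub>t G) (of_real t) ?d = (x, y' + scl G (of_real t) (y - y'))" for t
      by (simp add: scl_prod)
    have "N (?\<Phi> [] ((x, y') + ?d) - ?\<Phi> [] (x, y') - A (y - y')) \<le> 1 / (2 * M) * N (y - y')"
    proof (rule H.mean_value[where k = k])
      fix t :: real assume t: "0 \<le> t" "t \<le> 1"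
      show "H.Ck_norm_at k ?\<Phi> ((x, y') + scl (E \<times>\<^sub>t G) (of_real t) ?d)"
        unfolding seg by (rule C[OF UVD(1)[OF x Vs[OF t]]])
      show "N (?\<Phi> ([] @ [?d]) ((x, y') + scl (E \<times>\<^sub>t G) (of_real t) ?d) - A (y - y')) \<le> 1 / (2 * M) * N (y - y')"
        unfolding seg using near[OF x Vs[OF t] yy] by simp
    qed (use yy k0 G.linear_from_toD(1)[OF A] in \<open>auto simp: points_prod\<close>)
    then show ?thesis by simp
  qed
  \<comment> \<open>Absorbing the error of \<open>lip\<close> into the lower bound of
    \<open>A\<close> gives an inverse estimate; it yields uniqueness and, later, continuity of
    \<open>g\<close>.\<close>
  have expand: "N (y - y') \<le> 2 * M * N (?\<Phi> [] (x, y) - ?\<Phi> [] (x, y'))"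
    if x: "x \<in> U" and y: "y \<in> V" "y' \<in> V" for x y y'
  proof -
    have yy: "y - y' \<in> points G" using VG y by auto
    have pts: "A (y - y') \<in> points G" "?\<Phi> [] (x, y) - ?\<Phi> [] (x, y') \<in> points G"
      using G.linear_from_toD(1)[OF A yy] \<Phi>0[OF x y(1)] \<Phi>0[OF x y(2)] by auto
    have "N (A (y - y')) \<le> N (?\<Phi> [] (x, y) - ?\<Phi> [] (x, y')) + 1 / (2 * M) * N (y - y')"
      using G.N_le_add_diff[OF pts] G.N_diff_commute[OF pts] lip[OF x y] by simp
    then have "M * N (A (y - y')) \<le> M * (N (?\<Phi> [] (x, y) - ?\<Phi> [] (x, y')) + 1 / (2 * M) * N (y - y'))"
      using M by simp
    also have "\<dots> = M * N (?\<Phi> [] (x, y) - ?\<Phi> [] (x, y')) + N (y - y') / 2" using M by (simp add: algebra_simps)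
    finally show ?thesis using M(2)[OF yy] by simp
  qed
  have ex: "\<exists>y\<in>V. ?\<Phi> [] (x, y) = b" if x: "x \<in> U" for x
  proof -
    \<comment> \<open>The fixed point is sought in the closed ball of radius \<open>r / 2\<close>,
      which lies in the open ball \<open>V\<close>.\<close>
    have ball: "y \<in> V" if "y \<in> points G" "N (y - y0) \<le> r / 2" for y
      using that r by (auto simp: V_def)
    have xE: "x - x0 \<in> points E" using UE[OF x] x0 by auto
    obtain y where "y \<in> points G" "N (y - y0) \<le> r / 2" "?\<Phi> [] (x, y) = b"
    proof (rule G.near_linear_solve[OF A Abij M y0 bG', where r = "r / 2" and \<phi> = "\<lambda>y. ?\<Phi> [] (x, y)"])
      show "0 \<le> r / 2" using r by simp
      show "?\<Phi> [] (x, y) \<in> points G" if "y \<in> points G" "N (y - y0) \<le> r / 2" for y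
        by (rule \<Phi>0[OF x ball[OF that]])
      show "N (?\<Phi> [] (x, y) - ?\<Phi> [] (x, y') - A (y - y')) \<le> 1 / (2 * M) * N (y - y')"
        if "y \<in> points G" "N (y - y0) \<le> r / 2" "y' \<in> points G" "N (y' - y0) \<le> r / 2" for y y'
        by (rule lip[OF x ball[OF that(1,2)] ball[OF that(3,4)]])
      have "q' (x - x0, 0) < 1" using s_le(2)[OF xE] x by (auto simp: U_def)
      then have "N (?\<Phi> [] (?z0 + (x - x0, 0)) - ?\<Phi> [] ?z0) \<le> r / (4 * M) * prod_list (map p [])"
        using xE by (intro mboundD[OF q'(2)]) (auto simp: points_prod)
      then show "N (?\<Phi> [] (x, y0) - b) \<le> r / 2 / (2 * M)" using z0 by simp
    qed
    then show ?thesis using ball by blast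
  qed
  define g where "g x = (SOME y. y \<in> V \<and> ?\<Phi> [] (x, y) = b)" for x
  have g: "g x \<in> V" "?\<Phi> [] (x, g x) = b" if "x \<in> U" for x
    using someI_ex[of "\<lambda>y. y \<in> V \<and> ?\<Phi> [] (x, y) = b"] ex[OF that] unfolding g_def by blast+
  have uniq: "f (x, y) = Some b \<longleftrightarrow> y = g x" if xy: "x \<in> U" "y \<in> V" for x y
  proof
    assume "f (x, y) = Some b"
    then have "?\<Phi> [] (x, y) = b" by simp
    then have "N (y - g x) \<le> 0" using expand[OF xy g(1)[OF xy(1)]] g(2)[OF xy(1)] by simp
    then show "y = g x" using G.N_le_0_iff[of "y - g x"] VG xy g by simp
  next
    assume "y = g x"
    then show "f (x, y) = Some b" using f_eq[OF UVD(1)[OF xy]] g xy by simp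
  qed
  \<comment> \<open>At the parameter \<open>x + v\<close> both \<open>g (x + v)\<close> and the old
    value \<open>g x\<close> lie in \<open>V\<close>, so \<open>expand\<close> compares them; the
    defect of \<open>g x\<close> there tends to 0 since \<open>f\<close> is continuous.\<close>
  have cont: "limitin (topo G) (\<lambda>v. g (x + v)) (g x) (zero_filter E)" if x: "x \<in> U" for x
    unfolding G.limitin_N
  proof (intro conjI)
    note gx = g[OF x]
    have xU: "eventually (\<lambda>v. x + v \<in> U) (zero_filter E)" by (rule E.eventually_zero_filter_add[OF U(1) x])
    show "g x \<in> points G" using VG gx by blast
    show "eventually (\<lambda>v. g (x + v) \<in> points G) (zero_filter E)" using xU by eventually_elim (use VG g in blast)
    obtain p' where p': "H.Keller_seminorm ?\<Phi> (x, g x) 0 p'" using H.Keller_seminorm_exists[OF C[OF UVD(1)[OF x gx(1)]] k0(1)] .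
    have eq: "(x, g x) + (v, 0) = (x + v, g x)" for v by simp
    have flim: "filterlim (\<lambda>v. (v, 0)) (zero_filter (E \<times>\<^sub>t G)) (zero_filter E)"
      unfolding H.E.filterlim_zero_filter
    proof (intro conjI allI impI)
      show "eventually (\<lambda>v. (v, 0) \<in> points (E \<times>\<^sub>t G)) (zero_filter E)"
        using E.eventually_zero_filter_points by eventually_elim (simp add: points_prod)
      fix p assume "cont_seminorm (E \<times>\<^sub>t G) p"
      then have "cont_seminorm E (\<lambda>u. p (u, 0))" by (rule seminorm_inl[OF lE G.lcs])
      moreover have "filterlim (\<lambda>v. v) (zero_filter E) (zero_filter E)" by (rule filterlim_ident)
      ultimately show "((\<lambda>v. p (v, 0)) \<longlongrightarrow> 0) (zero_filter E)" unfolding E.filterlim_zero_filter by blast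
    qed
    have "((\<lambda>v. N (?\<Phi> [] ((x, g x) + (v, 0)) - ?\<Phi> [] (x, g x))) \<longlongrightarrow> 0) (zero_filter E)"
    proof (rule H.Keller_seminorm_tendsto[OF p' order_refl flim])
      show "eventually (\<lambda>v. slot_linear (E \<times>\<^sub>t G) G 0 (\<lambda>us. ?\<Phi> us ((x, g x) + (v, 0)))) (zero_filter E)"
        unfolding eq using xU by eventually_elim (rule slot[OF UVD(1)[OF _ gx(1)] k0(1)])
    qed simp_all
    then have "((\<lambda>v. 2 * M * N (?\<Phi> [] (x + v, g x) - b)) \<longlongrightarrow> 2 * M * 0) (zero_filter E)"
      unfolding eq gx(2) by (intro tendsto_intros)
    then have l: "((\<lambda>v. 2 * M * N (?\<Phi> [] (x + v, g x) - b)) \<longlongrightarrow> 0) (zero_filter E)" by simp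
    show "((\<lambda>v. N (g (x + v) - g x)) \<longlongrightarrow> 0) (zero_filter E)"
    proof (rule tendsto_sandwich[OF _ _ tendsto_const l])
      show "eventually (\<lambda>v. 0 \<le> N (g (x + v) - g x)) (zero_filter E)"
        using xU by eventually_elim (use VG g gx in \<open>auto intro!: G.N_nonneg\<close>)
      show "eventually (\<lambda>v. N (g (x + v) - g x) \<le> 2 * M * N (?\<Phi> [] (x + v, g x) - b)) (zero_filter E)"
        using xU
      proof eventually_elim
        case (elim v)
        show ?case
          using expand[OF elim g(1)[OF elim] gx(1)] g(2)[OF elim] G.N_diff_commute[OF bG' \<Phi>0[OF elim gx(1)]] by simp
      qed
    qed
  qed
  interpret I: implicit_map E G N ?D ?\<Phi> k b U g "2 * M"
  proof unfold_locales
    fix z assume "z \<in> ?D"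
    then show "H.Ck_norm_at k ?\<Phi> z" by (rule C)
  next
    fix x assume x: "x \<in> U"
    show "(x, g x) \<in> ?D" by (rule UVD(1)[OF x g(1)[OF x]])
    show "?\<Phi> [] (x, g x) = b" by (rule g(2)[OF x])
    show "limitin (topo G) (\<lambda>v. g (x + v)) (g x) (zero_filter E)" by (rule cont[OF x])
    show "bij_betw (\<lambda>v. ?\<Phi> [(0, v)] (x, g x)) (points G) (points G)" by (rule bij[OF x g(1)[OF x]])
    show "N v \<le> 2 * M * N (?\<Phi> [(0, v)] (x, g x))" if "v \<in> points G" for v
      by (rule bound[OF x g(1)[OF x] that])
  qed (use oD k U M in auto)
  show thesis
  proof (rule that[OF U V])
    show "x0 + scl E (of_real t) (x - x0) \<in> U" if x: "x \<in> U" and t: "0 \<le> t" "t \<le> 1" for x t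
    proof -
      have xE: "x - x0 \<in> points E" using UE[OF x] x0 by auto
      have "s (x0 + scl E (of_real t) (x - x0) - x0) = t * s (x - x0)"
        using E.seminorm_scale_real[OF s xE t(1)] by simp
      also have "\<dots> \<le> 1 * s (x - x0)" using t E.seminorm_nonneg[OF s xE] by (intro mult_right_mono) auto
      also have "\<dots> < 1 / 2" using x by (simp add: U_def)
      finally show ?thesis using x0 xE unfolding U_def by blast
    qed
    show "U \<times> V \<subseteq> W0 \<inter> dom f" using UVD by blast
    show "partial2_bijective G f x y" if "x \<in> U" "y \<in> V" for x y
      using partial2_bijective_iff[OF f k lE UVD(1)[OF that]] bij[OF that] by simp
    show "Ck_pi k E G (\<lambda>x. if x \<in> U then Some (g x) else None)" by (rule I.implicit_Ck_pi)
  qed (use g uniq cont in blast)+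
qed

section \<open>Maps into a projective limit\<close>

lemma cont_linear_limitin:
  assumes "cont_linear A B c" "limitin (topo A) h L \<F>"
  shows "limitin (topo B) (\<lambda>a. c (h a)) (c L) \<F>"
  unfolding limitin_def
proof (intro conjI allI impI)
  have cm: "continuous_map (topo A) (topo B) c" using assms(1) by (simp add: cont_linear_def)
  have L: "L \<in> points A" using assms(2) by (rule limitin_topspace)
  then show "c L \<in> points B" using assms(1) by (auto simp: cont_linear_def linear_from_to_def)
  fix W assume W: "openin (topo B) W \<and> c L \<in> W"
  then have "openin (topo A) {x \<in> points A. c x \<in> W}" by (intro openin_continuous_map_preimage[OF cm]) simp
  then have "eventually (\<lambda>a. h a \<in> {x \<in> points A. c x \<in> W}) \<F>"
    using assms(2) W L unfolding limitin_def by blast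
  then show "eventually (\<lambda>a. c (h a) \<in> W) \<F>" by eventually_elim simp
qed

locale proj_limit =
  fixes I :: "'i set" and \<Delta> and Fi :: "'i \<Rightarrow> ('k::real_or_complex, 'x::ab_group_add) tvs"
    and \<rho>\<rho> and F :: "('k, 'f::ab_group_add) tvs" and \<rho> and i0 :: 'i
  assumes dir: "direction_on I \<Delta>" and sys: "projective_system I \<Delta> Fi \<rho>\<rho>"
    and lim: "projective_limit I \<Delta> Fi \<rho>\<rho> F \<rho>" and i0: "i0 \<in> I"
begin

text \<open>The indices above \<open>i0\<close>, to which the conditions of extensibility refer.
  They are cofinal, so they determine the points and the topology of the limit.\<close>

definition J :: "'i set" where "J = {j. (i0, j) \<in> \<Delta>}"

lemma \<Delta>_I: "(i, j) \<in> \<Delta> \<Longrightarrow> i \<in> I \<and> j \<in> I"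
  using dir by (auto simp: direction_on_def)

lemma J_I: "j \<in> J \<Longrightarrow> j \<in> I"
  using \<Delta>_I by (auto simp: J_def)

lemma \<Delta>_refl: "i \<in> I \<Longrightarrow> (i, i) \<in> \<Delta>"
  using dir by (auto simp: direction_on_def refl_on_def)

lemma \<Delta>_trans: "(i, j) \<in> \<Delta> \<Longrightarrow> (j, l) \<in> \<Delta> \<Longrightarrow> (i, l) \<in> \<Delta>"
  using dir by (auto simp: direction_on_def elim: transE)

lemma i0_J: "i0 \<in> J"
  using \<Delta>_refl[OF i0] by (simp add: J_def)

lemma upper_J:
  assumes "i \<in> I" "i' \<in> I"
  obtains l where "l \<in> J" "(i, l) \<in> \<Delta>" "(i', l) \<in> \<Delta>"
proof -
  have directed: "\<exists>k. (a, k) \<in> \<Delta> \<and> (c, k) \<in> \<Delta>" if "a \<in> I" "c \<in> I" for a c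
    using dir that unfolding direction_on_def by blast
  obtain m where m: "(i, m) \<in> \<Delta>" "(i', m) \<in> \<Delta>" using directed[OF assms] by blast
  have "m \<in> I" using \<Delta>_I[OF m(1)] by blast
  then obtain l where "(m, l) \<in> \<Delta>" "(i0, l) \<in> \<Delta>"
    using directed[OF _ i0] by blast
  then show thesis using that[of l] \<Delta>_trans[OF m(1)] \<Delta>_trans[OF m(2)] by (simp add: J_def)
qed

lemma upper_finite:
  assumes "finite A" "A \<subseteq> I"
  shows "\<exists>l\<in>J. \<forall>i\<in>A. (i, l) \<in> \<Delta>"
  using assms
proof (induction A rule: finite_induct)
  case empty
  then show ?case using i0_J by auto
next
  case (insert a A)
  then obtain l where l: "l \<in> J" "\<forall>i\<in>A. (i, l) \<in> \<Delta>" by auto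
  obtain m where "m \<in> J" "(a, m) \<in> \<Delta>" "(l, m) \<in> \<Delta>" using upper_J[of a l] insert.prems J_I[OF l(1)] by auto
  then show ?case using l \<Delta>_trans by blast
qed

lemma cone: "proj_cone I \<Delta> Fi \<rho>\<rho> F \<rho>"
  using lim by (simp add: projective_limit_def universal_cone_def)

lemma lcs_F: "lcs F"
  using cone by (simp add: proj_cone_def)

lemma lcs_Fi: "i \<in> I \<Longrightarrow> lcs (Fi i)"
  using sys by (simp add: projective_system_def)

lemma \<rho>_lin: "i \<in> I \<Longrightarrow> cont_linear F (Fi i) (\<rho> i)"
  using cone by (simp add: proj_cone_def)

lemma \<rho>\<rho>_lin: "(i, j) \<in> \<Delta> \<Longrightarrow> cont_linear (Fi j) (Fi i) (\<rho>\<rho> i j)"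
  using sys by (auto simp: projective_system_def)

lemma \<rho>\<rho>_\<rho>: "(i, j) \<in> \<Delta> \<Longrightarrow> y \<in> points F \<Longrightarrow> \<rho>\<rho> i j (\<rho> j y) = \<rho> i y"
  using cone by (auto simp: proj_cone_def)

lemma \<rho>\<rho>_comp: "(i, j) \<in> \<Delta> \<Longrightarrow> (j, l) \<in> \<Delta> \<Longrightarrow> y \<in> points (Fi l) \<Longrightarrow> \<rho>\<rho> i j (\<rho>\<rho> j l y) = \<rho>\<rho> i l y"
  using sys by (auto simp: projective_system_def)

lemma \<rho>_in: "i \<in> I \<Longrightarrow> y \<in> points F \<Longrightarrow> \<rho> i y \<in> points (Fi i)"
  by (drule \<rho>_lin) (auto simp: cont_linear_def linear_from_to_def)

lemma \<rho>\<rho>_in: "(i, j) \<in> \<Delta> \<Longrightarrow> y \<in> points (Fi j) \<Longrightarrow> \<rho>\<rho> i j y \<in> points (Fi i)"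
  by (drule \<rho>\<rho>_lin) (auto simp: cont_linear_def linear_from_to_def)

section \<open>Points and topology of the limit space\<close>

abbreviation P where "P \<equiv> thread_space I \<Delta> Fi \<rho>\<rho>"

abbreviation e :: "'f \<Rightarrow> 'i \<Rightarrow> 'x" where "e y \<equiv> \<lambda>i. if i \<in> I then \<rho> i y else 0"

lemma e_in: "y \<in> points F \<Longrightarrow> e y \<in> points P"
  unfolding points_thread_space using \<rho>_in \<rho>\<rho>_\<rho> \<Delta>_I by auto

text \<open>Identifies \<open>F\<close> with the space of threads \<open>P\<close>. Universality
  applied to the coordinate cone of \<open>P\<close> gives \<open>h\<close>; both the composite
  \<open>y \<mapsto> h (e y)\<close> and the identity factor the cone of \<open>F\<close> through
  itself, so uniqueness makes them equal.\<close>

lemma universal_map: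
  "\<exists>h. cont_linear P F h \<and> (\<forall>p\<in>points P. \<forall>i\<in>I. \<rho> i (h p) = p i) \<and> (\<forall>y\<in>points F. h (e y) = y)"
proof -
  have ne: "I \<noteq> {}" using i0 by blast
  have sub: "\<Delta> \<subseteq> I \<times> I" using \<Delta>_I by auto
  have lP: "lcs P" by (rule lcs_thread_space[OF ne sub sys])
  interpret P: lcs_space P by standard fact
  have c: "cont_linear P (Fi i) (\<lambda>p. p i)" if i: "i \<in> I" for i
    using continuous_map_thread_component[OF i, of \<Delta> Fi \<rho>\<rho>] i
    unfolding cont_linear_def linear_from_to_def
    by (auto simp: points_thread_space) (simp add: thread_space_def)
  have "proj_cone I \<Delta> Fi \<rho>\<rho> P (\<lambda>i p. p i)"
    unfolding proj_cone_def using lP c by (auto simp: points_thread_space)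
  then obtain h where h: "cont_linear P F h" "\<forall>i\<in>I. \<forall>p\<in>points P. \<rho> i (h p) = p i"
    using projective_limit_universal[OF ne dir sys lim, where 'g = "'i \<Rightarrow> 'x"]
    unfolding universal_cone_def by blast
  have ec: "continuous_map (topo F) (topo P) e"
  proof (rule continuous_map_thread_space)
    show "e \<in> points F \<rightarrow> points P" using e_in by blast
    show "continuous_map (topo F) (topo (Fi i)) (\<lambda>y. e y i)" if "i \<in> I" for i
      using \<rho>_lin[OF that] that by (simp add: cont_linear_def)
  qed
  have s0: "scl (Fi (SOME i. i \<in> I)) c 0 = 0" for c
  proof -
    have "(SOME i. i \<in> I) \<in> I" using ne by (simp add: some_in_eq)
    then interpret lcs_space "Fi (SOME i. i \<in> I)" by unfold_locales (rule lcs_Fi)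
    show ?thesis by simp
  qed
  have el: "cont_linear F P e"
    unfolding cont_linear_def linear_from_to_def
  proof (intro conjI ballI allI ec)
    show "e \<in> points F \<rightarrow> points P" using e_in by blast
    show "e (x + y) = e x + e y" if "x \<in> points F" "y \<in> points F" for x y
      using that \<rho>_lin by (auto simp: cont_linear_def linear_from_to_def)
    show "e (scl F c x) = scl P c (e x)" if "x \<in> points F" for c x
      using that \<rho>_lin s0 by (auto simp: cont_linear_def linear_from_to_def thread_space_def)
  qed
  have "cont_linear F F (\<lambda>y. h (e y))"
    using el h(1) continuous_map_compose[of "topo F" "topo P" e "topo F" h]
    unfolding cont_linear_def linear_from_to_def o_def by (auto simp: Pi_iff simp del: if_split)
  moreover have "cont_linear F F (\<lambda>y. y)" unfolding cont_linear_def linear_from_to_def by auto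
  moreover have "\<exists>h1. \<forall>h'. cont_linear F F h' \<and> (\<forall>i\<in>I. \<forall>x\<in>points F. \<rho> i (h' x) = \<rho> i x) \<longrightarrow>
      (\<forall>x\<in>points F. h' x = h1 x)"
    using projective_limit_universal[OF ne dir sys lim, where 'g = 'f, unfolded universal_cone_def,
        THEN conjunct2, rule_format, OF cone] by (elim exE conjE) (rule exI)
  then obtain h1 where h1: "\<And>h'. cont_linear F F h' \<and> (\<forall>i\<in>I. \<forall>x\<in>points F. \<rho> i (h' x) = \<rho> i x) \<Longrightarrow>
      (\<forall>x\<in>points F. h' x = h1 x)" by blast
  moreover have "\<rho> i (h (e y)) = \<rho> i y" if "i \<in> I" "y \<in> points F" for i y
    using h(2) e_in[OF that(2)] that(1) by simp
  ultimately have "\<forall>y\<in>points F. h (e y) = h1 y" "\<forall>y\<in>points F. y = h1 y"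
    by (intro h1 conjI ballI; simp)+
  then have "h (e y) = y" if "y \<in> points F" for y using that by metis
  then show ?thesis using h by blast
qed

lemma eq_in_limit:
  assumes y: "y \<in> points F" "y' \<in> points F" and eq: "\<And>j. j \<in> J \<Longrightarrow> \<rho> j y = \<rho> j y'"
  shows "y = y'"
proof -
  obtain h where h: "\<forall>y\<in>points F. h (e y) = y" using universal_map by blast
  have "\<rho> i y = \<rho> i y'" if i: "i \<in> I" for i
  proof -
    obtain l where "l \<in> J" "(i, l) \<in> \<Delta>" using upper_J[OF i i] by metis
    then show ?thesis using \<rho>\<rho>_\<rho>[of i l] y eq by metis
  qed
  then have "e y = e y'" by auto
  then show ?thesis using h y by metis
qed

text \<open>A compatible family on the cofinal set \<open>J\<close> extends to a thread on all of
  \<open>I\<close>, since every index lies below some element of \<open>J\<close>.\<close>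

lemma thread_in_limit:
  assumes y: "\<And>j. j \<in> J \<Longrightarrow> y j \<in> points (Fi j)"
    and comp: "\<And>j l. j \<in> J \<Longrightarrow> l \<in> J \<Longrightarrow> (j, l) \<in> \<Delta> \<Longrightarrow> \<rho>\<rho> j l (y l) = y j"
  shows "\<exists>w\<in>points F. \<forall>j\<in>J. \<rho> j w = y j"
proof -
  have "\<exists>l\<in>J. (i, l) \<in> \<Delta>" if "i \<in> I" for i using upper_J[OF that that] by blast
  then obtain c where c: "\<And>i. i \<in> I \<Longrightarrow> c i \<in> J \<and> (i, c i) \<in> \<Delta>" by metis
  define p where "p i = (if i \<in> I then \<rho>\<rho> i (c i) (y (c i)) else 0)" for i
  \<comment> \<open>The value at \<open>i\<close> may be computed from any \<open>l\<close> in
    \<open>J\<close> above \<open>c i\<close>; this makes the choice \<open>c\<close> immaterial and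
    gives compatibility.\<close>
  have p: "p i = \<rho>\<rho> i l (y l)" if il: "(i, l) \<in> \<Delta>" "(c i, l) \<in> \<Delta>" "l \<in> J" for i l
  proof -
    have i: "i \<in> I" using \<Delta>_I il by blast
    have "p i = \<rho>\<rho> i (c i) (\<rho>\<rho> (c i) l (y l))" using i comp[of "c i" l] c[OF i] il by (simp add: p_def)
    then show ?thesis using \<rho>\<rho>_comp[of i "c i" l] c[OF i] il y by simp
  qed
  have "p \<in> points P"
    unfolding points_thread_space
  proof (intro CollectI conjI ballI allI impI; clarsimp?)
    show "p i \<in> points (Fi i)" if "i \<in> I" for i
      using that c[OF that] y \<rho>\<rho>_in[of i "c i"] by (simp add: p_def)
    show "p i = 0" if "i \<notin> I" for i using that by (simp add: p_def)
    show "p i = \<rho>\<rho> i i' (p i')" if ii: "(i, i') \<in> \<Delta>" for i i'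
    proof -
      have I: "i \<in> I" "i' \<in> I" using \<Delta>_I[OF ii] by auto
      obtain l where l: "l \<in> J" "(c i, l) \<in> \<Delta>" "(c i', l) \<in> \<Delta>"
        using upper_J[of "c i" "c i'"] c I J_I by metis
      have "(i, l) \<in> \<Delta>" "(i', l) \<in> \<Delta>" using \<Delta>_trans c I l by blast+
      then show ?thesis using p[of i l] p[of i' l] l \<rho>\<rho>_comp[OF ii, of l "y l"] y by simp
    qed
  qed
  moreover have "p j = y j" if j: "j \<in> J" for j
  proof -
    have "j \<in> I" using J_I[OF j] .
    then obtain l where "l \<in> J" "(c j, l) \<in> \<Delta>" "(j, l) \<in> \<Delta>" using upper_J[of "c j" j] c J_I by metis
    then show ?thesis using p[of j l] comp[OF j] by simp
  qed
  moreover obtain h where h: "cont_linear P F h" "\<forall>p\<in>points P. \<forall>i\<in>I. \<rho> i (h p) = p i"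
    using universal_map by blast
  ultimately have "h p \<in> points F \<and> (\<forall>j\<in>J. \<rho> j (h p) = y j)"
    using J_I by (auto simp: cont_linear_def linear_from_to_def)
  then show ?thesis by blast
qed

text \<open>The topology of \<open>F\<close> is initial for its projections, and directedness lets a
  single \<open>j\<close> in \<open>J\<close> replace the finitely many coordinates of a basic
  neighbourhood.\<close>

lemma zero_nbhd_limit:
  assumes "zero_nbhd F W"
  obtains j W' where "j \<in> J" "zero_nbhd (Fi j) W'" "\<And>y. y \<in> points F \<Longrightarrow> \<rho> j y \<in> W' \<Longrightarrow> y \<in> W"
proof -
  interpret F: lcs_space F by unfold_locales (rule lcs_F)
  obtain h where h: "cont_linear P F h" "\<forall>y\<in>points F. h (e y) = y" using universal_map by blast
  obtain Q where Q: "openin (topo F) Q" "0 \<in> Q" "Q \<subseteq> W" using assms by (auto simp: zero_nbhd_def)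
  have "openin (topo P) {p \<in> points P. h p \<in> Q}"
    using h(1) Q(1) by (intro openin_continuous_map_preimage) (auto simp: cont_linear_def)
  then obtain R where R: "openin (product_topology (\<lambda>i. topo (Fi i)) I) R"
    "{p \<in> points P. h p \<in> Q} = (\<lambda>p. restrict p I) -` R \<inter> points P"
    unfolding points_thread_space by (auto simp: thread_space_def openin_pullback_topology)
  have "e 0 \<in> {p \<in> points P. h p \<in> Q}" using e_in[of 0] bspec[OF h(2), of 0] Q(2) by simp
  then have "restrict (e 0) I \<in> R" using R(2) by blast
  then obtain B where B: "finite {i \<in> I. B i \<noteq> points (Fi i)}" "\<forall>i\<in>I. openin (topo (Fi i)) (B i)"
      "restrict (e 0) I \<in> Pi\<^sub>E I B" "Pi\<^sub>E I B \<subseteq> R"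
    using R(1) unfolding openin_product_topology_alt by meson
  define A where "A = {i \<in> I. B i \<noteq> points (Fi i)}"
  obtain j where j: "j \<in> J" "\<forall>i\<in>A. (i, j) \<in> \<Delta>" using upper_finite[of A] B(1) by (auto simp: A_def)
  have jI: "j \<in> I" using J_I[OF j(1)] .
  interpret Fj: lcs_space "Fi j" by unfold_locales (rule lcs_Fi[OF jI])
  have \<rho>0: "\<rho> i 0 = 0" if "i \<in> I" for i
  proof -
    have "\<rho> i (0 + 0) = \<rho> i 0 + \<rho> i 0"
      using \<rho>_lin[OF that] F.points_closed(1) unfolding cont_linear_def linear_from_to_def by blast
    then show ?thesis by simp
  qed
  \<comment> \<open>The intersection with \<open>points (Fi j)\<close> covers the case of an empty
    \<open>A\<close>.\<close>
  define W' where "W' = points (Fi j) \<inter> (\<Inter>i\<in>A. {y \<in> points (Fi j). \<rho>\<rho> i j y \<in> B i})"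
  have "openin (topo (Fi j)) W'"
  proof (cases "A = {}")
    case False
    have "openin (topo (Fi j)) (\<Inter>i\<in>A. {y \<in> points (Fi j). \<rho>\<rho> i j y \<in> B i})"
    proof (rule openin_INT2)
      show "finite A" "A \<noteq> {}" using B(1) False by (auto simp: A_def)
      fix i assume i: "i \<in> A"
      show "openin (topo (Fi j)) {y \<in> points (Fi j). \<rho>\<rho> i j y \<in> B i}"
        using \<rho>\<rho>_lin[of i j] j i B(2)
        by (intro openin_continuous_map_preimage[where Y = "topo (Fi i)"]) (auto simp: cont_linear_def A_def)
    qed
    then show ?thesis unfolding W'_def by blast
  qed (simp add: W'_def)
  moreover have "0 \<in> W'"
  proof -
    have "\<rho>\<rho> i j 0 \<in> B i" if i: "i \<in> A" for i
    proof -
      have iI: "i \<in> I" using i by (simp add: A_def)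
      have "\<rho>\<rho> i j (\<rho> j 0) = \<rho> i 0" using j i by (intro \<rho>\<rho>_\<rho>) auto
      moreover have "\<rho> i 0 \<in> B i" using B(3) iI by (auto simp: PiE_iff)
      ultimately show ?thesis using \<rho>0[OF jI] by simp
    qed
    then show ?thesis by (simp add: W'_def)
  qed
  ultimately have "zero_nbhd (Fi j) W'" by (rule zero_nbhd_openin)
  moreover have "y \<in> W" if y: "y \<in> points F" "\<rho> j y \<in> W'" for y
  proof -
    have "\<rho> i y \<in> B i" if i: "i \<in> I" for i
    proof (cases "i \<in> A")
      case True
      then have "\<rho>\<rho> i j (\<rho> j y) \<in> B i" using y(2) by (auto simp: W'_def)
      then show ?thesis using \<rho>\<rho>_\<rho>[of i j y] j True y(1) by simp
    next
      case False
      then show ?thesis using \<rho>_in[OF i y(1)] i by (simp add: A_def)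
    qed
    then have "restrict (e y) I \<in> R" using B(4) by auto
    then have "e y \<in> {p \<in> points P. h p \<in> Q}" using R(2) e_in[OF y(1)] by blast
    then show ?thesis using bspec[OF h(2) y(1)] Q(3) by auto
  qed
  ultimately show thesis using that j(1) by blast
qed

lemma limitin_limit:
  assumes L: "L \<in> points F" and ev: "eventually (\<lambda>a. h a \<in> points F) \<F>"
    and l: "\<And>j. j \<in> J \<Longrightarrow> limitin (topo (Fi j)) (\<lambda>a. \<rho> j (h a)) (\<rho> j L) \<F>"
  shows "limitin (topo F) h L \<F>"
  unfolding limitin_def
proof (intro conjI allI impI L)
  interpret F: lcs_space F by unfold_locales (rule lcs_F)
  fix U assume U: "openin (topo F) U \<and> L \<in> U"
  then obtain p where p: "cont_seminorm F p" "\<And>v. v \<in> points F \<Longrightarrow> p v < 1 \<Longrightarrow> L + v \<in> U"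
    using F.openin_nbhd by blast
  then have "zero_nbhd F {v \<in> points F. p v < 1}" by (simp add: cont_seminorm_def)
  then obtain j W' where j: "j \<in> J" "zero_nbhd (Fi j) W'"
    "\<And>y. y \<in> points F \<Longrightarrow> \<rho> j y \<in> W' \<Longrightarrow> y \<in> {v \<in> points F. p v < 1}"
    by (rule zero_nbhd_limit) blast
  interpret Fj: lcs_space "Fi j" by unfold_locales (rule lcs_Fi[OF J_I[OF j(1)]])
  obtain q where q: "cont_seminorm (Fi j) q" "\<forall>v\<in>points (Fi j). q v < 1 \<longrightarrow> v \<in> W'"
    using j(2) unfolding Fj.zero_nbhd_iff by blast
  have "((\<lambda>a. q (\<rho> j (h a) - \<rho> j L)) \<longlongrightarrow> 0) \<F>"
    using l[OF j(1)] q(1) by (simp add: Fj.limitin_iff)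
  then have "eventually (\<lambda>a. q (\<rho> j (h a) - \<rho> j L) < 1) \<F>" by (rule order_tendstoD) simp
  with ev show "eventually (\<lambda>a. h a \<in> U) \<F>"
  proof eventually_elim
    case (elim a)
    have lin: "linear_from_to F (Fi j) (\<rho> j)" using \<rho>_lin[OF J_I[OF j(1)]] by (simp add: cont_linear_def)
    have "\<rho> j (h a) = \<rho> j (h a - L) + \<rho> j L"
      using lin elim(1) L F.points_closed(3)[OF elim(1) L] unfolding linear_from_to_def
      by (metis diff_add_cancel)
    then have d: "\<rho> j (h a) - \<rho> j L = \<rho> j (h a - L)" by simp
    have dF: "h a - L \<in> points F" using elim(1) L by auto
    have "\<rho> j (h a - L) \<in> W'" using q(2) elim(2) \<rho>_in[OF J_I[OF j(1)] dF] unfolding d by blast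
    then have "L + (h a - L) \<in> U" using j(3)[OF dF] by (intro p(2)) auto
    then show ?case by simp
  qed
qed

lemma continuous_map_limit:
  assumes "\<And>x. x \<in> topspace X \<Longrightarrow> m x \<in> points F"
    and "\<And>j. j \<in> J \<Longrightarrow> continuous_map X (topo (Fi j)) (\<lambda>x. \<rho> j (m x))"
  shows "continuous_map X (topo F) m"
  unfolding continuous_map_atin
proof
  fix x assume x: "x \<in> topspace X"
  have ev: "eventually (\<lambda>u. u \<in> topspace X) (atin X x)"
    unfolding eventually_atin by (rule disjI2, rule exI[of _ "topspace X"]) (use x in simp)
  show "limitin (topo F) m (m x) (atin X x)"
  proof (rule limitin_limit)
    show "m x \<in> points F" by (rule assms(1)[OF x])
    show "eventually (\<lambda>u. m u \<in> points F) (atin X x)" using ev by eventually_elim (rule assms(1))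
    show "limitin (topo (Fi j)) (\<lambda>a. \<rho> j (m a)) (\<rho> j (m x)) (atin X x)" if "j \<in> J" for j
      using assms(2)[OF that] x unfolding continuous_map_atin by blast
  qed
qed

text \<open>The derivatives of the components form threads, because \<open>\<rho>\<rho> j l\<close>
  is continuous and linear and therefore commutes with limits of difference quotients. The points of
  \<open>F\<close> they define are the derivatives of \<open>g\<close>, and each condition is
  checked after projection. For Keller's condition a given \<open>W\<close> involves only one index
  \<open>j\<close>, whose neighbourhood of directions can be taken over.\<close>

theorem Ck_pi_limit:
  fixes E :: "('k, 'e::ab_group_add) tvs"
  assumes lE: "lcs E" and U: "openin (topo E) U" and gF: "\<And>x. x \<in> U \<Longrightarrow> g x \<in> points F"
    and Cj: "\<And>j. j \<in> J \<Longrightarrow> Ck_pi k E (Fi j) (\<lambda>x. if x \<in> U then Some (\<rho> j (g x)) else None)"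
  shows "Ck_pi k E F (\<lambda>x. if x \<in> U then Some (g x) else None)"
proof -
  interpret E: lcs_space E by standard fact
  interpret F: lcs_space F by unfold_locales (rule lcs_F)
  let ?f = "\<lambda>j x. if x \<in> U then Some (\<rho> j (g x)) else None"
  define \<Psi> where "\<Psi> j = dlist E (Fi j) (?f j)" for j
  have dom: "dom (?f j) = U" for j by (auto split: if_splits)
  have C: "Ck_at k E (Fi j) (\<Psi> j) x" if "j \<in> J" "x \<in> U" for j x
    using Ck_piD(5)[OF Cj[OF that(1)], of x] that(2) unfolding \<Psi>_def by (simp add: dom)
  have lFj: "lcs (Fi j)" if "j \<in> J" for j using lcs_Fi[OF J_I[OF that]] .
  have slot: "slot_linear E (Fi j) l (\<lambda>us. \<Psi> j us x)" if "j \<in> J" "x \<in> U" "enat l \<le> k" for j x l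
    using C[OF that(1,2)] that(3) unfolding Ck_at_def by blast
  have lim\<Psi>: "limitin (topo (Fi j)) (\<lambda>t. scl (Fi j) (inverse t) (\<Psi> j us (x + scl E t v) - \<Psi> j us x)) (\<Psi> j (us @ [v]) x) (at 0)"
    if "j \<in> J" "x \<in> U" "set us \<subseteq> points E" "v \<in> points E" "enat (Suc (length us)) \<le> k" for j x us v
    using C[OF that(1,2)] that(3-5) unfolding Ck_at_def by blast
  have in\<Psi>: "\<Psi> j us x \<in> points (Fi j)" if "j \<in> J" "x \<in> U" "set us \<subseteq> points E" "enat (length us) \<le> k" for j x us
    using slot_linearD(1)[OF slot[OF that(1,2,4)] that(3)] by simp
  have comp: "\<rho>\<rho> j l (\<Psi> l us x) = \<Psi> j us x"
    if jl: "j \<in> J" "l \<in> J" "(j, l) \<in> \<Delta>" and "set us \<subseteq> points E" "enat (length us) \<le> k" "x \<in> U" for j l us x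
    using that(4-6)
  proof (induction us arbitrary: x rule: rev_induct)
    case Nil
    then show ?case using \<rho>\<rho>_\<rho>[OF jl(3) gF] by (simp add: \<Psi>_def)
  next
    case (snoc v us)
    interpret Fj: lcs_space "Fi j" by standard (rule lFj[OF jl(1)])
    interpret Fl: lcs_space "Fi l" by standard (rule lFj[OF jl(2)])
    have us: "set us \<subseteq> points E" "v \<in> points E" "enat (Suc (length us)) \<le> k" "enat (length us) \<le> k"
      using snoc.prems by (auto intro: order_trans[rotated])
    have lin: "linear_from_to (Fi l) (Fi j) (\<rho>\<rho> j l)" using \<rho>\<rho>_lin[OF jl(3)] by (simp add: cont_linear_def)
    have l1: "limitin (topo (Fi j)) (\<lambda>t. \<rho>\<rho> j l (scl (Fi l) (inverse t) (\<Psi> l us (x + scl E t v) - \<Psi> l us x)))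
       (\<rho>\<rho> j l (\<Psi> l (us @ [v]) x)) (at 0)"
      by (rule cont_linear_limitin[OF \<rho>\<rho>_lin[OF jl(3)] lim\<Psi>[OF jl(2) snoc.prems(3) us(1-3)]])
    have xU: "eventually (\<lambda>t. x + scl E t v \<in> U) (at 0)"
      by (rule E.eventually_at_line[OF U snoc.prems(3) us(2)])
    have eq: "eventually (\<lambda>t. \<rho>\<rho> j l (scl (Fi l) (inverse t) (\<Psi> l us (x + scl E t v) - \<Psi> l us x)) =
       scl (Fi j) (inverse t) (\<Psi> j us (x + scl E t v) - \<Psi> j us x)) (at 0)"
      using xU
    proof eventually_elim
      case (elim t)
      let ?a = "\<Psi> l us (x + scl E t v)" and ?b = "\<Psi> l us x"
      have ab: "?a \<in> points (Fi l)" "?b \<in> points (Fi l)"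
        using in\<Psi>[OF jl(2)] elim us snoc.prems(3) by auto
      have "\<rho>\<rho> j l ((?a - ?b) + ?b) = \<rho>\<rho> j l (?a - ?b) + \<rho>\<rho> j l ?b"
        using lin ab Fl.points_closed(3)[OF ab] unfolding linear_from_to_def by blast
      then have "\<rho>\<rho> j l (?a - ?b) = \<rho>\<rho> j l ?a - \<rho>\<rho> j l ?b" by simp
      moreover have "\<rho>\<rho> j l (scl (Fi l) (inverse t) (?a - ?b)) = scl (Fi j) (inverse t) (\<rho>\<rho> j l (?a - ?b))"
        using lin Fl.points_closed(3)[OF ab] unfolding linear_from_to_def by blast
      ultimately show ?case using snoc.IH[OF us(1,4) elim] snoc.IH[OF us(1,4) snoc.prems(3)] by simp
    qed
    show ?case
      by (rule Fj.limitin_unique[OF limitin_transform_eventually[OF eq l1]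
            lim\<Psi>[OF jl(1) snoc.prems(3) us(1-3)] at_zero_neq_bot])
  qed
  \<comment> \<open>A choice in form only: by \<open>eq_in_limit\<close> at most one point has these
    projections.\<close>
  define \<Theta> where "\<Theta> us x = (SOME y. y \<in> points F \<and> (\<forall>j\<in>J. \<rho> j y = \<Psi> j us x))" for us x
  have \<Theta>: "\<Theta> us x \<in> points F" "\<And>j. j \<in> J \<Longrightarrow> \<rho> j (\<Theta> us x) = \<Psi> j us x"
    if "set us \<subseteq> points E" "enat (length us) \<le> k" "x \<in> U" for us x
  proof -
    have "\<exists>w\<in>points F. \<forall>j\<in>J. \<rho> j w = \<Psi> j us x"
    proof (rule thread_in_limit)
      show "\<Psi> j us x \<in> points (Fi j)" if "j \<in> J" for j using in\<Psi> that \<open>set us \<subseteq> points E\<close> \<open>enat (length us) \<le> k\<close> \<open>x \<in> U\<close> by blast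
    qed (use comp that in blast)
    then have "\<exists>w. w \<in> points F \<and> (\<forall>j\<in>J. \<rho> j w = \<Psi> j us x)" by blast
    from someI_ex[OF this] show "\<Theta> us x \<in> points F" "\<And>j. j \<in> J \<Longrightarrow> \<rho> j (\<Theta> us x) = \<Psi> j us x"
      unfolding \<Theta>_def by blast+
  qed
  have k0: "enat 0 \<le> k" by (simp flip: zero_enat_def)
  have \<Theta>0: "\<Theta> [] x = g x" if x: "x \<in> U" for x
  proof (rule eq_in_limit)
    show "\<Theta> [] x \<in> points F" using \<Theta>(1)[of "[]" x] x k0 by simp
    show "g x \<in> points F" by (rule gF[OF x])
    show "\<rho> j (\<Theta> [] x) = \<rho> j (g x)" if "j \<in> J" for j
      using \<Theta>(2)[of "[]" x j] x k0 that by (simp add: \<Psi>_def)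
  qed
  have \<rho>add: "\<rho> j (a + b) = \<rho> j a + \<rho> j b" and \<rho>scl: "\<rho> j (scl F c a) = scl (Fi j) c (\<rho> j a)"
    and \<rho>diff: "\<rho> j (a - b) = \<rho> j a - \<rho> j b"
    if "j \<in> J" "a \<in> points F" "b \<in> points F" for j a b c
  proof -
    note lin = \<rho>_lin[OF J_I[OF that(1)], unfolded cont_linear_def linear_from_to_def]
    show "\<rho> j (a + b) = \<rho> j a + \<rho> j b" "\<rho> j (scl F c a) = scl (Fi j) c (\<rho> j a)" using lin that by blast+
    have "\<rho> j ((a - b) + b) = \<rho> j (a - b) + \<rho> j b" using lin that F.points_closed(3) by blast
    then show "\<rho> j (a - b) = \<rho> j a - \<rho> j b" by simp
  qed
  show ?thesis
  proof (rule Ck_piI[OF lE lcs_F U, where \<Phi> = \<Theta>])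
    show "(if x \<in> U then Some (g x) else None) = (if x \<in> U then Some (\<Theta> [] x) else None)" for x
      using \<Theta>0 by simp
    fix x assume x: "x \<in> U"
    show "Ck_at k E F \<Theta> x"
      unfolding Ck_at_def
    proof (intro conjI allI impI; (elim conjE)?)
      fix l assume l: "enat l \<le> k"
      show "slot_linear E F l (\<lambda>us. \<Theta> us x)"
        unfolding slot_linear_def
      proof (intro conjI allI impI; elim conjE)
        show "\<Theta> us x \<in> points F" if "set us \<subseteq> points E" "length us = l" for us
          using \<Theta>(1)[OF that(1) _ x] that(2) l by simp
        fix as bs assume ab: "set as \<subseteq> points E" "set bs \<subseteq> points E" "length as + Suc (length bs) = l"
        have L: "set (as @ v # bs) \<subseteq> points E" "enat (length (as @ v # bs)) \<le> k" if "v \<in> points E" for v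
          using ab that l by auto
        have in\<Theta>: "\<Theta> (as @ v # bs) x \<in> points F" if "v \<in> points E" for v
          by (rule \<Theta>(1)[OF L[OF that] x])
        have \<rho>\<Theta>: "\<rho> j (\<Theta> (as @ v # bs) x) = \<Psi> j (as @ v # bs) x" if "v \<in> points E" "j \<in> J" for v j
          by (rule \<Theta>(2)[OF L[OF that(1)] x that(2)])
        show "linear_from_to E F (\<lambda>v. \<Theta> (as @ v # bs) x)"
          unfolding linear_from_to_def
        proof (intro conjI ballI allI)
          show "(\<lambda>v. \<Theta> (as @ v # bs) x) \<in> points E \<rightarrow> points F" using in\<Theta> by blast
          show "\<Theta> (as @ (v + w) # bs) x = \<Theta> (as @ v # bs) x + \<Theta> (as @ w # bs) x"
            if v: "v \<in> points E" and w: "w \<in> points E" for v w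
          proof (rule eq_in_limit)
            have vw: "v + w \<in> points E" by (rule E.points_closed(2)[OF v w])
            show "\<Theta> (as @ (v + w) # bs) x \<in> points F" by (rule in\<Theta>[OF vw])
            show "\<Theta> (as @ v # bs) x + \<Theta> (as @ w # bs) x \<in> points F" using in\<Theta>[OF v] in\<Theta>[OF w] by auto
            fix j assume j: "j \<in> J"
            have "linear_from_to E (Fi j) (\<lambda>v. \<Psi> j (as @ v # bs) x)"
              by (rule slot_linearD(2)[OF slot[OF j x l] ab])
            then have "\<Psi> j (as @ (v + w) # bs) x = \<Psi> j (as @ v # bs) x + \<Psi> j (as @ w # bs) x"
              using v w unfolding linear_from_to_def by blast
            then show "\<rho> j (\<Theta> (as @ (v + w) # bs) x) = \<rho> j (\<Theta> (as @ v # bs) x + \<Theta> (as @ w # bs) x)"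
              using \<rho>add[OF j in\<Theta>[OF v] in\<Theta>[OF w]] \<rho>\<Theta>[OF v j] \<rho>\<Theta>[OF w j] \<rho>\<Theta>[OF vw j] by simp
          qed
          show "\<Theta> (as @ scl E c v # bs) x = scl F c (\<Theta> (as @ v # bs) x)" if v: "v \<in> points E" for c v
          proof (rule eq_in_limit)
            have cv: "scl E c v \<in> points E" using v by auto
            show "\<Theta> (as @ scl E c v # bs) x \<in> points F" by (rule in\<Theta>[OF cv])
            show "scl F c (\<Theta> (as @ v # bs) x) \<in> points F" using in\<Theta>[OF v] by auto
            fix j assume j: "j \<in> J"
            have "linear_from_to E (Fi j) (\<lambda>v. \<Psi> j (as @ v # bs) x)"
              by (rule slot_linearD(2)[OF slot[OF j x l] ab])
            then have "\<Psi> j (as @ scl E c v # bs) x = scl (Fi j) c (\<Psi> j (as @ v # bs) x)"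
              using v unfolding linear_from_to_def by blast
            then show "\<rho> j (\<Theta> (as @ scl E c v # bs) x) = \<rho> j (scl F c (\<Theta> (as @ v # bs) x))"
              using \<rho>scl[OF j in\<Theta>[OF v] in\<Theta>[OF v], of c] \<rho>\<Theta>[OF v j] \<rho>\<Theta>[OF cv j] by simp
          qed
        qed
      qed
      show "continuous_map (product_topology (\<lambda>_. topo E) {..<l}) (topo F) (\<lambda>u. \<Theta> (map u [0..<l]) x)"
      proof (rule continuous_map_limit)
        have L: "set (map u [0..<l]) \<subseteq> points E" "enat (length (map u [0..<l])) \<le> k"
          if "u \<in> topspace (product_topology (\<lambda>_. topo E) {..<l})" for u
          using that l by (auto simp: PiE_iff)
        show "\<Theta> (map u [0..<l]) x \<in> points F"
          if "u \<in> topspace (product_topology (\<lambda>_. topo E) {..<l})" for u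
          by (rule \<Theta>(1)[OF L[OF that] x])
        fix j assume j: "j \<in> J"
        have "continuous_map (product_topology (\<lambda>_. topo E) {..<l}) (topo (Fi j)) (\<lambda>u. \<Psi> j (map u [0..<l]) x)"
          using C[OF j x] l unfolding Ck_at_def by blast
        then show "continuous_map (product_topology (\<lambda>_. topo E) {..<l}) (topo (Fi j)) (\<lambda>u. \<rho> j (\<Theta> (map u [0..<l]) x))"
          by (rule continuous_map_eq) (rule \<Theta>(2)[OF L x j, symmetric])
      qed
      fix W assume "zero_nbhd F W"
      then obtain j W' where j: "j \<in> J" "zero_nbhd (Fi j) W'"
        "\<And>y. y \<in> points F \<Longrightarrow> \<rho> j y \<in> W' \<Longrightarrow> y \<in> W" using zero_nbhd_limit by metis
      interpret Fj: lcs_space "Fi j" by standard (rule lFj[OF j(1)])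
      obtain U0 where U0: "zero_nbhd E U0" "\<And>\<epsilon>::real. \<epsilon> > 0 \<Longrightarrow>
           eventually (\<lambda>v. \<forall>us. set us \<subseteq> U0 \<and> length us = l \<longrightarrow>
             \<Psi> j us (x + v) - \<Psi> j us x \<in> scl (Fi j) (of_real \<epsilon>) ` W') (zero_filter E)"
        using C[OF j(1) x] l j(2) unfolding Ck_at_def by meson
      show "\<exists>U. zero_nbhd E U \<and> (\<forall>\<epsilon>::real. \<epsilon> > 0 \<longrightarrow>
           eventually (\<lambda>v. \<forall>us. set us \<subseteq> U \<and> length us = l \<longrightarrow>
             \<Theta> us (x + v) - \<Theta> us x \<in> scl F (of_real \<epsilon>) ` W) (zero_filter E))"
      proof (rule exI[of _ U0], intro conjI allI impI U0(1))
        fix \<epsilon> :: real assume eps: "\<epsilon> > 0"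
        show "eventually (\<lambda>v. \<forall>us. set us \<subseteq> U0 \<and> length us = l \<longrightarrow>
             \<Theta> us (x + v) - \<Theta> us x \<in> scl F (of_real \<epsilon>) ` W) (zero_filter E)"
          using U0(2)[OF eps] E.eventually_zero_filter_add[OF U x]
        proof eventually_elim
          case (elim v)
          show ?case
          proof (intro allI impI, elim conjE)
            fix us assume us: "set us \<subseteq> U0" "length us = l"
            have us': "set us \<subseteq> points E" "enat (length us) \<le> k" using us zero_nbhd_subset[OF U0(1)] l by auto
            let ?d = "\<Theta> us (x + v) - \<Theta> us x"
            have d: "?d \<in> points F" using \<Theta>(1)[OF us' x] \<Theta>(1)[OF us' elim(2)] by auto
            obtain w where w: "w \<in> W'" "\<Psi> j us (x + v) - \<Psi> j us x = scl (Fi j) (of_real \<epsilon>) w"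
              using elim(1) us by blast
            have "\<rho> j ?d = scl (Fi j) (of_real \<epsilon>) w"
              using \<rho>diff[OF j(1) \<Theta>(1)[OF us' elim(2)] \<Theta>(1)[OF us' x]] w(2) \<Theta>(2)[OF us' x j(1)]
                \<Theta>(2)[OF us' elim(2) j(1)] by simp
            \<comment> \<open>\<open>W\<close> is only known to contain the preimage of
              \<open>W'\<close>, so the increment is divided by \<epsilon> before it is
              tested.\<close>
            then have "\<rho> j (scl F (of_real (1 / \<epsilon>)) ?d) = scl (Fi j) (of_real (1 / \<epsilon>)) (scl (Fi j) (of_real \<epsilon>) w)"
              using \<rho>scl[OF j(1) d d, of "of_real (1 / \<epsilon>)"] by (simp only:)
            also have "\<dots> = w" using eps by (simp flip: of_real_mult)
            finally have "scl F (of_real (1 / \<epsilon>)) ?d \<in> W" using w(1) d by (intro j(3)) (auto intro: F.points_closed)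
            moreover have "?d = scl F (of_real \<epsilon>) (scl F (of_real (1 / \<epsilon>)) ?d)" using eps by (simp flip: of_real_mult)
            ultimately show "?d \<in> scl F (of_real \<epsilon>) ` W" by blast
          qed
        qed
      qed
    next
      fix us v assume us: "set us \<subseteq> points E" "v \<in> points E" "enat (Suc (length us)) \<le> k"
      have us': "enat (length us) \<le> k" using us(3) by (auto intro: order_trans[rotated])
      have usv: "set (us @ [v]) \<subseteq> points E" "enat (length (us @ [v])) \<le> k" using us by auto
      have xU: "eventually (\<lambda>t. x + scl E t v \<in> U) (at 0)" by (rule E.eventually_at_line[OF U x us(2)])
      show "limitin (topo F) (\<lambda>t. scl F (inverse t) (\<Theta> us (x + scl E t v) - \<Theta> us x)) (\<Theta> (us @ [v]) x) (at 0)"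
      proof (rule limitin_limit[OF \<Theta>(1)[OF usv x]])
        show "eventually (\<lambda>t. scl F (inverse t) (\<Theta> us (x + scl E t v) - \<Theta> us x) \<in> points F) (at 0)"
          using xU by eventually_elim (intro F.points_closed \<Theta>(1)[OF us(1) us'] x)
        fix j assume j: "j \<in> J"
        have eq: "eventually (\<lambda>t. scl (Fi j) (inverse t) (\<Psi> j us (x + scl E t v) - \<Psi> j us x) =
           \<rho> j (scl F (inverse t) (\<Theta> us (x + scl E t v) - \<Theta> us x))) (at 0)"
          using xU
        proof eventually_elim
          case (elim t)
          have a: "\<Theta> us (x + scl E t v) \<in> points F" "\<Theta> us x \<in> points F"
            using \<Theta>(1)[OF us(1) us' elim] \<Theta>(1)[OF us(1) us' x] .
          show ?case
            using \<rho>scl[OF j F.points_closed(3)[OF a] a(1), of "inverse t"] \<rho>diff[OF j a]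
              \<Theta>(2)[OF us(1) us' elim j] \<Theta>(2)[OF us(1) us' x j] by simp
        qed
        show "limitin (topo (Fi j)) (\<lambda>t. \<rho> j (scl F (inverse t) (\<Theta> us (x + scl E t v) - \<Theta> us x)))
            (\<rho> j (\<Theta> (us @ [v]) x)) (at 0)"
          unfolding \<Theta>(2)[OF usv x j]
          by (rule limitin_transform_eventually[OF eq lim\<Psi>[OF j x us]])
      qed
    qed
  qed
qed

end

section \<open>Extending the solution to the limit space\<close>

text \<open>The data of the definition of \<open>B\<partial>\<^sub>2\<close>-extensibility at one index \<open>j\<close> above \<open>i0\<close>, together with the
  solution \<open>g\<close> at \<open>i0\<close>: \<open>G0\<close>, \<open>f0\<close>, \<open>b0\<close> belong to \<open>i0\<close> and \<open>G\<close>, \<open>f\<close>, \<open>b\<close> to \<open>j\<close>.\<close>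

locale extension_step =
  fixes E :: "('k::real_or_complex, 'e::ab_group_add) tvs" and G0 G :: "('k, 'x::ab_group_add) tvs"
    and f0 f :: "'e \<times> 'x \<rightharpoonup> 'x" and b0 b :: 'x and \<rho> :: "'x \<Rightarrow> 'x" and k :: enat
    and x0 :: 'e and y0 :: 'x and W0 :: "('e \<times> 'x) set" and U :: "'e set" and V :: "'x set" and g :: "'e \<Rightarrow> 'x"
  assumes lE: "lcs E" and lG0: "lcs G0" and bG: "banachable G" and f: "Ck_pi k (E \<times>\<^sub>t G) G f" and k: "1 \<le> k"
    and \<rho>: "cont_linear G G0 \<rho>" and inj: "inj_on \<rho> (points G)"
    and b: "b \<in> points G" "\<rho> b = b0"
    and y0: "y0 \<in> points G" "\<rho> y0 = g x0"
    and comm: "\<And>x y. x \<in> points E \<Longrightarrow> y \<in> points G \<Longrightarrow> map_option \<rho> (f (x, y)) = f0 (x, \<rho> y)"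
    and bij: "\<And>x y. (x, y) \<in> dom f \<Longrightarrow> (x, \<rho> y) \<in> W0 \<Longrightarrow> partial2_bijective G0 f0 x (\<rho> y) \<Longrightarrow>
        partial2_bijective G f x y"
    and clos: "\<And>x1 y1 y. x1 \<in> points E \<Longrightarrow> y1 \<in> points G0 \<Longrightarrow> (\<forall>n\<ge>1::nat. y n \<in> points G) \<Longrightarrow>
        (\<forall>n\<ge>1. f0 (scl E (inverse (of_nat n)) x0 + scl E (1 - inverse (of_nat n)) x1, \<rho> (y n)) = Some b0) \<Longrightarrow>
        f0 (x1, y1) = Some b0 \<Longrightarrow> limitin (topo G0) (\<lambda>n. \<rho> (y n)) y1 sequentially \<Longrightarrow> y1 \<in> \<rho> ` points G"
    and U: "openin (topo E) U" "x0 \<in> U" and V: "openin (topo G0) V"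
    and star: "\<And>x s. x \<in> U \<Longrightarrow> 0 \<le> s \<Longrightarrow> s \<le> 1 \<Longrightarrow> x0 + scl E (of_real s) (x - x0) \<in> U"
    and UV: "U \<times> V \<subseteq> W0 \<inter> dom f0" and gV: "\<And>x. x \<in> U \<Longrightarrow> g x \<in> V"
    and sol: "\<And>x y. x \<in> U \<Longrightarrow> y \<in> V \<Longrightarrow> f0 (x, y) = Some b0 \<longleftrightarrow> y = g x"
    and bij0: "\<And>x y. x \<in> U \<Longrightarrow> y \<in> V \<Longrightarrow> partial2_bijective G0 f0 x y"
    and cont: "\<And>x. x \<in> U \<Longrightarrow> limitin (topo G0) (\<lambda>v. g (x + v)) (g x) (zero_filter E)"
begin

lemma lG: "lcs G"
  using bG by (simp add: banachable_def)

sublocale E: lcs_space E by standard (rule lE)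
sublocale G0: lcs_space G0 by standard (rule lG0)
sublocale G: lcs_space G by standard (rule lG)

section \<open>Lifting the solution from \<open>i0\<close> to one index above it\<close>

lemma UE: "x \<in> U \<Longrightarrow> x \<in> points E"
  using U(1) openin_subset by blast

text \<open>\<open>comm\<close> carries the equation at \<open>i0\<close> to \<open>j\<close>:
  equality of domains shows that \<open>f (x, y)\<close> is defined, and injectivity of \<rho> shows
  that its value is \<open>b\<close>.\<close>

lemma solves:
  assumes x: "x \<in> U" and y: "y \<in> points G" "\<rho> y = g x"
  shows "f (x, y) = Some b"
proof -
  have "f0 (x, \<rho> y) = Some b0" using sol[OF x gV[OF x]] y by simp
  then obtain w where w: "f (x, y) = Some w" "\<rho> w = b0"
    using comm[OF UE[OF x] y(1)] by (cases "f (x, y)") auto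
  have "w \<in> points G" using Ck_piD(2)[OF f] w by (auto simp: ran_def)
  then have "w = b" using inj w(2) b by (auto simp: inj_on_def)
  then show ?thesis using w by simp
qed

text \<open>Condition (2), here \<open>bij\<close>, makes the implicit function theorem applicable
  at the lifted point. Near \<open>x\<close> its solution projects into \<open>V\<close>, where
  solutions at \<open>i0\<close> are unique, so it projects to \<open>g\<close>.\<close>

lemma local_lift:
  assumes x: "x \<in> U" and y: "y \<in> points G" "\<rho> y = g x"
  obtains O' h where "openin (topo E) O'" "x \<in> O'" "O' \<subseteq> U"
    "\<And>u. u \<in> O' \<Longrightarrow> h u \<in> points G \<and> \<rho> (h u) = g u"
    "Ck_pi k E G (\<lambda>u. if u \<in> O' then Some (h u) else None)"
proof -
  have xE: "x \<in> points E" using UE[OF x] .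
  have fxy: "f (x, y) = Some b" by (rule solves[OF x y])
  have bijG: "partial2_bijective G f x y"
  proof (rule bij)
    show "(x, y) \<in> dom f" using fxy by blast
    show "(x, \<rho> y) \<in> W0" using UV x gV[OF x] y by auto
    show "partial2_bijective G0 f0 x (\<rho> y)" using bij0[OF x gV[OF x]] y by simp
  qed
  obtain U1 V1 h where U1: "openin (topo E) U1" "x \<in> U1" and V1: "y \<in> V1" "openin (topo G) V1"
    and h: "\<And>u. u \<in> U1 \<Longrightarrow> h u \<in> V1" "\<And>u w. u \<in> U1 \<Longrightarrow> w \<in> V1 \<Longrightarrow> f (u, w) = Some b \<longleftrightarrow> w = h u"
      "\<And>u. u \<in> U1 \<Longrightarrow> limitin (topo G) (\<lambda>v. h (u + v)) (h u) (zero_filter E)"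
      "Ck_pi k E G (\<lambda>u. if u \<in> U1 then Some (h u) else None)"
  proof (rule implicit_function[OF lE bG f k fxy bijG openin_topspace], goal_cases)
    case 1
    show ?case using xE y by (simp add: points_prod)
  next
    case (2 U1 V1 h)
    show ?case by (rule that[of U1 V1 h, OF 2(2,3,5,4,8,9,11,12)])
  qed
  have hG: "h u \<in> points G" if "u \<in> U1" for u using h(1)[OF that] openin_subset[OF V1(2)] by blast
  have hx: "h x = y" using h(2)[OF U1(2) V1(1)] fxy by simp
  have "continuous_map (subtopology (topo E) U1) (topo G) h"
    using h(3) by (simp add: E.continuous_map_at[OF U1(1)])
  then have "continuous_map (subtopology (topo E) U1) (topo G0) (\<rho> \<circ> h)"
    using \<rho> by (intro continuous_map_compose) (auto simp: cont_linear_def)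
  then have "openin (subtopology (topo E) U1) {u \<in> topspace (subtopology (topo E) U1). (\<rho> \<circ> h) u \<in> V}"
    using V by (rule openin_continuous_map_preimage)
  then have o1: "openin (topo E) {u \<in> topspace (subtopology (topo E) U1). (\<rho> \<circ> h) u \<in> V}"
    using U1(1) openin_trans_full by blast
  \<comment> \<open>Shrinks to the points where the projected solution stays in \<open>V\<close>;
    outside \<open>V\<close> a solution at \<open>i0\<close> could differ from
    \<open>g\<close>.\<close>
  define O' where "O' = U \<inter> {u \<in> topspace (subtopology (topo E) U1). (\<rho> \<circ> h) u \<in> V}"
  have oO: "openin (topo E) O'" unfolding O'_def by (intro openin_Int U(1) o1)
  have O': "u \<in> U" "u \<in> U1" "\<rho> (h u) \<in> V" if "u \<in> O'" for u using that by (auto simp: O'_def)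
  have lift: "h u \<in> points G \<and> \<rho> (h u) = g u" if u: "u \<in> O'" for u
  proof
    show hu: "h u \<in> points G" by (rule hG[OF O'(2)[OF u]])
    have "f (u, h u) = Some b" using h(2)[OF O'(2)[OF u] h(1)[OF O'(2)[OF u]]] by simp
    then have "f0 (u, \<rho> (h u)) = Some b0" using comm[OF UE[OF O'(1)[OF u]] hu] b by simp
    then show "\<rho> (h u) = g u" using sol[OF O'(1,3)[OF u]] by simp
  qed
  have "Ck_pi k E G (\<lambda>u. if u \<in> O' then Some (h u) else None)"
  proof (rule Ck_pi_local[OF lE lG])
    fix u assume "u \<in> dom (\<lambda>u. if u \<in> O' then Some (h u) else None)"
    then have "u \<in> O'" by (auto split: if_splits)
    then show "\<exists>f' Q. Ck_pi k E G f' \<and> openin (topo E) Q \<and> u \<in> Q \<and>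
        Q \<subseteq> dom (\<lambda>u. if u \<in> O' then Some (h u) else None) \<and>
        (\<forall>y\<in>Q. (if y \<in> O' then Some (h y) else None) = f' y)"
      using h(4) oO O'(2) by (intro exI[of _ "\<lambda>u. if u \<in> U1 then Some (h u) else None"] exI[of _ O'])
        (auto simp: dom_def)
  qed
  moreover have "x \<in> O'" using x U1(2) xE gV[OF x] hx y by (auto simp: O'_def)
  moreover have "O' \<subseteq> U" by (auto simp: O'_def)
  ultimately show thesis using that oO lift by blast
qed

text \<open>Connectedness of the segment from \<open>x0\<close> to \<open>x1\<close> as an infimum
  argument: condition (3) shows that the infimum \<open>t\<close> of the bad parameters is itself
  good, and \<open>local_lift\<close> then extends goodness beyond \<open>t\<close>.\<close>

lemma lift_exists:
  assumes x1: "x1 \<in> U"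
  shows "g x1 \<in> \<rho> ` points G"
proof (rule ccontr)
  assume no: "g x1 \<notin> \<rho> ` points G"
  let ?R = "\<rho> ` points G"
  define c where "c s = x0 + scl E (of_real s) (x1 - x0)" for s :: real
  have x0E: "x0 \<in> points E" and x1E: "x1 \<in> points E" using UE U(2) x1 by auto
  have cU: "c s \<in> U" if "0 \<le> s" "s \<le> 1" for s using star[OF x1 that] by (simp add: c_def)
  have c_add: "c (s + t) = c s + scl E (of_real t) (x1 - x0)" for s t
    by (simp add: c_def E.scale_left_distrib algebra_simps)
  define B where "B = {s. 0 \<le> s \<and> s \<le> 1 \<and> g (c s) \<notin> ?R}"
  have "1 \<in> B" using no by (simp add: B_def c_def)
  have bdd: "bdd_below B" unfolding B_def by (rule bdd_belowI[of _ 0]) auto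
  define t where "t = Inf B"
  have t01: "0 \<le> t" "t \<le> 1"
    unfolding t_def using \<open>1 \<in> B\<close> bdd by (auto intro!: cInf_greatest cInf_lower simp: B_def)
  have below: "g (c s) \<in> ?R" if "0 \<le> s" "s < t" for s
  proof (rule ccontr)
    assume "g (c s) \<notin> ?R"
    then have "s \<in> B" using that t01 by (simp add: B_def)
    then show False using cInf_lower[OF _ bdd, of s] that by (simp add: t_def)
  qed
  have "g (c t) \<in> ?R"
  proof (cases "t = 0")
    case True
    then show ?thesis using y0 by (auto simp: c_def intro!: image_eqI[of _ _ y0])
  next
    case False
    then have t0: "t > 0" using t01 by simp
    \<comment> \<open>Condition (3) prescribes the points
      \<open>n\<^sup>-\<^sup>1 x0 + (1 - n\<^sup>-\<^sup>1) x1\<close>; with \<open>c t\<close> in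
      the place of \<open>x1\<close> these are \<open>c (t - t / n)\<close>. For
      \<open>n = 1\<close> the parameter is 0, which \<open>below\<close> includes.\<close>
    define s where "s n = t + (- (t / real n))" for n :: nat
    have s: "0 \<le> s n" "s n < t" "s n \<le> 1" if "n \<ge> 1" for n
    proof -
      have "t / real n \<le> t / 1" using that t0 by (intro divide_left_mono) auto
      then show "0 \<le> s n" by (simp add: s_def)
      have "t / real n > 0" using that t0 by simp
      then show "s n < t" by (simp add: s_def)
      then show "s n \<le> 1" using t01 by simp
    qed
    have "\<forall>n. \<exists>y. n \<ge> 1 \<longrightarrow> y \<in> points G \<and> \<rho> y = g (c (s n))"
      using below[OF s(1,2)] by (metis imageE)
    then obtain y where y: "\<And>n. n \<ge> 1 \<Longrightarrow> y n \<in> points G \<and> \<rho> (y n) = g (c (s n))" by metis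
    have ctU: "c t \<in> U" by (rule cU[OF t01])
    have path: "scl E (inverse (of_nat n)) x0 + scl E (1 - inverse (of_nat n)) (c t) = c (s n)" if n: "n \<ge> 1" for n
    proof -
      have coef: "(1 - inverse (of_nat n)) * of_real t = (of_real (s n) :: 'k)"
        by (simp add: s_def divide_inverse algebra_simps)
      have "scl E (inverse (of_nat n)) x0 + scl E (1 - inverse (of_nat n)) (c t) =
          (scl E (inverse (of_nat n)) x0 + scl E (1 - inverse (of_nat n)) x0) +
          scl E ((1 - inverse (of_nat n)) * of_real t) (x1 - x0)"
        unfolding c_def by (simp only: E.scale_right_distrib E.scale_scale add.assoc)
      also have "scl E (inverse (of_nat n)) x0 + scl E (1 - inverse (of_nat n)) x0 = x0"
        unfolding E.scale_left_distrib[symmetric] by simp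
      finally show ?thesis unfolding coef c_def .
    qed
    show ?thesis
    proof (rule clos[of "c t" "g (c t)" y])
      show "c t \<in> points E" by (rule UE[OF ctU])
      show "g (c t) \<in> points G0" using gV[OF ctU] openin_subset[OF V] by blast
      show "\<forall>n\<ge>1. y n \<in> points G" using y by blast
      show "\<forall>n\<ge>1. f0 (scl E (inverse (of_nat n)) x0 + scl E (1 - inverse (of_nat n)) (c t), \<rho> (y n)) = Some b0"
      proof (intro allI impI)
        fix n :: nat assume n: "1 \<le> n"
        have u: "c (s n) \<in> U" by (rule cU[OF s(1,3)[OF n]])
        show "f0 (scl E (inverse (of_nat n)) x0 + scl E (1 - inverse (of_nat n)) (c t), \<rho> (y n)) = Some b0"
          unfolding path[OF n] using sol[OF u gV[OF u]] y[OF n] by simp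
      qed
      show "f0 (c t, g (c t)) = Some b0" using sol[OF ctU gV[OF ctU]] by simp
      \<comment> \<open>The convergence is composed through the filter \<open>at 0\<close>, which
        requires nonzero parameters; they are nonzero because \<open>t > 0\<close>.\<close>
      have "filterlim (\<lambda>n. scl E (of_real (- (t / real n))) (x1 - x0)) (zero_filter E) sequentially"
      proof -
        have a: "filterlim (\<lambda>n. - (t / real n)) (at 0) sequentially"
          unfolding filterlim_at
        proof
          have "((\<lambda>n. - (t * (1 / real n))) \<longlongrightarrow> - (t * 0)) sequentially"
            by (intro tendsto_intros lim_1_over_n)
          then show "((\<lambda>n. - (t / real n)) \<longlongrightarrow> 0) sequentially" by simp
          show "eventually (\<lambda>n. - (t / real n) \<in> UNIV \<and> - (t / real n) \<noteq> 0) sequentially"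
            using t0 eventually_gt_at_top[of 0] by (auto elim: eventually_mono)
        qed
        have b: "filterlim (of_real :: real \<Rightarrow> 'k) (at 0) (at 0)"
          unfolding filterlim_at by (auto simp: eventually_at_filter intro!: tendsto_eq_intros)
        have c: "filterlim (\<lambda>a. scl E a (x1 - x0)) (zero_filter E) (at 0)"
          using x0E x1E by (intro E.filterlim_scale_zero_filter) auto
        show ?thesis by (rule filterlim_compose[OF c filterlim_compose[OF b a]])
      qed
      then have l: "limitin (topo G0) (\<lambda>n. g (c t + scl E (of_real (- (t / real n))) (x1 - x0))) (g (c t)) sequentially"
        by (rule limitin_compose_filterlim[OF cont[OF ctU]])
      have "eventually (\<lambda>n. g (c t + scl E (of_real (- (t / real n))) (x1 - x0)) = \<rho> (y n)) sequentially"
        using eventually_ge_at_top[of 1]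
      proof eventually_elim
        case (elim n)
        then show ?case using y[OF elim] c_add[of t "- (t / real n)"] by (simp add: s_def)
      qed
      from limitin_transform_eventually[OF this l]
      show "limitin (topo G0) (\<lambda>n. \<rho> (y n)) (g (c t)) sequentially" .
    qed
  qed
  then obtain y where y: "y \<in> points G" "\<rho> y = g (c t)" by (metis imageE)
  obtain O' h where O': "openin (topo E) O'" "c t \<in> O'" "O' \<subseteq> U"
    "\<And>u. u \<in> O' \<Longrightarrow> h u \<in> points G \<and> \<rho> (h u) = g u"
    by (rule local_lift[OF cU[OF t01] y]) blast
  have "eventually (\<lambda>a. c t + scl E a (x1 - x0) \<in> O') (at 0)"
    using x0E x1E by (intro E.eventually_at_line[OF O'(1,2)]) auto
  then obtain d where d: "d > 0" "\<And>a. a \<noteq> 0 \<Longrightarrow> dist a 0 < d \<Longrightarrow> c t + scl E a (x1 - x0) \<in> O'"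
    unfolding eventually_at by auto
  have near: "g (c s) \<in> ?R" if s: "t \<le> s" "s < t + d" for s
  proof -
    have "c s \<in> O'"
    proof (cases "s = t")
      case False
      have "dist (of_real (s - t) :: 'k) 0 < d"
        unfolding dist_norm diff_zero norm_of_real using s by simp
      moreover have "(of_real (s - t) :: 'k) \<noteq> 0" using False by simp
      ultimately have "c t + scl E (of_real (s - t)) (x1 - x0) \<in> O'" by (intro d(2))
      then show ?thesis using c_add[of t "s - t"] by simp
    qed (use O'(2) in simp)
    from O'(4)[OF this] show ?thesis by (metis imageI)
  qed
  \<comment> \<open>By the definition of the infimum some bad parameter lies between
    \<open>t\<close> and \<open>t + d\<close>, where all parameters are good.\<close>
  obtain s where s: "s \<in> B" "s < t + d"
    using cInf_less_iff[of B "t + d"] bdd \<open>1 \<in> B\<close> d(1) by (auto simp: t_def)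
  have "t \<le> s" using cInf_lower[OF s(1) bdd] by (simp add: t_def)
  then show False using near[OF _ s(2)] s(1) by (simp add: B_def)
qed

definition lift :: "'e \<Rightarrow> 'x" where "lift x = inv_into (points G) \<rho> (g x)"

lemma lift: "x \<in> U \<Longrightarrow> lift x \<in> points G" "x \<in> U \<Longrightarrow> \<rho> (lift x) = g x"
  using lift_exists by (auto simp: lift_def intro: inv_into_into f_inv_into_f)

text \<open>Injectivity of \<rho> makes the local solutions from \<open>local_lift\<close> coincide
  with \<open>lift\<close>, so the class is inherited locally.\<close>

theorem lift_Ck_pi: "Ck_pi k E G (\<lambda>x. if x \<in> U then Some (lift x) else None)"
proof (rule Ck_pi_local[OF lE lG])
  fix x assume "x \<in> dom (\<lambda>x. if x \<in> U then Some (lift x) else None)"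
  then have x: "x \<in> U" by (auto split: if_splits)
  obtain O' h where O': "openin (topo E) O'" "x \<in> O'" "O' \<subseteq> U"
    "\<And>u. u \<in> O' \<Longrightarrow> h u \<in> points G \<and> \<rho> (h u) = g u"
    "Ck_pi k E G (\<lambda>u. if u \<in> O' then Some (h u) else None)"
    by (rule local_lift[OF x lift[OF x]]) blast
  have eq: "lift u = h u" if u: "u \<in> O'" for u
  proof -
    have uU: "u \<in> U" using O'(3) u by blast
    show ?thesis using inj_onD[OF inj, of "lift u" "h u"] lift[OF uU] O'(4)[OF u] by simp
  qed
  show "\<exists>f' Q. Ck_pi k E G f' \<and> openin (topo E) Q \<and> x \<in> Q \<and>
      Q \<subseteq> dom (\<lambda>x. if x \<in> U then Some (lift x) else None) \<and>
      (\<forall>y\<in>Q. (if y \<in> U then Some (lift y) else None) = f' y)"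
    using O' eq by (intro exI[of _ "\<lambda>u. if u \<in> O' then Some (h u) else None"] exI[of _ O'])
      (auto simp: dom_def)
qed

end

section \<open>Assembling the solution in the limit space\<close>

theorem theorem4p5:
  fixes E :: "('k::real_or_complex, 'e::ab_group_add) tvs"
    and F :: "('k, 'f::ab_group_add) tvs"
    and f :: "'e \<times> 'f \<rightharpoonup> 'f"
    and k :: enat
  assumes "lcs E" and "lcs F" and "1 \<le> k"
    and "Bd2_extensible TYPE('i) TYPE('x::ab_group_add) k E F f z b"
  shows "\<exists>W. openin (topo (E \<times>\<^sub>t F)) W \<and> z \<in> W \<and>
           (\<exists>g :: 'e \<rightharpoonup> 'f.
              Map.graph g = {(x, y). (x, y) \<in> W \<inter> dom f \<and> f (x, y) = Some b} \<and>
              Ck_pi k E F g)"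
proof -
  obtain x0 y0 where z: "z = (x0, y0)" by (cases z)
  obtain I :: "'i set" and \<Delta> and Fi :: "'i \<Rightarrow> ('k, 'x) tvs" and \<rho>\<rho> fi \<rho> i0 W0 where
    fz: "f (x0, y0) = Some b"
    and Bp: "Bp2_extension I \<Delta> Fi \<rho>\<rho> fi \<rho> E F f"
    and Ck: "\<And>i. i \<in> I \<Longrightarrow> Ck_pi k (E \<times>\<^sub>t Fi i) (Fi i) (fi i)"
    and i0: "i0 \<in> I" and W0: "openin (topo (E \<times>\<^sub>t Fi i0)) W0" "(x0, \<rho> i0 y0) \<in> W0" "W0 \<subseteq> dom (fi i0)"
    and bij0: "partial2_bijective (Fi i0) (fi i0) x0 (\<rho> i0 y0)"
    and step: "\<And>j. (i0, j) \<in> \<Delta> \<Longrightarrow>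
           inj_on (\<rho>\<rho> i0 j) (points (Fi j)) \<and>
           (\<forall>x\<in>points E. \<forall>y\<in>points F. map_option (\<rho> j) (f (x, y)) = fi j (x, \<rho> j y)) \<and>
           (\<forall>x\<in>points E. \<forall>y\<in>points (Fi j).
              map_option (\<rho>\<rho> i0 j) (fi j (x, y)) = fi i0 (x, \<rho>\<rho> i0 j y)) \<and>
           (\<forall>x y. (x, y) \<in> dom (fi j) \<and> (x, \<rho>\<rho> i0 j y) \<in> W0 \<and>
              partial2_bijective (Fi i0) (fi i0) x (\<rho>\<rho> i0 j y) \<longrightarrow>
              partial2_bijective (Fi j) (fi j) x y) \<and>
           (\<forall>x1\<in>points E. \<forall>y1\<in>points (Fi i0). \<forall>y :: nat \<Rightarrow> 'x.
              (\<forall>n\<ge>1. y n \<in> points (Fi j)) \<and>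
              (\<forall>n\<ge>1. fi i0 (scl E (inverse (of_nat n)) x0 + scl E (1 - inverse (of_nat n)) x1,
                 \<rho>\<rho> i0 j (y n)) = Some (\<rho> i0 b)) \<and>
              fi i0 (x1, y1) = Some (\<rho> i0 b) \<and>
              limitin (topo (Fi i0)) (\<lambda>n. \<rho>\<rho> i0 j (y n)) y1 sequentially \<longrightarrow>
              y1 \<in> \<rho>\<rho> i0 j ` points (Fi j))"
    using assms(4) unfolding z Bd2_extensible_def prod.case by (elim conjE exE) blast
  have vm: "vector_map (E \<times>\<^sub>t F) F f" and dir: "direction_on I \<Delta>"
    and sys: "projective_system I \<Delta> Fi \<rho>\<rho>" and lim: "projective_limit I \<Delta> Fi \<rho>\<rho> F \<rho>"
    and ban: "\<And>i. i \<in> I \<Longrightarrow> banachable (Fi i)"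
    and ext: "\<And>i x y w. i \<in> I \<Longrightarrow> f (x, y) = Some w \<Longrightarrow> fi i (x, \<rho> i y) = Some (\<rho> i w)"
    using Bp unfolding Bp2_extension_def by blast+
  interpret L: proj_limit I \<Delta> Fi \<rho>\<rho> F \<rho> i0 by unfold_locales (fact dir sys lim i0)+
  have domf: "dom f \<subseteq> points E \<times> points F" and ranf: "ran f \<subseteq> points F"
    using vm by (auto simp: vector_map_def points_prod)
  have xyF: "x \<in> points E" "y \<in> points F" "w \<in> points F" if "f (x, y) = Some w" for x y w
  proof -
    have "(x, y) \<in> points E \<times> points F" using domf that by blast
    then show "x \<in> points E" "y \<in> points F" by auto
    show "w \<in> points F" using ranf that by (auto simp: ran_def)
  qed
  have b: "b \<in> points F" and y0: "y0 \<in> points F" using xyF[OF fz] by auto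
  have J: "(i0, j) \<in> \<Delta>" if "j \<in> L.J" for j using that by (simp add: L.J_def)
  obtain U V g where U: "openin (topo E) U" "x0 \<in> U" and V: "openin (topo (Fi i0)) V" "\<rho> i0 y0 \<in> V"
    and star: "\<And>x s. x \<in> U \<Longrightarrow> 0 \<le> s \<Longrightarrow> s \<le> 1 \<Longrightarrow> x0 + scl E (of_real s) (x - x0) \<in> U"
    and UV: "U \<times> V \<subseteq> W0 \<inter> dom (fi i0)" and gV: "\<And>x. x \<in> U \<Longrightarrow> g x \<in> V"
    and sol: "\<And>x y. x \<in> U \<Longrightarrow> y \<in> V \<Longrightarrow> fi i0 (x, y) = Some (\<rho> i0 b) \<longleftrightarrow> y = g x"
    and bij: "\<And>x y. x \<in> U \<Longrightarrow> y \<in> V \<Longrightarrow> partial2_bijective (Fi i0) (fi i0) x y"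
    and cont: "\<And>x. x \<in> U \<Longrightarrow> limitin (topo (Fi i0)) (\<lambda>v. g (x + v)) (g x) (zero_filter E)"
  proof (rule implicit_function[OF assms(1) ban[OF i0] Ck[OF i0] assms(3) ext[OF i0 fz] bij0 W0(1,2)], goal_cases)
    case (1 U V g)
    show ?case by (rule that[of U V g, OF 1(2-11)])
  qed
  have gx0: "g x0 = \<rho> i0 y0" using sol[OF U(2) V(2)] ext[OF i0 fz] by simp
  \<comment> \<open>All \<open>j\<close> share the same \<open>U\<close>, \<open>V\<close> and
    \<open>g\<close>; this yields a common domain for the limit.\<close>
  have ES: "extension_step E (Fi i0) (Fi j) (fi i0) (fi j) (\<rho> i0 b) (\<rho> j b) (\<rho>\<rho> i0 j) k x0 (\<rho> j y0) W0 U V g"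
    if j: "j \<in> L.J" for j
  proof (unfold_locales; (fact U V(1) star UV gV sol bij cont assms(1,3))?)
    note S = step[OF J[OF j]]
    show "lcs (Fi i0)" by (rule L.lcs_Fi[OF i0])
    show "banachable (Fi j)" by (rule ban[OF L.J_I[OF j]])
    show "Ck_pi k (E \<times>\<^sub>t Fi j) (Fi j) (fi j)" by (rule Ck[OF L.J_I[OF j]])
    show "cont_linear (Fi j) (Fi i0) (\<rho>\<rho> i0 j)" by (rule L.\<rho>\<rho>_lin[OF J[OF j]])
    show "inj_on (\<rho>\<rho> i0 j) (points (Fi j))" using S by blast
    show "\<rho> j b \<in> points (Fi j)" "\<rho> j y0 \<in> points (Fi j)" using L.\<rho>_in[OF L.J_I[OF j]] b y0 by auto
    show "\<rho>\<rho> i0 j (\<rho> j b) = \<rho> i0 b" by (rule L.\<rho>\<rho>_\<rho>[OF J[OF j] b])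
    show "\<rho>\<rho> i0 j (\<rho> j y0) = g x0" unfolding gx0 by (rule L.\<rho>\<rho>_\<rho>[OF J[OF j] y0])
    show "map_option (\<rho>\<rho> i0 j) (fi j (x, y)) = fi i0 (x, \<rho>\<rho> i0 j y)"
      if "x \<in> points E" "y \<in> points (Fi j)" for x y using S that by blast
    show "partial2_bijective (Fi j) (fi j) x y"
      if "(x, y) \<in> dom (fi j)" "(x, \<rho>\<rho> i0 j y) \<in> W0" "partial2_bijective (Fi i0) (fi i0) x (\<rho>\<rho> i0 j y)" for x y
      using S that by blast
    show "y1 \<in> \<rho>\<rho> i0 j ` points (Fi j)"
      if "x1 \<in> points E" "y1 \<in> points (Fi i0)" "\<forall>n\<ge>1. y n \<in> points (Fi j)"
        "\<forall>n\<ge>1. fi i0 (scl E (inverse (of_nat n)) x0 + scl E (1 - inverse (of_nat n)) x1, \<rho>\<rho> i0 j (y n)) = Some (\<rho> i0 b)"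
        "fi i0 (x1, y1) = Some (\<rho> i0 b)" "limitin (topo (Fi i0)) (\<lambda>n. \<rho>\<rho> i0 j (y n)) y1 sequentially"
      for x1 y1 and y :: "nat \<Rightarrow> 'x"
      using S[THEN conjunct2, THEN conjunct2, THEN conjunct2, THEN conjunct2] that by blast
  qed
  define gj where "gj j = extension_step.lift (Fi j) (\<rho>\<rho> i0 j) g" for j
  have gj: "gj j x \<in> points (Fi j)" "\<rho>\<rho> i0 j (gj j x) = g x" if "j \<in> L.J" "x \<in> U" for j x
    using extension_step.lift[OF ES[OF that(1)] that(2)] unfolding gj_def by auto
  have gjC: "Ck_pi k E (Fi j) (\<lambda>x. if x \<in> U then Some (gj j x) else None)" if "j \<in> L.J" for j
    using extension_step.lift_Ck_pi[OF ES[OF that]] unfolding gj_def .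
  have inj: "y = y'" if "j \<in> L.J" "y \<in> points (Fi j)" "y' \<in> points (Fi j)" "\<rho>\<rho> i0 j y = \<rho>\<rho> i0 j y'" for j y y'
    using step[OF J[OF that(1)]] that(2-4) by (auto dest: inj_onD)
  \<comment> \<open>Both sides project to \<open>g x\<close> at \<open>i0\<close>, and the
    projection from \<open>Fi j\<close> is injective.\<close>
  have thread: "\<rho>\<rho> j l (gj l x) = gj j x" if "j \<in> L.J" "l \<in> L.J" "(j, l) \<in> \<Delta>" "x \<in> U" for j l x
  proof (rule inj[OF that(1)])
    show "\<rho>\<rho> j l (gj l x) \<in> points (Fi j)" "gj j x \<in> points (Fi j)"
      using L.\<rho>\<rho>_in[OF that(3)] gj(1) that by auto
    show "\<rho>\<rho> i0 j (\<rho>\<rho> j l (gj l x)) = \<rho>\<rho> i0 j (gj j x)"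
      using L.\<rho>\<rho>_comp[OF J[OF that(1)] that(3)] gj that by simp
  qed
  have "\<exists>y. y \<in> points F \<and> (\<forall>j\<in>L.J. \<rho> j y = gj j x)" if x: "x \<in> U" for x
    using L.thread_in_limit[of "\<lambda>j. gj j x"] gj(1)[OF _ x] thread[OF _ _ _ x] by blast
  then obtain G where G: "\<And>x. x \<in> U \<Longrightarrow> G x \<in> points F" "\<And>x j. x \<in> U \<Longrightarrow> j \<in> L.J \<Longrightarrow> \<rho> j (G x) = gj j x"
    by metis
  have Gi0: "\<rho> i0 (G x) = g x" if x: "x \<in> U" for x
    using L.\<rho>\<rho>_\<rho>[OF L.\<Delta>_refl[OF i0] G(1)[OF x]] gj(2)[OF L.i0_J x] G(2)[OF x L.i0_J] by simp
  have GC: "Ck_pi k E F (\<lambda>x. if x \<in> U then Some (G x) else None)"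
  proof (rule L.Ck_pi_limit[OF assms(1) U(1) G(1)])
    fix j assume j: "j \<in> L.J"
    have "(\<lambda>x. if x \<in> U then Some (\<rho> j (G x)) else None) = (\<lambda>x. if x \<in> U then Some (gj j x) else None)"
      using G(2) j by auto
    then show "Ck_pi k E (Fi j) (\<lambda>x. if x \<in> U then Some (\<rho> j (G x)) else None)" using gjC[OF j] by simp
  qed
  \<comment> \<open>Equality of domains in condition (0) ensures that \<open>f (x, G x)\<close> is
    defined; its value is then determined by the projections.\<close>
  have Gsol: "f (x, G x) = Some b" if x: "x \<in> U" for x
  proof -
    have xE: "x \<in> points E" using U(1) x openin_subset by blast
    have fj: "map_option (\<rho> j) (f (x, G x)) = Some (\<rho> j b)" if j: "j \<in> L.J" for j
    proof -
      have "fi j (x, gj j x) = Some (\<rho> j b)"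
        using extension_step.solves[OF ES[OF j] x gj[OF j x]] .
      then show ?thesis using step[OF J[OF j]] xE G(1)[OF x] G(2)[OF x j] by simp
    qed
    then obtain w where w: "f (x, G x) = Some w" using L.i0_J by (cases "f (x, G x)") auto
    have "w = b" by (rule L.eq_in_limit[OF xyF(3)[OF w] b]) (use fj w in simp)
    then show ?thesis using w by simp
  qed
  \<comment> \<open>Uniqueness is decided at \<open>i0\<close>: there \<open>\<rho> i0 y\<close>
    solves the equation inside \<open>V\<close>, so it is \<open>g x\<close>, and injectivity passes
    this on to every \<open>j\<close>.\<close>
  have uniq: "y = G x" if x: "x \<in> U" and y: "\<rho> i0 y \<in> V" "f (x, y) = Some b" for x y
  proof (rule L.eq_in_limit[OF xyF(2)[OF y(2)] G(1)[OF x]])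
    fix j assume j: "j \<in> L.J"
    have "\<rho> i0 y = g x" using sol[OF x y(1)] ext[OF i0 y(2)] by simp
    then have eq: "\<rho>\<rho> i0 j (\<rho> j y) = \<rho>\<rho> i0 j (\<rho> j (G x))"
      using L.\<rho>\<rho>_\<rho>[OF J[OF j] xyF(2)[OF y(2)]] gj(2)[OF j x] G(2)[OF x j] by simp
    note in' = L.\<rho>_in[OF L.J_I[OF j]]
    show "\<rho> j y = \<rho> j (G x)"
      by (rule inj[OF j in'[OF xyF(2)[OF y(2)]] in'[OF G(1)[OF x]] eq])
  qed
  \<comment> \<open>The restriction on \<open>y\<close> is a condition on its projection to
    \<open>Fi i0\<close> alone, matching the neighbourhood in which \<open>g\<close> is
    unique.\<close>
  let ?W = "U \<times> {y \<in> points F. \<rho> i0 y \<in> V}"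
  have "openin (topo F) {y \<in> points F. \<rho> i0 y \<in> V}"
    using L.\<rho>_lin[OF i0] V(1) by (intro openin_continuous_map_preimage) (auto simp: cont_linear_def)
  then have "openin (topo (E \<times>\<^sub>t F)) ?W" using U(1) by (simp add: topo_prod openin_prod_Times_iff)
  moreover have "z \<in> ?W" using z U(2) V(2) y0 by simp
  moreover have "Map.graph (\<lambda>x. if x \<in> U then Some (G x) else None) =
      {(x, y). (x, y) \<in> ?W \<inter> dom f \<and> f (x, y) = Some b}"
  proof -
    have "(x, y) \<in> Map.graph (\<lambda>x. if x \<in> U then Some (G x) else None) \<longleftrightarrow> x \<in> U \<and> y = G x" for x y
      by (auto simp: graph_def split: if_splits)
    moreover have "x \<in> U \<and> y = G x \<longleftrightarrow> (x, y) \<in> ?W \<inter> dom f \<and> f (x, y) = Some b" for x y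
      using G(1) Gi0 gV Gsol uniq by auto
    ultimately show ?thesis by auto
  qed
  ultimately show ?thesis using GC by blast
qed

end
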